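(* Let $v$ be a flow on a surface $S$ with an $\omega$-limit set $\omega$ of a point containing a non-singular point $x$ and with a point $y\in S-\omega$ satisfying $\omega(y)=\omega$. Then there is a flow $\widetilde v$ on $S$ satisfying the following properties: (1) The $\omega$-limit set $\omega_{\widetilde v}(y)$ of $y$ with respect to $\widetilde v$ is not arcwise-connected. (2) The restriction $v|_{S-\omega}$ of $v$ is topologically equivalent to the restriction $\widetilde v|_{S-\omega_{\widetilde v}(y)}$. (3) The flow $v_x$ is topologically equivalent to some flow $v'$ which is topologically semi-conjugate to the flow $\widetilde v$, where $v_x$ is the resulting flow of $v$ by replacing $x$ with a singular point. (4) The topological semi-conjugacy from $\widetilde v$ to $v'$ can be obtained by collapsing a connected closed invariant subset of $\omega_{\widetilde v}(y)$ into a singleton.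
   Context: A surface is a paracompact two-dimensional manifold, possibly with boundary and not necessarily orientable. A flow is a continuous $\mathbb{R}$-action $v:\mathbb{R}\times S\to S$; $v_t=v(t,\cdot)$. $O(x)$ denotes the orbit of $x$. A point $x$ is singular if $v_t(x)=x$ for all $t$. $\omega(x)=\bigcap_{n\in\mathbb{R}}\overline{\{v_t(x)\mid t>n\}}$; $\omega_w(x)$ denotes the $\omega$-limit set with respect to a flow $w$ (and similarly for $\alpha_w(x)$). A set is invariant if it is a union of orbits. A flow $v$ on a surface $M$ is topologically equivalent to a flow $w$ on a surface $N$ if there is a homeomorphism $M\to N$ carrying orbits of $v$ to orbits of $w$ and preserving the direction of time. A flow $v:\mathbb{R}\times Z\to Z$ is topologically semi-conjugate to a flow $w:\mathbb{R}\times Y\to Y$ via $h:Y\to Z$ if $h$ is a continuous surjection with $v(t,h(p))=h(w(t,p))$ for all $(t,p)\in\mathbb{R}\times Y$. The resulting flow $v_x$ of $v$ by replacing a non-singular point $x$ with a singular point: choose an open trivial flow box $B$ containing $x$, i.e. a disk $B$ identified with a square $[-1,1]^2$, with $x$ corresponding to $0$, so that the maximal orbit arcs of $v$ in $B$ are the horizontal arcs, the orbits of the vector field $(1,0)$; replace the flow in $B$ by the one whose orbit arcs are generated by $(\varphi,0)$, where $\varphi:[-1,1]^2\to[0,1]$ is a $C^\infty$ function with $\varphi^{-1}(0)=\{0\}$ and $\varphi=1$ near the boundary of the square. Thus $v_x$ has $x$ as a new singular point; the restrictions of $v$ and $v_x$ to $S-O(x)$ are topologically equivalent and all points outside $O(x)$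 have the same $\alpha$- and $\omega$-limit sets for $v$ and $v_x$; the orbit $O(x)$ of $v$ becomes the disjoint union of the singular point $x$ and one non-recurrent orbit with $\omega$- and $\alpha$-limit set $\{x\}$ (if $O(x)$ is periodic), or the disjoint union of $x$ and two non-singular orbits $O_1,O_2$ with $\omega_{v_x}(O_1)=\{x\}=\alpha_{v_x}(O_2)$, $\alpha_{v_x}(O_1)=\alpha(x)$, $\omega_{v_x}(O_2)=\omega(x)$ (if $O(x)$ is not periodic). *)

theory Defs
  imports "HOL-Analysis.Analysis"
begin

definition paracompact_in :: "'a topology \<Rightarrow> bool" where
  "paracompact_in X \<longleftrightarrow>
     (\<forall>\<U>. (\<forall>U\<in>\<U>. openin X U) \<and> \<Union>\<U> = topspace X \<longrightarrow>
        (\<exists>\<V>. (\<forall>V\<in>\<V>. openin X V) \<and> \<Union>\<V> = topspace X \<and>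
             (\<forall>V\<in>\<V>. \<exists>U\<in>\<U>. V \<subseteq> U) \<and> locally_finite_in X \<V>))"

definition half_plane :: "(real \<times> real) set" where
  "half_plane = {p. snd p \<ge> 0}"

text \<open>Possibly with boundary, not necessarily connected, compact or orientable.\<close>

definition surface :: "'a topology \<Rightarrow> bool" where
  "surface X \<longleftrightarrow>
     Hausdorff_space X \<and> paracompact_in X \<and>
     (\<forall>p\<in>topspace X. \<exists>U W. openin X U \<and> p \<in> U \<and> openin (top_of_set half_plane) W \<and>
        subtopology X U homeomorphic_space top_of_set W)"

definition arcwise_connected_in :: "'a topology \<Rightarrow> 'a set \<Rightarrow> bool" where
  "arcwise_connected_in X A \<longleftrightarrow>
     A \<subseteq> topspace X \<and>
     (\<forall>p\<in>A. \<forall>q\<in>A. p \<noteq> q \<longrightarrow>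
        (\<exists>\<gamma>. embedding_map (top_of_set {0..1::real}) X \<gamma> \<and> \<gamma> ` {0..1} \<subseteq> A \<and>
             \<gamma> 0 = p \<and> \<gamma> 1 = q))"

text \<open>A flow is given as a total function of the underlying type; only its values on the
  carrier of the topology are relevant.\<close>

definition flow_on :: "'a topology \<Rightarrow> (real \<Rightarrow> 'a \<Rightarrow> 'a) \<Rightarrow> bool" where
  "flow_on X v \<longleftrightarrow>
     continuous_map (prod_topology euclideanreal X) X (\<lambda>(t, p). v t p) \<and>
     (\<forall>p\<in>topspace X. v 0 p = p) \<and>
     (\<forall>s t. \<forall>p\<in>topspace X. v (s + t) p = v s (v t p))"

definition orbit :: "(real \<Rightarrow> 'a \<Rightarrow> 'a) \<Rightarrow> 'a \<Rightarrow> 'a set" where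
  "orbit v p = range (\<lambda>t. v t p)"

definition singular_point :: "(real \<Rightarrow> 'a \<Rightarrow> 'a) \<Rightarrow> 'a \<Rightarrow> bool" where
  "singular_point v p \<longleftrightarrow> (\<forall>t. v t p = p)"

definition omega_limit :: "'a topology \<Rightarrow> (real \<Rightarrow> 'a \<Rightarrow> 'a) \<Rightarrow> 'a \<Rightarrow> 'a set" where
  "omega_limit X v p = (\<Inter>n::real. X closure_of {v t p | t. t > n})"

definition invariant_set :: "'a topology \<Rightarrow> (real \<Rightarrow> 'a \<Rightarrow> 'a) \<Rightarrow> 'a set \<Rightarrow> bool" where
  "invariant_set X v A \<longleftrightarrow> (\<exists>P\<subseteq>topspace X. A = (\<Union>p\<in>P. orbit v p))"

text \<open>The reparametrisation \<open>\<tau>\<close> is an increasing bijection of the real line, hence a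
  homeomorphism; so \<open>h\<close> maps each orbit onto an orbit and preserves the direction of time.\<close>

definition topologically_equivalent ::
  "'a topology \<Rightarrow> (real \<Rightarrow> 'a \<Rightarrow> 'a) \<Rightarrow> 'b topology \<Rightarrow> (real \<Rightarrow> 'b \<Rightarrow> 'b) \<Rightarrow> bool" where
  "topologically_equivalent X v Y w \<longleftrightarrow>
     (\<exists>h. homeomorphic_map X Y h \<and>
        (\<forall>p\<in>topspace X. \<exists>\<tau>::real \<Rightarrow> real.
           strict_mono \<tau> \<and> surj \<tau> \<and> (\<forall>t. h (v t p) = w (\<tau> t) (h p))))"

text \<open>The flow \<open>v\<close> on \<open>Z\<close> is semi-conjugate to the flow \<open>w\<close> on \<open>Y\<close>; note that the map goes
  from \<open>Y\<close> to \<open>Z\<close>.\<close>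

definition topologically_semiconjugate ::
  "'b topology \<Rightarrow> (real \<Rightarrow> 'b \<Rightarrow> 'b) \<Rightarrow> 'a topology \<Rightarrow> (real \<Rightarrow> 'a \<Rightarrow> 'a) \<Rightarrow> ('a \<Rightarrow> 'b) \<Rightarrow> bool" where
  "topologically_semiconjugate Z v Y w h \<longleftrightarrow>
     continuous_map Y Z h \<and> h ` topspace Y = topspace Z \<and>
     (\<forall>t. \<forall>p\<in>topspace Y. v t (h p) = h (w t p))"

text \<open>The map \<open>h\<close> is, up to a homeomorphism of its target, the projection from \<open>Y\<close> onto the
  quotient space in which \<open>C\<close> is identified to one point.\<close>

definition collapses_to_point :: "'a topology \<Rightarrow> 'b topology \<Rightarrow> ('a \<Rightarrow> 'b) \<Rightarrow> 'a set \<Rightarrow> bool" where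
  "collapses_to_point Y Z h C \<longleftrightarrow>
     C \<noteq> {} \<and> C \<subseteq> topspace Y \<and> quotient_map Y Z h \<and>
     (\<forall>p\<in>topspace Y. \<forall>q\<in>topspace Y. h p = h q \<longleftrightarrow> p = q \<or> p \<in> C \<and> q \<in> C)"

primrec k_times_differentiable_on :: "nat \<Rightarrow> (real \<times> real) set \<Rightarrow> (real \<times> real \<Rightarrow> real) \<Rightarrow> bool" where
  "k_times_differentiable_on 0 U f \<longleftrightarrow> continuous_on U f"
| "k_times_differentiable_on (Suc k) U f \<longleftrightarrow>
     (\<exists>f'. (\<forall>p\<in>U. (f has_derivative f' p) (at p)) \<and>
           (\<forall>d. k_times_differentiable_on k U (\<lambda>p. f' p d)))"

text \<open>Meant for open \<open>U\<close>.\<close>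

definition C_infinity_on :: "(real \<times> real) set \<Rightarrow> (real \<times> real \<Rightarrow> real) \<Rightarrow> bool" where
  "C_infinity_on U f \<longleftrightarrow> (\<forall>k. k_times_differentiable_on k U f)"

definition square :: "(real \<times> real) set" where
  "square = {-1..1} \<times> {-1..1}"

definition open_square :: "(real \<times> real) set" where
  "open_square = {-1<..<1} \<times> {-1<..<1}"

text \<open>Smoothness on the closed square amounts to smoothness on the open one, because \<open>\<phi>\<close> is
  constant near the boundary.\<close>

definition slowing_function :: "(real \<times> real \<Rightarrow> real) \<Rightarrow> bool" where
  "slowing_function \<phi> \<longleftrightarrow>
     C_infinity_on open_square \<phi> \<and>
     \<phi> ` square \<subseteq> {0..1} \<and>
     {p\<in>square. \<phi> p = 0} = {(0, 0)} \<and>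
     (\<exists>r<1. \<forall>p\<in>square. \<bar>fst p\<bar> > r \<or> \<bar>snd p\<bar> > r \<longrightarrow> \<phi> p = 1)"

text \<open>The chart \<open>g\<close> identifies \<open>R\<close> with \<open>g ` R\<close> such that the directed orbit arcs of \<open>v\<close> inside
  \<open>g ` R\<close> are those of the vector field \<open>F\<close> inside \<open>R\<close>: running along \<open>v\<close> inside \<open>g ` R\<close> one
  gets from \<open>g p\<close> to \<open>g q\<close> if and only if some integral curve of \<open>F\<close> inside \<open>R\<close> leads from \<open>p\<close>
  to \<open>q\<close>. The parametrisations of these arcs need not correspond.\<close>

definition orbit_arcs_generated_by ::
  "(real \<Rightarrow> 'a \<Rightarrow> 'a) \<Rightarrow> (real \<times> real \<Rightarrow> 'a) \<Rightarrow> (real \<times> real) set \<Rightarrow>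
   (real \<times> real \<Rightarrow> real \<times> real) \<Rightarrow> bool" where
  "orbit_arcs_generated_by v g R F \<longleftrightarrow>
     (\<forall>p\<in>R. \<forall>q\<in>R.
        (\<exists>t\<ge>0. v t (g p) = g q \<and> (\<forall>s\<in>{0..t}. v s (g p) \<in> g ` R)) \<longleftrightarrow>
        (\<exists>T\<ge>0. \<exists>c. c 0 = p \<and> c T = q \<and>
           (\<forall>s\<in>{0..T}. c s \<in> R \<and> (c has_vector_derivative F (c s)) (at s within {0..T}))))"

text \<open>The set \<open>H\<close> is the whole plane if \<open>x\<close> is an interior point of the surface, and
  \<^const>\<open>half_plane\<close> if \<open>x\<close> is a boundary point; a neighbourhood of a boundary point is
  modelled on the upper half of the square, with \<open>x\<close> in the middle of its lower edge.\<close>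

definition trivial_flow_box ::
  "'a topology \<Rightarrow> (real \<Rightarrow> 'a \<Rightarrow> 'a) \<Rightarrow> 'a \<Rightarrow> (real \<times> real) set \<Rightarrow> (real \<times> real \<Rightarrow> 'a) \<Rightarrow> bool" where
  "trivial_flow_box X v x H g \<longleftrightarrow>
     H \<in> {UNIV, half_plane} \<and>
     embedding_map (top_of_set (square \<inter> H)) X g \<and>
     openin X (g ` (open_square \<inter> H)) \<and>
     g (0, 0) = x \<and>
     orbit_arcs_generated_by v g (square \<inter> H) (\<lambda>p. (1, 0))"

text \<open>The result depends on the choices of the box, of \<open>\<phi>\<close> and of the parametrisation of the
  new orbit arcs, hence a relation: \<open>w\<close> is a flow resulting from \<open>v\<close>.\<close>

definition singular_replacement ::
  "'a topology \<Rightarrow> (real \<Rightarrow> 'a \<Rightarrow> 'a) \<Rightarrow> 'a \<Rightarrow> (real \<Rightarrow> 'a \<Rightarrow> 'a) \<Rightarrow> bool" where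
  "singular_replacement X v x w \<longleftrightarrow>
     flow_on X w \<and>
     (\<exists>H g \<phi>. trivial_flow_box X v x H g \<and> slowing_function \<phi> \<and>
        orbit_arcs_generated_by w g (square \<inter> H) (\<lambda>p. (\<phi> p, 0)) \<and>
        (\<forall>p\<in>topspace X. \<forall>t\<ge>0.
           (\<forall>s\<in>{0..t}. v s p \<notin> g ` (square \<inter> H)) \<longrightarrow> (\<forall>s\<in>{0..t}. w s p = v s p)))"

end

theory Submission
  imports Defs
begin

text \<open>Near \<open>x\<close> the flow is slowed down so that \<open>x\<close> becomes a fixed point; this does not change the orbits
  other than that of \<open>x\<close>, and all ways to do it are equivalent by reparametrisation. The point \<open>x\<close> is then
  blown up to a topologist's sine curve, a set which no path traverses. If the flow is slow enough
  compared with the modulus of continuity of the blow-up outside \<open>x\<close>, it lifts to a continuous flow that fixes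
  the sine curve. The orbit of \<open>y\<close> passes \<open>x\<close> along horizontal arcs whose heights tend to zero, and the
  blow-up of these arcs accumulates at the whole sine curve, so that the new \<open>\<omega>\<close>-limit set of \<open>y\<close> is the
  full preimage of the old one. The old one has empty interior, since it does not contain \<open>y\<close>; hence paths
  in the preimage cannot change their height near the sine curve, and must climb up the stem.\<close>

section \<open>Collapsing a topologist's sine curve\<close>

text \<open>The flow is merely continuous, so flow boxes cannot come from the rectification of a
  vector field: local sections have to be built, and invariance of domain shows, at interior and at
  boundary points, that the resulting box is a neighbourhood. Only the half of the box above the
  orbit of \<open>x\<close> is blown up. This suffices because the orbit of \<open>y\<close> returns
  near \<open>x\<close> on at least one side, and it is the only choice at a boundary point. The
  blow-up fixes the lower edge apart from the origin and is continued by the identity below it. The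
  sine curve is the intersection of nested regions bounded by the images of the level sets of
  \<open>shell\<close>; strict monotonicity of these regions in the radius gives injectivity, the
  intermediate value theorem surjectivity. The statement speaks of every flow that results from
  replacing \<open>x\<close>. Each of them is shown to be \<open>v\<close> run through exactly those
  times before the orbit meets \<open>x\<close> (\<open>slowing_at\<close>), a description in which
  box, \<open>\<phi>\<close> and speed no longer occur.\<close>

definition half_box :: "(real \<times> real) set" where
  "half_box = {-1..1} \<times> {0..1}"

text \<open>For \<open>r \<rightarrow> 0\<close> the image under the blow-up of the points at \<open>shell\<close> distance \<open>r\<close> shrinks to the sine
  curve: \<open>mix r y\<close> tends to 0 if \<open>y < 1/4\<close>, where the rows of half-width \<open>halfwidth r y\<close> about \<open>centre r y\<close>
  contract to the stem, and it is 1 if \<open>y \<ge> 1/4\<close>, where they contract to the bar. The factor \<open>taper\<close> makes the blow-up the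
  identity for \<open>r \<ge> 1/2\<close>.\<close>

definition shell :: "real \<times> real \<Rightarrow> real" where
  "shell p = max \<bar>fst p\<bar> (snd p)"

text \<open>The value \<open>1/4 + r/2\<close> equals \<open>r + taper r / 4\<close> for
  \<open>r \<le> 1/2\<close>, the half-width of the rows where \<open>mix\<close> is 1. From radius
  1/2 on the maximum is \<open>r\<close>, as the identity requires.\<close>

definition shell_top :: "real \<Rightarrow> real" where
  "shell_top r = max r (1/4 + r/2)"

definition taper :: "real \<Rightarrow> real" where
  "taper r = max 0 (1 - 2 * r)"

text \<open>Below the bar this is the distance to the bar until \<open>r * y\<close> takes over. The
  second term keeps the argument of the sine finite on each shell of positive radius, also at and
  above height 1/4; where it takes over, \<open>mix\<close> is 1 and the sine term has faded
  out.\<close>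

definition gap :: "real \<Rightarrow> real \<Rightarrow> real" where
  "gap r y = max (1/4 - y) (r * y)"

definition mix :: "real \<Rightarrow> real \<Rightarrow> real" where
  "mix r y = r * y / gap r y"

definition centre :: "real \<Rightarrow> real \<Rightarrow> real" where
  "centre r y = taper r * (1 - mix r y) * sin (pi / gap r y) / 4"

definition halfwidth :: "real \<Rightarrow> real \<Rightarrow> real" where
  "halfwidth r y = r + taper r * mix r y / 4"

definition blow_up :: "real \<times> real \<Rightarrow> real \<times> real" where
  "blow_up p = (let r = shell p; y = snd p * shell_top r / r
     in (centre r y + halfwidth r y * (fst p / r), y))"

text \<open>The lower end is the origin because \<open>sin (4 * pi) = 0\<close>: the sine curve is
  attached to the lower edge at the place of \<open>x\<close>.\<close>

definition stem :: "(real \<times> real) set" where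
  "stem = (\<lambda>y. (sin (pi / (1/4 - y)) / 4, y)) ` {0..<1/4}"

definition bar :: "(real \<times> real) set" where
  "bar = {-1/4..1/4} \<times> {1/4}"

lemma gap_pos: "0 < r \<Longrightarrow> 0 \<le> y \<Longrightarrow> 0 < gap r y"
  unfolding gap_def by (cases "y < 1/4") (auto simp: less_max_iff_disj)

lemma mix_bounds: "0 < r \<Longrightarrow> 0 \<le> y \<Longrightarrow> 0 \<le> mix r y \<and> mix r y \<le> 1"
  using gap_pos[of r y] unfolding mix_def by (auto simp: divide_simps gap_def)

lemma mix_eq_1: "0 < r \<Longrightarrow> 1/4 - y \<le> r * y \<Longrightarrow> 0 < y \<Longrightarrow> mix r y = 1"
  unfolding mix_def gap_def by (simp add: max_def)

text \<open>For \<open>e = 1\<close> and \<open>e = -1\<close> this says that the right edge moves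
  right and the left edge moves left as the radius grows, so the regions enclosed by the shells are
  nested. An edge has the form \<open>r + taper r * E r / 4\<close>, where \<open>E r\<close>
  averages a sine value and 1 with weight \<open>mix\<close> and hence grows with
  \<open>mix\<close>. The decrease of \<open>taper\<close> costs at most half of the growth of
  \<open>r\<close>.\<close>

lemma edge_strict_mono:
  fixes e :: real
  assumes r: "0 < r" "r < r'" "0 \<le> y" and e: "\<bar>e\<bar> \<le> 1"
  shows "e * centre r y + halfwidth r y < e * centre r' y + halfwidth r' y"
proof -
  define E where "E r = (1 - mix r y) * (e * sin (pi / gap r y)) + mix r y" for r
  have sb: "\<bar>e * sin z\<bar> \<le> 1" for z
    using e abs_sin_le_one[of z] by (simp add: abs_mult mult_le_one)
  have bd: "-1 \<le> E r \<and> E r \<le> 1" if "0 < r" for r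
  proof -
    have m: "0 \<le> mix r y" "mix r y \<le> 1" using mix_bounds that r by auto
    have s: "-1 \<le> e * sin (pi / gap r y)" "e * sin (pi / gap r y) \<le> 1"
      using sb[of "pi / gap r y"] by linarith+
    have "(1 - mix r y) * (e * sin (pi / gap r y)) \<le> (1 - mix r y) * 1"
      using m s by (intro mult_left_mono) auto
    moreover have "(1 - mix r y) * (-1) \<le> (1 - mix r y) * (e * sin (pi / gap r y))"
      using m s by (intro mult_left_mono) auto
    ultimately show ?thesis unfolding E_def using m by (auto simp: algebra_simps)
  qed
  \<comment> \<open>As long as \<open>mix\<close> is below 1 at the larger radius, the gap does not
    depend on the radius and both sine values coincide; otherwise \<open>E r'\<close> is the maximal
    value 1.\<close>
  have mono: "E r \<le> E r'"
  proof (cases "1/4 - y \<le> r' * y")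
    case True
    then have "0 < y" using r by (cases "y = 0") auto
    then have "E r' = 1" unfolding E_def using mix_eq_1[of r' y] True r by simp
    then show ?thesis using bd r by auto
  next
    case False
    have "r * y \<le> r' * y" using r by (simp add: mult_right_mono)
    moreover have "0 \<le> r' * y" using r by simp
    ultimately have g: "gap r y = 1/4 - y" "gap r' y = 1/4 - y" "1/4 - y > 0"
      using False unfolding gap_def by auto
    have "mix r y \<le> mix r' y" using g(3) unfolding mix_def g(1,2) using \<open>r * y \<le> r' * y\<close>
      by (intro divide_right_mono) auto
    moreover have "e * sin (pi / (1/4 - y)) \<le> 1" using sb[of "pi / (1/4 - y)"] by linarith
    ultimately have "0 \<le> (mix r' y - mix r y) * (1 - e * sin (pi / (1/4 - y)))" by simp
    then show ?thesis unfolding E_def g(1,2) by (simp add: algebra_simps)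
  qed
  have eq: "e * centre r y + halfwidth r y = r + taper r * E r / 4" for r
    unfolding centre_def halfwidth_def E_def by (simp add: field_simps)
  have c: "0 \<le> taper r'" "taper r' \<le> taper r" "taper r - taper r' \<le> 2 * (r' - r)"
    using r unfolding taper_def by (auto simp: max_def)
  have "taper r * E r \<le> taper r' * E r + 2 * (r' - r)"
  proof -
    have "(taper r - taper r') * E r \<le> (taper r - taper r') * 1"
      using c bd[OF r(1)] by (intro mult_left_mono) auto
    then show ?thesis using c by (simp add: algebra_simps)
  qed
  moreover have "taper r' * E r \<le> taper r' * E r'" using c mono by (simp add: mult_left_mono)
  ultimately show ?thesis unfolding eq using r by simp
qed

lemma shell_top_pos: "0 \<le> r \<Longrightarrow> 0 < shell_top r" unfolding shell_top_def by auto

lemma shell_top_strict_mono: "r < r' \<Longrightarrow> shell_top r < shell_top r'"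
  unfolding shell_top_def by auto

lemma shell_pos: "p \<in> half_box \<Longrightarrow> p \<noteq> (0,0) \<Longrightarrow> 0 < shell p \<and> shell p \<le> 1"
  unfolding half_box_def shell_def by (cases p) auto

lemma halfwidth_pos: "0 < r \<Longrightarrow> 0 \<le> y \<Longrightarrow> 0 < halfwidth r y"
  unfolding halfwidth_def taper_def using mix_bounds[of r y] by (simp add: add_pos_nonneg)

lemma halfwidth_wide: "0 < r \<Longrightarrow> 1/4 \<le> y \<Longrightarrow> halfwidth r y = shell_top r \<and> centre r y = 0"
proof -
  assume r: "0 < r" "1/4 \<le> y"
  then have "mix r y = 1" by (intro mix_eq_1) (auto intro: order_trans[of _ 0])
  then show ?thesis unfolding halfwidth_def centre_def taper_def shell_top_def by (auto simp: max_def field_simps)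
qed

text \<open>At radius 1 the taper vanishes and equality holds; monotonicity in the radius does the
  rest.\<close>

lemma edge_bound:
  assumes "0 < r" "r \<le> 1" "0 \<le> y"
  shows "\<bar>centre r y\<bar> + halfwidth r y \<le> 1"
proof -
  have "e * centre r y + halfwidth r y \<le> 1" if "\<bar>e\<bar> \<le> 1" for e
  proof (cases "r = 1")
    case True then show ?thesis unfolding centre_def halfwidth_def taper_def by simp
  next
    case False
    then have "e * centre r y + halfwidth r y < e * centre 1 y + halfwidth 1 y"
      using assms that by (intro edge_strict_mono) auto
    then show ?thesis unfolding centre_def halfwidth_def taper_def by simp
  qed
  from this[of 1] this[of "-1"] show ?thesis by auto
qed

lemma blow_up_id:
  assumes "p \<in> half_box" "1/2 \<le> shell p \<or> snd p = 0" "p \<noteq> (0,0)"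
  shows "blow_up p = p"
proof (cases "1/2 \<le> shell p")
  case True
  then have t: "shell_top (shell p) = shell p" "taper (shell p) = 0"
    unfolding shell_top_def taper_def by auto
  show ?thesis using shell_pos[OF assms(1,3)] unfolding blow_up_def Let_def t centre_def halfwidth_def
    by (simp add: prod_eq_iff t)
next
  case False
  then have "snd p = 0" using assms by auto
  then show ?thesis using shell_pos[OF assms(1,3)] unfolding blow_up_def Let_def centre_def halfwidth_def mix_def gap_def
    by (simp add: prod_eq_iff)
qed

lemma blow_up_snd:
  assumes "p \<in> half_box" "p \<noteq> (0,0)"
  shows "0 \<le> snd (blow_up p) \<and> snd (blow_up p) \<le> shell_top (shell p) \<and> shell_top (shell p) \<le> 1"
proof -
  have r: "0 < shell p" "shell p \<le> 1" using shell_pos[OF assms] by auto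
  have "snd p \<ge> 0" "snd p \<le> shell p" using assms unfolding half_box_def shell_def by auto
  then have "snd p * shell_top (shell p) \<le> shell p * shell_top (shell p)"
    using shell_top_pos[of "shell p"] r by (intro mult_right_mono) auto
  then show ?thesis using r \<open>snd p \<ge> 0\<close> shell_top_pos[of "shell p"]
    unfolding blow_up_def Let_def by (auto simp: divide_simps mult.commute shell_top_def)
qed

lemma blow_up_fst:
  assumes "p \<in> half_box" "p \<noteq> (0,0)"
  defines "r \<equiv> shell p" and "y \<equiv> snd (blow_up p)"
  shows "fst (blow_up p) = centre r y + halfwidth r y * (fst p / r)" "\<bar>fst p / r\<bar> \<le> 1"
proof -
  show "fst (blow_up p) = centre r y + halfwidth r y * (fst p / r)"
    unfolding r_def y_def blow_up_def Let_def by simp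
  have "0 < r" using shell_pos[OF assms(1,2)] r_def by auto
  then show "\<bar>fst p / r\<bar> \<le> 1" unfolding r_def shell_def by (auto simp: divide_simps)
qed

lemma blow_up_half_box:
  assumes "p \<in> half_box" "p \<noteq> (0,0)"
  shows "blow_up p \<in> half_box"
proof -
  let ?r = "shell p" let ?y = "snd (blow_up p)"
  have y: "0 \<le> ?y" "?y \<le> 1" using blow_up_snd[OF assms] by auto
  have r: "0 < ?r" "?r \<le> 1" using shell_pos[OF assms] by auto
  have "\<bar>halfwidth ?r ?y * (fst p / ?r)\<bar> \<le> halfwidth ?r ?y * 1"
    unfolding abs_mult using halfwidth_pos[OF r(1) y(1)] blow_up_fst(2)[OF assms] by (intro mult_mono) auto
  then have "\<bar>fst (blow_up p)\<bar> \<le> 1" unfolding blow_up_fst(1)[OF assms]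
    using edge_bound[OF r y(1)] by linarith
  then show ?thesis using y unfolding half_box_def by (cases "blow_up p") auto
qed

text \<open>Let \<open>q\<close> be on the larger shell. It lies on a side or on the top of that
  shell, so its image lies on an edge or the top of its region, strictly outside the smaller region
  that contains the image of \<open>p\<close>. Within one shell every row is mapped affinely with
  the positive factor \<open>halfwidth\<close>.\<close>

lemma blow_up_inj: "inj_on blow_up (half_box - {(0,0)})"
proof -
  have less: False if p: "p \<in> half_box" "p \<noteq> (0,0)" and q: "q \<in> half_box" "q \<noteq> (0,0)"
    and eq: "blow_up p = blow_up q" and lt: "shell p < shell q" for p q
  proof -
    let ?r = "shell p" and ?r' = "shell q" and ?y = "snd (blow_up p)"
    have r: "0 < ?r" using shell_pos p by auto
    have y: "0 \<le> ?y" using blow_up_snd p by auto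
    have hw: "0 < halfwidth ?r ?y" using halfwidth_pos r y by auto
    have x: "\<bar>fst (blow_up p) - centre ?r ?y\<bar> \<le> halfwidth ?r ?y"
    proof -
      have "\<bar>halfwidth ?r ?y * (fst p / ?r)\<bar> \<le> halfwidth ?r ?y * 1"
        unfolding abs_mult using hw blow_up_fst(2)[OF p] by (intro mult_mono) auto
      then show ?thesis unfolding blow_up_fst(1)[OF p] by simp
    qed
    have xq: "fst (blow_up p) = centre ?r' ?y + halfwidth ?r' ?y * (fst q / ?r')"
      using blow_up_fst(1)[OF q] eq by simp
    consider "fst q = ?r'" | "fst q = - ?r'" | "snd q = ?r'" unfolding shell_def by linarith
    then show False
    proof cases
      case 1
      with xq r lt have "fst (blow_up p) = centre ?r' ?y + halfwidth ?r' ?y" by simp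
      with edge_strict_mono[OF r lt y, of 1] x show False by simp
    next
      case 2
      with xq r lt have "fst (blow_up p) = centre ?r' ?y - halfwidth ?r' ?y" by simp
      with edge_strict_mono[OF r lt y, of "-1"] x show False by simp
    next
      case 3
      then have "snd (blow_up q) = shell_top ?r'" unfolding blow_up_def Let_def using r lt by simp
      with blow_up_snd[OF p] eq shell_top_strict_mono[OF lt] show False by simp
    qed
  qed
  show ?thesis
  proof (rule inj_onI)
    fix p q assume p: "p \<in> half_box - {(0,0)}" and q: "q \<in> half_box - {(0,0)}" and eq: "blow_up p = blow_up q"
    then have s: "shell p = shell q" using less[of p q] less[of q p] by (cases "shell p" "shell q" rule: linorder_cases) auto
    have r: "0 < shell p" using shell_pos p by auto
    have "snd p * shell_top (shell p) / shell p = snd q * shell_top (shell p) / shell p"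
      using arg_cong[OF eq, of snd] s unfolding blow_up_def Let_def by simp
    then have 1: "snd p = snd q" using r shell_top_pos[of "shell p"] by simp
    have y: "0 \<le> snd (blow_up p)" using blow_up_snd p by auto
    have "halfwidth (shell p) (snd (blow_up p)) * (fst p / shell p) = halfwidth (shell p) (snd (blow_up p)) * (fst q / shell p)"
      using blow_up_fst(1)[of p] blow_up_fst(1)[of q] p q eq s by auto
    then have "fst p = fst q" using r halfwidth_pos[OF r y] by simp
    with 1 show "p = q" by (simp add: prod_eq_iff)
  qed
qed

lemma blow_up_cont: "continuous_on (half_box - {(0,0)}) blow_up"
proof -
  have s: "continuous_on A shell" for A unfolding shell_def by (intro continuous_intros)
  have rz: "\<forall>p\<in>half_box - {(0,0)}. shell p \<noteq> 0" using shell_pos by force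
  have y: "continuous_on (half_box - {(0,0)}) (\<lambda>p. snd p * shell_top (shell p) / shell p)"
    unfolding shell_top_def using rz by (intro continuous_intros s) auto
  have g: "continuous_on (half_box - {(0,0)}) (\<lambda>p. gap (shell p) (snd p * shell_top (shell p) / shell p))"
    unfolding gap_def by (intro continuous_intros s y)
  have ynn: "p \<in> half_box - {(0,0)} \<Longrightarrow> 0 \<le> snd p * shell_top (shell p) / shell p" for p
    using blow_up_snd[of p] unfolding blow_up_def Let_def by simp
  have gp: "p \<in> half_box - {(0,0)} \<Longrightarrow> gap (shell p) (snd p * shell_top (shell p) / shell p) \<noteq> 0" for p
    using gap_pos[of "shell p" "snd p * shell_top (shell p) / shell p"] ynn[of p] shell_pos[of p] by auto
  have m: "continuous_on (half_box - {(0,0)}) (\<lambda>p. mix (shell p) (snd p * shell_top (shell p) / shell p))"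
    unfolding mix_def using gp by (intro continuous_intros s y g) auto
  show ?thesis unfolding blow_up_def Let_def centre_def halfwidth_def taper_def
    using gp rz by (intro continuous_intros s y m g) auto
qed

section \<open>Nested regions around the sine curve, and the inverse of the blow-up\<close>

definition blob :: "(real \<times> real) set" where
  "blob = stem \<union> bar"

text \<open>The limiting case of radius 0 in the monotonicity of the edges: the stem lies strictly
  inside every region.\<close>

lemma edge_stem:
  assumes "0 < r" "0 \<le> y" "y < 1/4" "\<bar>e\<bar> \<le> 1"
  shows "e * (sin (pi / (1/4 - y)) / 4) < e * centre r y + halfwidth r y"
proof -
  define \<sigma> where "\<sigma> = e * sin (pi / (1/4 - y))"
  have s: "\<bar>\<sigma>\<bar> \<le> 1" unfolding \<sigma>_def using assms(4) abs_sin_le_one[of "pi / (1/4 - y)"] by (simp add: abs_mult mult_le_one)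
  define E where "E = (1 - mix r y) * (e * sin (pi / gap r y)) + mix r y"
  have "\<sigma> \<le> E"
  proof (cases "1/4 - y \<le> r * y")
    case True
    then have "0 < y" using assms by (cases "y = 0") auto
    then show ?thesis using mix_eq_1[of r y] True assms s unfolding E_def by auto
  next
    case False
    then have g: "gap r y = 1/4 - y" unfolding gap_def by simp
    have "0 \<le> mix r y" using mix_bounds assms by auto
    then have "0 \<le> mix r y * (1 - \<sigma>)" using s by simp
    then show ?thesis unfolding E_def g \<sigma>_def by (simp add: algebra_simps)
  qed
  have eq: "e * centre r y + halfwidth r y = r + taper r * E / 4"
    unfolding centre_def halfwidth_def E_def by (simp add: field_simps)
  have "taper r * \<sigma> \<le> taper r * E" using \<open>\<sigma> \<le> E\<close> unfolding taper_def by (intro mult_left_mono) auto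
  moreover have "\<sigma> < 4 * r + taper r * \<sigma>"
  proof (cases "r \<le> 1/2")
    case True
    then have c: "taper r = 1 - 2 * r" unfolding taper_def by simp
    have "0 < r * (4 - 2 * \<sigma>)" using s assms by simp
    then show ?thesis unfolding c by (simp add: algebra_simps)
  next
    case False
    then have "taper r = 0" unfolding taper_def by simp
    then show ?thesis using False s by simp
  qed
  ultimately show ?thesis unfolding eq using \<sigma>_def by simp
qed

text \<open>Positive, zero or negative according to whether the point lies outside, on or inside the
  image under the blow-up of the points at shell distance \<open>r\<close>.\<close>

definition excess :: "real \<times> real \<Rightarrow> real \<Rightarrow> real" where
  "excess p r = max (snd p - shell_top r)
     (max (fst p - (centre r (snd p) + halfwidth r (snd p)))
          (centre r (snd p) - halfwidth r (snd p) - fst p))"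

lemma blob_half_box: "blob \<subseteq> half_box"
proof -
  have "\<bar>sin z / 4\<bar> \<le> 1" for z :: real using abs_sin_le_one[of z] by linarith
  then have "-1 \<le> sin z / 4 \<and> sin z / 4 \<le> 1" for z :: real using abs_sin_le_one[of z] by linarith
  then show ?thesis unfolding blob_def stem_def bar_def half_box_def by auto
qed

lemma excess_blob:
  assumes "p \<in> blob" "0 < r"
  shows "excess p r < 0"
proof (cases "p \<in> bar")
  case True
  then have "snd p = 1/4" "\<bar>fst p\<bar> \<le> 1/4" unfolding bar_def by auto
  moreover have "1/4 < shell_top r" using assms(2) unfolding shell_top_def by linarith
  ultimately show ?thesis using halfwidth_wide[of r "snd p"] assms unfolding excess_def by auto
next
  case False
  then obtain y where y: "0 \<le> y" "y < 1/4" "p = (sin (pi / (1/4 - y)) / 4, y)" using assms unfolding blob_def stem_def by auto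
  moreover have "y < shell_top r" using assms y unfolding shell_top_def by auto
  ultimately show ?thesis using edge_stem[OF assms(2) y(1,2), of 1] edge_stem[OF assms(2) y(1,2), of "-1"]
    unfolding excess_def by auto
qed

lemma excess_strict_antimono:
  assumes "0 < r" "r < r'" "0 \<le> snd p"
  shows "excess p r' < excess p r"
  using edge_strict_mono[OF assms, of 1] edge_strict_mono[OF assms, of "-1"] shell_top_strict_mono[OF assms(2)]
  unfolding excess_def by auto

lemma excess_blow_up:
  assumes "p \<in> half_box" "p \<noteq> (0,0)"
  shows "excess (blow_up p) (shell p) = 0"
proof -
  let ?r = "shell p" and ?y = "snd (blow_up p)"
  let ?w = "halfwidth ?r ?y" and ?a = "fst p / ?r"
  have r: "0 < ?r" using shell_pos assms by auto
  have y: "0 \<le> ?y" "?y \<le> shell_top ?r" using blow_up_snd assms by auto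
  have w: "0 < ?w" using halfwidth_pos r y by auto
  have a: "\<bar>?a\<bar> \<le> 1" and x: "fst (blow_up p) = centre ?r ?y + ?w * ?a"
    using blow_up_fst[OF assms] by auto
  have "?w * ?a \<le> ?w * 1" "?w * (-1) \<le> ?w * ?a" using w a by (intro mult_left_mono; linarith)+
  moreover consider "fst p = ?r" | "fst p = - ?r" | "snd p = ?r" unfolding shell_def by linarith
  then have "?w * ?a = ?w \<or> ?w * ?a = - ?w \<or> ?y = shell_top ?r"
  proof cases
    case 1 then show ?thesis using r by simp
  next
    case 2 then have "?a = -1" using r by (simp add: divide_eq_eq)
    then show ?thesis by simp
  next
    case 3 then show ?thesis unfolding blow_up_def Let_def using r by simp
  qed
  ultimately show ?thesis unfolding excess_def x using y(2) by auto
qed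

lemma blow_up_notin_blob: "p \<in> half_box \<Longrightarrow> p \<noteq> (0,0) \<Longrightarrow> blow_up p \<notin> blob"
  using excess_blow_up[of p] excess_blob[of "blow_up p" "shell p"] shell_pos[of p] by auto

lemma excess_zero_imp:
  assumes p: "p \<in> half_box" and r: "0 < r" "r \<le> 1" and e: "excess p r = 0"
  shows "\<exists>q\<in>half_box - {(0,0)}. blow_up q = p \<and> shell q = r"
proof -
  obtain x y where xy: "p = (x, y)" by (cases p)
  have y: "0 \<le> y" using p xy unfolding half_box_def by auto
  let ?w = "halfwidth r y" and ?c = "centre r y"
  have w: "0 < ?w" using halfwidth_pos r y by auto
  have t: "0 < shell_top r" using shell_top_pos r by simp
  \<comment> \<open>These invert the two coordinates of the blow-up for the fixed radius
    \<open>r\<close>. That one of the three bounds in the excess is attained puts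
    \<open>(a, b)\<close> on the shell of radius \<open>r\<close>.\<close>
  define a where "a = (x - ?c) * r / ?w"
  define b where "b = y * r / shell_top r"
  from e have le: "y \<le> shell_top r" "x - ?c \<le> ?w" "- ?w \<le> x - ?c"
    and eq: "y = shell_top r \<or> x - ?c = ?w \<or> x - ?c = - ?w"
    unfolding excess_def xy by (auto simp: max_def split: if_splits)
  have b: "0 \<le> b" "b \<le> r" unfolding b_def using y t r le by (auto simp: divide_le_eq mult.commute mult_right_mono)
  have "(x - ?c) * r \<le> ?w * r" "- ?w * r \<le> (x - ?c) * r" using le r by (intro mult_right_mono; linarith)+
  then have a: "a \<le> r" "- r \<le> a" unfolding a_def using w by (auto simp: divide_simps mult.commute)
  have "b = r \<or> a = r \<or> a = - r" using eq t w unfolding a_def b_def by auto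
  then have s: "shell (a, b) = r" unfolding shell_def using a b r by auto
  have "blow_up (a, b) = p" unfolding blow_up_def Let_def s xy using r w t unfolding a_def b_def by simp
  moreover have "(a, b) \<in> half_box - {(0,0)}" using a b r s unfolding half_box_def by (auto simp: shell_def)
  ultimately show ?thesis using s by blast
qed

text \<open>Radius 0 can be included only below the bar, where \<open>gap 0\<close> is still
  positive.\<close>

lemma excess_continuous_radius:
  assumes "0 \<le> snd p" "0 < r0 \<or> snd p < 1/4 \<and> 0 \<le> r0"
  shows "continuous_on {r0..1} (excess p)"
proof -
  have g: "\<forall>r\<in>{r0..1}. gap r (snd p) \<noteq> 0"
  proof
    fix r assume "r \<in> {r0..1}"
    then show "gap r (snd p) \<noteq> 0" using gap_pos[of r "snd p"] assms unfolding gap_def by force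
  qed
  have gc: "continuous_on {r0..1} (\<lambda>r. gap r (snd p))" unfolding gap_def by (intro continuous_intros)
  show ?thesis using g
    unfolding excess_def shell_top_def centre_def halfwidth_def taper_def mix_def by (intro continuous_intros gc) auto
qed

lemma excess_continuous_point:
  assumes "0 < r"
  shows "continuous_on half_box (\<lambda>p. excess p r)"
proof -
  have g: "\<forall>p\<in>half_box. gap r (snd p) \<noteq> 0"
    using gap_pos[OF assms] unfolding half_box_def by force
  have gc: "continuous_on half_box (\<lambda>p. gap r (snd p))" unfolding gap_def by (intro continuous_intros)
  show ?thesis using g
    unfolding excess_def shell_top_def centre_def halfwidth_def taper_def mix_def by (intro continuous_intros gc) auto
qed

lemma excess_pos_if_notin_blob:
  assumes p: "p \<in> half_box" "p \<notin> blob"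
  shows "\<exists>r. 0 < r \<and> r \<le> 1 \<and> 0 < excess p r"
proof -
  obtain x y where xy: "p = (x, y)" by (cases p)
  have b: "0 \<le> y" "y \<le> 1" "\<bar>x\<bar> \<le> 1" using p xy unfolding half_box_def by auto
  show ?thesis
  proof (cases "y < 1/4")
    case True
    then have ne: "x \<noteq> sin (pi / (1/4 - y)) / 4" using p b xy unfolding blob_def stem_def by force
    \<comment> \<open>At radius 0 the region has shrunk to the stem and the excess is the horizontal
      distance from it; continuity keeps it positive for small radii.\<close>
    have 0: "excess p 0 > 0"
      using True ne xy unfolding excess_def centre_def halfwidth_def mix_def taper_def gap_def by auto
    have "continuous_on {0..1} (excess p)" using excess_continuous_radius[of p 0] True b xy by auto
    then have "isCont (excess p) 0 \<or> (excess p \<longlongrightarrow> excess p 0) (at 0 within {0..1})" by (simp add: continuous_on_def)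
    then have "(excess p \<longlongrightarrow> excess p 0) (at 0 within {0..1})" by (auto simp: isCont_def intro: tendsto_within_subset)
    then have "eventually (\<lambda>r. 0 < excess p r) (at 0 within {0..1})" using 0 by (rule order_tendstoD)
    then obtain d where d: "d > 0" "\<And>r. r \<in> {0..1} \<Longrightarrow> r \<noteq> 0 \<Longrightarrow> dist r 0 < d \<Longrightarrow> 0 < excess p r"
      unfolding eventually_at by auto
    show ?thesis using d by (intro exI[of _ "min 1 (d/2)"]) auto
  next
    case False
    have "\<not> (\<bar>x\<bar> \<le> 1/4 \<and> y = 1/4)" using p xy unfolding blob_def bar_def by auto
    then have r: "0 < max \<bar>x\<bar> y - 1/4" using False by auto
    \<comment> \<open>With \<open>m\<close> the maximum of \<open>|x|\<close> and \<open>y\<close>,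
      the radius \<open>m - 1/4\<close> has \<open>shell_top\<close> below \<open>m\<close>. From
      height 1/4 on, \<open>shell_top\<close> is also the half-width, so the point lies outside the
      region.\<close>
    let ?r = "max \<bar>x\<bar> y - 1/4"
    have "shell_top ?r < max \<bar>x\<bar> y"
    proof -
      have "m - 1/4 < m \<and> 1/4 + (m - 1/4)/2 < m" if "0 < m - 1/4" for m :: real using that by (simp add: field_simps)
      from this[OF r] show ?thesis unfolding shell_top_def by (simp only: max_less_iff_conj)
    qed
    then have "shell_top ?r < \<bar>x\<bar> \<or> shell_top ?r < y" unfolding less_max_iff_disj .
    moreover have "s < \<bar>x\<bar> \<or> s < y \<Longrightarrow> s < x \<or> s < - x \<or> s < y" for s by linarith
    ultimately have "shell_top ?r < x \<or> shell_top ?r < - x \<or> shell_top ?r < y" by blast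
    moreover have "halfwidth ?r y = shell_top ?r" "centre ?r y = 0" using halfwidth_wide[OF r, of y] False by simp_all
    ultimately have "0 < excess p ?r" unfolding excess_def xy fst_conv snd_conv less_max_iff_disj by (simp add: disj_ac less_minus_iff[of _ x])
    moreover have "max \<bar>x\<bar> y \<le> 1" using b by (simp only: max.bounded_iff)
    then have "?r \<le> 1" using diff_mono[of "max \<bar>x\<bar> y" 1 0 "1/4"] by (simp del: diff_mono)
    ultimately show ?thesis using r by blast
  qed
qed

text \<open>The excess is positive at some radius because the point is off the blob, and it is not
  positive at radius 1, whose region is the whole half box. At a zero in between, the point lies on
  the image of a shell.\<close>

lemma blow_up_surj:
  assumes p: "p \<in> half_box" "p \<notin> blob"
  shows "\<exists>q\<in>half_box - {(0,0)}. blow_up q = p"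
proof -
  obtain r0 where r0: "0 < r0" "r0 \<le> 1" "0 < excess p r0" using excess_pos_if_notin_blob[OF p] by auto
  have "excess p 1 \<le> 0" using p unfolding excess_def shell_top_def centre_def halfwidth_def taper_def half_box_def by auto
  moreover have "continuous_on {r0..1} (excess p)" using excess_continuous_radius[of p r0] r0 p unfolding half_box_def by auto
  ultimately obtain r where "r0 \<le> r" "r \<le> 1" "excess p r = 0" using IVT2'[of "excess p" 1 0 r0] r0 by auto
  then show ?thesis using excess_zero_imp[of p r] p r0 by auto
qed

definition collapse :: "real \<times> real \<Rightarrow> real \<times> real" where
  "collapse p = (if p \<in> blob then (0,0) else inv_into (half_box - {(0,0)}) blow_up p)"

lemma collapse_blow_up: "p \<in> half_box \<Longrightarrow> p \<noteq> (0,0) \<Longrightarrow> collapse (blow_up p) = p"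
  unfolding collapse_def using blow_up_notin_blob inv_into_f_f[OF blow_up_inj] by auto

lemma blow_up_collapse:
  assumes "p \<in> half_box" "p \<notin> blob"
  shows "blow_up (collapse p) = p" "collapse p \<in> half_box" "collapse p \<noteq> (0,0)"
proof -
  obtain q where "q \<in> half_box - {(0,0)}" "p = blow_up q" using blow_up_surj[OF assms] by auto
  then show "blow_up (collapse p) = p" "collapse p \<in> half_box" "collapse p \<noteq> (0,0)" using collapse_blow_up[of q] by auto
qed

lemma zero_in_half_box: "(0,0) \<in> half_box" by (simp add: half_box_def)

lemma collapse_half_box: "p \<in> half_box \<Longrightarrow> collapse p \<in> half_box"
  using blow_up_collapse(2)[of p] zero_in_half_box by (cases "p \<in> blob") (auto simp: collapse_def)

lemma collapse_eq_zero: "p \<in> half_box \<Longrightarrow> collapse p = (0,0) \<longleftrightarrow> p \<in> blob"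
  using blow_up_collapse(3)[of p] by (auto simp: collapse_def)

lemma compact_half_box: "compact half_box" unfolding half_box_def by (intro compact_Times compact_Icc)

text \<open>As the range is compact, a closed graph suffices. Limits other than the origin are
  handled by the continuity of the blow-up. If the images tend to the origin, their radii tend to 0,
  which the excess forbids near a point off the blob.\<close>

lemma collapse_cont: "continuous_on half_box collapse"
proof (rule continuous_from_closed_graph[OF compact_half_box])
  show "collapse \<in> half_box \<rightarrow> half_box" using collapse_half_box by auto
  have cl: "closed half_box" using compact_half_box compact_imp_closed by auto
  have "closed ((\<lambda>p. (p, collapse p)) ` half_box)"
    unfolding closed_sequential_limits
  proof (intro allI impI, elim conjE)
    fix f l assume f: "\<forall>n. f n \<in> (\<lambda>p. (p, collapse p)) ` half_box" and lim: "f \<longlonglongrightarrow> l"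
    define P where "P n = fst (f n)" for n
    have P: "P n \<in> half_box" "f n = (P n, collapse (P n))" for n
      using f[rule_format, of n] unfolding P_def by (auto simp: image_iff)
    obtain p q where l: "l = (p, q)" by (cases l)
    have Pl: "P \<longlonglongrightarrow> p" using tendsto_fst[OF lim] l unfolding P_def by simp
    have Ql: "(\<lambda>n. collapse (P n)) \<longlonglongrightarrow> q" using tendsto_snd[OF lim] P l by simp
    have p: "p \<in> half_box" by (rule closed_sequentially[OF cl _ Pl]) (rule P)
    have q: "q \<in> half_box" by (rule closed_sequentially[OF cl _ Ql]) (intro collapse_half_box P)
    have "collapse p = q"
    proof (cases "q = (0,0)")
      case False
      have ev: "eventually (\<lambda>n. collapse (P n) \<noteq> (0,0)) sequentially"
        using tendsto_imp_eventually_ne[OF Ql False] .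
      have "((\<lambda>n. blow_up (collapse (P n))) \<longlongrightarrow> blow_up q) sequentially"
        by (rule continuous_on_tendsto_compose[OF blow_up_cont Ql])
           (use q False ev P(1) collapse_half_box in \<open>auto elim!: eventually_mono\<close>)
      moreover have "eventually (\<lambda>n. blow_up (collapse (P n)) = P n) sequentially"
        using ev by eventually_elim (metis P(1) blow_up_collapse(1) collapse_def)
      ultimately have "P \<longlonglongrightarrow> blow_up q" by (simp add: tendsto_cong)
      then have "p = blow_up q" using Pl LIMSEQ_unique by blast
      then show ?thesis using collapse_blow_up q False by auto
    next
      case True
      have "p \<in> blob"
      proof (rule ccontr)
        assume "p \<notin> blob"
        then obtain r where r: "0 < r" "r \<le> 1" "0 < excess p r" using excess_pos_if_notin_blob p by blast
        have "((\<lambda>n. excess (P n) r) \<longlongrightarrow> excess p r) sequentially"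
          by (rule continuous_on_tendsto_compose[OF excess_continuous_point[OF r(1)] Pl]) (use P p in auto)
        then have ev: "eventually (\<lambda>n. 0 < excess (P n) r) sequentially" using r(3) by (rule order_tendstoD)
        \<comment> \<open>The excess of \<open>P n\<close> is 0 at its own radius and positive at
          \<open>r\<close>; since it decreases with the radius, \<open>r\<close> is not the larger
          one.\<close>
        have "eventually (\<lambda>n. r \<le> shell (collapse (P n))) sequentially"
          using ev
        proof eventually_elim
          case (elim n)
          then have nb: "P n \<notin> blob" using excess_blob[of "P n" r] r by auto
          let ?s = "shell (collapse (P n))"
          have "excess (P n) ?s = 0" "0 < ?s" using blow_up_collapse[OF P(1) nb] excess_blow_up[of "collapse (P n)"] shell_pos by auto
          moreover have "0 \<le> snd (P n)" using P(1)[of n] unfolding half_box_def by auto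
          ultimately show "r \<le> ?s" using excess_strict_antimono[of ?s r "P n"] elim by force
        qed
        moreover have "(\<lambda>n. shell (collapse (P n))) \<longlonglongrightarrow> shell q" unfolding shell_def by (intro tendsto_intros Ql)
        ultimately have "r \<le> shell q" using tendsto_lowerbound by fastforce
        then show False using True r unfolding shell_def by simp
      qed
      then show ?thesis using True unfolding collapse_def by simp
    qed
    then show "l \<in> (\<lambda>p. (p, collapse p)) ` half_box" using l p by auto
  qed
  then show "closed ((\<lambda>x. Pair x (collapse x)) ` half_box)" by simp
qed

section \<open>Topology of the sine curve and its approximation by blown-up horizontal arcs\<close>

lemma zero_in_blob: "(0,0) \<in> blob"
proof -
  have "sin (pi / (1/4)) = sin (of_int 4 * pi)" by (simp add: mult.commute)
  then have "sin (pi / (1/4)) = 0" using sin_int_times_real[of 4] by simp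
  then show ?thesis unfolding blob_def stem_def by (auto intro!: image_eqI[of _ _ 0])
qed

lemma sin_add_2npi: "sin (x + 2 * pi * real n) = sin x"
proof (induction n)
  case (Suc n)
  have "x + 2 * pi * real (Suc n) = (x + 2 * pi * real n) + 2 * pi" by (simp add: algebra_simps)
  then show ?case using Suc sin_periodic by metis
qed simp

lemma stem_cont: "continuous_on {0..<1/4::real} (\<lambda>y. (sin (pi / (1/4 - y)) / 4, y))"
  by (intro continuous_intros) auto

text \<open>Only points of the stem at positive height will be recognized as limits of blown-up
  horizontal arcs, hence the restriction. A point of the bar is approached along heights at which
  the sine has the value \<open>4 * fst p\<close>.\<close>

lemma blob_closure: "blob \<subseteq> closure (stem \<inter> {p. 0 < snd p})"
proof
  fix p assume "p \<in> blob"
  show "p \<in> closure (stem \<inter> {p. 0 < snd p})"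
  proof (cases "p \<in> bar")
    case True
    then have p: "snd p = 1/4" "\<bar>fst p\<bar> \<le> 1/4" unfolding bar_def by auto
    define \<theta> where "\<theta> = arcsin (4 * fst p)"
    have th: "sin \<theta> = 4 * fst p" "-(pi/2) \<le> \<theta>" "\<theta> \<le> pi/2" unfolding \<theta>_def using p arcsin_lbound[of "4 * fst p"] arcsin_ubound[of "4 * fst p"] by auto
    \<comment> \<open>The shift \<open>n + 3\<close> keeps the denominator above
      \<open>4 * pi\<close>, so that \<open>d n < 1/4\<close> and the height
      \<open>1/4 - d n\<close> is positive.\<close>
    define d where "d n = pi / (\<theta> + 2 * pi * real (n + 3))" for n
    have den: "\<theta> + 2 * pi * real (n + 3) > 4 * pi" for n
    proof -
      have "2 * pi * 3 \<le> 2 * pi * real (n + 3)" by (intro mult_left_mono) auto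
      then show ?thesis using th pi_gt_zero by linarith
    qed
    have den0: "\<theta> + 2 * pi * real (n + 3) > 0" for n using den[of n] pi_gt_zero by linarith
    have d: "0 < d n" "d n < 1/4" for n
      using den[of n] den0[of n] unfolding d_def by (auto simp: divide_simps)
    have "pi / d n = \<theta> + 2 * pi * real (n + 3)" for n unfolding d_def using den0[of n] by simp
    then have sd: "sin (pi / d n) = 4 * fst p" for n using th(1) sin_add_2npi[of \<theta> "n + 3"] by (simp del: of_nat_add)
    have "filterlim (\<lambda>n. \<theta> + 2 * pi * real (n + 3)) at_top sequentially"
    proof -
      have "filterlim (\<lambda>n. real (n + 3)) at_top sequentially"
        by (rule filterlim_compose[OF filterlim_real_sequentially filterlim_add_const_nat_at_top])
      then have "filterlim (\<lambda>n. 2 * pi * real (n + 3)) at_top sequentially"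
        by (intro filterlim_tendsto_pos_mult_at_top[OF tendsto_const]) auto
      then show ?thesis by (intro filterlim_tendsto_add_at_top[OF tendsto_const])
    qed
    then have "d \<longlonglongrightarrow> 0" unfolding d_def by (intro tendsto_divide_0[OF tendsto_const] filterlim_at_top_imp_at_infinity)
    then have *: "(\<lambda>n. (fst p, 1/4 - d n)) \<longlonglongrightarrow> (fst p, 1/4 - 0)" by (intro tendsto_intros)
    have lim: "(\<lambda>n. (fst p, 1/4 - d n)) \<longlonglongrightarrow> p"
    proof -
      have "(fst p, 1/4 - 0) = p" using p(1) by (simp add: prod_eq_iff)
      with * show ?thesis by simp
    qed
    have "(fst p, 1/4 - d n) \<in> stem \<inter> {p. 0 < snd p}" for n
      using d[of n] sd[of n] unfolding stem_def by (auto intro!: image_eqI[of _ _ "1/4 - d n"])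
    then show ?thesis using lim unfolding closure_sequential by (intro exI[of _ "\<lambda>n. (fst p, 1/4 - d n)"] conjI allI)
  next
    case False
    then obtain y where y: "0 \<le> y" "y < 1/4" "p = (sin (pi / (1/4 - y)) / 4, y)" using \<open>p \<in> blob\<close> unfolding blob_def stem_def by auto
    \<comment> \<open>The upward shift matters at the lower end of the stem, whose height is 0; the
      divisor \<open>n + 2\<close> keeps the shifted height below 1/4.\<close>
    define Y where "Y n = y + (1/4 - y) / real (n + 2)" for n
    have Y: "0 < Y n" "Y n < 1/4" for n
    proof -
      have "0 < (1/4 - y) / real (n + 2)" using y by simp
      moreover have "(1/4 - y) / real (n + 2) < (1/4 - y) / 1" using y by (intro divide_strict_left_mono) auto
      then have "(1/4 - y) / real (n + 2) < 1/4 - y" by simp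
      ultimately show "0 < Y n" "Y n < 1/4" unfolding Y_def using y by linarith+
    qed
    have "(\<lambda>n. (1/4 - y) / real (n + 2)) \<longlonglongrightarrow> 0" by (rule LIMSEQ_ignore_initial_segment[OF lim_const_over_n])
    then have "Y \<longlonglongrightarrow> y + 0" unfolding Y_def by (intro tendsto_add tendsto_const)
    then have "Y \<longlonglongrightarrow> y" by simp
    then have "(\<lambda>n. (sin (pi / (1/4 - Y n)) / 4, Y n)) \<longlonglongrightarrow> p"
      unfolding y(3) by (intro tendsto_intros) (use y in auto)
    moreover have "(sin (pi / (1/4 - Y n)) / 4, Y n) \<in> stem \<inter> {p. 0 < snd p}" for n
      using Y[of n] unfolding stem_def by auto
    ultimately show ?thesis unfolding closure_sequential
      by (intro exI[of _ "\<lambda>n. (sin (pi / (1/4 - Y n)) / 4, Y n)"] conjI allI)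
  qed
qed

lemma connected_blob: "connected blob"
proof (rule connected_intermediate_closure[of stem])
  show "connected stem" unfolding stem_def by (intro connected_continuous_image stem_cont) auto
  show "stem \<subseteq> blob" unfolding blob_def by auto
  show "blob \<subseteq> closure stem" using blob_closure closure_mono[of "stem \<inter> {p. 0 < snd p}" stem] by blast
qed

text \<open>The arc at height \<open>b\<close> meets the right side of every shell of radius
  \<open>r\<close> with \<open>b \<le> r \<le> 1\<close>, and the image of this point lies on the
  right edge of the region. For a suitable \<open>r\<close> its height is \<open>snd c\<close>; this
  \<open>r\<close> tends to 0 with \<open>b\<close>, and the edge then tends to the stem.\<close>

lemma blow_up_horizontal_dense:
  assumes "c \<in> stem" "0 < snd c" "0 < \<epsilon>"
  shows "\<exists>\<delta>>0. \<forall>b. 0 < b \<and> b < \<delta> \<longrightarrow> (\<exists>a\<in>{-1..1}. dist (blow_up (a, b)) c < \<epsilon>)"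
proof -
  obtain y where y: "0 < y" "y < 1/4" and c: "c = (sin (pi / (1/4 - y)) / 4, y)" using assms unfolding stem_def by auto
  have g: "((\<lambda>r. gap r y) \<longlongrightarrow> gap 0 y) (at_right 0)" unfolding gap_def by (intro tendsto_intros)
  have g0: "gap 0 y \<noteq> 0" unfolding gap_def using y by auto
  have "((\<lambda>r. centre r y + halfwidth r y) \<longlongrightarrow> centre 0 y + halfwidth 0 y) (at_right 0)"
    unfolding centre_def halfwidth_def taper_def mix_def by (intro tendsto_intros g g0) auto
  moreover have "centre 0 y + halfwidth 0 y = sin (pi / (1/4 - y)) / 4"
    unfolding centre_def halfwidth_def taper_def mix_def gap_def using y by auto
  ultimately have "eventually (\<lambda>r. dist (centre r y + halfwidth r y) (sin (pi / (1/4 - y)) / 4) < \<epsilon>) (at_right 0)"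
    using assms(3) by (simp add: tendstoD)
  then obtain d where d: "0 < d" "\<And>r. 0 < r \<Longrightarrow> r < d \<Longrightarrow> dist (centre r y + halfwidth r y) (sin (pi / (1/4 - y)) / 4) < \<epsilon>"
    unfolding eventually_at_right_field by auto
  \<comment> \<open>The bound \<open>y\<close> keeps the denominator of the radius below at least
    \<open>2 * y\<close>; the second bound then makes this radius smaller than both \<open>d\<close>
    and 1/2.\<close>
  define \<delta> where "\<delta> = min y (2 * y * min d (1/2))"
  have "\<exists>a\<in>{-1..1}. dist (blow_up (a, b)) c < \<epsilon>" if b: "0 < b" "b < \<delta>" for b
  proof -
    \<comment> \<open>The solution of \<open>b * shell_top r / r = y\<close> with
      \<open>shell_top r = 1/4 + r/2\<close>.\<close>
    define r where "r = b / (4 * y - 2 * b)"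
    have "b < y" using b unfolding \<delta>_def by simp
    then have den: "2 * y \<le> 4 * y - 2 * b" "0 < 4 * y - 2 * b" "4 * y - 2 * b < 1" using b y by auto
    have r0: "0 < r" unfolding r_def using b den by simp
    have "b < 2 * y * min d (1/2)" using b unfolding \<delta>_def by simp
    also have "\<dots> \<le> (4 * y - 2 * b) * min d (1/2)" using den d by (intro mult_right_mono) auto
    finally have "r < min d (1/2)" unfolding r_def using den(2) by (simp only: pos_divide_less_eq mult.commute)
    then have rd: "r < d" "r < 1/2" by simp_all
    have br: "b \<le> r" unfolding r_def using den b by (simp add: le_divide_eq mult_left_le)
    have s: "shell (r, b) = r" unfolding shell_def using br r0 by simp
    have t: "shell_top r = 1/4 + r/2" unfolding shell_top_def using rd by simp
    have "b / r = 4 * y - 2 * b" unfolding r_def using den b by simp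
    moreover have "b * shell_top r / r = (b / r) / 4 + b / 2" unfolding t using r0 by (simp add: field_simps)
    ultimately have "b * shell_top r / r = y" by (simp add: field_simps)
    then have "blow_up (r, b) = (centre r y + halfwidth r y, y)" unfolding blow_up_def Let_def s using r0 by simp
    then have "dist (blow_up (r, b)) c < \<epsilon>" using d(2)[OF r0 rd(1)] unfolding c by (simp add: dist_Pair_Pair)
    then show ?thesis using r0 rd by (intro bexI[of _ r]) auto
  qed
  moreover have "0 < \<delta>" unfolding \<delta>_def using y d by auto
  ultimately show ?thesis by blast
qed

text \<open>The argument \<open>Z\<close> of the sine is continuous and tends to infinity, so it
  attains all large values. Arbitrarily close to \<open>b\<close> the sine is therefore 1 and also
  0, and \<open>4 * L\<close> would have to be both.\<close>

lemma no_path_up_stem: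
  fixes Y :: "real \<Rightarrow> real"
  assumes ab: "a < b" and cont: "continuous_on {a..<b} Y" and lt: "\<And>t. a \<le> t \<Longrightarrow> t < b \<Longrightarrow> Y t < 1/4"
    and lim: "(Y \<longlongrightarrow> 1/4) (at_left b)"
    and limx: "((\<lambda>t. sin (pi / (1/4 - Y t)) / 4) \<longlongrightarrow> L) (at_left b)"
  shows False
proof -
  define Z where "Z t = pi / (1/4 - Y t)" for t
  have Zc: "continuous_on {a..<b} Z" unfolding Z_def using lt by (intro continuous_intros cont) force
  have "((\<lambda>t. 1/4 - Y t) \<longlongrightarrow> 1/4 - 1/4) (at_left b)" by (intro tendsto_intros lim)
  moreover have "eventually (\<lambda>t. t \<in> {a<..<b}) (at_left b)" using ab eventually_at_left_real by blast
  then have "eventually (\<lambda>t. 0 < 1/4 - Y t) (at_left b)" by eventually_elim (use lt in force)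
  then have "eventually (\<lambda>t. 1/4 - Y t \<in> {0<..} \<and> 1/4 - Y t \<noteq> 0) (at_left b)" by eventually_elim auto
  ultimately have "filterlim (\<lambda>t. 1/4 - Y t) (at_right 0) (at_left b)" by (simp add: filterlim_at)
  then have Zinf: "filterlim Z at_top (at_left b)" unfolding Z_def
    unfolding divide_inverse
    by (intro filterlim_tendsto_pos_mult_at_top[OF tendsto_const pi_gt_zero] filterlim_compose[OF filterlim_inverse_at_top_right])
  have near: "\<exists>t>s. t < b \<and> Z t = z" if s: "a \<le> s" "s < b" and z: "Z s < z" for s z
  proof -
    have "eventually (\<lambda>t. z \<le> Z t \<and> s < t \<and> t < b) (at_left b)"
      using Zinf s eventually_at_left_real[of s b] by (auto simp: filterlim_at_top elim: eventually_elim2)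
    then obtain t where t: "z \<le> Z t" "s < t" "t < b" using eventually_happens' trivial_limit_at_left_real by blast
    have "continuous_on {s..t} Z" by (rule continuous_on_subset[OF Zc]) (use s t in auto)
    then obtain u where "s \<le> u" "u \<le> t" "Z u = z" using IVT'[of Z s z t] z t by auto
    then show ?thesis using z t by (intro exI[of _ u]) (auto simp: order_less_le)
  qed
  have sinlim: "((\<lambda>t. sin (Z t)) \<longlongrightarrow> 4 * L) (at_left b)"
    using tendsto_mult[OF tendsto_const[of 4] limx] unfolding Z_def by simp
  have "4 * L = e" if e: "sin \<theta> = e" for e \<theta>
  proof (rule ccontr)
    assume "4 * L \<noteq> e"
    then have "eventually (\<lambda>t. sin (Z t) \<noteq> e) (at_left b)" using tendsto_imp_eventually_ne[OF sinlim] by blast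
    then obtain s where s: "s < b" "\<And>t. s < t \<Longrightarrow> t < b \<Longrightarrow> sin (Z t) \<noteq> e" unfolding eventually_at_left_field by blast
    obtain n :: nat where n: "Z (max a s') < \<theta> + 2 * pi * real n" if "s' = (max a s)" for s'
    proof -
      obtain n :: nat where "(Z (max a s) - \<theta>) / (2 * pi) < real n" using reals_Archimedean2 by blast
      then have "Z (max a s) < \<theta> + 2 * pi * real n" by (simp add: divide_less_eq algebra_simps)
      then show ?thesis using that by (simp add: max.assoc[symmetric])
    qed
    then obtain t where t: "t > max a s" "t < b" "Z t = \<theta> + 2 * pi * real n"
      using near[of "max a s" "\<theta> + 2 * pi * real n"] s ab by auto
    have "sin (Z t) = e" unfolding t(3) using e sin_add_2npi by simp
    then show False using s(2)[of t] t by auto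
  qed
  from this[of "pi/2" 1] this[of 0 0] show False by simp
qed

section \<open>Local sections of planar flows\<close>

text \<open>The flow of the surface read in a chart. It makes sense only while orbits stay in the
  chart, hence the restrictions to \<open>T\<close> and \<open>N\<close>; the half plane as ambient
  space covers interior and boundary points together.\<close>

locale planar_local_flow =
  fixes \<psi> :: "real \<Rightarrow> real \<times> real \<Rightarrow> real \<times> real" and N :: "(real \<times> real) set"
    and x0 :: "real \<times> real" and T :: real
  assumes N_open: "openin (top_of_set half_plane) N"
    and T_pos: "0 < T"
    and cont: "continuous_on ({-T..T} \<times> N) (\<lambda>(t, q). \<psi> t q)"
    and into: "\<bar>t\<bar> \<le> T \<Longrightarrow> q \<in> N \<Longrightarrow> \<psi> t q \<in> half_plane"
    and flow_0: "q \<in> N \<Longrightarrow> \<psi> 0 q = q"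
    and flow_add: "q \<in> N \<Longrightarrow> \<psi> t q \<in> N \<Longrightarrow> \<bar>t\<bar> \<le> T \<Longrightarrow> \<bar>s\<bar> \<le> T \<Longrightarrow> \<bar>s + t\<bar> \<le> T \<Longrightarrow>
      \<psi> s (\<psi> t q) = \<psi> (s + t) q"
    and x0_N: "x0 \<in> N"
    and moving: "\<And>e. 0 < e \<Longrightarrow> \<exists>t. 0 < t \<and> t < e \<and> \<psi> t x0 \<noteq> x0"
begin

definition B :: "real \<Rightarrow> (real \<times> real) set" where
  "B r = ball x0 r \<inter> half_plane"

lemma x0_half: "x0 \<in> half_plane" using x0_N N_open openin_imp_subset by blast

lemma B_mono: "r \<le> s \<Longrightarrow> B r \<subseteq> B s" unfolding B_def by auto

lemma x0_B: "0 < r \<Longrightarrow> x0 \<in> B r" unfolding B_def using x0_half by simp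

lemma B_convex: "convex (B r)"
proof -
  have "half_plane = {p. inner (0, 1) p \<ge> 0}" unfolding half_plane_def by auto
  then have "convex half_plane" using convex_halfspace_ge[of 0 "(0,1) :: real \<times> real"] by (simp only:)
  then show ?thesis unfolding B_def by (intro convex_Int) auto
qed

lemma ex_B_N: "\<exists>r>0. B r \<subseteq> N"
  using N_open x0_N unfolding openin_contains_ball B_def by auto

lemma cont_compose:
  assumes "continuous_on A f" "continuous_on A g" "\<And>z. z \<in> A \<Longrightarrow> \<bar>f z\<bar> \<le> T" "\<And>z. z \<in> A \<Longrightarrow> g z \<in> N"
  shows "continuous_on A (\<lambda>z. \<psi> (f z) (g z))"
proof -
  have "continuous_on A ((\<lambda>(t, q). \<psi> t q) \<circ> (\<lambda>z. (f z, g z)))"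
    by (rule continuous_on_compose[OF continuous_on_Pair[OF assms(1,2)] continuous_on_subset[OF cont]])
       (use assms(3,4) in \<open>force simp: abs_le_iff\<close>)
  then show ?thesis by (simp add: o_def)
qed

lemma box_near:
  assumes c: "continuous_on ({-\<tau>..\<tau>} \<times> N) h" "0 < \<tau>" and U: "open U" "h (0, x0) \<in> U"
  shows "\<exists>r>0. \<forall>t q. \<bar>t\<bar> \<le> r \<longrightarrow> q \<in> N \<longrightarrow> dist q x0 < r \<longrightarrow> \<bar>t\<bar> \<le> \<tau> \<and> h (t, q) \<in> U"
proof -
  have "openin (top_of_set ({-\<tau>..\<tau>} \<times> N)) (({-\<tau>..\<tau>} \<times> N) \<inter> h -` U)"
    using continuous_openin_preimage_gen[OF c(1) U(1)] .
  moreover have "(0, x0) \<in> ({-\<tau>..\<tau>} \<times> N) \<inter> h -` U" using c U x0_N by auto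
  ultimately obtain e where e: "e > 0" "ball (0, x0) e \<inter> ({-\<tau>..\<tau>} \<times> N) \<subseteq> ({-\<tau>..\<tau>} \<times> N) \<inter> h -` U"
    unfolding openin_contains_ball by blast
  show ?thesis
  proof (intro exI[of _ "min \<tau> (e/2)"] conjI allI impI)
    show "0 < min \<tau> (e/2)" using c e by auto
    fix t q assume t: "\<bar>t\<bar> \<le> min \<tau> (e/2)" and q: "q \<in> N" "dist q x0 < min \<tau> (e/2)"
    have "dist (0, x0) (t, q) \<le> \<bar>t\<bar> + dist x0 q"
      unfolding dist_Pair_Pair using sqrt_sum_squares_le_sum[of "dist 0 t" "dist x0 q"] by simp
    then have "(t, q) \<in> ball (0, x0) e" using t q by (simp add: dist_commute)
    moreover have "(t, q) \<in> {-\<tau>..\<tau>} \<times> N" using t q by (auto simp: abs_le_iff)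
    ultimately show "\<bar>t\<bar> \<le> \<tau>" "h (t, q) \<in> U" using e(2) t by auto
  qed
qed

text \<open>The local section is a level set of \<open>F q = \<integral>\<^bsub>0\<^esub>\<^bsup>T1\<^esup> \<psi> s q \<bullet> d ds\<close> with \<open>d = \<psi> T1 x0 - x0\<close>: along
  an orbit near \<open>x0\<close> its derivative is \<open>(\<psi> T1 q - q) \<bullet> d > 0\<close>.\<close>

lemma ex_transversal_function:
  "\<exists>F \<delta> r. 0 < \<delta> \<and> 4 * \<delta> \<le> T \<and> 0 < r \<and> B r \<subseteq> N \<and> continuous_on N F \<and>
     (\<forall>q\<in>B r. \<forall>t. \<bar>t\<bar> \<le> \<delta> \<longrightarrow> \<psi> t q \<in> N) \<and>
     (\<forall>q\<in>B r. \<forall>t t'. - \<delta> \<le> t \<longrightarrow> t < t' \<longrightarrow> t' \<le> \<delta> \<longrightarrow> F (\<psi> t q) < (F (\<psi> t' q) :: real))"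
proof -
  obtain T1 where T1: "0 < T1" "T1 < T/2" "\<psi> T1 x0 \<noteq> x0" using moving[of "T/2"] T_pos by auto
  define d where "d = \<psi> T1 x0 - x0"
  have d: "0 < inner d d" using T1 unfolding d_def by simp
  define F where "F q = integral {0..T1} (\<lambda>s. inner (\<psi> s q) d)" for q
  have Fc: "continuous_on N F"
  proof -
    have "continuous_on (N \<times> cbox 0 T1) (\<lambda>(q, s). inner (\<psi> s q) d)"
      unfolding case_prod_unfold using T1 T_pos by (intro continuous_intros cont_compose) auto
    then show ?thesis unfolding F_def using integral_continuous_on_param[of N 0 T1 "\<lambda>q s. inner (\<psi> s q) d"] by simp
  qed
  obtain rN where rN: "0 < rN" "B rN \<subseteq> N" using ex_B_N by auto
  have "continuous_on ({-(T/2)..T/2} \<times> N) (\<lambda>z. inner (\<psi> (fst z + T1) (snd z) - \<psi> (fst z) (snd z)) d)"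
    using T1 by (intro continuous_intros cont_compose) (auto simp: abs_le_iff)
  from box_near[OF this _ open_greaterThan[of 0]] obtain r1 where r1: "0 < r1"
    "\<And>t q. \<bar>t\<bar> \<le> r1 \<Longrightarrow> q \<in> N \<Longrightarrow> dist q x0 < r1 \<Longrightarrow> \<bar>t\<bar> \<le> T/2 \<and> 0 < inner (\<psi> (t + T1) q - \<psi> t q) d"
    using d T_pos flow_0[OF x0_N] unfolding d_def by auto
  have "continuous_on ({-T..T} \<times> N) (\<lambda>z. \<psi> (fst z) (snd z))"
    by (intro continuous_intros cont_compose) (auto simp: abs_le_iff)
  from box_near[OF this _ open_ball[of x0 rN]] obtain r2 where r2: "0 < r2"
    "\<And>t q. \<bar>t\<bar> \<le> r2 \<Longrightarrow> q \<in> N \<Longrightarrow> dist q x0 < r2 \<Longrightarrow> \<bar>t\<bar> \<le> T \<and> \<psi> t q \<in> ball x0 rN"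
    using T_pos rN flow_0[OF x0_N] by auto
  define r where "r = min rN (min r1 r2)"
  define \<delta> where "\<delta> = min (r/2) (T/4)"
  have r: "0 < r" "B r \<subseteq> N" using rN r1 r2 B_mono[of r rN] unfolding r_def by auto
  have Bd: "q \<in> N \<and> dist q x0 < r1 \<and> dist q x0 < r2" if "q \<in> B r" for q
    using that r(2) unfolding B_def r_def by (auto simp: dist_commute)
  have dl: "0 < \<delta>" "4 * \<delta> \<le> T" "\<delta> \<le> r1" "\<delta> \<le> r2" unfolding \<delta>_def r_def using rN r1 r2 T_pos by auto
  have inN: "\<psi> t q \<in> N" if "q \<in> B r" "\<bar>t\<bar> \<le> \<delta>" for t q
    using r2(2)[of t q] Bd[OF that(1)] that(2) dl into[of t q] rN unfolding B_def by auto
  have "F (\<psi> t q) < F (\<psi> t' q)" if q: "q \<in> B r" and t: "-\<delta> \<le> t" "t < t'" "t' \<le> \<delta>" for q t t'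
  proof -
    have qN: "q \<in> N" using Bd q by auto
    have "continuous_on {-T..T} (\<lambda>s. inner (\<psi> s q) d)"
      using qN by (intro continuous_intros cont_compose) (auto simp: abs_le_iff)
    then obtain P where P: "\<And>s. s \<in> {-T..T} \<Longrightarrow> (P has_vector_derivative inner (\<psi> s q) d) (at s within {-T..T})"
      using antiderivative_continuous by blast
    \<comment> \<open>A shift of the integration variable expresses \<open>F\<close> along the orbit
      by one antiderivative. So \<open>F\<close> is differentiable along orbits although the flow is
      only continuous.\<close>
    have FP: "F (\<psi> s q) = P (T1 + s) - P s" if s: "\<bar>s\<bar> \<le> \<delta>" for s
    proof -
      have "F (\<psi> s q) = integral {0..T1} (\<lambda>a. inner (\<psi> (a + s) q) d)"
        unfolding F_def using inN[OF q s] qN flow_add[OF qN inN[OF q s]] s dl T1 T_pos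
        by (intro Henstock_Kurzweil_Integration.integral_cong) (auto simp: abs_le_iff)
      moreover have "((\<lambda>a. inner (\<psi> (a + s) q) d) has_integral (P (T1 + s) - P (0 + s))) {0..T1}"
      proof (rule fundamental_theorem_of_calculus)
        show "0 \<le> T1" using T1 by simp
        fix a assume a: "a \<in> {0..T1}"
        have "((P \<circ> (\<lambda>a. a + s)) has_vector_derivative (1 *\<^sub>R inner (\<psi> (a + s) q) d)) (at a within {0..T1})"
        proof (rule vector_diff_chain_within)
          show "((\<lambda>a. a + s) has_vector_derivative 1) (at a within {0..T1})"
            by (auto intro!: derivative_eq_intros)
          show "(P has_vector_derivative inner (\<psi> (a + s) q) d) (at (a + s) within (\<lambda>a. a + s) ` {0..T1})"
            by (rule has_vector_derivative_within_subset[OF P]) (use a s dl T1 T_pos in \<open>auto simp: abs_le_iff\<close>)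
        qed
        then show "((\<lambda>a. P (a + s)) has_vector_derivative inner (\<psi> (a + s) q) d) (at a within {0..T1})" by (simp add: o_def)
      qed
      ultimately show ?thesis using integral_unique by force
    qed
    have "P (T1 + t) - P t < P (T1 + t') - P t'"
    proof (rule DERIV_pos_imp_increasing[OF t(2)])
      fix s assume s: "t \<le> s" "s \<le> t'"
      have PD: "DERIV P a :> inner (\<psi> a q) d" if "-T < a" "a < T" for a
        using P[of a] that by (simp add: has_real_derivative_iff_has_vector_derivative at_within_Icc_at)
      have "DERIV (\<lambda>s. P (T1 + s)) s :> inner (\<psi> (T1 + s) q) d"
        using PD[of "T1 + s"] DERIV_shift[of P _ s T1] s t dl T1 T_pos by (simp add: add.commute)
      then have "DERIV (\<lambda>s. P (T1 + s) - P s) s :> inner (\<psi> (T1 + s) q) d - inner (\<psi> s q) d"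
        using s t dl T1 T_pos by (auto intro!: DERIV_diff PD)
      moreover have "0 < inner (\<psi> (T1 + s) q) d - inner (\<psi> s q) d"
        using r1(2)[of s q] Bd[OF q] s t dl by (simp add: inner_diff_left add.commute)
      ultimately show "\<exists>y. DERIV (\<lambda>s. P (T1 + s) - P s) s :> y \<and> 0 < y" by blast
    qed
    then show ?thesis using FP[of t] FP[of t'] t by simp
  qed
  with dl r Fc inN show ?thesis by (intro exI[of _ F] exI[of _ \<delta>] exI[of _ r] conjI ballI allI impI) auto
qed

end

section \<open>Return times and the projection along orbits to the local section\<close>

locale planar_section = planar_local_flow +
  fixes F :: "real \<times> real \<Rightarrow> real" and \<delta> r :: real
  assumes dl: "0 < \<delta>" "4 * \<delta> \<le> T" and r: "0 < r" "B r \<subseteq> N" and F_cont: "continuous_on N F"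
    and stay: "\<And>q t. q \<in> B r \<Longrightarrow> \<bar>t\<bar> \<le> \<delta> \<Longrightarrow> \<psi> t q \<in> N"
    and F_mono: "\<And>q t t'. q \<in> B r \<Longrightarrow> - \<delta> \<le> t \<Longrightarrow> t < t' \<Longrightarrow> t' \<le> \<delta> \<Longrightarrow> F (\<psi> t q) < F (\<psi> t' q)"
begin

definition \<Sigma> :: "(real \<times> real) set" where
  "\<Sigma> = {q \<in> B r. F q = F x0}"

lemma \<Sigma>_N: "p \<in> \<Sigma> \<Longrightarrow> p \<in> N" "p \<in> \<Sigma> \<Longrightarrow> p \<in> B r" using r unfolding \<Sigma>_def by auto

text \<open>\<open>F\<close> increases strictly along the orbit but has the same value at both
  points.\<close>

lemma section_return_trivial:
  assumes "p \<in> \<Sigma>" "q \<in> \<Sigma>" "\<bar>t\<bar> \<le> \<delta>" "\<psi> t p = q"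
  shows "t = 0 \<and> p = q"
proof -
  have p: "p \<in> B r" "F (\<psi> 0 p) = F (\<psi> t p)" using assms flow_0[OF \<Sigma>_N(1)] unfolding \<Sigma>_def by auto
  then have "t = 0" using F_mono[of p 0 t] F_mono[of p t 0] assms(3) dl by (cases t "0::real" rule: linorder_cases) auto
  then show ?thesis using assms flow_0[OF \<Sigma>_N(1)] by auto
qed

lemma flow_back:
  assumes "q \<in> B r" "\<bar>t\<bar> \<le> \<delta>"
  shows "\<psi> (- t) (\<psi> t q) = q"
proof -
  have q: "q \<in> N" using assms r by blast
  have "\<psi> (- t) (\<psi> t q) = \<psi> (- t + t) q" using assms dl T_pos by (intro flow_add q stay) auto
  then show ?thesis using flow_0[OF q] by simp
qed

lemma section_flow_inj:
  assumes "p \<in> \<Sigma>" "q \<in> \<Sigma>" "\<bar>s\<bar> \<le> \<delta>/2" "\<bar>t\<bar> \<le> \<delta>/2" "\<psi> s p = \<psi> t q"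
  shows "s = t \<and> p = q"
proof -
  have "\<psi> (- t) (\<psi> s p) = \<psi> (s - t) p"
  proof -
    have "\<bar>s\<bar> \<le> \<delta>" "\<bar>s\<bar> \<le> T" "\<bar>- t\<bar> \<le> T" "\<bar>- t + s\<bar> \<le> T" using assms(3,4) dl T_pos by linarith+
    then show ?thesis using flow_add[of p s "- t"] stay[OF \<Sigma>_N(2)] \<Sigma>_N(1) assms(1) by simp
  qed
  then have "\<psi> (s - t) p = q" using flow_back[OF \<Sigma>_N(2)] assms dl by simp
  moreover have "\<bar>s - t\<bar> \<le> \<delta>" using assms(3,4) by linarith
  ultimately show ?thesis using section_return_trivial[OF assms(1,2), of "s - t"] by simp
qed

lemma B_N: "q \<in> B r \<Longrightarrow> q \<in> N" using r by auto

definition \<eta> :: real where "\<eta> = \<delta> / 2"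

lemma eta: "0 < \<eta>" "\<eta> \<le> \<delta>/2" "\<eta> \<le> \<delta>" "8 * \<eta> \<le> T" unfolding \<eta>_def using dl by auto

lemma F_flow_cont: "\<bar>t\<bar> \<le> \<delta> \<Longrightarrow> continuous_on (B r) (\<lambda>q. F (\<psi> t q))"
  using stay dl T_pos B_N
  by (intro continuous_on_compose2[OF F_cont cont_compose]) (auto intro!: continuous_intros)

text \<open>True at \<open>x0\<close> because \<open>F\<close> increases along its orbit, and
  preserved nearby by continuity. It makes the intermediate value theorem find a passage through the
  section for every nearby point.\<close>

lemma ex_radius: "\<exists>\<rho>>0. \<rho> \<le> r \<and> (\<forall>q\<in>B \<rho>. F (\<psi> (-\<eta>) q) < F x0 \<and> F x0 < F (\<psi> \<eta> q))"
proof -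
  have x: "F (\<psi> (-\<eta>) x0) < F x0" "F x0 < F (\<psi> \<eta> x0)"
    using F_mono[OF x0_B[OF r(1)], of "-\<eta>" 0] F_mono[OF x0_B[OF r(1)], of 0 \<eta>] eta flow_0[OF x0_N] by auto
  have o: "openin (top_of_set (B r)) (B r \<inter> (\<lambda>q. F (\<psi> (-\<eta>) q)) -` {..<F x0})"
    "openin (top_of_set (B r)) (B r \<inter> (\<lambda>q. F (\<psi> \<eta> q)) -` {F x0<..})"
    using continuous_openin_preimage_gen[OF F_flow_cont] eta by auto
  then have "openin (top_of_set (B r)) ((B r \<inter> (\<lambda>q. F (\<psi> (-\<eta>) q)) -` {..<F x0}) \<inter> (B r \<inter> (\<lambda>q. F (\<psi> \<eta> q)) -` {F x0<..}))"
    by (rule openin_Int)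
  then obtain e where e: "e > 0" "ball x0 e \<inter> B r \<subseteq> (B r \<inter> (\<lambda>q. F (\<psi> (-\<eta>) q)) -` {..<F x0}) \<inter> (B r \<inter> (\<lambda>q. F (\<psi> \<eta> q)) -` {F x0<..})"
    unfolding openin_contains_ball using x x0_B[OF r(1)] by blast
  have "B (min e r) \<subseteq> ball x0 e \<inter> B r" unfolding B_def by auto
  then have "\<forall>q\<in>B (min e r). F (\<psi> (-\<eta>) q) < F x0 \<and> F x0 < F (\<psi> \<eta> q)" using e(2) by blast
  then show ?thesis using e r by (intro exI[of _ "min e r"]) auto
qed

definition \<rho>0 :: real where
  "\<rho>0 = (SOME \<rho>. 0 < \<rho> \<and> \<rho> \<le> r \<and> (\<forall>q\<in>B \<rho>. F (\<psi> (-\<eta>) q) < F x0 \<and> F x0 < F (\<psi> \<eta> q)))"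

lemma rho0: "0 < \<rho>0" "\<rho>0 \<le> r" "q \<in> B \<rho>0 \<Longrightarrow> F (\<psi> (-\<eta>) q) < F x0 \<and> F x0 < F (\<psi> \<eta> q)"
proof -
  have "0 < \<rho>0 \<and> \<rho>0 \<le> r \<and> (\<forall>q\<in>B \<rho>0. F (\<psi> (-\<eta>) q) < F x0 \<and> F x0 < F (\<psi> \<eta> q))"
    unfolding \<rho>0_def by (rule someI_ex) (use ex_radius in blast)
  then show "0 < \<rho>0" "\<rho>0 \<le> r" "q \<in> B \<rho>0 \<Longrightarrow> F (\<psi> (-\<eta>) q) < F x0 \<and> F x0 < F (\<psi> \<eta> q)" by blast+
qed

lemma B_rho0: "q \<in> B \<rho>0 \<Longrightarrow> q \<in> B r" using rho0(2) B_mono by auto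

definition \<theta> :: "real \<times> real \<Rightarrow> real" where
  "\<theta> q = (THE t. \<bar>t\<bar> \<le> \<eta> \<and> F (\<psi> t q) = F x0)"

lemma theta_unique:
  assumes "q \<in> B r" "\<bar>t\<bar> \<le> \<delta>" "\<bar>t'\<bar> \<le> \<delta>" "F (\<psi> t q) = F (\<psi> t' q)" shows "t = t'"
proof -
  have "- \<delta> \<le> t" "t \<le> \<delta>" "- \<delta> \<le> t'" "t' \<le> \<delta>" using assms(2,3) by auto
  then show ?thesis using F_mono[OF assms(1), of t t'] F_mono[OF assms(1), of t' t] assms(4)
    by (cases t t' rule: linorder_cases) auto
qed

lemma theta_eq:
  assumes "q \<in> B r" "\<bar>t\<bar> \<le> \<eta>" "F (\<psi> t q) = F x0" shows "\<theta> q = t"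
  unfolding \<theta>_def
proof (rule the_equality)
  show "\<bar>t\<bar> \<le> \<eta> \<and> F (\<psi> t q) = F x0" using assms by simp
  fix t' assume "\<bar>t'\<bar> \<le> \<eta> \<and> F (\<psi> t' q) = F x0"
  then show "t' = t" using theta_unique[OF assms(1), of t' t] assms eta by simp
qed

lemma theta:
  assumes "q \<in> B \<rho>0"
  shows "\<bar>\<theta> q\<bar> \<le> \<eta>" "F (\<psi> (\<theta> q) q) = F x0"
proof -
  have c: "continuous_on {-\<eta>..\<eta>} (\<lambda>t. F (\<psi> t q))"
    using stay[OF B_rho0[OF assms]] eta dl T_pos B_N[OF B_rho0[OF assms]]
    by (intro continuous_on_compose2[OF F_cont cont_compose]) (auto intro!: continuous_intros simp: abs_le_iff)
  have "\<exists>t\<ge>-\<eta>. t \<le> \<eta> \<and> F (\<psi> t q) = F x0"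
    using rho0(3)[OF assms] eta c by (intro IVT') auto
  then obtain t where "- \<eta> \<le> t" "t \<le> \<eta>" "F (\<psi> t q) = F x0" by blast
  then have "\<bar>t\<bar> \<le> \<eta>" "F (\<psi> t q) = F x0" by auto
  then show "\<bar>\<theta> q\<bar> \<le> \<eta>" "F (\<psi> (\<theta> q) q) = F x0" using theta_eq[OF B_rho0[OF assms]] by auto
qed

text \<open>The graph is the solution set of the continuous equation
  \<open>F (\<psi> t q) = F x0\<close>, and the values lie in a compact interval, so the closed
  graph criterion applies.\<close>

lemma theta_cont: "continuous_on (B \<rho>0) \<theta>"
proof -
  have "closedin (top_of_set (B \<rho>0 \<times> {-\<eta>..\<eta>})) ((B \<rho>0 \<times> {-\<eta>..\<eta>}) \<inter> (\<lambda>z. F (\<psi> (snd z) (fst z))) -` {F x0})"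
    using stay[OF B_rho0] eta dl T_pos B_N[OF B_rho0]
    by (intro continuous_closedin_preimage_gen continuous_on_compose2[OF F_cont cont_compose])
       (auto intro!: continuous_intros simp: abs_le_iff)
  moreover have "(B \<rho>0 \<times> {-\<eta>..\<eta>}) \<inter> (\<lambda>z. F (\<psi> (snd z) (fst z))) -` {F x0} = (\<lambda>q. Pair q (\<theta> q)) ` B \<rho>0"
  proof (intro set_eqI iffI)
    fix z assume z: "z \<in> (B \<rho>0 \<times> {-\<eta>..\<eta>}) \<inter> (\<lambda>z. F (\<psi> (snd z) (fst z))) -` {F x0}"
    then have "\<theta> (fst z) = snd z" by (intro theta_eq B_rho0) auto
    then show "z \<in> (\<lambda>q. Pair q (\<theta> q)) ` B \<rho>0" using z by (intro image_eqI[of _ _ "fst z"]) auto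
  next
    fix z assume "z \<in> (\<lambda>q. Pair q (\<theta> q)) ` B \<rho>0"
    then show "z \<in> (B \<rho>0 \<times> {-\<eta>..\<eta>}) \<inter> (\<lambda>z. F (\<psi> (snd z) (fst z))) -` {F x0}" using theta by (auto simp: abs_le_iff minus_le_iff[of \<eta>])
  qed
  moreover have "\<theta> \<in> B \<rho>0 \<rightarrow> {-\<eta>..\<eta>}" using theta(1) by (auto simp: abs_le_iff minus_le_iff[of \<eta>])
  ultimately show ?thesis
    using continuous_closed_graph_eq[of "{-\<eta>..\<eta>}" \<theta> "B \<rho>0"] by simp
qed

definition proj :: "real \<times> real \<Rightarrow> real \<times> real" where
  "proj q = \<psi> (\<theta> q) q"

lemma proj_cont: "continuous_on (B \<rho>0) proj"
  unfolding proj_def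
proof (intro cont_compose theta_cont continuous_on_id)
  fix z assume z: "z \<in> B \<rho>0"
  show "\<bar>\<theta> z\<bar> \<le> T" using theta(1)[OF z] eta dl T_pos by linarith
  show "z \<in> N" using B_N[OF B_rho0[OF z]] .
qed

lemma theta_section:
  assumes "q \<in> \<Sigma>"
  shows "\<theta> q = 0 \<and> proj q = q"
proof -
  have q: "q \<in> B r" "F q = F x0" using assms unfolding \<Sigma>_def by blast+
  have 0: "\<psi> 0 q = q" using flow_0[OF B_N[OF q(1)]] .
  have "\<theta> q = 0" using theta_eq[OF q(1), of 0] 0 q(2) eta(1) by simp
  then show ?thesis unfolding proj_def using 0 by simp
qed

lemma x0_section: "x0 \<in> \<Sigma>" unfolding \<Sigma>_def using x0_B r by auto

lemma ex_proj_radius: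
  assumes "0 < e"
  shows "\<exists>\<rho>>0. \<rho> \<le> \<rho>0 \<and> proj ` B \<rho> \<subseteq> \<Sigma> \<inter> ball x0 e"
proof -
  have "openin (top_of_set (B \<rho>0)) (B \<rho>0 \<inter> proj -` ball x0 (min e r))"
    by (rule continuous_openin_preimage_gen[OF proj_cont open_ball])
  moreover have "x0 \<in> B \<rho>0 \<inter> proj -` ball x0 (min e r)" using x0_B[OF rho0(1)] theta_section[OF x0_section] r assms by auto
  ultimately obtain d where d: "d > 0" "ball x0 d \<inter> B \<rho>0 \<subseteq> B \<rho>0 \<inter> proj -` ball x0 (min e r)" unfolding openin_contains_ball by blast
  have "proj q \<in> \<Sigma> \<inter> ball x0 e" if "q \<in> B (min d \<rho>0)" for q
  proof -
    have q: "q \<in> B \<rho>0" "q \<in> ball x0 d" using that unfolding B_def by auto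
    then have "proj q \<in> ball x0 (min e r)" using d(2) by auto
    moreover have "proj q \<in> half_plane" unfolding proj_def using into theta(1)[OF q(1)] eta dl T_pos B_N[OF B_rho0[OF q(1)]] by simp
    ultimately show ?thesis using theta(2)[OF q(1)] unfolding \<Sigma>_def B_def proj_def by auto
  qed
  then show ?thesis using d rho0 by (intro exI[of _ "min d \<rho>0"]) auto
qed

lemma proj_back:
  assumes "q \<in> B \<rho>0" shows "q = \<psi> (- \<theta> q) (proj q)"
  unfolding proj_def using flow_back[OF B_rho0[OF assms]] theta(1)[OF assms] eta by simp

lemma path_connected_proj: "\<rho> \<le> \<rho>0 \<Longrightarrow> path_connected (proj ` B \<rho>)"
  by (rule path_connected_continuous_image[OF continuous_on_subset[OF proj_cont B_mono] convex_imp_path_connected[OF B_convex]])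

text \<open>The projection of a small ball of the half plane is path connected, so it contains an
  arc from \<open>x0\<close> unless it is a single point. In that case a nearby point would be
  determined by its time \<open>\<theta>\<close>, which would embed an open set of the plane in the
  line.\<close>

lemma ex_section_arc:
  assumes "0 < e"
  shows "\<exists>\<alpha>. arc \<alpha> \<and> path_image \<alpha> \<subseteq> \<Sigma> \<inter> ball x0 e \<and> pathstart \<alpha> = x0"
proof -
  obtain \<rho> where \<rho>: "0 < \<rho>" "\<rho> \<le> \<rho>0" "proj ` B \<rho> \<subseteq> \<Sigma> \<inter> ball x0 e" using ex_proj_radius[OF assms] by (elim exE conjE) (rule that)
  have "\<exists>p\<in>proj ` B \<rho>. p \<noteq> x0"
  proof (rule ccontr)
    assume *: "\<not> (\<exists>p\<in>proj ` B \<rho>. p \<noteq> x0)"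
    define O' where "O' = ball x0 \<rho> \<inter> {p. 0 < snd p}"
    have O: "open O'" "O' \<subseteq> B \<rho>" unfolding O'_def B_def half_plane_def
      by (auto intro!: open_Int open_Collect_less continuous_intros)
    have "x0 + (0, \<rho>/2) \<in> O'" unfolding O'_def using \<rho>(1) x0_half by (auto simp: dist_norm half_plane_def norm_Pair)
    then have ne: "O' \<noteq> {}" by auto
    have "inj_on \<theta> O'"
    proof (rule inj_onI)
      fix p q assume pq: "p \<in> O'" "q \<in> O'" "\<theta> p = \<theta> q"
      have "p \<in> B \<rho>0" "q \<in> B \<rho>0" "proj p = x0" "proj q = x0" using pq O B_mono[OF \<rho>(2)] * by blast+
      then show "p = q" using proj_back[of p] proj_back[of q] pq(3) by metis
    qed
    moreover have "continuous_on O' \<theta>" using continuous_on_subset[OF theta_cont] O B_mono[OF \<rho>(2)] by blast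
    ultimately have "DIM(real \<times> real) \<le> DIM(real)" using invariance_of_dimension[OF _ O(1) _ ne] by blast
    then show False by simp
  qed
  then obtain p where p: "p \<in> proj ` B \<rho>" "p \<noteq> x0" by blast
  moreover have "x0 \<in> proj ` B \<rho>" using theta_section[OF x0_section] x0_B[OF \<rho>(1)] by (metis image_eqI)
  ultimately obtain \<alpha> where "arc \<alpha>" "path_image \<alpha> \<subseteq> proj ` B \<rho>" "pathstart \<alpha> = x0"
    using path_connected_proj[OF \<rho>(2)] unfolding path_connected_arcwise by metis
  then show ?thesis using \<rho>(3) by blast
qed

lemma tube_cont:
  assumes c: "continuous_on J \<gamma>" and s: "\<gamma> ` J \<subseteq> \<Sigma>"
  shows "continuous_on (J \<times> {-\<eta>..\<eta>}) (\<lambda>(u, t). \<psi> t (\<gamma> u))"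
  unfolding case_prod_unfold
proof (rule cont_compose)
  show "continuous_on (J \<times> {-\<eta>..\<eta>}) (\<lambda>z. \<gamma> (fst z))"
    by (rule continuous_on_compose2[OF c continuous_on_fst[OF continuous_on_id]]) auto
  fix z assume "z \<in> J \<times> {-\<eta>..\<eta>}"
  then have z: "fst z \<in> J" "- \<eta> \<le> snd z" "snd z \<le> \<eta>" by auto
  show "\<bar>snd z\<bar> \<le> T" using z eta dl T_pos by linarith
  show "\<gamma> (fst z) \<in> N" using \<Sigma>_N(1) s z(1) by blast
qed (rule continuous_on_snd[OF continuous_on_id])

lemma tube_inj:
  assumes s: "\<gamma> ` J \<subseteq> \<Sigma>" "inj_on \<gamma> J"
    and "u \<in> J" "u' \<in> J" "\<bar>t\<bar> \<le> \<eta>" "\<bar>t'\<bar> \<le> \<eta>" "\<psi> t (\<gamma> u) = \<psi> t' (\<gamma> u')"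
  shows "t = t' \<and> u = u'"
proof -
  have "\<gamma> u \<in> \<Sigma>" "\<gamma> u' \<in> \<Sigma>" "\<bar>t\<bar> \<le> \<delta>/2" "\<bar>t'\<bar> \<le> \<delta>/2" using assms eta by auto
  then have "t = t'" "\<gamma> u = \<gamma> u'" using section_flow_inj assms(7) by blast+
  then show ?thesis using assms(2-4) by (simp add: inj_on_def)
qed

lemma open_tube:
  fixes a b :: real
  assumes c: "continuous_on {a<..<b} \<gamma>" and s: "\<gamma> ` {a<..<b} \<subseteq> \<Sigma>" "inj_on \<gamma> {a<..<b}" and \<tau>: "\<tau> \<le> \<eta>"
  shows "open ((\<lambda>(u, t). \<psi> t (\<gamma> u)) ` ({a<..<b} \<times> {-\<tau><..<\<tau>}))"
proof (rule invariance_of_domain)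
  show "continuous_on ({a<..<b} \<times> {-\<tau><..<\<tau>}) (\<lambda>(u, t). \<psi> t (\<gamma> u))"
    by (rule continuous_on_subset[OF tube_cont[OF c s(1)]]) (use \<tau> in auto)
  show "open ({a<..<b} \<times> {-\<tau><..<\<tau>})" by (intro open_Times) auto
  show "inj_on (\<lambda>(u, t). \<psi> t (\<gamma> u)) ({a<..<b} \<times> {-\<tau><..<\<tau>})"
  proof (rule inj_onI)
    fix z z' assume z: "z \<in> {a<..<b} \<times> {-\<tau><..<\<tau>}" "z' \<in> {a<..<b} \<times> {-\<tau><..<\<tau>}"
      and eq: "(\<lambda>(u, t). \<psi> t (\<gamma> u)) z = (\<lambda>(u, t). \<psi> t (\<gamma> u)) z'"
    have "\<bar>snd z\<bar> \<le> \<eta>" "\<bar>snd z'\<bar> \<le> \<eta>" "fst z \<in> {a<..<b}" "fst z' \<in> {a<..<b}" using z \<tau> by auto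
    then have "snd z = snd z' \<and> fst z = fst z'" using tube_inj[OF s, of "fst z" "fst z'" "snd z" "snd z'"] eq
      by (simp add: case_prod_unfold)
    then show "z = z'" by (simp add: prod_eq_iff)
  qed
qed

lemma section_in_tube_imp:
  assumes "p \<in> \<Sigma>" "q \<in> \<Sigma>" "\<bar>t\<bar> \<le> \<eta>" "p = \<psi> t q"
  shows "p = q"
  using section_return_trivial[OF assms(2,1), of t] assms eta flow_0[OF \<Sigma>_N(1)[OF assms(2)]] by simp

text \<open>An arc that starts at \<open>x0\<close> cannot exhaust the section near an interior
  point: arc parameter and flow time would map a neighbourhood onto an open set that contains the
  origin but has nonnegative first coordinates. A missed point is joined to \<open>x0\<close> inside
  the section. This second arc meets the first one only at \<open>x0\<close>, because the tube over
  the interior of the first arc is open and contains no other points of the section.\<close>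

lemma two_sided_arc:
  assumes x: "0 < snd x0"
  shows "\<exists>\<gamma>. arc \<gamma> \<and> path_image \<gamma> \<subseteq> \<Sigma> \<and> \<gamma> (1/2) = x0"
proof -
  obtain \<alpha> where \<alpha>: "arc \<alpha>" "path_image \<alpha> \<subseteq> \<Sigma> \<inter> ball x0 1" "pathstart \<alpha> = x0" using ex_section_arc[of 1] by auto
  have \<alpha>0: "\<alpha> 0 = x0" using \<alpha>(3) by (simp add: pathstart_def)
  have \<alpha>\<Sigma>: "\<And>u. u \<in> {0..1} \<Longrightarrow> \<alpha> u \<in> \<Sigma>" using \<alpha>(2) unfolding path_image_def by blast
  have \<alpha>c: "continuous_on {0..1} \<alpha>" and \<alpha>i: "inj_on \<alpha> {0..1}" using \<alpha>(1) unfolding arc_def path_def by auto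
  have not_end: "\<not> \<Sigma> \<inter> B \<rho> \<subseteq> path_image \<alpha>" if \<rho>pos: "0 < \<rho>" for \<rho>
  proof
    assume sub: "\<Sigma> \<inter> B \<rho> \<subseteq> path_image \<alpha>"
    obtain \<rho>' where \<rho>': "0 < \<rho>'" "\<rho>' \<le> \<rho>0" "proj ` B \<rho>' \<subseteq> \<Sigma> \<inter> ball x0 \<rho>" using ex_proj_radius[OF \<rho>pos] by (elim exE conjE) (rule that)
    \<comment> \<open>The bound \<open>snd x0\<close> keeps the ball inside the half plane, which
      makes it a planar domain inside \<open>B \<rho>'\<close>.\<close>
    define U where "U = ball x0 (min \<rho>' (snd x0))"
    have UB: "U \<subseteq> B \<rho>'"
    proof
      fix p assume p: "p \<in> U"
      have "dist (snd x0) (snd p) < snd x0" using p dist_snd_le[of x0 p] unfolding U_def by auto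
      then have "0 \<le> snd p" unfolding dist_real_def by linarith
      then show "p \<in> B \<rho>'" using p unfolding U_def B_def half_plane_def by auto
    qed
    have UB0: "U \<subseteq> B \<rho>0" using UB B_mono[OF \<rho>'(2)] by blast
    have pi: "proj q \<in> path_image \<alpha>" if "q \<in> U" for q
    proof -
      have "proj q \<in> \<Sigma> \<inter> ball x0 \<rho>" using \<rho>'(3) UB that by blast
      then show ?thesis using sub unfolding B_def \<Sigma>_def by blast
    qed
    obtain h where h: "homeomorphism {0..1} (path_image \<alpha>) \<alpha> h" using homeomorphism_arc[OF \<alpha>(1)] by blast
    have "open ((\<lambda>q. (h (proj q), \<theta> q)) ` U)"
    proof (rule invariance_of_domain)
      have "continuous_on U (\<lambda>q. h (proj q))"
        by (rule continuous_on_compose2[OF homeomorphism_cont2[OF h] continuous_on_subset[OF proj_cont UB0]]) (use pi in blast)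
      then show "continuous_on U (\<lambda>q. (h (proj q), \<theta> q))"
        using continuous_on_subset[OF theta_cont UB0] by (rule continuous_on_Pair)
      show "open U" unfolding U_def by simp
      show "inj_on (\<lambda>q. (h (proj q), \<theta> q)) U"
      proof (rule inj_onI)
        fix p q assume pq: "p \<in> U" "q \<in> U" "(h (proj p), \<theta> p) = (h (proj q), \<theta> q)"
        then have "\<alpha> (h (proj p)) = \<alpha> (h (proj q))" by simp
        then have "proj p = proj q" using homeomorphism_apply2[OF h pi[OF pq(1)]] homeomorphism_apply2[OF h pi[OF pq(2)]] by simp
        then show "p = q" using proj_back[of p] proj_back[of q] UB0 pq by (metis Pair_inject subsetD)
      qed
    qed
    moreover have "(0, 0) \<in> (\<lambda>q. (h (proj q), \<theta> q)) ` U"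
    proof (rule image_eqI)
      show "x0 \<in> U" unfolding U_def using \<rho>' x by simp
      have "h (\<alpha> 0) = 0" using homeomorphism_apply1[OF h, of 0] by simp
      then show "(0, 0) = (h (proj x0), \<theta> x0)" using theta_section[OF x0_section] \<alpha>0 by simp
    qed
    ultimately obtain e where e: "e > 0" "ball (0, 0) e \<subseteq> (\<lambda>q. (h (proj q), \<theta> q)) ` U" using open_contains_ball_eq by blast
    have "(- (e/2), 0) \<in> ball (0, 0 :: real) e" using e(1) by (simp add: dist_Pair_Pair)
    then obtain q where q: "q \<in> U" "(- (e/2), 0) = (h (proj q), \<theta> q)" using e(2) by blast
    then have "h (proj q) < 0" using e(1) by simp
    moreover have "h (proj q) \<in> {0..1}" using pi[OF q(1)] h unfolding homeomorphism_def by blast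
    ultimately show False by simp
  qed
  have pf: "\<alpha> 1 \<noteq> x0" using \<alpha>0 \<alpha>i by (metis atLeastAtMost_iff inj_on_contraD less_eq_real_def zero_less_one zero_neq_one order_refl)
  \<comment> \<open>This radius keeps the second arc away from the far end of the first.\<close>
  obtain \<rho> where \<rho>: "0 < \<rho>" "\<rho> \<le> \<rho>0" "proj ` B \<rho> \<subseteq> \<Sigma> \<inter> ball x0 (dist x0 (\<alpha> 1))"
    using ex_proj_radius[of "dist x0 (\<alpha> 1)"] pf by (metis zero_less_dist_iff)
  obtain q where q: "q \<in> \<Sigma>" "q \<in> B \<rho>" "q \<notin> path_image \<alpha>" using not_end[OF \<rho>(1)] by blast
  have x0\<alpha>: "x0 \<in> path_image \<alpha>" using \<alpha>0 unfolding path_image_def by force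
  have "q \<in> proj ` B \<rho>" "x0 \<in> proj ` B \<rho>" using theta_section[OF q(1)] theta_section[OF x0_section] q(2) x0_B[OF \<rho>(1)] by (metis image_eqI)+
  then obtain \<beta> where \<beta>: "arc \<beta>" "path_image \<beta> \<subseteq> proj ` B \<rho>" "pathstart \<beta> = q" "pathfinish \<beta> = x0"
    using path_connected_proj[OF \<rho>(2)] q(3) x0\<alpha> unfolding path_connected_arcwise by metis
  have \<beta>c: "continuous_on {0..1} \<beta>" and \<beta>i: "inj_on \<beta> {0..1}" using \<beta>(1) unfolding arc_def path_def by auto
  have \<beta>\<Sigma>: "\<And>u. u \<in> {0..1} \<Longrightarrow> \<beta> u \<in> \<Sigma> \<inter> ball x0 (dist x0 (\<alpha> 1))" using \<beta>(2) \<rho>(3) unfolding path_image_def by blast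
  have \<beta>1: "\<beta> 1 = x0" and \<beta>0: "\<beta> 0 = q" using \<beta> by (auto simp: pathstart_def pathfinish_def)
  define K where "K = {0..1} \<inter> \<beta> -` path_image \<alpha>"
  have "closed K" unfolding K_def
    by (rule continuous_closed_preimage[OF \<beta>c]) (auto simp: closed_arc_image[OF \<alpha>(1)])
  moreover have "K \<subseteq> {0..1}" unfolding K_def by blast
  ultimately have "compact K" by (metis compact_Icc compact_Int_closed inf.absorb_iff2)
  moreover have "1 \<in> K" unfolding K_def using \<beta>1 x0\<alpha> by simp
  ultimately obtain t1 where t1: "t1 \<in> K" "\<And>t. t \<in> K \<Longrightarrow> t1 \<le> t" using compact_attains_inf[of K] by blast
  have t101: "t1 \<in> {0..1}" "\<beta> t1 \<in> path_image \<alpha>" using t1(1) unfolding K_def by auto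
  have "t1 \<noteq> 0" using t101(2) \<beta>0 q(3) by auto
  then have t1p: "0 < t1" using t101(1) by simp
  obtain u1 where u1: "u1 \<in> {0..1}" "\<beta> t1 = \<alpha> u1" using t101(2) unfolding path_image_def by blast
  have "u1 \<noteq> 1" using \<beta>\<Sigma>[OF t101(1)] u1(2) by auto
  have "u1 = 0"
  proof (rule ccontr)
    assume "u1 \<noteq> 0"
    then have u1': "u1 \<in> {0<..<1}" using u1 \<open>u1 \<noteq> 1\<close> by auto
    let ?V = "(\<lambda>(u, t). \<psi> t (\<alpha> u)) ` ({0<..<1} \<times> {-\<eta><..<\<eta>})"
    have "open ?V"
      by (rule open_tube) (use \<alpha>\<Sigma> in \<open>auto intro: continuous_on_subset[OF \<alpha>c] inj_on_subset[OF \<alpha>i]\<close>)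
    moreover have "\<beta> t1 \<in> ?V"
      using u1 u1' eta flow_0[OF \<Sigma>_N(1)[OF \<alpha>\<Sigma>[OF u1(1)]]] by (intro image_eqI[of _ _ "(u1, 0)"]) auto
    ultimately have "openin (top_of_set {0..1}) ({0..1} \<inter> \<beta> -` ?V) \<and> t1 \<in> {0..1} \<inter> \<beta> -` ?V"
      using continuous_openin_preimage_gen[OF \<beta>c, of ?V] t101(1) by (simp only: Int_iff vimage_eq)
    then obtain d where d': "d > 0" "ball t1 d \<inter> {0..1} \<subseteq> {0..1} \<inter> \<beta> -` ?V" unfolding openin_contains_ball by blast
    have d: "d > 0" "\<And>t. t \<in> {0..1} \<Longrightarrow> dist t t1 < d \<Longrightarrow> \<beta> t \<in> ?V"
    proof -
      show "d > 0" by (rule d'(1))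
      fix t :: real assume "t \<in> {0..1}" "dist t t1 < d"
      then have "t \<in> ball t1 d \<inter> {0..1}" by (simp add: dist_commute)
      then show "\<beta> t \<in> ?V" using d'(2) by blast
    qed
    \<comment> \<open>A time just before the first meeting \<open>t1\<close>. If \<open>u1\<close>
      were interior, \<open>\<beta> t\<close> would lie in the open tube and, being a point of the
      section, on the first arc: too early.\<close>
    define t where "t = max 0 (t1 - d/2)"
    have t: "t \<in> {0..1}" "dist t t1 < d" "t < t1" using t1p t101 d(1) unfolding t_def dist_real_def by auto
    obtain u s where us: "u \<in> {0<..<1}" "s \<in> {-\<eta><..<\<eta>}" "\<beta> t = \<psi> s (\<alpha> u)" using d(2)[OF t(1,2)] by auto
    have "\<beta> t = \<alpha> u" by (rule section_in_tube_imp[of _ _ s]) (use us \<beta>\<Sigma>[OF t(1)] \<alpha>\<Sigma>[of u] in auto)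
    then have "t \<in> K" unfolding K_def path_image_def using t(1) us(1) by force
    then show False using t1(2) t(3) by force
  qed
  then have "\<beta> t1 = \<beta> 1" using u1(2) \<alpha>0 \<beta>1 by simp
  then have "t1 = 1" using \<beta>i t101(1) by (simp add: inj_on_def)
  have "path_image \<beta> \<inter> path_image \<alpha> \<subseteq> {x0}"
  proof
    fix p assume p: "p \<in> path_image \<beta> \<inter> path_image \<alpha>"
    then obtain t where t: "t \<in> {0..1}" "p = \<beta> t" unfolding path_image_def by blast
    then have "t \<in> K" unfolding K_def using p by simp
    then have "t = 1" using t1(2) \<open>t1 = 1\<close> t(1) by force
    then show "p \<in> {x0}" using t \<beta>1 by simp
  qed
  then have "arc (\<beta> +++ \<alpha>)" using arc_join[OF \<beta>(1) \<alpha>(1)] \<alpha>(3) \<beta>(4) by simp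
  moreover have "path_image (\<beta> +++ \<alpha>) \<subseteq> \<Sigma>"
    using path_image_join_subset[of \<beta> \<alpha>] \<beta>(2) \<rho>(3) \<alpha>(2) by blast
  moreover have "(\<beta> +++ \<alpha>) (1/2) = x0" unfolding joinpaths_def using \<beta>1 by simp
  ultimately show ?thesis by blast
qed

text \<open>If a boundary point moved into the interior, the inverse time map would carry a planar
  neighbourhood of its image onto an open subset of the plane that contains \<open>q\<close> and
  lies in the half plane.\<close>

lemma boundary_invariant:
  assumes q: "q \<in> N" "\<psi> t q \<in> N" "\<bar>t\<bar> \<le> T" "snd q = 0"
  shows "snd (\<psi> t q) = 0"
proof (rule ccontr)
  assume ne: "snd (\<psi> t q) \<noteq> 0"
  have "0 \<le> snd (\<psi> t q)" using into[OF q(3,1)] unfolding half_plane_def by simp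
  with ne have pos: "0 < snd (\<psi> t q)" by simp
  obtain O' where O': "open O'" "N = half_plane \<inter> O'" using N_open unfolding openin_open by blast
  define P where "P = O' \<inter> {p. 0 < snd p}"
  have P: "open P" "P \<subseteq> N" unfolding P_def O'(2) half_plane_def using O'(1)
    by (auto intro!: open_Int open_Collect_less continuous_intros)
  have c: "continuous_on P (\<lambda>p. \<psi> (- t) p)" by (rule cont_compose) (use P q(3) in auto)
  define U where "U = P \<inter> (\<lambda>p. \<psi> (- t) p) -` O'"
  have U: "open U" unfolding U_def by (rule continuous_open_preimage[OF c P(1) O'(1)])
  have UN: "p \<in> N \<and> \<psi> (- t) p \<in> N" if "p \<in> U" for p
  proof -
    have "p \<in> N" using that P(2) unfolding U_def by blast
    moreover have "\<psi> (- t) p \<in> half_plane" using into[of "- t" p] q(3) \<open>p \<in> N\<close> by simp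
    ultimately show ?thesis using that O'(2) unfolding U_def by blast
  qed
  have bk: "\<psi> t (\<psi> (- t) p) = p" if "p \<in> U" for p
    using flow_add[of p "- t" t] UN[OF that] q(3) T_pos flow_0[of p] by simp
  have "open ((\<lambda>p. \<psi> (- t) p) ` U)"
  proof (rule invariance_of_domain[OF continuous_on_subset[OF c] U])
    show "U \<subseteq> P" unfolding U_def by blast
    show "inj_on (\<lambda>p. \<psi> (- t) p) U" by (rule inj_on_inverseI[of _ "\<psi> t"]) (rule bk)
  qed
  moreover have "q \<in> (\<lambda>p. \<psi> (- t) p) ` U"
  proof (rule image_eqI)
    show eq: "q = \<psi> (- t) (\<psi> t q)" using flow_add[of q t "- t"] q T_pos flow_0[of q] by simp
    show "\<psi> t q \<in> U" unfolding U_def P_def using q(1,2) O'(2) pos eq by auto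
  qed
  ultimately obtain e where e: "e > 0" "ball q e \<subseteq> (\<lambda>p. \<psi> (- t) p) ` U" using open_contains_ball_eq by blast
  have "(fst q, - (e/2)) \<in> ball q e" using e(1) q(4) by (cases q) (simp add: dist_Pair_Pair dist_real_def)
  then obtain p where "p \<in> U" "(fst q, - (e/2)) = \<psi> (- t) p" using e(2) by blast
  then have "(fst q, - (e/2)) \<in> half_plane" using UN N_open openin_imp_subset by (metis subsetD)
  then show False using e(1) unfolding half_plane_def by simp
qed

text \<open>The orbit of \<open>x0\<close> stays in the boundary line and, by invariance of domain
  in dimension one, covers a neighbourhood of \<open>x0\<close> there. Another point of the section
  on this part of the line would lie on the short orbit of \<open>x0\<close>, which does not return
  to the section; so the arc leaves the boundary at once.\<close>

lemma boundary_arc: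
  assumes x: "snd x0 = 0"
  shows "\<exists>\<alpha>. arc \<alpha> \<and> path_image \<alpha> \<subseteq> \<Sigma> \<and> \<alpha> 0 = x0 \<and> (\<forall>t. \<bar>t\<bar> \<le> \<eta> \<longrightarrow> snd (\<psi> t x0) = 0) \<and>
    (\<forall>u\<in>{0<..1}. \<forall>t. \<bar>t\<bar> \<le> \<eta> \<longrightarrow> 0 < snd (\<psi> t (\<alpha> u)))"
proof -
  have stayN: "\<psi> t p \<in> N" "\<bar>t\<bar> \<le> T" if "p \<in> \<Sigma>" "\<bar>t\<bar> \<le> \<eta>" for p t
    using stay[OF \<Sigma>_N(2)[OF that(1)]] that(2) eta dl T_pos by auto
  have bd: "snd (\<psi> t x0) = 0" if "\<bar>t\<bar> \<le> \<eta>" for t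
    using boundary_invariant[OF x0_N stayN[OF x0_section that] x] .
  have "open ((\<lambda>t. fst (\<psi> t x0)) ` {-\<eta><..<\<eta>})"
  proof (rule invariance_of_domain)
    show "continuous_on {-\<eta><..<\<eta>} (\<lambda>t. fst (\<psi> t x0))"
      by (intro continuous_intros cont_compose) (use x0_N eta dl T_pos in auto)
    show "inj_on (\<lambda>t. fst (\<psi> t x0)) {-\<eta><..<\<eta>}"
    proof (rule inj_onI)
      fix s t assume st: "s \<in> {-\<eta><..<\<eta>}" "t \<in> {-\<eta><..<\<eta>}" "fst (\<psi> s x0) = fst (\<psi> t x0)"
      have "\<bar>s\<bar> \<le> \<eta>" "\<bar>t\<bar> \<le> \<eta>" using st by auto
      moreover from this have "\<psi> s x0 = \<psi> t x0" using bd st(3) by (simp add: prod_eq_iff)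
      ultimately show "s = t" using section_flow_inj[OF x0_section x0_section, of s t] eta by auto
    qed
  qed auto
  moreover have "fst x0 \<in> (\<lambda>t. fst (\<psi> t x0)) ` {-\<eta><..<\<eta>}"
    using eta flow_0[OF x0_N] by (intro image_eqI[of _ _ 0]) auto
  ultimately obtain e where e: "e > 0" "ball (fst x0) e \<subseteq> (\<lambda>t. fst (\<psi> t x0)) ` {-\<eta><..<\<eta>}" using open_contains_ball_eq by blast
  obtain \<alpha> where \<alpha>: "arc \<alpha>" "path_image \<alpha> \<subseteq> \<Sigma> \<inter> ball x0 e" "pathstart \<alpha> = x0" using ex_section_arc[OF e(1)] by auto
  have \<alpha>0: "\<alpha> 0 = x0" using \<alpha>(3) by (simp add: pathstart_def)
  have pos: "0 < snd (\<psi> t (\<alpha> u))" if u: "u \<in> {0<..1}" and t: "\<bar>t\<bar> \<le> \<eta>" for u t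
  proof -
    have \<alpha>u: "\<alpha> u \<in> \<Sigma>" "\<alpha> u \<in> ball x0 e"
    proof -
      have "\<alpha> u \<in> path_image \<alpha>" using u unfolding path_image_def by simp
      then show "\<alpha> u \<in> \<Sigma>" "\<alpha> u \<in> ball x0 e" using \<alpha>(2) by blast+
    qed
    have ne: "snd (\<alpha> u) \<noteq> 0"
    proof
      assume 0: "snd (\<alpha> u) = 0"
      have "fst (\<alpha> u) \<in> ball (fst x0) e" using \<alpha>u(2) dist_fst_le[of x0 "\<alpha> u"] by simp
      then obtain s where s: "s \<in> {-\<eta><..<\<eta>}" "fst (\<alpha> u) = fst (\<psi> s x0)" using e(2) by blast
      then have "\<bar>s\<bar> \<le> \<eta>" by auto
      then have "\<psi> s x0 = \<alpha> u" using bd[of s] 0 s(2) by (simp add: prod_eq_iff)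
      then have "x0 = \<alpha> u" using section_return_trivial[OF x0_section \<alpha>u(1), of s] s eta by auto
      then have "\<alpha> 0 = \<alpha> u" using \<alpha>0 by simp
      then show False using \<alpha>(1) u unfolding arc_def inj_on_def by force
    qed
    have bk: "\<psi> (- t) (\<psi> t (\<alpha> u)) = \<alpha> u" using flow_back[OF \<Sigma>_N(2)[OF \<alpha>u(1)]] t eta by simp
    have "snd (\<psi> t (\<alpha> u)) \<noteq> 0"
    proof
      assume 0: "snd (\<psi> t (\<alpha> u)) = 0"
      have "snd (\<psi> (- t) (\<psi> t (\<alpha> u))) = 0"
        by (rule boundary_invariant[OF stayN(1)[OF \<alpha>u(1) t] _ _ 0]) (use bk \<Sigma>_N(1)[OF \<alpha>u(1)] stayN(2)[OF \<alpha>u(1) t] in simp_all)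
      then show False using bk ne by simp
    qed
    moreover have "0 \<le> snd (\<psi> t (\<alpha> u))" using into[OF stayN(2)[OF \<alpha>u(1) t] \<Sigma>_N(1)[OF \<alpha>u(1)]] unfolding half_plane_def by simp
    ultimately show ?thesis by simp
  qed
  show ?thesis using \<alpha>(1,2) \<alpha>0 bd pos by blast
qed

text \<open>Invariance of domain is applied to the tube doubled by reflection in the boundary line.\<close>

lemma boundary_tube_open:
  assumes \<alpha>: "arc \<alpha>" "path_image \<alpha> \<subseteq> \<Sigma>" "\<alpha> 0 = x0" and x: "\<And>t. \<bar>t\<bar> \<le> \<eta> \<Longrightarrow> snd (\<psi> t x0) = 0"
    and pos: "\<And>u t. u \<in> {0<..1} \<Longrightarrow> \<bar>t\<bar> \<le> \<eta> \<Longrightarrow> 0 < snd (\<psi> t (\<alpha> u))" and \<tau>: "\<tau> \<le> \<eta>"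
  shows "openin (top_of_set half_plane) ((\<lambda>(u, t). \<psi> t (\<alpha> u)) ` ({0..<1} \<times> {-\<tau><..<\<tau>}))"
proof -
  have \<alpha>\<Sigma>: "\<And>u. u \<in> {0..1} \<Longrightarrow> \<alpha> u \<in> \<Sigma>" using \<alpha>(2) unfolding path_image_def by blast
  have \<alpha>c: "continuous_on {0..1} \<alpha>" and \<alpha>i: "inj_on \<alpha> {0..1}" using \<alpha>(1) unfolding arc_def path_def by auto
  define D where "D = {-1<..<1::real} \<times> {-\<tau><..<\<tau>}"
  define z where "z w = \<psi> (snd w) (\<alpha> \<bar>fst w\<bar>)" for w :: "real \<times> real"
  define \<Phi> where "\<Phi> w = (fst (z w), if 0 \<le> fst w then snd (z w) else - snd (z w))" for w
  have Dw: "\<bar>fst w\<bar> \<in> {0..1}" "\<bar>snd w\<bar> \<le> \<eta>" "\<bar>snd w\<bar> \<le> T" if "w \<in> D" for w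
    using that \<tau> eta dl T_pos unfolding D_def by auto
  have zc: "continuous_on D z" unfolding z_def
  proof (rule cont_compose)
    show "continuous_on D (\<lambda>w. \<alpha> \<bar>fst w\<bar>)"
      by (rule continuous_on_compose2[OF \<alpha>c]) (use Dw in \<open>auto intro!: continuous_intros\<close>)
  qed (use Dw \<alpha>\<Sigma> \<Sigma>_N in \<open>auto intro!: continuous_intros\<close>)
  have z0: "snd (z w) = 0" if "w \<in> D" "fst w = 0" for w
    using x[OF Dw(2)[OF that(1)]] that(2) \<alpha>(3) unfolding z_def by simp
  have zp: "0 < snd (z w)" if "w \<in> D" "fst w \<noteq> 0" for w
    unfolding z_def by (rule pos) (use Dw[OF that(1)] that(2) in auto)
  have "continuous_on D (\<lambda>w. if 0 \<le> fst w then snd (z w) else - snd (z w))"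
  proof -
    have D: "D = (D \<inter> {w. 0 \<le> fst w}) \<union> (D \<inter> {w. fst w \<le> 0})" by auto
    have "continuous_on ((D \<inter> {w. 0 \<le> fst w}) \<union> (D \<inter> {w. fst w \<le> 0})) (\<lambda>w. if 0 \<le> fst w then snd (z w) else - snd (z w))"
    proof (rule continuous_on_cases_local)
      show "closedin (top_of_set (D \<inter> {w. 0 \<le> fst w} \<union> D \<inter> {w. fst w \<le> 0})) (D \<inter> {w. 0 \<le> fst w})"
        "closedin (top_of_set (D \<inter> {w. 0 \<le> fst w} \<union> D \<inter> {w. fst w \<le> 0})) (D \<inter> {w. fst w \<le> 0})"
        unfolding D[symmetric] by (intro closedin_closed_Int closed_Collect_le continuous_intros)+
      show "continuous_on (D \<inter> {w. 0 \<le> fst w}) (\<lambda>w. snd (z w))" "continuous_on (D \<inter> {w. fst w \<le> 0}) (\<lambda>w. - snd (z w))"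
        by (intro continuous_intros continuous_on_subset[OF zc]; blast)+
      fix w assume "w \<in> D \<inter> {w. 0 \<le> fst w} \<and> \<not> 0 \<le> fst w \<or> w \<in> D \<inter> {w. fst w \<le> 0} \<and> 0 \<le> fst w"
      then have "w \<in> D" "fst w = 0" by auto
      then show "snd (z w) = - snd (z w)" using z0 by simp
    qed
    then show ?thesis using D by simp
  qed
  then have \<Phi>c: "continuous_on D \<Phi>" unfolding \<Phi>_def by (intro continuous_on_Pair continuous_on_fst zc)
  have "open (\<Phi> ` D)"
  proof (rule invariance_of_domain[OF \<Phi>c])
    show "open D" unfolding D_def by (intro open_Times) auto
    show "inj_on \<Phi> D"
    proof (rule inj_onI)
      fix w w' assume w: "w \<in> D" "w' \<in> D" and eq: "\<Phi> w = \<Phi> w'"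
      have nn: "0 \<le> snd (z w)" "0 \<le> snd (z w')" using z0 zp w by (metis less_eq_real_def)+
      have f: "fst (z w) = fst (z w')"
        and s: "(if 0 \<le> fst w then snd (z w) else - snd (z w)) = (if 0 \<le> fst w' then snd (z w') else - snd (z w'))"
        using eq unfolding \<Phi>_def by auto
      have "snd (z w) = snd (z w')" using s nn by (auto split: if_splits)
      with f have "z w = z w'" by (simp add: prod_eq_iff)
      then have "snd w = snd w' \<and> \<bar>fst w\<bar> = \<bar>fst w'\<bar>" unfolding z_def
        using tube_inj[of \<alpha> "{0..1}" "\<bar>fst w\<bar>" "\<bar>fst w'\<bar>" "snd w" "snd w'"] Dw[OF w(1)] Dw[OF w(2)] \<alpha>\<Sigma> \<alpha>i by blast
      moreover have "fst w = fst w'" if "\<bar>fst w\<bar> = \<bar>fst w'\<bar>"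
      proof (rule ccontr)
        assume "fst w \<noteq> fst w'"
        then have n: "fst w \<noteq> 0" "fst w' \<noteq> 0" "fst w = - fst w'" using that by auto
        then show False using s zp[OF w(1)] zp[OF w(2)] by (auto split: if_splits)
      qed
      ultimately show "w = w'" by (simp add: prod_eq_iff)
    qed
  qed
  moreover have "half_plane \<inter> \<Phi> ` D = (\<lambda>(u, t). \<psi> t (\<alpha> u)) ` ({0..<1} \<times> {-\<tau><..<\<tau>})"
  proof (intro set_eqI iffI)
    fix p assume "p \<in> half_plane \<inter> \<Phi> ` D"
    then obtain w where w: "w \<in> D" "p = \<Phi> w" "0 \<le> snd p" unfolding half_plane_def by blast
    have "0 \<le> fst w"
    proof (rule ccontr)
      assume "\<not> 0 \<le> fst w"
      then show False using w zp[OF w(1)] unfolding \<Phi>_def by auto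
    qed
    then show "p \<in> (\<lambda>(u, t). \<psi> t (\<alpha> u)) ` ({0..<1} \<times> {-\<tau><..<\<tau>})"
      using w(1,2) unfolding \<Phi>_def z_def D_def by (intro image_eqI[of _ _ w]) auto
  next
    fix p assume "p \<in> (\<lambda>(u, t). \<psi> t (\<alpha> u)) ` ({0..<1} \<times> {-\<tau><..<\<tau>})"
    then obtain w where w: "w \<in> {0..<1} \<times> {-\<tau><..<\<tau>}" "p = \<psi> (snd w) (\<alpha> (fst w))" by auto
    then have wD: "w \<in> D" "0 \<le> fst w" unfolding D_def by auto
    then have "p = z w" using w(2) unfolding z_def by simp
    moreover have "\<Phi> w = z w" unfolding \<Phi>_def using wD(2) by simp
    moreover have "z w \<in> half_plane" unfolding z_def
      by (rule into[OF Dw(3)[OF wD(1)] \<Sigma>_N(1)[OF \<alpha>\<Sigma>[OF Dw(1)[OF wD(1)]]]])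
    ultimately show "p \<in> half_plane \<inter> \<Phi> ` D" using wD(1) by (metis IntI image_eqI)
  qed
  ultimately show ?thesis unfolding openin_open by metis
qed

end

context planar_local_flow
begin

text \<open>The box uses flow times up to \<open>\<sigma>\<close>, whereas returns to the section
  arc are excluded up to \<open>4 * \<sigma>\<close>. The slack absorbs the offsets of both end
  points when an orbit arc between two points of the box is moved back to the section.\<close>

lemma planar_box:
  "\<exists>H \<sigma> \<gamma>. H \<in> {UNIV, half_plane} \<and> 0 < \<sigma> \<and> 4 * \<sigma> \<le> T \<and> \<gamma> 0 = x0 \<and>
     continuous_on {u \<in> {-1..1}. (0, u) \<in> H} \<gamma> \<and>
     (\<forall>u\<in>{u \<in> {-1..1}. (0, u) \<in> H}. \<gamma> u \<in> N \<and> (\<forall>t. \<bar>t\<bar> \<le> 4 * \<sigma> \<longrightarrow> \<psi> t (\<gamma> u) \<in> N)) \<and>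
     (\<forall>u\<in>{u \<in> {-1..1}. (0, u) \<in> H}. \<forall>u'\<in>{u \<in> {-1..1}. (0, u) \<in> H}. \<forall>t. \<bar>t\<bar> \<le> 4 * \<sigma> \<longrightarrow>
        \<psi> t (\<gamma> u) = \<gamma> u' \<longrightarrow> t = 0 \<and> u = u') \<and>
     openin (top_of_set half_plane) ((\<lambda>(a, u). \<psi> (\<sigma> * a) (\<gamma> u)) ` (open_square \<inter> H))"
proof -
  obtain F \<delta> r where F: "0 < \<delta>" "4 * \<delta> \<le> T" "0 < r" "B r \<subseteq> N" "continuous_on N F"
     "\<forall>q\<in>B r. \<forall>t. \<bar>t\<bar> \<le> \<delta> \<longrightarrow> \<psi> t q \<in> N"
     "\<forall>q\<in>B r. \<forall>t t'. - \<delta> \<le> t \<longrightarrow> t < t' \<longrightarrow> t' \<le> \<delta> \<longrightarrow> F (\<psi> t q) < (F (\<psi> t' q) :: real)"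
    using ex_transversal_function by (elim exE conjE) (rule that)
  have F6: "\<And>q t. q \<in> B r \<Longrightarrow> \<bar>t\<bar> \<le> \<delta> \<Longrightarrow> \<psi> t q \<in> N" using F(6) by simp
  have F7: "\<And>q t t'. q \<in> B r \<Longrightarrow> - \<delta> \<le> t \<Longrightarrow> t < t' \<Longrightarrow> t' \<le> \<delta> \<Longrightarrow> F (\<psi> t q) < F (\<psi> t' q)" using F(7) by simp
  interpret planar_section \<psi> N x0 T F \<delta> r
    by unfold_locales (fact F(1), fact F(2), fact F(3), fact F(4), fact F(5), erule (1) F6, erule (3) F7)
  define \<sigma> where "\<sigma> = \<eta> / 4"
  have \<sigma>: "0 < \<sigma>" "4 * \<sigma> = \<eta>" "4 * \<sigma> \<le> T" "\<sigma> \<le> \<eta>" unfolding \<sigma>_def using eta dl by auto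
  have stayN: "p \<in> \<Sigma> \<Longrightarrow> p \<in> N \<and> (\<forall>t. \<bar>t\<bar> \<le> 4 * \<sigma> \<longrightarrow> \<psi> t p \<in> N)" for p
    using stay[OF \<Sigma>_N(2)] \<Sigma>_N(1) eta \<sigma>(2) by simp
  have sect: "t = 0 \<and> u = u'" if "\<gamma> ` J \<subseteq> \<Sigma>" "inj_on \<gamma> J" "u \<in> J" "u' \<in> J" "\<bar>t\<bar> \<le> 4 * \<sigma>" "\<psi> t (\<gamma> u) = \<gamma> u'"
    for t u u' J and \<gamma> :: "real \<Rightarrow> real \<times> real"
  proof -
    have "\<gamma> u \<in> \<Sigma>" "\<gamma> u' \<in> \<Sigma>" "\<bar>t\<bar> \<le> \<delta>" using that eta \<sigma>(2) by auto
    then have "t = 0 \<and> \<gamma> u = \<gamma> u'" using section_return_trivial that(6) by blast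
    then show ?thesis using that(2-4) by (simp add: inj_on_def)
  qed
  have img: "(\<lambda>(a, u). \<psi> (\<sigma> * a) (\<gamma> u)) ` ({-1<..<1} \<times> J) = (\<lambda>(u, t). \<psi> t (\<gamma> u)) ` (J \<times> {-\<sigma><..<\<sigma>})"
    for J :: "real set" and \<gamma> :: "real \<Rightarrow> real \<times> real"
  proof (intro set_eqI iffI)
    fix p assume "p \<in> (\<lambda>(a, u). \<psi> (\<sigma> * a) (\<gamma> u)) ` ({-1<..<1} \<times> J)"
    then obtain a u where au: "-1 < a" "a < 1" "u \<in> J" "p = \<psi> (\<sigma> * a) (\<gamma> u)" by auto
    have "- \<sigma> < \<sigma> * a" "\<sigma> * a < \<sigma>" using mult_strict_left_mono[OF au(1) \<sigma>(1)] mult_strict_left_mono[OF au(2) \<sigma>(1)] by auto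
    then show "p \<in> (\<lambda>(u, t). \<psi> t (\<gamma> u)) ` (J \<times> {-\<sigma><..<\<sigma>})" using au by (intro image_eqI[of _ _ "(u, \<sigma> * a)"]) auto
  next
    fix p assume "p \<in> (\<lambda>(u, t). \<psi> t (\<gamma> u)) ` (J \<times> {-\<sigma><..<\<sigma>})"
    then obtain t u where tu: "- \<sigma> < t" "t < \<sigma>" "u \<in> J" "p = \<psi> t (\<gamma> u)" by auto
    then show "p \<in> (\<lambda>(a, u). \<psi> (\<sigma> * a) (\<gamma> u)) ` ({-1<..<1} \<times> J)"
      using \<sigma>(1) by (intro image_eqI[of _ _ "(t / \<sigma>, u)"]) (auto simp: divide_simps)
  qed
  show ?thesis
  proof (cases "0 < snd x0")
    case True
    obtain \<gamma>0 where \<gamma>0: "arc \<gamma>0" "path_image \<gamma>0 \<subseteq> \<Sigma>" "\<gamma>0 (1/2) = x0" using two_sided_arc[OF True] by blast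
    define \<gamma> where "\<gamma> u = \<gamma>0 ((u + 1) / 2)" for u
    have J: "{u \<in> {-1..1}. (0::real, u) \<in> UNIV} = {-1..1::real}" by auto
    have c: "continuous_on {-1..1} \<gamma>" unfolding \<gamma>_def
      by (rule continuous_on_compose2[of "{0..1}" \<gamma>0]) (use \<gamma>0(1) in \<open>auto intro!: continuous_intros simp: arc_def path_def\<close>)
    have i: "inj_on \<gamma> {-1..1}"
    proof (rule inj_onI)
      fix u u' assume u: "u \<in> {-1..1}" "u' \<in> {-1..1}" "\<gamma> u = \<gamma> u'"
      then have "(u + 1)/2 = (u' + 1)/2" using \<gamma>0(1) unfolding arc_def \<gamma>_def by (auto dest: inj_onD)
      then show "u = u'" by simp
    qed
    have s: "\<gamma> ` {-1..1} \<subseteq> \<Sigma>"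
    proof
      fix p assume "p \<in> \<gamma> ` {-1..1}"
      then obtain u where "u \<in> {-1..1}" "p = \<gamma>0 ((u + 1) / 2)" unfolding \<gamma>_def by blast
      then have "p \<in> path_image \<gamma>0" unfolding path_image_def by auto
      then show "p \<in> \<Sigma>" using \<gamma>0(2) by blast
    qed
    have "open ((\<lambda>(u, t). \<psi> t (\<gamma> u)) ` ({-1<..<1} \<times> {-\<sigma><..<\<sigma>}))"
    proof (rule open_tube[OF _ _ _ \<sigma>(4)])
      show "continuous_on {-1<..<1} \<gamma>" by (rule continuous_on_subset[OF c]) auto
      show "\<gamma> ` {-1<..<1} \<subseteq> \<Sigma>" using s image_mono[of "{-1<..<1}" "{-1..1}" \<gamma>] by force
      show "inj_on \<gamma> {-1<..<1}" by (rule inj_on_subset[OF i]) auto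
    qed
    moreover have "(\<lambda>(u, t). \<psi> t (\<gamma> u)) ` ({-1<..<1} \<times> {-\<sigma><..<\<sigma>}) \<subseteq> half_plane"
    proof
      fix p assume "p \<in> (\<lambda>(u, t). \<psi> t (\<gamma> u)) ` ({-1<..<1} \<times> {-\<sigma><..<\<sigma>})"
      then obtain u t where ut: "u \<in> {-1<..<1}" "t \<in> {-\<sigma><..<\<sigma>}" "p = \<psi> t (\<gamma> u)" by auto
      have "\<gamma> u \<in> \<Sigma>" using s ut(1) by force
      moreover have "\<bar>t\<bar> \<le> T" using ut(2) \<sigma> by auto
      ultimately show "p \<in> half_plane" using into \<Sigma>_N(1) ut(3) by blast
    qed
    ultimately have o: "openin (top_of_set half_plane) ((\<lambda>(a, u). \<psi> (\<sigma> * a) (\<gamma> u)) ` (open_square \<inter> UNIV))"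
      unfolding open_square_def Int_UNIV_right img[of \<gamma>] by (simp add: open_subset)
    show ?thesis
    proof (intro exI[of _ UNIV] exI[of _ \<sigma>] exI[of _ \<gamma>] conjI o \<sigma>(1,3))
      show "\<gamma> 0 = x0" unfolding \<gamma>_def using \<gamma>0(3) by simp
      show "continuous_on {u \<in> {-1..1}. (0::real, u) \<in> UNIV} \<gamma>" unfolding J by (rule c)
      show "\<forall>u\<in>{u \<in> {-1..1}. (0::real, u) \<in> UNIV}. \<gamma> u \<in> N \<and> (\<forall>t. \<bar>t\<bar> \<le> 4 * \<sigma> \<longrightarrow> \<psi> t (\<gamma> u) \<in> N)"
        unfolding J using stayN s by blast
      show "\<forall>u\<in>{u \<in> {-1..1}. (0::real, u) \<in> UNIV}. \<forall>u'\<in>{u \<in> {-1..1}. (0::real, u) \<in> UNIV}. \<forall>t. \<bar>t\<bar> \<le> 4 * \<sigma> \<longrightarrow>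
        \<psi> t (\<gamma> u) = \<gamma> u' \<longrightarrow> t = 0 \<and> u = u'" unfolding J using sect[OF s i] by blast
    qed simp
  next
    case False
    then have x: "snd x0 = 0" using x0_half unfolding half_plane_def by auto
    obtain \<alpha> where \<alpha>: "arc \<alpha>" "path_image \<alpha> \<subseteq> \<Sigma>" "\<alpha> 0 = x0" "\<forall>t. \<bar>t\<bar> \<le> \<eta> \<longrightarrow> snd (\<psi> t x0) = 0"
      "\<forall>u\<in>{0<..1}. \<forall>t. \<bar>t\<bar> \<le> \<eta> \<longrightarrow> 0 < snd (\<psi> t (\<alpha> u))" using boundary_arc[OF x] by blast
    have J: "{u \<in> {-1..1}. (0::real, u) \<in> half_plane} = {0..1::real}" unfolding half_plane_def by auto
    have c: "continuous_on {0..1} \<alpha>" and i: "inj_on \<alpha> {0..1}" using \<alpha>(1) unfolding arc_def path_def by auto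
    have s: "\<alpha> ` {0..1} \<subseteq> \<Sigma>" using \<alpha>(2) unfolding path_image_def .
    have os: "open_square \<inter> half_plane = {-1<..<1} \<times> {0..<1}" unfolding open_square_def half_plane_def by auto
    have o: "openin (top_of_set half_plane) ((\<lambda>(a, u). \<psi> (\<sigma> * a) (\<alpha> u)) ` (open_square \<inter> half_plane))"
      unfolding os img[of \<alpha>] by (rule boundary_tube_open[OF \<alpha>(1,2,3) _ _ \<sigma>(4)]) (use \<alpha>(4,5) in auto)
    show ?thesis
    proof (intro exI[of _ half_plane] exI[of _ \<sigma>] exI[of _ \<alpha>] conjI o \<sigma>(1,3) \<alpha>(3))
      show "continuous_on {u \<in> {-1..1}. (0::real, u) \<in> half_plane} \<alpha>" unfolding J by (rule c)
      show "\<forall>u\<in>{u \<in> {-1..1}. (0::real, u) \<in> half_plane}. \<alpha> u \<in> N \<and> (\<forall>t. \<bar>t\<bar> \<le> 4 * \<sigma> \<longrightarrow> \<psi> t (\<alpha> u) \<in> N)"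
        unfolding J using stayN s by blast
      show "\<forall>u\<in>{u \<in> {-1..1}. (0::real, u) \<in> half_plane}. \<forall>u'\<in>{u \<in> {-1..1}. (0::real, u) \<in> half_plane}. \<forall>t. \<bar>t\<bar> \<le> 4 * \<sigma> \<longrightarrow>
        \<psi> t (\<alpha> u) = \<alpha> u' \<longrightarrow> t = 0 \<and> u = u'" unfolding J using sect[OF s i] by blast
    qed simp
  qed
qed

end

section \<open>Flow boxes\<close>

lemma flow_continuous:
  assumes "flow_on X v"
  shows "continuous_map (prod_topology euclideanreal X) X (\<lambda>(t, p). v t p)"
    "p \<in> topspace X \<Longrightarrow> v 0 p = p" "p \<in> topspace X \<Longrightarrow> v (s + t) p = v s (v t p)"
    "p \<in> topspace X \<Longrightarrow> v t p \<in> topspace X"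
proof -
  show c: "continuous_map (prod_topology euclideanreal X) X (\<lambda>(t, p). v t p)"
    and "p \<in> topspace X \<Longrightarrow> v 0 p = p" "p \<in> topspace X \<Longrightarrow> v (s + t) p = v s (v t p)"
    using assms unfolding flow_on_def by auto
  have "(\<lambda>(t, p). v t p) \<in> topspace (prod_topology euclideanreal X) \<rightarrow> topspace X"
    using continuous_map_funspace[OF c] .
  then show "p \<in> topspace X \<Longrightarrow> v t p \<in> topspace X" by (auto simp: Pi_iff)
qed

lemma flow_inverse: "flow_on X v \<Longrightarrow> p \<in> topspace X \<Longrightarrow> v (- t) (v t p) = p"
  using flow_continuous(2,3)[of X v p] by (metis add.left_inverse)

lemma flow_continuous_compose:
  assumes "flow_on X v" "continuous_map Y euclideanreal f" "continuous_map Y X g"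
  shows "continuous_map Y X (\<lambda>y. v (f y) (g y))"
proof -
  have "continuous_map Y (prod_topology euclideanreal X) (\<lambda>y. (f y, g y))"
    using assms(2,3) by (simp add: continuous_map_pairedI)
  from continuous_map_compose[OF this flow_continuous(1)[OF assms(1)]] show ?thesis by (simp add: o_def)
qed

text \<open>A positive time divided by a large natural number falls below \<open>e\<close>; negative
  times follow by inversion.\<close>

lemma singular_if_locally_constant:
  assumes v: "flow_on X v" "p \<in> topspace X" and e: "0 < e" "\<And>t. 0 < t \<Longrightarrow> t < e \<Longrightarrow> v t p = p"
  shows "singular_point v p"
proof -
  have n: "v (real n * t) p = p" if "v t p = p" for n t
  proof (induction n)
    case 0 show ?case using flow_continuous(2)[OF v] by simp
  next
    case (Suc n)
    have "v (t + real n * t) p = v t (v (real n * t) p)" using flow_continuous(3)[OF v] .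
    then show ?case using Suc that by (simp add: distrib_right)
  qed
  have pos: "v t p = p" if "0 < t" for t
  proof -
    obtain n :: nat where n': "t / e < real n" using reals_Archimedean2 by blast
    moreover have "0 < t / e" using that e by simp
    ultimately have "0 < real n" by linarith
    then have "v (t / real n) p = p" using n' that e by (intro e(2)) (auto simp: divide_simps mult.commute)
    then have "v (real n * (t / real n)) p = p" by (rule n)
    then show ?thesis using \<open>0 < real n\<close> by simp
  qed
  have "v t p = p" for t
  proof (cases "t" "0 :: real" rule: linorder_cases)
    case less
    then have "v (- t) p = p" using pos by simp
    then show ?thesis using flow_inverse[OF v, of "- t"] by simp
  qed (use pos flow_continuous(2)[OF v] in auto)
  then show ?thesis unfolding singular_point_def by simp
qed

lemma flow_tube:
  assumes v: "flow_on X v" "x \<in> topspace X" and U: "openin X U" "x \<in> U"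
  shows "\<exists>T>0. \<exists>V. openin X V \<and> x \<in> V \<and> V \<subseteq> U \<and> (\<forall>t. \<bar>t\<bar> \<le> T \<longrightarrow> (\<forall>p\<in>V. v t p \<in> U))"
proof -
  let ?W = "{z \<in> topspace (prod_topology euclideanreal X). (\<lambda>(t, p). v t p) z \<in> U}"
  have op: "openin (prod_topology euclideanreal X) ?W"
    by (rule openin_continuous_map_preimage[OF flow_continuous(1)[OF v(1)] U(1)])
  have "(0, x) \<in> ?W" using v(2) U(2) flow_continuous(2)[OF v] by simp
  from openin_prod_topology_alt[THEN iffD1, rule_format, OF op this]
  obtain A V where AV: "openin euclideanreal A" "openin X V" "0 \<in> A" "x \<in> V" "A \<times> V \<subseteq> ?W"
    by (elim exE conjE) (rule that)
  have "open A" using AV(1) by simp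
  obtain e where e: "e > 0" "ball 0 e \<subseteq> A" using \<open>open A\<close> AV(3) open_contains_ball_eq by blast
  show ?thesis
  proof (intro exI[of _ "e/2"] exI[of _ "V \<inter> U"] conjI allI impI ballI)
    show "openin X (V \<inter> U)" using AV U by blast
    fix t p assume t: "\<bar>t\<bar> \<le> e/2" and p: "p \<in> V \<inter> U"
    have "t \<in> ball 0 e" using t e(1) by (simp add: dist_real_def)
    then have "t \<in> A" using e(2) by blast
    then have "(t, p) \<in> ?W" using AV(5) p by blast
    then show "v t p \<in> U" by simp
  qed (use AV U e in auto)
qed

text \<open>In contrast to \<^const>\<open>trivial_flow_box\<close>, the flow has constant speed \<open>1 / \<sigma>\<close> in this box.\<close>

definition uniform_flow_box ::
  "'a topology \<Rightarrow> (real \<Rightarrow> 'a \<Rightarrow> 'a) \<Rightarrow> 'a \<Rightarrow> (real \<times> real) set \<Rightarrow> real \<Rightarrow> (real \<times> real \<Rightarrow> 'a) \<Rightarrow> bool" where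
  "uniform_flow_box X v x H \<sigma> g \<longleftrightarrow>
     H \<in> {UNIV, half_plane} \<and> 0 < \<sigma> \<and>
     embedding_map (top_of_set (square \<inter> H)) X g \<and>
     openin X (g ` (open_square \<inter> H)) \<and> g (0, 0) = x \<and>
     (\<forall>a u s. (a, u) \<in> square \<inter> H \<longrightarrow> a + s / \<sigma> \<in> {-1..1} \<longrightarrow> v s (g (a, u)) = g (a + s / \<sigma>, u)) \<and>
     (\<forall>p\<in>square \<inter> H. \<forall>q\<in>square \<inter> H. \<forall>s. \<bar>s\<bar> \<le> \<sigma> \<longrightarrow> v s (g p) = g q \<longrightarrow>
        snd q = snd p \<and> fst q = fst p + s / \<sigma>)"

lemma square_half: "H \<in> {UNIV, half_plane} \<Longrightarrow> square \<inter> H = {-1..1} \<times> {u \<in> {-1..1}. (0, u) \<in> H}"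
  unfolding square_def half_plane_def by auto

theorem ex_uniform_flow_box:
  fixes S :: "'a topology"
  assumes S: "surface S" and v: "flow_on S v" and x: "x \<in> topspace S" and ns: "\<not> singular_point v x"
    and Ux: "openin S Ux" "x \<in> Ux"
  shows "\<exists>H \<sigma> g. uniform_flow_box S v x H \<sigma> g \<and> g ` (square \<inter> H) \<subseteq> Ux"
proof -
  obtain U W where U: "openin S U" "x \<in> U" "openin (top_of_set half_plane) W"
    "subtopology S U homeomorphic_space top_of_set W" using S x unfolding surface_def by blast
  obtain f f' where f: "homeomorphic_maps (subtopology S U) (top_of_set W) f f'"
    using U(4) unfolding homeomorphic_space_def by blast
  have US: "U \<subseteq> topspace S" using U(1) openin_subset by blast
  have fU: "\<And>p. p \<in> U \<Longrightarrow> f p \<in> W \<and> f' (f p) = p" and f'W: "\<And>q. q \<in> W \<Longrightarrow> f' q \<in> U \<and> f (f' q) = q"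
    and fc: "continuous_map (subtopology S U) (top_of_set W) f" and f'c: "continuous_map (top_of_set W) (subtopology S U) f'"
    using f US unfolding homeomorphic_maps_def continuous_map_def by (auto simp: topspace_subtopology_subset)
  have f'cS: "continuous_map (top_of_set W) S f'" using f'c by (simp add: continuous_map_in_subtopology)
  have fo: "openin (top_of_set W) (f ` V)" if "openin S V" "V \<subseteq> U" for V
  proof -
    have "openin (subtopology S U) V" using that U(1) by (simp add: openin_open_subtopology)
    moreover have "homeomorphic_map (subtopology S U) (top_of_set W) f" using f homeomorphic_maps_map by blast
    ultimately show ?thesis by (simp add: homeomorphic_map_openness_eq)
  qed
  define U1 where "U1 = U \<inter> Ux"
  have U1: "openin S U1" "x \<in> U1" "U1 \<subseteq> U" "U1 \<subseteq> Ux" unfolding U1_def using U Ux by auto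
  obtain T V where T: "T > 0" "openin S V" "x \<in> V" "V \<subseteq> U1" "\<And>t p. \<bar>t\<bar> \<le> T \<Longrightarrow> p \<in> V \<Longrightarrow> v t p \<in> U1"
    using flow_tube[OF v x U1(1,2)] by metis
  define N where "N = f ` V"
  define \<psi> where "\<psi> t q = f (v t (f' q))" for t q
  have VU: "V \<subseteq> U" using T(4) U1(3) by blast
  have NV: "f' q \<in> V \<and> q \<in> W" if "q \<in> N" for q using that fU VU unfolding N_def by auto
  have NW: "openin (top_of_set W) N" unfolding N_def by (rule fo[OF T(2) VU])
  have vU: "v t (f' q) \<in> U" if "q \<in> N" "\<bar>t\<bar> \<le> T" for t q using T(5) NV[OF that(1)] that(2) U1(3) by blast
  have f'\<psi>: "f' (\<psi> t q) = v t (f' q)" if "q \<in> N" "\<bar>t\<bar> \<le> T" for t q unfolding \<psi>_def using fU vU[OF that] by simp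
  interpret planar_local_flow \<psi> N "f x" T
  proof
    show "openin (top_of_set half_plane) N" using NW U(3) openin_trans by blast
    show "0 < T" by (rule T)
    have "continuous_map (top_of_set ({-T..T} \<times> N)) S (\<lambda>z. v (fst z) (f' (snd z)))"
    proof (rule flow_continuous_compose[OF v])
      show "continuous_map (top_of_set ({-T..T} \<times> N)) euclideanreal fst" by (simp add: continuous_intros)
      have "continuous_map (top_of_set ({-T..T} \<times> N)) (top_of_set W) snd"
        using NV by (auto simp: continuous_map_in_subtopology intro!: continuous_intros)
      from continuous_map_compose[OF this f'cS]
      show "continuous_map (top_of_set ({-T..T} \<times> N)) S (\<lambda>z. f' (snd z))" by (simp only: o_def)
    qed
    then have "continuous_map (top_of_set ({-T..T} \<times> N)) (subtopology S U) (\<lambda>z. v (fst z) (f' (snd z)))"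
      using vU by (auto simp: continuous_map_in_subtopology)
    from continuous_map_compose[OF this fc]
    have "continuous_on ({-T..T} \<times> N) (\<lambda>z. \<psi> (fst z) (snd z))"
      by (simp add: continuous_map_in_subtopology o_def \<psi>_def)
    then show "continuous_on ({-T..T} \<times> N) (\<lambda>(t, q). \<psi> t q)" by (simp add: case_prod_unfold)
    show "\<psi> t q \<in> half_plane" if "\<bar>t\<bar> \<le> T" "q \<in> N" for t q
      unfolding \<psi>_def using fU[OF vU[OF that(2,1)]] U(3) openin_imp_subset by blast
    show "\<psi> 0 q = q" if "q \<in> N" for q
      unfolding \<psi>_def using flow_continuous(2)[OF v] NV[OF that] f'W VU US by (metis subsetD)
    show "\<psi> s (\<psi> t q) = \<psi> (s + t) q" if "q \<in> N" "\<psi> t q \<in> N" "\<bar>t\<bar> \<le> T" "\<bar>s\<bar> \<le> T" "\<bar>s + t\<bar> \<le> T" for q t s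
      unfolding \<psi>_def[of s] f'\<psi>[OF that(1,3)] unfolding \<psi>_def[of "s + t"]
      using flow_continuous(3)[OF v] NV[OF that(1)] VU US by (metis subsetD)
    show "f x \<in> N" unfolding N_def using T(3) by blast
    show "\<exists>t. 0 < t \<and> t < e \<and> \<psi> t (f x) \<noteq> f x" if "0 < e" for e
    proof (rule ccontr)
      assume *: "\<not> ?thesis"
      have "v t x = x" if t: "0 < t" "t < min e T" for t
      proof -
        have "\<psi> t (f x) = f x" using * t by auto
        moreover have "v t x \<in> U" "f' (f x) = x" using T(5)[of t x] T(3) t U1(3) fU U(2) by auto
        ultimately show ?thesis unfolding \<psi>_def using fU by metis
      qed
      then have "singular_point v x" using that T(1) by (intro singular_if_locally_constant[OF v x, of "min e T"]) auto
      then show False using ns by blast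
    qed
  qed
  obtain H \<sigma> \<gamma> where H: "H \<in> {UNIV, half_plane}" and \<sigma>: "0 < \<sigma>" "4 * \<sigma> \<le> T" and \<gamma>0: "\<gamma> 0 = f x"
    and \<gamma>c: "continuous_on {u \<in> {-1..1}. (0, u) \<in> H} \<gamma>"
    and \<gamma>N': "\<forall>u\<in>{u \<in> {-1..1}. (0, u) \<in> H}. \<gamma> u \<in> N \<and> (\<forall>t. \<bar>t\<bar> \<le> 4 * \<sigma> \<longrightarrow> \<psi> t (\<gamma> u) \<in> N)"
    and sect': "\<forall>u\<in>{u \<in> {-1..1}. (0, u) \<in> H}. \<forall>u'\<in>{u \<in> {-1..1}. (0, u) \<in> H}. \<forall>t. \<bar>t\<bar> \<le> 4 * \<sigma> \<longrightarrow>
        \<psi> t (\<gamma> u) = \<gamma> u' \<longrightarrow> t = 0 \<and> u = u'"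
    and o: "openin (top_of_set half_plane) ((\<lambda>(a, u). \<psi> (\<sigma> * a) (\<gamma> u)) ` (open_square \<inter> H))"
    using planar_box by (elim exE conjE) (rule that)
  define J where "J = {u \<in> {-1..1}. (0, u) \<in> H}"
  define g where "g z = v (\<sigma> * fst z) (f' (\<gamma> (snd z)))" for z
  have R: "square \<inter> H = {-1..1} \<times> J" unfolding J_def by (rule square_half[OF H])
  have \<gamma>N: "\<gamma> u \<in> N" if "u \<in> J" for u using \<gamma>N' that unfolding J_def by blast
  have bnd: "\<bar>\<sigma> * a\<bar> \<le> \<sigma>" if "a \<in> {-1..1}" for a
    using that \<sigma>(1) by (simp add: abs_mult abs_le_iff mult_left_le)
  have kS: "f' (\<gamma> u) \<in> topspace S" if "u \<in> J" for u using NV[OF \<gamma>N[OF that]] VU US by blast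
  have sect: "s = 0 \<and> u = u'" if "u \<in> J" "u' \<in> J" "\<bar>s\<bar> \<le> 4 * \<sigma>" "v s (f' (\<gamma> u)) = f' (\<gamma> u')" for s u u'
  proof -
    have "\<psi> s (\<gamma> u) = \<gamma> u'" unfolding \<psi>_def that(4) using f'W NV[OF \<gamma>N[OF that(2)]] by simp
    then show ?thesis using sect' that(1-3) unfolding J_def by blast
  qed
  have step: "snd q = snd p \<and> fst q = fst p + s / \<sigma>" if pq: "p \<in> square \<inter> H" "q \<in> square \<inter> H" "\<bar>s\<bar> \<le> \<sigma>" "v s (g p) = g q" for p q s
  proof -
    obtain a u where p: "p = (a, u)" "a \<in> {-1..1}" "u \<in> J" using pq(1) unfolding R by auto
    obtain b w where q: "q = (b, w)" "b \<in> {-1..1}" "w \<in> J" using pq(2) unfolding R by auto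
    have "v (- (\<sigma> * b)) (v s (g p)) = f' (\<gamma> w)" unfolding pq(4) unfolding q g_def using flow_inverse[OF v kS[OF q(3)]] by simp
    moreover have "v (- (\<sigma> * b)) (v s (g p)) = v (- (\<sigma> * b) + (s + \<sigma> * a)) (f' (\<gamma> u))"
      unfolding p g_def by (simp only: flow_continuous(3)[OF v kS[OF p(3)]] fst_conv snd_conv)
    moreover have "- (\<sigma> * b) + (s + \<sigma> * a) = s + \<sigma> * a - \<sigma> * b" by simp
    ultimately have "v (s + \<sigma> * a - \<sigma> * b) (f' (\<gamma> u)) = f' (\<gamma> w)" by metis
    \<comment> \<open>Each of the three terms is at most \<open>\<sigma>\<close>, so the total lies
      within the range of \<open>sect\<close>.\<close>
    moreover have "\<bar>s + \<sigma> * a - \<sigma> * b\<bar> \<le> 4 * \<sigma>" using bnd[OF p(2)] bnd[OF q(2)] pq(3) \<sigma>(1) by linarith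
    ultimately have "s + \<sigma> * a - \<sigma> * b = 0 \<and> u = w" using sect p q by blast
    then show ?thesis using p q \<sigma>(1) by (simp add: field_simps)
  qed
  have gU: "g z \<in> U1" if "z \<in> square \<inter> H" for z
  proof -
    have z: "fst z \<in> {-1..1}" "snd z \<in> J" using that unfolding R by auto
    have "\<bar>\<sigma> * fst z\<bar> \<le> T" using bnd[OF z(1)] \<sigma> by linarith
    moreover have "f' (\<gamma> (snd z)) \<in> V" using NV \<gamma>N z(2) by blast
    ultimately show ?thesis unfolding g_def by (rule T(5))
  qed
  have gS: "g z \<in> topspace S" if "z \<in> square \<inter> H" for z using gU[OF that] U1(3) US by blast
  have gc: "continuous_map (top_of_set (square \<inter> H)) S g"
    unfolding g_def R
  proof (rule flow_continuous_compose[OF v])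
    show "continuous_map (top_of_set ({-1..1} \<times> J)) euclideanreal (\<lambda>z. \<sigma> * fst z)"
      by (simp, intro continuous_intros)
    have "continuous_on ({-1..1} \<times> J) (\<lambda>z. \<gamma> (snd z))"
      by (rule continuous_on_compose2[OF \<gamma>c[folded J_def]]) (auto intro!: continuous_intros)
    moreover have "\<gamma> u \<in> W" if "u \<in> J" for u using NV[OF \<gamma>N[OF that]] by simp
    ultimately have "continuous_map (top_of_set ({-1..1} \<times> J)) (top_of_set W) (\<lambda>z. \<gamma> (snd z))"
      by (auto simp: continuous_map_in_subtopology)
    from continuous_map_compose[OF this f'cS]
    show "continuous_map (top_of_set ({-1..1} \<times> J)) S (\<lambda>z. f' (\<gamma> (snd z)))" by (simp only: o_def)
  qed
  have gi: "inj_on g (square \<inter> H)"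
  proof (rule inj_onI)
    fix p q assume pq: "p \<in> square \<inter> H" "q \<in> square \<inter> H" "g p = g q"
    then have "v 0 (g p) = g q" using flow_continuous(2)[OF v gS] by simp
    then show "p = q" using step[OF pq(1,2), of 0] \<sigma>(1) by (simp add: prod_eq_iff)
  qed
  have "closed half_plane" unfolding half_plane_def
    by (rule closed_Collect_le[OF continuous_on_const continuous_on_snd[OF continuous_on_id]])
  then have "closed H" using H by auto
  then have cR: "compact (square \<inter> H)" unfolding square_def by (intro compact_Int_closed compact_Times compact_Icc)
  have ge: "embedding_map (top_of_set (square \<inter> H)) S g"
  proof (rule injective_closed_imp_embedding_map[OF gc])
    show "closed_map (top_of_set (square \<inter> H)) S g"
      by (rule continuous_imp_closed_map[OF gc]) (use cR S in \<open>simp_all add: compact_space_subtopology compactin_euclidean_iff surface_def\<close>)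
  qed (use gi in simp)
  have "g ` (open_square \<inter> H) = f' ` ((\<lambda>(a, u). \<psi> (\<sigma> * a) (\<gamma> u)) ` (open_square \<inter> H))"
    unfolding image_image
  proof (rule image_cong[OF refl])
    fix z assume "z \<in> open_square \<inter> H"
    then have "z \<in> square \<inter> H" unfolding open_square_def square_def by auto
    then have z: "fst z \<in> {-1..1}" "snd z \<in> J" unfolding R by auto
    then have "\<bar>\<sigma> * fst z\<bar> \<le> T" using bnd[of "fst z"] \<sigma> by linarith
    then show "g z = f' (case z of (a, u) \<Rightarrow> \<psi> (\<sigma> * a) (\<gamma> u))"
      unfolding case_prod_unfold g_def using f'\<psi>[OF \<gamma>N[OF z(2)]] by simp
  qed
  moreover have "openin (top_of_set W) ((\<lambda>(a, u). \<psi> (\<sigma> * a) (\<gamma> u)) ` (open_square \<inter> H))"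
  proof (rule openin_subset_trans[OF o])
    show "W \<subseteq> half_plane" using U(3) openin_imp_subset by blast
    show "(\<lambda>(a, u). \<psi> (\<sigma> * a) (\<gamma> u)) ` (open_square \<inter> H) \<subseteq> W"
    proof
      fix p assume "p \<in> (\<lambda>(a, u). \<psi> (\<sigma> * a) (\<gamma> u)) ` (open_square \<inter> H)"
      then obtain a u where "(a, u) \<in> open_square" "(a, u) \<in> H" and p: "p = \<psi> (\<sigma> * a) (\<gamma> u)" by auto
      then have "(a, u) \<in> square \<inter> H" unfolding open_square_def square_def by auto
      then have z: "a \<in> {-1..1}" "u \<in> J" unfolding R by auto
      then have "\<bar>\<sigma> * a\<bar> \<le> T" using bnd[of a] \<sigma> by linarith
      then show "p \<in> W" unfolding p \<psi>_def using fU[OF vU[OF \<gamma>N[OF z(2)]]] by blast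
    qed
  qed
  then have "openin (subtopology S U) (f' ` ((\<lambda>(a, u). \<psi> (\<sigma> * a) (\<gamma> u)) ` (open_square \<inter> H)))"
    using f homeomorphic_maps_sym[of "subtopology S U"] homeomorphic_maps_map homeomorphic_map_openness_eq by metis
  ultimately have go: "openin S (g ` (open_square \<inter> H))" using U(1) openin_open_subtopology by metis
  have "uniform_flow_box S v x H \<sigma> g"
    unfolding uniform_flow_box_def
  proof (intro conjI H \<sigma>(1) ge go)
    show "g (0, 0) = x" unfolding g_def using \<gamma>0 fU[OF U(2)] flow_continuous(2)[OF v x] by simp
    show "\<forall>p\<in>square \<inter> H. \<forall>q\<in>square \<inter> H. \<forall>s. \<bar>s\<bar> \<le> \<sigma> \<longrightarrow> v s (g p) = g q \<longrightarrow> snd q = snd p \<and> fst q = fst p + s / \<sigma>"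
      using step by blast
    show "\<forall>a u s. (a, u) \<in> square \<inter> H \<longrightarrow> a + s / \<sigma> \<in> {-1..1} \<longrightarrow> v s (g (a, u)) = g (a + s / \<sigma>, u)"
    proof (intro allI impI)
      fix a u s assume "(a, u) \<in> square \<inter> H"
      then have "u \<in> J" unfolding R by auto
      then have "v s (v (\<sigma> * a) (f' (\<gamma> u))) = v (s + \<sigma> * a) (f' (\<gamma> u))" using flow_continuous(3)[OF v kS] by simp
      moreover have "s + \<sigma> * a = \<sigma> * (a + s / \<sigma>)" using \<sigma>(1) by (simp add: field_simps)
      ultimately show "v s (g (a, u)) = g (a + s / \<sigma>, u)" unfolding g_def by simp
    qed
  qed
  moreover have "g ` (square \<inter> H) \<subseteq> Ux" using gU U1(4) by blast
  ultimately show ?thesis by blast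
qed

section \<open>Slowing functions and their integral curves\<close>

lemma k_times_Suc_imp: "k_times_differentiable_on (Suc k) U f \<Longrightarrow> k_times_differentiable_on k U f"
proof (induction k arbitrary: f)
  case 0
  then obtain f' where "\<forall>p\<in>U. (f has_derivative f' p) (at p)" by auto
  then have "\<forall>p\<in>U. isCont f p" using has_derivative_continuous by blast
  then show ?case by (simp add: continuous_at_imp_continuous_on)
next
  case (Suc k)
  then obtain f' where f': "\<forall>p\<in>U. (f has_derivative f' p) (at p)" "\<forall>d. k_times_differentiable_on (Suc k) U (\<lambda>p. f' p d)"
    by (subst (asm) (2) k_times_differentiable_on.simps(2)) blast
  with Suc.IH have "\<forall>d. k_times_differentiable_on k U (\<lambda>p. f' p d)" by blast
  with f' show ?case by auto
qed

lemma k_times_const: "k_times_differentiable_on k U (\<lambda>_. c)"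
  by (induction k arbitrary: c) (auto intro!: exI[of _ "\<lambda>_ _. 0"])

lemma k_times_linear:
  assumes "bounded_linear f" shows "k_times_differentiable_on k U f"
proof (cases k)
  case 0 then show ?thesis using assms by (simp add: linear_continuous_on)
next
  case (Suc j)
  then show ?thesis using assms k_times_const
    by (auto intro!: exI[of _ "\<lambda>_. f"] bounded_linear_imp_has_derivative)
qed

lemma k_times_add:
  "k_times_differentiable_on k U f \<Longrightarrow> k_times_differentiable_on k U g \<Longrightarrow> k_times_differentiable_on k U (\<lambda>p. f p + g p)"
proof (induction k arbitrary: f g)
  case 0 then show ?case by (auto intro!: continuous_intros)
next
  case (Suc k)
  obtain f' where f': "\<forall>p\<in>U. (f has_derivative f' p) (at p)" "\<forall>d. k_times_differentiable_on k U (\<lambda>p. f' p d)" using Suc.prems by auto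
  obtain g' where g': "\<forall>p\<in>U. (g has_derivative g' p) (at p)" "\<forall>d. k_times_differentiable_on k U (\<lambda>p. g' p d)" using Suc.prems by auto
  show ?case unfolding k_times_differentiable_on.simps
  proof (intro exI[of _ "\<lambda>p d. f' p d + g' p d"] conjI ballI allI)
    show "((\<lambda>p. f p + g p) has_derivative (\<lambda>d. f' p d + g' p d)) (at p)" if "p \<in> U" for p
      using f' g' that by (intro has_derivative_add) auto
  qed (use Suc.IH f' g' in auto)
qed

lemma k_times_mult:
  "k_times_differentiable_on k U f \<Longrightarrow> k_times_differentiable_on k U g \<Longrightarrow> k_times_differentiable_on k U (\<lambda>p. f p * g p)"
proof (induction k arbitrary: f g)
  case 0 then show ?case by (auto intro!: continuous_intros)
next
  case (Suc k)
  obtain f' where f': "\<forall>p\<in>U. (f has_derivative f' p) (at p)" "\<forall>d. k_times_differentiable_on k U (\<lambda>p. f' p d)" using Suc.prems by auto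
  obtain g' where g': "\<forall>p\<in>U. (g has_derivative g' p) (at p)" "\<forall>d. k_times_differentiable_on k U (\<lambda>p. g' p d)" using Suc.prems by auto
  have fg: "k_times_differentiable_on k U f" "k_times_differentiable_on k U g" using Suc.prems k_times_Suc_imp by blast+
  show ?case unfolding k_times_differentiable_on.simps
  proof (intro exI[of _ "\<lambda>p d. f p * g' p d + f' p d * g p"] conjI ballI allI)
    show "((\<lambda>p. f p * g p) has_derivative (\<lambda>d. f p * g' p d + f' p d * g p)) (at p)" if "p \<in> U" for p
      using f' g' that by (intro has_derivative_mult) auto
  qed (use Suc.IH f' g' fg in \<open>auto intro!: k_times_add\<close>)
qed

lemma k_times_inverse:
  assumes "\<And>p. p \<in> U \<Longrightarrow> f p \<noteq> 0"
  shows "k_times_differentiable_on k U f \<Longrightarrow> k_times_differentiable_on k U (\<lambda>p. inverse (f p))"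
proof (induction k)
  case 0 then show ?case using assms by (auto intro!: continuous_intros)
next
  case (Suc k)
  obtain f' where f': "\<forall>p\<in>U. (f has_derivative f' p) (at p)" "\<forall>d. k_times_differentiable_on k U (\<lambda>p. f' p d)" using Suc.prems by auto
  have i: "k_times_differentiable_on k U (\<lambda>p. inverse (f p))" using Suc k_times_Suc_imp by blast
  show ?case unfolding k_times_differentiable_on.simps
  proof (intro exI[of _ "\<lambda>p d. (-1) * (inverse (f p) * f' p d * inverse (f p))"] conjI ballI allI)
    show "((\<lambda>p. inverse (f p)) has_derivative (\<lambda>d. (-1) * (inverse (f p) * f' p d * inverse (f p)))) (at p)" if "p \<in> U" for p
      using Deriv.has_derivative_inverse[of f p "f' p" UNIV, OF assms[OF that]] f'(1) that by simp
    show "k_times_differentiable_on k U (\<lambda>p. (-1) * (inverse (f p) * f' p d * inverse (f p)))" for d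
      by (intro k_times_mult k_times_const i f'(2)[rule_format])
  qed
qed

text \<open>The classical flat function, generalized by the power \<open>m\<close>: the derivative
  of a member of the family is a linear combination of two other members, so a single induction over
  all \<open>m\<close> gives smoothness, also at 0.\<close>

definition flat :: "nat \<Rightarrow> real \<Rightarrow> real" where
  "flat m t = (if 0 < t then exp (- (1 / t)) / t ^ m else 0)"

lemma flat_tendsto_0: "(flat m \<longlongrightarrow> 0) (at 0)"
proof -
  have "((\<lambda>y. y ^ m / exp y) \<longlongrightarrow> 0) (at_top :: real filter)" by (rule tendsto_power_div_exp_0)
  then have "((\<lambda>t. (inverse t) ^ m / exp (inverse t)) \<longlongrightarrow> (0::real)) (at_right 0)"
    by (rule filterlim_compose[OF _ filterlim_inverse_at_top_right])
  moreover have "eventually (\<lambda>t. (inverse t) ^ m / exp (inverse t) = flat m t) (at_right 0)"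
    unfolding eventually_at_right_field flat_def
    by (auto intro!: exI[of _ 1] simp: exp_minus field_simps power_inverse)
  ultimately have r: "(flat m \<longlongrightarrow> 0) (at_right 0)" by (rule Lim_transform_eventually)
  have "eventually (\<lambda>t. 0 = flat m t) (at_left 0)" unfolding eventually_at_left_field flat_def by (auto intro!: exI[of _ "-1"])
  then have "(flat m \<longlongrightarrow> 0) (at_left 0)" by (rule Lim_transform_eventually[OF tendsto_const])
  with r show ?thesis by (simp add: filterlim_split_at)
qed

lemma flat_deriv: "DERIV (flat m) t :> flat (m + 2) t - real m * flat (m + 1) t"
proof (cases t "0 :: real" rule: linorder_cases)
  case less
  have "DERIV (\<lambda>_. 0) t :> (0 :: real)" by simp
  then have "DERIV (flat m) t :> 0"
    by (rule has_field_derivative_transform_within_open[of _ _ _ "{..<0}"]) (use less in \<open>auto simp: flat_def\<close>)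
  then show ?thesis using less unfolding flat_def by simp
next
  case equal
  have "((\<lambda>h. (flat m h - flat m 0) / (h - 0)) \<longlongrightarrow> 0) (at 0)"
  proof (rule Lim_transform_eventually[OF flat_tendsto_0[of "m + 1"]])
    show "eventually (\<lambda>h. flat (m + 1) h = (flat m h - flat m 0) / (h - 0)) (at 0)"
      unfolding eventually_at_filter flat_def by (auto intro!: always_eventually)
  qed
  then have "DERIV (flat m) 0 :> 0" by (simp add: has_field_derivative_iff)
  then show ?thesis using equal unfolding flat_def by simp
next
  case greater
  have "DERIV (\<lambda>t. exp (- (1 / t)) / t ^ m) t :> (exp (- (1 / t)) * (1 / t\<^sup>2) * t ^ m - exp (- (1 / t)) * (real m * t ^ (m - 1))) / (t ^ m * t ^ m)"
    using greater by (auto intro!: derivative_eq_intros simp: power2_eq_square)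
  then have "DERIV (flat m) t :> (exp (- (1 / t)) * (1 / t\<^sup>2) * t ^ m - exp (- (1 / t)) * (real m * t ^ (m - 1))) / (t ^ m * t ^ m)"
    by (rule has_field_derivative_transform_within_open[of _ _ _ "{0<..}"]) (use greater in \<open>auto simp: flat_def\<close>)
  moreover have "(exp (- (1 / t)) * (1 / t\<^sup>2) * t ^ m - exp (- (1 / t)) * (real m * t ^ (m - 1))) / (t ^ m * t ^ m)
     = flat (m + 2) t - real m * flat (m + 1) t"
    using greater unfolding flat_def by (cases m) (auto simp: field_simps power2_eq_square)
  ultimately show ?thesis by simp
qed

lemma k_times_flat:
  assumes "\<And>k. k_times_differentiable_on k U q"
  shows "k_times_differentiable_on k U (\<lambda>p. flat m (q p))"
proof (induction k arbitrary: m)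
  case 0
  have "continuous_on UNIV (flat m)" by (intro continuous_at_imp_continuous_on ballI DERIV_isCont[OF flat_deriv])
  then show ?case using assms[of 0] continuous_on_compose2[of UNIV "flat m" U q] by simp
next
  case (Suc k)
  obtain q' where q': "\<forall>p\<in>U. (q has_derivative q' p) (at p)" "\<forall>d. k_times_differentiable_on k U (\<lambda>p. q' p d)" using assms[of "Suc k"] by auto
  show ?case unfolding k_times_differentiable_on.simps
  proof (intro exI[of _ "\<lambda>p d. q' p d * (flat (m + 2) (q p) + (- real m) * flat (m + 1) (q p))"] conjI ballI allI)
    show "((\<lambda>p. flat m (q p)) has_derivative (\<lambda>d. q' p d * (flat (m + 2) (q p) + (- real m) * flat (m + 1) (q p)))) (at p)" if "p \<in> U" for p
      using DERIV_compose_FDERIV[of "flat m" "flat (m + 2) (q p) + (- real m) * flat (m + 1) (q p)" q p "q' p" UNIV]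
        flat_deriv[of m "q p"] q'(1) that by simp
    show "k_times_differentiable_on k U (\<lambda>p. q' p d * (flat (m + 2) (q p) + (- real m) * flat (m + 1) (q p)))" for d
      by (intro k_times_mult k_times_add k_times_const Suc.IH q'(2)[rule_format])
  qed
qed

lemma ex_slowing_function: "\<exists>\<phi>. slowing_function \<phi>"
proof -
  define q1 q2 :: "real \<times> real \<Rightarrow> real" where "q1 p = fst p * fst p + snd p * snd p" and "q2 p = 1/2 + (-1) * q1 p" for p
  \<comment> \<open>The standard smooth quotient. The denominator is positive since
    \<open>q1\<close> and \<open>q2\<close> add up to 1/2; the value is 0 only at the origin and 1
    where the squared norm is at least 1/2.\<close>
  define \<phi> where "\<phi> p = flat 0 (q1 p) * inverse (flat 0 (q1 p) + flat 0 (q2 p))" for p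
  have pos: "0 < flat 0 (q1 p) + flat 0 (q2 p)" "0 \<le> flat 0 (q1 p)" "0 \<le> flat 0 (q2 p)" for p
    unfolding flat_def q2_def by (auto simp: add_pos_nonneg)
  have k1: "k_times_differentiable_on k U q1" for k U
    unfolding q1_def by (intro k_times_add k_times_mult k_times_linear bounded_linear_fst bounded_linear_snd)
  have k2: "k_times_differentiable_on k U q2" for k U
    unfolding q2_def by (intro k_times_add k_times_mult k_times_const k1)
  have "k_times_differentiable_on k U \<phi>" for k U unfolding \<phi>_def
    by (intro k_times_mult k_times_inverse k_times_add k_times_flat k1 k2) (use pos in \<open>force simp: less_le\<close>)
  then have C: "C_infinity_on open_square \<phi>" unfolding C_infinity_on_def by blast
  have r: "0 \<le> \<phi> p" "\<phi> p \<le> 1" for p unfolding \<phi>_def using pos[of p] by (auto simp: divide_simps)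
  have q1z: "q1 p = 0 \<longleftrightarrow> p = (0,0)" for p unfolding q1_def by (cases p) (simp add: sum_squares_eq_zero_iff)
  have q1n: "0 \<le> q1 p" for p unfolding q1_def by simp
  have z: "\<phi> p = 0 \<longleftrightarrow> p = (0,0)" for p
  proof -
    have "\<phi> p = 0 \<longleftrightarrow> flat 0 (q1 p) = 0" unfolding \<phi>_def using pos(1)[of p] by simp
    also have "\<dots> \<longleftrightarrow> q1 p = 0" unfolding flat_def using q1n[of p] by auto
    finally show ?thesis using q1z by simp
  qed
  \<comment> \<open>The bound 9/10 is less than 1, and its square exceeds 1/2.\<close>
  have one: "\<phi> p = 1" if "\<bar>fst p\<bar> > 9/10 \<or> \<bar>snd p\<bar> > 9/10" for p
  proof -
    have sq: "(9/10) * (9/10) \<le> \<bar>z\<bar> * \<bar>z\<bar>" if "\<bar>z\<bar> > 9/10" for z :: real using that by (intro mult_mono) auto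
    have "9/10 * (9/10) \<le> q1 p" using that
    proof
      assume "9/10 < \<bar>fst p\<bar>"
      then show ?thesis using sq[of "fst p"] zero_le_square[of "snd p"] unfolding q1_def abs_mult_self_eq by linarith
    next
      assume "9/10 < \<bar>snd p\<bar>"
      then show ?thesis using sq[of "snd p"] zero_le_square[of "fst p"] unfolding q1_def abs_mult_self_eq by linarith
    qed
    then have "1/2 \<le> q1 p" by simp
    then have "flat 0 (q2 p) = 0" unfolding flat_def q2_def by simp
    then show ?thesis unfolding \<phi>_def using pos(1)[of p] by simp
  qed
  have "(0, 0) \<in> square" unfolding square_def by simp
  then have "slowing_function \<phi>" unfolding slowing_function_def
    using C r z one by (intro conjI exI[of _ "9/10"]) auto
  then show ?thesis by blast
qed

text \<open>Reachability along the field \<open>(\<phi>, 0)\<close>: the origin blocks the axis, is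
  reached only from itself and is left by no curve. That integral curves realize exactly this
  relation is \<open>slowing_arcs\<close>; \<open>\<phi>\<close> no longer occurs in it.\<close>

definition slow_le :: "real \<times> real \<Rightarrow> real \<times> real \<Rightarrow> bool" where
  "slow_le p q \<longleftrightarrow> snd p = snd q \<and> fst p \<le> fst q \<and> (p = q \<or> \<not> (snd p = 0 \<and> fst p \<le> 0 \<and> 0 \<le> fst q))"

lemma horizontal_curve_integral:
  fixes c :: "real \<Rightarrow> real \<times> real"
  assumes c: "\<And>s. s \<in> {0..T} \<Longrightarrow> (c has_vector_derivative (f (c s), 0)) (at s within {0..T})"
    and st: "0 \<le> s" "s \<le> t" "t \<le> T"
  shows "((\<lambda>r. f (c r)) has_integral (fst (c t) - fst (c s))) {s..t}" "snd (c t) = snd (c s)"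
proof -
  have d: "(c has_vector_derivative (f (c r), 0)) (at r within {s..t})" if "r \<in> {s..t}" for r
    by (rule has_vector_derivative_within_subset[OF c]) (use that st in auto)
  have "((\<lambda>r. fst (c r)) has_vector_derivative f (c r)) (at r within {s..t})" if "r \<in> {s..t}" for r
    using bounded_linear.has_vector_derivative[OF bounded_linear_fst d[OF that]] by simp
  then show "((\<lambda>r. f (c r)) has_integral (fst (c t) - fst (c s))) {s..t}"
    by (rule fundamental_theorem_of_calculus[OF st(2)])
  have "((\<lambda>r. snd (c r)) has_vector_derivative 0) (at r within {s..t})" if "r \<in> {s..t}" for r
    using bounded_linear.has_vector_derivative[OF bounded_linear_snd d[OF that]] by simp
  from fundamental_theorem_of_calculus[OF st(2) this]
  have "((\<lambda>r. 0 :: real) has_integral (snd (c t) - snd (c s))) {s..t}" .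
  then show "snd (c t) = snd (c s)" using has_integral_unique[OF _ has_integral_0] by fastforce
qed

lemma arc_curve_trivial:
  "p \<in> R \<Longrightarrow> \<exists>T\<ge>0. \<exists>c. c 0 = p \<and> c T = p \<and>
    (\<forall>s\<in>{0..T::real}. c s \<in> R \<and> (c has_vector_derivative F (c s)) (at s within {0..T}))"
proof (rule exI[of _ 0], intro conjI exI[of _ "\<lambda>_. p"] ballI)
  have "at 0 within {0..0::real} = bot" by (simp add: at_within_eq_bot_iff)
  then show "((\<lambda>_. p) has_vector_derivative F p) (at s within {0..0})" if "s \<in> {0..0}" for s :: real
    using that by (simp add: has_vector_derivative_def has_derivative_def bounded_linear_scaleR_left)
qed auto

lemma unit_arcs:
  assumes H: "H \<in> {UNIV, half_plane}" and p: "p \<in> square \<inter> H" and q: "q \<in> square \<inter> H"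
  shows "(\<exists>T\<ge>0. \<exists>c. c 0 = p \<and> c T = q \<and> (\<forall>s\<in>{0..T}. c s \<in> square \<inter> H \<and>
      (c has_vector_derivative (1, 0)) (at s within {0..T}))) \<longleftrightarrow> snd p = snd q \<and> fst p \<le> fst q" (is "?L \<longleftrightarrow> ?R")
proof
  assume ?L
  then obtain T c where T: "T \<ge> 0" "c 0 = p" "c T = q" "\<forall>s\<in>{0..T}. c s \<in> square \<inter> H \<and>
      (c has_vector_derivative (1, 0)) (at s within {0..T})" by blast
  have "((\<lambda>r. 1 :: real) has_integral (fst (c T) - fst (c 0))) {0..T}" "snd (c T) = snd (c 0)"
    using horizontal_curve_integral[of T c "\<lambda>_. 1" 0 T] T by auto
  then show ?R using has_integral_nonneg[of "\<lambda>_. 1 :: real" "fst (c T) - fst (c 0)" "{0..T}"] T by auto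
next
  assume R: ?R
  show ?L
  proof (intro exI[of _ "fst q - fst p"] conjI exI[of _ "\<lambda>s. (fst p + s, snd p)"] ballI)
    fix s assume "s \<in> {0..fst q - fst p}"
    then show "(fst p + s, snd p) \<in> square \<inter> H" using p q H R unfolding square_def half_plane_def by auto
    show "((\<lambda>s. (fst p + s, snd p)) has_vector_derivative (1, 0)) (at s within {0..fst q - fst p})"
      by (intro has_vector_derivative_Pair) (auto intro!: derivative_eq_intros)
  qed (use R in \<open>auto simp: prod_eq_iff\<close>)
qed

text \<open>A differentiable function that vanishes at the origin is bounded linearly near it. This
  bound is what puts the origin out of reach in finite time.\<close>

lemma slowing_near_zero:
  assumes "slowing_function \<phi>"
  shows "\<exists>L \<rho>. 0 < L \<and> 0 < \<rho> \<and> (\<forall>z. \<bar>z\<bar> < \<rho> \<longrightarrow> 0 \<le> \<phi> (z, 0) \<and> \<phi> (z, 0) \<le> L * \<bar>z\<bar>)"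
proof -
  have 0: "(0, 0) \<in> open_square" unfolding open_square_def by simp
  have sq: "(z, 0) \<in> square" if "\<bar>z\<bar> < 1" for z using that unfolding square_def by auto
  have "k_times_differentiable_on (Suc 0) open_square \<phi>" using assms unfolding slowing_function_def C_infinity_on_def by blast
  then obtain D where D: "(\<phi> has_derivative D (0,0)) (at (0,0))" using 0 by auto
  have \<phi>0: "\<phi> (0,0) = 0" and nn: "\<And>p. p \<in> square \<Longrightarrow> 0 \<le> \<phi> p"
    using assms unfolding slowing_function_def by (blast, auto)
  have bl: "bounded_linear (D (0,0))" using D has_derivative_bounded_linear by blast
  then obtain K where K: "0 < K" "\<And>h. norm (D (0,0) h) \<le> norm h * K" using bounded_linear.pos_bounded by blast
  obtain d where d: "d > 0" "\<And>y. norm (y - (0,0)) < d \<Longrightarrow> norm (\<phi> y - \<phi> (0,0) - D (0,0) (y - (0,0))) \<le> 1 * norm (y - (0,0))"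
    using D unfolding has_derivative_at_alt by (meson zero_less_one)
  show ?thesis
  proof (rule exI[of _ "K + 1"], rule exI[of _ "min d 1"], intro conjI allI impI)
    fix z :: real assume z: "\<bar>z\<bar> < min d 1"
    show "0 \<le> \<phi> (z, 0)" using nn sq z by simp
    have n: "norm ((z, 0) - (0, 0 :: real)) = \<bar>z\<bar>" by (simp add: norm_Pair)
    have "norm (\<phi> (z, 0) - \<phi> (0,0) - D (0,0) ((z, 0) - (0,0))) \<le> \<bar>z\<bar>" using d(2)[of "(z, 0)"] z n by simp
    moreover have "norm (D (0,0) ((z, 0) - (0,0))) \<le> \<bar>z\<bar> * K" using K(2)[of "(z, 0) - (0,0)"] n by simp
    ultimately have "\<phi> (z, 0) \<le> \<bar>z\<bar> + \<bar>z\<bar> * K" unfolding \<phi>0 real_norm_def by linarith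
    then show "\<phi> (z, 0) \<le> (K + 1) * \<bar>z\<bar>" by (simp add: algebra_simps)
  qed (use K d in auto)
qed

text \<open>Gronwall's argument with the integrating factor \<open>exp (L * r)\<close>.\<close>

lemma exp_weighted_monotone:
  fixes a :: "real \<Rightarrow> real"
  assumes st: "s \<le> t" and a: "\<And>r. r \<in> {s..t} \<Longrightarrow> (a has_vector_derivative f r) (at r within {s..t})"
    and le: "\<And>r. r \<in> {s..t} \<Longrightarrow> f r + L * a r \<le> 0"
  shows "exp (L * t) * a t \<le> exp (L * s) * a s"
proof -
  have "((\<lambda>r. exp (L * r) * a r) has_vector_derivative (exp (L * r) * (f r + L * a r))) (at r within {s..t})" if "r \<in> {s..t}" for r
    using a[OF that] unfolding has_real_derivative_iff_has_vector_derivative[symmetric]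
    by (auto intro!: derivative_eq_intros simp: algebra_simps)
  from fundamental_theorem_of_calculus[OF st this]
  have "((\<lambda>r. exp (L * r) * (f r + L * a r)) has_integral (exp (L * t) * a t - exp (L * s) * a s)) {s..t}" .
  then have "exp (L * t) * a t - exp (L * s) * a s \<le> 0"
    by (rule has_integral_le[OF _ has_integral_0]) (use le in \<open>auto intro!: mult_nonneg_nonpos\<close>)
  then show ?thesis by simp
qed

lemma has_vector_derivative_fst:
  "(c has_vector_derivative d) F \<Longrightarrow> ((\<lambda>r. fst (c r)) has_vector_derivative fst d) F"
  using bounded_linear.has_vector_derivative[OF bounded_linear_fst] .

text \<open>On the axis the speed near the origin is at most \<open>L\<close> times the distance
  from it. The distance weighted with an exponential is then monotone in the direction that forbids
  leaving the origin and, with the other sign of \<open>L\<close>, arriving there.\<close>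

lemma slowing_arc_imp:
  assumes \<phi>: "slowing_function \<phi>"
    and c: "c 0 = p" "c T = q" "0 \<le> T" "\<And>s. s \<in> {0..T} \<Longrightarrow> c s \<in> square \<and> (c has_vector_derivative (\<phi> (c s), 0)) (at s within {0..T})"
  shows "slow_le p q"
proof -
  have nn: "\<And>p. p \<in> square \<Longrightarrow> 0 \<le> \<phi> p" using \<phi> unfolding slowing_function_def by auto
  have cd: "(c has_vector_derivative (\<phi> (c s), 0)) (at s within {0..T})" if "s \<in> {0..T}" for s using c(4) that by blast
  have mono: "fst (c s) \<le> fst (c t)" if "0 \<le> s" "s \<le> t" "t \<le> T" for s t
  proof -
    have "((\<lambda>r. \<phi> (c r)) has_integral (fst (c t) - fst (c s))) {s..t}" using horizontal_curve_integral(1)[OF cd that] .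
    then have "0 \<le> fst (c t) - fst (c s)" by (rule has_integral_nonneg) (use nn c(4) that in auto)
    then show ?thesis by simp
  qed
  have sn: "snd (c s) = snd p" if "0 \<le> s" "s \<le> T" for s
    using horizontal_curve_integral(2)[OF cd, of 0 s] that c(1) by simp
  have "p = q" if z: "snd p = 0" "fst p \<le> 0" "0 \<le> fst q"
  proof -
    define a where "a s = fst (c s)" for s
    have cs: "c s = (a s, 0)" if "0 \<le> s" "s \<le> T" for s using sn[OF that] z(1) unfolding a_def by (simp add: prod_eq_iff)
    have ad: "(a has_vector_derivative \<phi> (a r, 0)) (at r within {s..t})" if "0 \<le> s" "t \<le> T" "r \<in> {s..t}" for r s t
    proof -
      have "(c has_vector_derivative (\<phi> (c r), 0)) (at r within {s..t})"
        by (rule has_vector_derivative_within_subset[OF cd]) (use that in auto)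
      then show ?thesis using has_vector_derivative_fst[of c "(\<phi> (c r), 0)"] cs[of r] that unfolding a_def by simp
    qed
    have ac: "continuous_on {s..t} a" if "0 \<le> s" "t \<le> T" for s t
      using ad[OF that] has_vector_derivative_continuous continuous_on_eq_continuous_within by blast
    have am: "a s \<le> a t" if "0 \<le> s" "s \<le> t" "t \<le> T" for s t using mono[OF that] unfolding a_def .
    obtain L \<rho> where L: "0 < L" "0 < \<rho>" "\<forall>z. \<bar>z\<bar> < \<rho> \<longrightarrow> 0 \<le> \<phi> (z, 0) \<and> \<phi> (z, 0) \<le> L * \<bar>z\<bar>" using slowing_near_zero[OF \<phi>] by blast
    have a0: "a 0 \<le> 0" "0 \<le> a T" using z c unfolding a_def by auto
    obtain s0 where s0: "0 \<le> s0" "s0 \<le> T" "a s0 = 0" using IVT'[of a 0 0 T] a0 c(3) ac[of 0 T] by auto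
    have "a T \<le> 0"
    proof (rule ccontr)
      assume "\<not> a T \<le> 0"
      \<comment> \<open>The curve is stopped at distance \<open>\<rho>/2\<close> at the latest,
        within the range of the linear bound.\<close>
      then obtain t1 where t1: "s0 \<le> t1" "t1 \<le> T" "a t1 = min (a T) (\<rho>/2)"
        using IVT'[of a s0 "min (a T) (\<rho>/2)" T] s0 L(2) ac[of s0 T] by auto
      have "exp ((-L) * t1) * a t1 \<le> exp ((-L) * s0) * a s0"
      proof (rule exp_weighted_monotone[OF t1(1) ad[OF s0(1) t1(2)]])
        fix r assume r: "r \<in> {s0..t1}"
        then have "0 \<le> a r" "a r \<le> \<rho>/2" using am[of s0 r] am[of r t1] s0 t1 by auto
        then show "\<phi> (a r, 0) + - L * a r \<le> 0" using L(2) L(3)[rule_format, of "a r"] by simp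
      qed
      then have "a t1 \<le> 0" using s0(3) by (simp add: mult_le_0_iff)
      then show False using t1(3) \<open>\<not> a T \<le> 0\<close> L(2) by simp
    qed
    moreover have "0 \<le> a 0"
    proof (rule ccontr)
      assume "\<not> 0 \<le> a 0"
      then obtain t1 where t1: "0 \<le> t1" "t1 \<le> s0" "a t1 = max (a 0) (- \<rho>/2)"
        using IVT'[of a 0 "max (a 0) (- \<rho>/2)" s0] s0 L(2) ac[of 0 s0] by auto
      have "exp (L * s0) * a s0 \<le> exp (L * t1) * a t1"
      proof (rule exp_weighted_monotone[OF t1(2) ad[OF t1(1) s0(2)]])
        fix r assume r: "r \<in> {t1..s0}"
        then have "a r \<le> 0" "- \<rho>/2 \<le> a r" using am[of r s0] am[of t1 r] s0 t1 by auto
        then show "\<phi> (a r, 0) + L * a r \<le> 0" using L(2) L(3)[rule_format, of "a r"] by simp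
      qed
      then have "0 \<le> a t1" using s0(3) by (simp add: zero_le_mult_iff)
      then show False using t1(3) \<open>\<not> 0 \<le> a 0\<close> L(2) by simp
    qed
    ultimately have "a 0 = 0" "a T = 0" using a0 by auto
    then show "p = q" using cs[of 0] cs[of T] c by simp
  qed
  then show ?thesis unfolding slow_le_def using mono[of 0 T] sn[of T] c by auto
qed

lemma slowing_continuous:
  assumes \<phi>: "slowing_function \<phi>" shows "continuous_on square \<phi>"
proof -
  obtain r where r: "r < 1" "\<And>p. p \<in> square \<Longrightarrow> \<bar>fst p\<bar> > r \<or> \<bar>snd p\<bar> > r \<Longrightarrow> \<phi> p = 1"
    using \<phi> unfolding slowing_function_def by blast
  define A where "A = square \<inter> {p. \<bar>fst p\<bar> > r \<or> \<bar>snd p\<bar> > r}"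
  have op: "open open_square" unfolding open_square_def by (intro open_Times) auto
  have os: "open_square \<subseteq> square" unfolding open_square_def square_def by auto
  have sq: "square = open_square \<union> A" unfolding A_def open_square_def square_def using r(1) by auto
  have "k_times_differentiable_on 0 open_square \<phi>" using \<phi> unfolding slowing_function_def C_infinity_on_def by blast
  then have c1: "continuous_on open_square \<phi>" by simp
  have c2: "continuous_on A \<phi>" using continuous_on_const[of A 1] by (rule continuous_on_eq) (use r(2) in \<open>auto simp: A_def\<close>)
  have o1: "openin (top_of_set square) open_square" by (rule open_subset[OF os op])
  have o2: "openin (top_of_set square) A" unfolding A_def
    by (intro openin_open_Int open_Collect_disj open_Collect_less continuous_intros)
  show ?thesis using continuous_on_Un_local_open[of open_square A \<phi>] o1 o2 c1 c2 sq by simp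
qed

text \<open>Separation of variables: the solution is the inverse of an antiderivative
  \<open>K\<close> of the reciprocal of \<open>f\<close>.\<close>

lemma ex_autonomous_solution:
  fixes f :: "real \<Rightarrow> real"
  assumes ab: "a \<le> b" and f: "continuous_on {a..b} f" "\<And>z. z \<in> {a..b} \<Longrightarrow> 0 < f z"
  shows "\<exists>T\<ge>0. \<exists>k. k 0 = a \<and> k T = b \<and> (\<forall>s\<in>{0..T}. k s \<in> {a..b} \<and> (k has_vector_derivative f (k s)) (at s))"
proof -
  \<comment> \<open>Extending \<open>f\<close> by constants beyond the interval makes the derivative
    of the solution two-sided at both ends.\<close>
  define F where "F z = f (max a (min b z))" for z
  have cl: "max a (min b z) \<in> {a..b}" for z using ab by auto
  have Fp: "0 < F z" for z unfolding F_def using f(2)[OF cl] .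
  have "continuous_on {a-1..b+1} (\<lambda>z. f (max a (min b z)))"
    by (rule continuous_on_compose2[OF f(1)]) (use cl in \<open>auto intro!: continuous_intros\<close>)
  then have "continuous_on {a-1..b+1} F" unfolding F_def .
  then have "continuous_on {a-1..b+1} (\<lambda>z. inverse (F z))" using Fp by (intro continuous_intros) (auto simp: less_imp_neq[THEN not_sym])
  then obtain K where K: "\<And>z. z \<in> {a-1..b+1} \<Longrightarrow> (K has_vector_derivative inverse (F z)) (at z within {a-1..b+1})"
    using antiderivative_continuous by blast
  have Kc: "continuous_on {a-1..b+1} K" using K has_vector_derivative_continuous continuous_on_eq_continuous_within by blast
  have Kd: "DERIV K z :> inverse (F z)" if "a - 1 < z" "z < b + 1" for z
    using K[of z] that by (simp add: has_real_derivative_iff_has_vector_derivative at_within_Icc_at)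
  have Km: "K z < K w" if zw: "a - 1 \<le> z" "z < w" "w \<le> b + 1" for z w
  proof (rule DERIV_pos_imp_increasing_open[OF zw(2)])
    show "\<exists>y. DERIV K u :> y \<and> 0 < y" if "z < u" "u < w" for u
      using Kd[of u] that zw Fp[of u] by (intro exI[of _ "inverse (F u)"]) auto
    show "continuous_on {z..w} K" by (rule continuous_on_subset[OF Kc]) (use zw in auto)
  qed
  have Ki: "inj_on K {a-1..b+1}"
  proof (rule inj_onI)
    fix z w assume "z \<in> {a-1..b+1}" "w \<in> {a-1..b+1}" "K z = K w"
    then show "z = w" using Km[of z w] Km[of w z] by (cases z w rule: linorder_cases) auto
  qed
  define g where "g = inv_into {a-1..b+1} K"
  have gK: "g (K z) = z" if "z \<in> {a-1..b+1}" for z unfolding g_def using inv_into_f_f[OF Ki that] .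
  have im: "y \<in> K ` {a-1..b+1}" if "K (a-1) \<le> y" "y \<le> K (b+1)" for y
    using IVT'[of K "a-1" y "b+1"] that ab Kc by auto
  have Kg: "K (g y) = y" if "K (a-1) \<le> y" "y \<le> K (b+1)" for y
    unfolding g_def using f_inv_into_f[OF im[OF that]] .
  have "continuous_on (K ` {a-1..b+1}) g" by (rule continuous_on_inv[OF Kc compact_Icc]) (use gK in blast)
  then have gc: "continuous_on {K (a-1)<..<K (b+1)} g"
    by (rule continuous_on_subset) (use im in auto)
  have gd: "DERIV g y :> F (g y)" if y: "K a \<le> y" "y \<le> K b" for y
  proof -
    have y': "K (a-1) < y" "y < K (b+1)" using y Km[of "a-1" a] Km[of b "b+1"] ab by auto
    have cg: "isCont g y" using gc y' continuous_on_eq_continuous_at[of "{K (a-1)<..<K (b+1)}" g] by auto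
    have gy: "g y \<in> {a-1..b+1}" "K (g y) = y" using inv_into_into[OF im[of y]] Kg[of y] y' unfolding g_def by auto
    have "g y \<noteq> a - 1" "g y \<noteq> b + 1" using gy(2) y' by auto
    then have "a - 1 < g y" "g y < b + 1" using gy(1) by auto
    then have "DERIV g y :> inverse (inverse (F (g y)))"
      by (intro DERIV_inverse_function[OF Kd _ y' _ cg]) (use Fp[of "g y"] Kg in auto)
    then show ?thesis by simp
  qed
  show ?thesis
  proof (intro exI[of _ "K b - K a"] conjI exI[of _ "\<lambda>s. g (s + K a)"] ballI)
    show "0 \<le> K b - K a" using Km[of a b] ab by (cases "a = b") auto
    show "g (0 + K a) = a" "g (K b - K a + K a) = b" using gK[of a] gK[of b] ab by auto
    fix s assume s: "s \<in> {0..K b - K a}"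
    have gs: "g (s + K a) \<in> {a-1..b+1}" "K (g (s + K a)) = s + K a"
    proof -
      have "K (a-1) \<le> s + K a" "s + K a \<le> K (b+1)" using s Km[of "a-1" a] Km[of b "b+1"] ab by auto
      then show "g (s + K a) \<in> {a-1..b+1}" "K (g (s + K a)) = s + K a" using inv_into_into[OF im] Kg unfolding g_def by auto
    qed
    show ab': "g (s + K a) \<in> {a..b}"
    proof (rule ccontr)
      assume "g (s + K a) \<notin> {a..b}"
      then consider "g (s + K a) < a" | "b < g (s + K a)" by fastforce
      then show False
      proof cases
        case 1 then show False using Km[of "g (s + K a)" a] gs s ab by auto
      next
        case 2 then show False using Km[of b "g (s + K a)"] gs s ab by auto
      qed
    qed
    have "DERIV (\<lambda>s. g (s + K a)) s :> F (g (s + K a))" using gd[of "s + K a"] s DERIV_shift[of g _ s "K a"] by auto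
    moreover have "F (g (s + K a)) = f (g (s + K a))" unfolding F_def using ab' by (simp add: min_absorb2 max_absorb2)
    ultimately show "((\<lambda>s. g (s + K a)) has_vector_derivative f (g (s + K a))) (at s)"
      by (simp add: has_real_derivative_iff_has_vector_derivative)
  qed
qed

lemma slowing_arcs:
  assumes \<phi>: "slowing_function \<phi>" and H: "H \<in> {UNIV, half_plane}" and p: "p \<in> square \<inter> H" and q: "q \<in> square \<inter> H"
  shows "(\<exists>T\<ge>0. \<exists>c. c 0 = p \<and> c T = q \<and> (\<forall>s\<in>{0..T}. c s \<in> square \<inter> H \<and>
      (c has_vector_derivative (\<phi> (c s), 0)) (at s within {0..T}))) \<longleftrightarrow> slow_le p q" (is "?L \<longleftrightarrow> ?R")
proof
  assume ?L
  then show ?R using slowing_arc_imp[OF \<phi>] by blast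
next
  assume R: ?R
  show ?L
  proof (cases "p = q")
    case True
    show ?thesis unfolding True[symmetric] by (rule arc_curve_trivial[OF p])
  next
    case False
    define u where "u = snd p"
    have pq: "p = (fst p, u)" "q = (fst q, u)" "fst p \<le> fst q" using R unfolding slow_le_def u_def by (auto simp: prod_eq_iff)
    have in_sq: "(z, u) \<in> square \<inter> H" if "z \<in> {fst p..fst q}" for z
      using p q that H unfolding u_def square_def half_plane_def by auto
    have ne: "(z, u) \<noteq> (0, 0)" if "z \<in> {fst p..fst q}" for z
      using R False that unfolding slow_le_def u_def by auto
    have pos: "0 < \<phi> (z, u)" if z: "z \<in> {fst p..fst q}" for z
    proof -
      have "0 \<le> \<phi> (z, u)" "\<phi> (z, u) \<noteq> 0" using \<phi> in_sq[OF z] ne[OF z] unfolding slowing_function_def by auto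
      then show ?thesis by simp
    qed
    have "continuous_on {fst p..fst q} (\<lambda>z. \<phi> (z, u))"
      by (rule continuous_on_compose2[OF slowing_continuous[OF \<phi>]]) (use in_sq in \<open>auto intro!: continuous_intros\<close>)
    then obtain T k where T: "0 \<le> T" and k: "k 0 = fst p" "k T = fst q"
      "\<forall>s\<in>{0..T}. k s \<in> {fst p..fst q} \<and> (k has_vector_derivative \<phi> (k s, u)) (at s)"
      using ex_autonomous_solution[OF pq(3), of "\<lambda>z. \<phi> (z, u)"] pos by blast
    show ?thesis
    proof (intro exI[of _ T] conjI exI[of _ "\<lambda>s. (k s, u)"] ballI T)
      show "(k 0, u) = p" "(k T, u) = q" using k pq by auto
      fix s assume s: "s \<in> {0..T}"
      show "(k s, u) \<in> square \<inter> H" using k(3) s in_sq by blast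
      have "(k has_vector_derivative \<phi> (k s, u)) (at s within {0..T})" using k(3) s has_vector_derivative_at_within by blast
      then show "((\<lambda>s. (k s, u)) has_vector_derivative (\<phi> (k s, u), 0)) (at s within {0..T})"
        by (intro has_vector_derivative_Pair) auto
    qed
  qed
qed

section \<open>Slowing down a flow\<close>

text \<open>The maximal time interval around 0 on which the orbit of \<open>p\<close> has not met
  \<open>x\<close>, in either direction. It is the domain of that orbit when \<open>x\<close> is
  removed from the space.\<close>

definition avoiding_times :: "(real \<Rightarrow> 'a \<Rightarrow> 'a) \<Rightarrow> 'a \<Rightarrow> 'a \<Rightarrow> real set" where
  "avoiding_times v x p = {s. \<forall>r\<in>{min 0 s..max 0 s}. v r p \<noteq> x}"

lemma avoiding_times_interval:
  "s \<in> avoiding_times v x p \<Longrightarrow> s' \<in> avoiding_times v x p \<Longrightarrow> s \<le> r \<Longrightarrow> r \<le> s' \<Longrightarrow>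
    v r p \<noteq> x \<and> r \<in> avoiding_times v x p"
proof -
  assume s: "s \<in> avoiding_times v x p" "s' \<in> avoiding_times v x p" and r: "s \<le> r" "r \<le> s'"
  have a: "v a p \<noteq> x" if "a \<in> {min 0 r..max 0 r}" for a
  proof (cases "0 \<le> r")
    case True
    then have "a \<in> {min 0 s'..max 0 s'}" using that r by auto
    then show ?thesis using s(2) unfolding avoiding_times_def by blast
  next
    case False
    then have "a \<in> {min 0 s..max 0 s}" using that r by auto
    then show ?thesis using s(1) unfolding avoiding_times_def by blast
  qed
  have "r \<in> {min 0 r..max 0 r}" by auto
  then show ?thesis using a unfolding avoiding_times_def by blast
qed

text \<open>The function \<open>k\<close> is the reciprocal of the factor by which the flow is slowed down.\<close>

locale punctured_speed =
  fixes X :: "'a topology" and v :: "real \<Rightarrow> 'a \<Rightarrow> 'a" and x :: 'a and k :: "'a \<Rightarrow> real"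
  assumes flow: "flow_on X v" and haus: "Hausdorff_space X" and x_in: "x \<in> topspace X"
    and k_cont: "continuous_map (subtopology X (topspace X - {x})) euclideanreal k"
    and k_ge: "\<And>p. p \<in> topspace X \<Longrightarrow> p \<noteq> x \<Longrightarrow> 1 \<le> k p"
begin

abbreviation before :: "'a \<Rightarrow> real set" where
  "before \<equiv> avoiding_times v x"

text \<open>The time needed by the slowed flow for the orbit arc from \<open>p\<close> to \<open>v s p\<close>; one of the two integrals is zero.\<close>

definition time_to :: "real \<Rightarrow> 'a \<Rightarrow> real" where
  "time_to s p = integral {0..s} (\<lambda>r. k (v r p)) - integral {s..0} (\<lambda>r. k (v r p))"

lemma v_in: "p \<in> topspace X \<Longrightarrow> v t p \<in> topspace X"
  and v_0: "p \<in> topspace X \<Longrightarrow> v 0 p = p"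
  and v_add: "p \<in> topspace X \<Longrightarrow> v (s + t) p = v s (v t p)"
  using flow_continuous[OF flow] by auto

lemma before_zero: "p \<in> topspace X \<Longrightarrow> p \<noteq> x \<Longrightarrow> 0 \<in> before p"
  unfolding avoiding_times_def using v_0 by simp

lemma before_interval: "s \<in> before p \<Longrightarrow> s' \<in> before p \<Longrightarrow> s \<le> r \<Longrightarrow> r \<le> s' \<Longrightarrow> v r p \<noteq> x \<and> r \<in> before p"
  by (rule avoiding_times_interval)

lemma before_shift:
  assumes p: "p \<in> topspace X" and s: "s \<in> before p" and s': "s' \<in> before (v s p)"
  shows "s + s' \<in> before p"
  unfolding avoiding_times_def
proof (intro CollectI ballI)
  fix r assume r: "r \<in> {min 0 (s + s')..max 0 (s + s')}"
  have eq: "v r p = v (r - s) (v s p)" using v_add[OF p, of "r - s" s] by simp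
  show "v r p \<noteq> x"
  proof (cases "r \<in> {min 0 s..max 0 s}")
    case True then show ?thesis using s unfolding avoiding_times_def by blast
  next
    case False
    then have "r - s \<in> {min 0 s'..max 0 s'}" using r by (auto simp: min_def max_def split: if_splits)
    then show ?thesis unfolding eq using s' unfolding avoiding_times_def by blast
  qed
qed

lemma k_orbit_cont:
  assumes p: "p \<in> topspace X" and s: "\<And>r. r \<in> A \<Longrightarrow> v r p \<noteq> x"
  shows "continuous_on A (\<lambda>r. k (v r p))"
proof -
  have "continuous_map (top_of_set A) X (\<lambda>r. v r p)"
    using flow_continuous_compose[OF flow, of "top_of_set A" "\<lambda>r. r" "\<lambda>_. p"] p by simp
  then have "continuous_map (top_of_set A) (subtopology X (topspace X - {x})) (\<lambda>r. v r p)"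
    using s v_in[OF p] by (auto simp: continuous_map_in_subtopology)
  from continuous_map_compose[OF this k_cont] show ?thesis by (simp add: o_def)
qed

lemma k_integrable:
  assumes "p \<in> topspace X" "s \<in> before p" "s' \<in> before p"
  shows "(\<lambda>r. k (v r p)) integrable_on {s..s'}"
  by (rule integrable_continuous_interval[OF k_orbit_cont[OF assms(1)]]) (use before_interval[OF assms(2,3)] in auto)

lemma time_to_diff:
  assumes p: "p \<in> topspace X" and s: "s \<in> before p" "s' \<in> before p" "s \<le> s'"
  shows "time_to s' p - time_to s p = integral {s..s'} (\<lambda>r. k (v r p))"
proof -
  let ?f = "\<lambda>r. k (v r p)"
  have "v 0 p \<noteq> x" using s(1) unfolding avoiding_times_def by force
  then have 0: "0 \<in> before p" unfolding avoiding_times_def by simp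
  note i = k_integrable[OF p]
  have emp: "integral {a..b} ?f = 0" if "b \<le> a" for a b
    using that by (cases "a = b") auto
  consider "0 \<le> s" | "s \<le> 0" "0 \<le> s'" | "s' \<le> 0" using s(3) by linarith
  then show ?thesis
  proof cases
    case 1
    have "integral {0..s} ?f + integral {s..s'} ?f = integral {0..s'} ?f"
      by (rule Henstock_Kurzweil_Integration.integral_combine[OF 1 s(3) i[OF 0 s(2)]])
    then show ?thesis unfolding time_to_def using emp[of 0 s] emp[of 0 s'] 1 s(3) by simp
  next
    case 2
    have "integral {s..0} ?f + integral {0..s'} ?f = integral {s..s'} ?f"
      by (rule Henstock_Kurzweil_Integration.integral_combine[OF 2 i[OF s(1,2)]])
    then show ?thesis unfolding time_to_def using emp[of s 0] emp[of 0 s'] 2 by simp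
  next
    case 3
    have "integral {s..s'} ?f + integral {s'..0} ?f = integral {s..0} ?f"
      by (rule Henstock_Kurzweil_Integration.integral_combine[OF s(3) 3 i[OF s(1) 0]])
    then show ?thesis unfolding time_to_def using emp[of s 0] emp[of s' 0] 3 s(3) by simp
  qed
qed

lemma time_to_lower:
  assumes p: "p \<in> topspace X" and s: "s \<in> before p" "s' \<in> before p" "s \<le> s'"
    and c: "\<And>r. s \<le> r \<Longrightarrow> r \<le> s' \<Longrightarrow> c \<le> k (v r p)"
  shows "c * (s' - s) \<le> time_to s' p - time_to s p"
proof -
  have "((\<lambda>r. c) has_integral (s' - s) *\<^sub>R c) {s..s'}" using has_integral_const_real[of c s s'] s(3) by simp
  moreover have "((\<lambda>r. k (v r p)) has_integral (integral {s..s'} (\<lambda>r. k (v r p)))) {s..s'}"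
    using k_integrable[OF p s(1,2)] by (rule integrable_integral)
  ultimately have "(s' - s) *\<^sub>R c \<le> integral {s..s'} (\<lambda>r. k (v r p))"
    by (rule has_integral_le) (use c in auto)
  then show ?thesis unfolding time_to_diff[OF p s] by (simp add: mult.commute)
qed

lemma time_to_ge:
  assumes p: "p \<in> topspace X" and s: "s \<in> before p" "s' \<in> before p" "s \<le> s'"
  shows "s' - s \<le> time_to s' p - time_to s p"
  using time_to_lower[OF p s, of 1] k_ge[OF v_in[OF p]] before_interval[OF s(1,2)] by simp

lemma time_to_mono:
  assumes p: "p \<in> topspace X" and s: "s \<in> before p" "s' \<in> before p"
  shows "time_to s p < time_to s' p \<longleftrightarrow> s < s'" "time_to s p = time_to s' p \<longleftrightarrow> s = s'"
  using time_to_ge[OF p s] time_to_ge[OF p s(2,1)] by (cases s s' rule: linorder_cases; force)+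

lemma time_to_0: "time_to 0 p = 0" unfolding time_to_def by simp

text \<open>The cocycle identity that becomes the group law of the slowed flow.\<close>

lemma time_to_add:
  assumes p: "p \<in> topspace X" and s: "s \<in> before p" and s': "s' \<in> before (v s p)"
  shows "time_to (s + s') p = time_to s p + time_to s' (v s p)"
proof -
  let ?q = "v s p"
  have q: "?q \<in> topspace X" using v_in p by blast
  have b: "s + s' \<in> before p" using before_shift[OF p s s'] .
  have "v 0 ?q \<noteq> x" using s' unfolding avoiding_times_def by force
  then have 0: "0 \<in> before ?q" unfolding avoiding_times_def by simp
  have sh: "integral {a + s..b + s} (\<lambda>r. k (v r p)) = integral {a..b} (\<lambda>r. k (v r ?q))" for a b
    using integral_shift_real_ivl[of "a + s" s "b + s" "\<lambda>r. k (v r p)"] v_add[OF p] by simp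
  show ?thesis
  proof (cases "0 \<le> s'")
    case True
    have "time_to (s + s') p - time_to s p = integral {s..s + s'} (\<lambda>r. k (v r p))"
      using time_to_diff[OF p s b] True by simp
    also have "\<dots> = integral {0..s'} (\<lambda>r. k (v r ?q))" using sh[of 0 s'] by (simp add: add.commute)
    also have "\<dots> = time_to s' ?q" using time_to_diff[OF q 0 s' True] time_to_0 by simp
    finally show ?thesis by simp
  next
    case False
    have "time_to s p - time_to (s + s') p = integral {s + s'..s} (\<lambda>r. k (v r p))"
      using time_to_diff[OF p b s] False by simp
    also have "\<dots> = integral {s'..0} (\<lambda>r. k (v r ?q))" using sh[of s' 0] by (simp add: add.commute)
    also have "\<dots> = - time_to s' ?q" using time_to_diff[OF q s' 0] False time_to_0 by simp
    finally show ?thesis by simp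
  qed
qed

lemma time_to_cont:
  assumes p: "p \<in> topspace X" and s: "s \<in> before p" "s' \<in> before p"
  shows "continuous_on {s..s'} (\<lambda>t. time_to t p)"
proof (cases "s \<le> s'")
  case True
  have "continuous_on {s..s'} (\<lambda>t. time_to s p + integral {s..t} (\<lambda>r. k (v r p)))"
    by (intro continuous_intros indefinite_integral_continuous_1 k_integrable[OF p s])
  then show ?thesis
    by (rule continuous_on_eq) (use time_to_diff[OF p s(1)] before_interval[OF s] in fastforce)
qed simp

text \<open>Compactness of the time interval is used twice: the tube lemma keeps neighbouring arcs
  away from \<open>x\<close>, and a finite subcover makes the closeness of \<open>k\<close> uniform
  along the arc. The margins \<open>a'\<close> and \<open>b'\<close> leave room for slightly
  different times.\<close>

lemma near_orbit_arc:
  assumes p: "p \<in> topspace X" and ab: "a \<le> b" and nx: "\<And>r. r \<in> {a..b} \<Longrightarrow> v r p \<noteq> x" and e: "0 < e"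
  shows "\<exists>N a' b'. openin X N \<and> p \<in> N \<and> a' < a \<and> b < b' \<and>
    (\<forall>q\<in>N. (\<forall>r. a' \<le> r \<longrightarrow> r \<le> b' \<longrightarrow> v r q \<noteq> x) \<and> (\<forall>r\<in>{a..b}. \<bar>k (v r q) - k (v r p)\<bar> < e))"
proof -
  let ?P = "prod_topology euclideanreal X"
  have "openin X (topspace X - {x})"
    using haus x_in by (simp add: openin_diff closedin_Hausdorff_singleton Hausdorff_imp_t1_space closedin_t1_singleton)
  from openin_continuous_map_preimage[OF flow_continuous(1)[OF flow] this]
  have W1: "openin ?P {z \<in> topspace ?P. (\<lambda>(t, p). v t p) z \<in> topspace X - {x}}" (is "openin _ ?W1") .
  have cW: "continuous_map (subtopology ?P ?W1) (subtopology X (topspace X - {x})) (\<lambda>(t, p). v t p)"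
    using flow_continuous(1)[OF flow] by (auto simp: continuous_map_in_subtopology intro: continuous_map_from_subtopology)
  have kW: "continuous_map (subtopology ?P ?W1) euclideanreal (\<lambda>z. k ((\<lambda>(t, p). v t p) z))"
    using continuous_map_compose[OF cW k_cont] by (simp add: o_def)
  obtain U0 V0 where UV0: "openin euclideanreal U0" "openin X V0" "{a..b} \<subseteq> U0" "p \<in> V0" "U0 \<times> V0 \<subseteq> ?W1"
    using tube_lemma_left[OF W1, of "{a..b}" p] p nx v_in[OF p] by (force simp: compactin_euclidean_iff)
  have loc: "\<exists>N d. openin X N \<and> p \<in> N \<and> 0 < d \<and> (\<forall>q\<in>N. \<forall>r. \<bar>r - s\<bar> < d \<longrightarrow> \<bar>k (v r q) - k (v s p)\<bar> < e/2)"
    if s: "s \<in> {a..b}" for s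
  proof -
    have "openin (subtopology ?P ?W1) {z \<in> topspace (subtopology ?P ?W1). k ((\<lambda>(t, p). v t p) z) \<in> ball (k (v s p)) (e/2)}"
      by (rule openin_continuous_map_preimage[OF kW]) simp
    then have op: "openin ?P {z \<in> topspace (subtopology ?P ?W1). k ((\<lambda>(t, p). v t p) z) \<in> ball (k (v s p)) (e/2)}"
      by (rule openin_trans_full[OF _ W1])
    have "(s, p) \<in> {z \<in> topspace (subtopology ?P ?W1). k ((\<lambda>(t, p). v t p) z) \<in> ball (k (v s p)) (e/2)}"
      using p nx[OF s] v_in[OF p] e by simp
    from openin_prod_topology_alt[THEN iffD1, rule_format, OF op this]
    obtain A N where A: "openin euclideanreal A" "openin X N" "s \<in> A" "p \<in> N"
      "A \<times> N \<subseteq> {z \<in> topspace (subtopology ?P ?W1). k ((\<lambda>(t, p). v t p) z) \<in> ball (k (v s p)) (e/2)}"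
      by (elim exE conjE) (rule that)
    have "open A" using A(1) by simp
    then obtain d where d: "d > 0" "ball s d \<subseteq> A" using A(3) open_contains_ball_eq by blast
    have "\<bar>k (v r q) - k (v s p)\<bar> < e/2" if "q \<in> N" "\<bar>r - s\<bar> < d" for q r
    proof -
      have "r \<in> ball s d" using that(2) by (simp add: dist_real_def abs_minus_commute)
      then have "(r, q) \<in> A \<times> N" using d(2) that(1) by blast
      then have "k (v r q) \<in> ball (k (v s p)) (e/2)" using A(5) by fastforce
      then show ?thesis by (simp add: dist_real_def abs_minus_commute)
    qed
    then show ?thesis using A(2,4) d(1) by blast
  qed
  have "\<forall>s\<in>{a..b}. \<exists>N d. openin X N \<and> p \<in> N \<and> 0 < d \<and> (\<forall>q\<in>N. \<forall>r. \<bar>r - s\<bar> < d \<longrightarrow> \<bar>k (v r q) - k (v s p)\<bar> < e/2)"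
    using loc by blast
  then obtain N d where Nd: "\<forall>s\<in>{a..b}. openin X (N s) \<and> p \<in> N s \<and> 0 < d s \<and> (\<forall>q\<in>N s. \<forall>r. \<bar>r - s\<bar> < d s \<longrightarrow> \<bar>k (v r q) - k (v s p)\<bar> < e/2)"
    by metis
  have "{a..b} \<subseteq> \<Union> ((\<lambda>s. ball s (d s)) ` {a..b})" using Nd by force
  then obtain F where F: "F \<subseteq> {a..b}" "finite F" "{a..b} \<subseteq> \<Union> ((\<lambda>s. ball s (d s)) ` F)"
    using compactE_image[of "{a..b}" "{a..b}" "\<lambda>s. ball s (d s)"] by (metis compact_Icc open_ball)
  have "F \<noteq> {}" using F(3) ab by auto
  define M where "M = V0 \<inter> \<Inter> (N ` F)"
  have M: "openin X M" "p \<in> M" unfolding M_def using UV0 F \<open>F \<noteq> {}\<close> Nd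
    by (auto intro!: openin_Int openin_Inter)
  have est: "\<bar>k (v r q) - k (v r p)\<bar> < e" if q: "q \<in> M" and r: "r \<in> {a..b}" for q r
  proof -
    obtain s where s: "s \<in> F" "r \<in> ball s (d s)" using F(3) r by blast
    have rs: "\<bar>r - s\<bar> < d s" using s(2) by (simp add: dist_real_def abs_minus_commute)
    have "\<bar>k (v r q) - k (v s p)\<bar> < e/2" "\<bar>k (v r p) - k (v s p)\<bar> < e/2"
      using Nd F(1) s(1) rs q M(2) unfolding M_def by blast+
    then show ?thesis by linarith
  qed
  have "open U0" using UV0(1) by simp
  then obtain da db where dab: "da > 0" "ball a da \<subseteq> U0" "db > 0" "ball b db \<subseteq> U0"
    using UV0(3) ab open_contains_ball_eq by (metis atLeastAtMost_iff order_refl subsetD)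
  have "v r q \<noteq> x" if "q \<in> M" "a - da/2 \<le> r" "r \<le> b + db/2" for q r
  proof -
    have "r \<in> ball a da \<or> r \<in> {a..b} \<or> r \<in> ball b db" using that dab by (auto simp: dist_real_def)
    then have "(r, q) \<in> U0 \<times> V0" using dab UV0(3) that(1) unfolding M_def by blast
    then have "(r, q) \<in> ?W1" using UV0(5) by blast
    then show ?thesis by simp
  qed
  then show ?thesis using M est dab by (intro exI[of _ M] exI[of _ "a - da/2"] exI[of _ "b + db/2"]) auto
qed

lemma time_to_near:
  assumes p: "p \<in> topspace X" and s: "s \<in> before p" and e: "0 < e"
  shows "\<exists>N d. openin X N \<and> p \<in> N \<and> 0 < d \<and> (\<forall>q\<in>N. q \<in> topspace X \<and> q \<noteq> x \<and>
    (\<forall>s'. \<bar>s' - s\<bar> \<le> d \<longrightarrow> s' \<in> before q) \<and> \<bar>time_to s q - time_to s p\<bar> < e)"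
proof -
  let ?a = "min 0 s" and ?b = "max 0 s"
  have ab: "?a \<le> ?b" by simp
  have nx: "\<And>r. r \<in> {?a..?b} \<Longrightarrow> v r p \<noteq> x" using s unfolding avoiding_times_def by blast
  have e': "0 < e / (\<bar>s\<bar> + 1)" using e by simp
  obtain N a' b' where N: "openin X N" "p \<in> N" "a' < ?a" "?b < b'"
    "\<And>q r. q \<in> N \<Longrightarrow> a' \<le> r \<Longrightarrow> r \<le> b' \<Longrightarrow> v r q \<noteq> x" "\<And>q r. q \<in> N \<Longrightarrow> r \<in> {?a..?b} \<Longrightarrow> \<bar>k (v r q) - k (v r p)\<bar> < e / (\<bar>s\<bar> + 1)"
    using near_orbit_arc[OF p ab nx e'] by metis
  define d where "d = min (s - a') (b' - s)"
  have a'b': "a' < 0" "0 < b'" "a' < s" "s < b'" using N(3,4) by auto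
  have Nt: "q \<in> topspace X" if "q \<in> N" for q using that N(1) openin_subset by blast
  have bq: "s' \<in> before q" if "q \<in> N" "\<bar>s' - s\<bar> \<le> d" for q s'
    unfolding avoiding_times_def
  proof (intro CollectI ballI)
    fix r assume "r \<in> {min 0 s'..max 0 s'}"
    then have "a' \<le> r" "r \<le> b'" using that(2) a'b' unfolding d_def by (auto simp: abs_le_iff)
    then show "v r q \<noteq> x" using N(5) that(1) by blast
  qed
  have close: "\<bar>time_to s q - time_to s p\<bar> < e" if q: "q \<in> N" for q
  proof -
    have iab: "{?a..?b} \<subseteq> before q" "{?a..?b} \<subseteq> before p"
    proof -
      have "0 \<in> before z" "s \<in> before z" if z: "z \<in> N" for z
        using N(5)[OF z] a'b' unfolding avoiding_times_def by (auto simp: min_def max_def split: if_splits)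
      then have "?a \<in> before z" "?b \<in> before z" if "z \<in> N" for z using that by (auto simp: min_def max_def)
      then show "{?a..?b} \<subseteq> before q" "{?a..?b} \<subseteq> before p" using before_interval q N(2) by (meson atLeastAtMost_iff subsetI)+
    qed
    have i: "(\<lambda>r. k (v r z)) integrable_on {?a..?b}" if "z \<in> {p, q}" for z
    proof -
      have "?a \<in> {?a..?b}" "?b \<in> {?a..?b}" using ab by (simp_all del: min.bounded_iff max.bounded_iff)
      then have "?a \<in> before z" "?b \<in> before z" "z \<in> topspace X" using that iab p Nt[OF q] by blast+
      then show ?thesis by (intro k_integrable)
    qed
    have sg: "\<bar>time_to s q - time_to s p\<bar> = \<bar>integral {?a..?b} (\<lambda>r. k (v r q)) - integral {?a..?b} (\<lambda>r. k (v r p))\<bar>"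
      unfolding time_to_def by (cases s "0 :: real" rule: linorder_cases) auto
    have df: "integral {?a..?b} (\<lambda>r. k (v r q)) - integral {?a..?b} (\<lambda>r. k (v r p)) = integral {?a..?b} (\<lambda>r. k (v r q) - k (v r p))"
      using i by (intro Henstock_Kurzweil_Integration.integral_diff[symmetric]) auto
    have nb: "norm (integral {?a..?b} (\<lambda>r. k (v r q) - k (v r p))) \<le> e / (\<bar>s\<bar> + 1) * (?b - ?a)"
    proof (rule integral_bound[OF ab])
      show "continuous_on {?a..?b} (\<lambda>r. k (v r q) - k (v r p))"
      proof (rule continuous_on_diff)
        show "continuous_on {?a..?b} (\<lambda>r. k (v r p))" by (rule k_orbit_cont[OF p nx])
        have "v r q \<noteq> x" if r: "r \<in> {?a..?b}" for r
        proof -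
          have "?a \<le> r" "r \<le> ?b" using r unfolding atLeastAtMost_iff by blast+
          then have "a' \<le> r" "r \<le> b'" using N(3,4) by (meson less_imp_le less_le_trans le_less_trans)+
          then show "v r q \<noteq> x" using N(5)[OF q] by blast
        qed
        then show "continuous_on {?a..?b} (\<lambda>r. k (v r q))" by (rule k_orbit_cont[OF Nt[OF q]])
      qed
      show "norm (k (v t q) - k (v t p)) \<le> e / (\<bar>s\<bar> + 1)" if "t \<in> {?a..?b}" for t
        using N(6)[OF q that] by simp
    qed
    have "e / (\<bar>s\<bar> + 1) * (?b - ?a) < e"
    proof -
      have "?b - ?a = \<bar>s\<bar>" by auto
      then show ?thesis using e by (simp add: divide_simps)
    qed
    from le_less_trans[OF nb this] show ?thesis unfolding sg df real_norm_def .
  qed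
  have ne: "q \<noteq> x" if "q \<in> N" for q
  proof -
    have "v 0 q \<noteq> x" by (rule N(5)[OF that]) (use a'b' in simp_all)
    then show ?thesis using v_0[OF Nt[OF that]] by simp
  qed
  have "0 < d" unfolding d_def using a'b' by simp
  show ?thesis
  proof (intro exI[of _ N] exI[of _ d] conjI ballI allI impI N(1,2) \<open>0 < d\<close>)
    fix q assume q: "q \<in> N"
    show "q \<in> topspace X" by (rule Nt[OF q])
    show "q \<noteq> x" by (rule ne[OF q])
    show "\<bar>time_to s q - time_to s p\<bar> < e" by (rule close[OF q])
    show "s' \<in> before q" if "\<bar>s' - s\<bar> \<le> d" for s' by (rule bq[OF q that])
  qed
qed

end

text \<open>The two assumptions say that neither \<open>x\<close> nor the end of an orbit is reached
  in finite slowed time, so that the clock is defined for all real times.\<close>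

locale time_change = punctured_speed +
  assumes unbounded_above: "\<And>p M. p \<in> topspace X \<Longrightarrow> p \<noteq> x \<Longrightarrow> \<exists>s\<in>before p. M \<le> time_to s p"
    and unbounded_below: "\<And>p M. p \<in> topspace X \<Longrightarrow> p \<noteq> x \<Longrightarrow> \<exists>s\<in>before p. time_to s p \<le> - M"
begin

definition clock :: "real \<Rightarrow> 'a \<Rightarrow> real" where
  "clock t p = (THE s. s \<in> before p \<and> time_to s p = t)"

definition slowed :: "real \<Rightarrow> 'a \<Rightarrow> 'a" where
  "slowed t p = (if p = x then x else v (clock t p) p)"

lemma clock_eq:
  assumes "p \<in> topspace X" "s \<in> before p" "time_to s p = t"
  shows "clock t p = s"
  unfolding clock_def
proof (rule the_equality)
  show "s \<in> before p \<and> time_to s p = t" using assms by simp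
  show "s' = s" if "s' \<in> before p \<and> time_to s' p = t" for s'
    using time_to_mono(2)[OF assms(1), of s' s] that assms by simp
qed

lemma clock:
  assumes p: "p \<in> topspace X" "p \<noteq> x"
  shows "clock t p \<in> before p" "time_to (clock t p) p = t"
proof -
  obtain s where s: "s \<in> before p" "\<bar>t\<bar> \<le> time_to s p" using unbounded_above[OF p] by blast
  obtain s' where s': "s' \<in> before p" "time_to s' p \<le> - \<bar>t\<bar>" using unbounded_below[OF p] by blast
  have ss: "s' \<le> s" using time_to_ge[OF p(1) s(1) s'(1)] s s' by linarith
  have b: "time_to s' p \<le> t" "t \<le> time_to s p" using s(2) s'(2) by linarith+
  obtain r where r: "s' \<le> r" "r \<le> s" "time_to r p = t"
    using IVT'[of "\<lambda>r. time_to r p", OF b ss time_to_cont[OF p(1) s'(1) s(1)]] by blast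
  have "r \<in> before p" using before_interval[OF s'(1) s(1)] r by blast
  then have "clock t p = r" using clock_eq[OF p(1)] r(3) by blast
  then show "clock t p \<in> before p" "time_to (clock t p) p = t" using r \<open>r \<in> before p\<close> by auto
qed

lemma clock_strict_mono:
  assumes p: "p \<in> topspace X" "p \<noteq> x" and t: "t < t'"
  shows "clock t p < clock t' p"
  using time_to_mono(1)[OF p(1) clock(1)[OF p] clock(1)[OF p], of t t'] clock(2)[OF p] t by simp

lemma clock_surj: "p \<in> topspace X \<Longrightarrow> s \<in> before p \<Longrightarrow> clock (time_to s p) p = s"
  using clock_eq by blast

lemma clock_0: "p \<in> topspace X \<Longrightarrow> p \<noteq> x \<Longrightarrow> clock 0 p = 0"
  using clock_eq[OF _ before_zero time_to_0] by blast

lemma slowed_in: "p \<in> topspace X \<Longrightarrow> slowed t p \<in> topspace X"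
  unfolding slowed_def using v_in x_in by simp

lemma slowed_ne: "p \<in> topspace X \<Longrightarrow> p \<noteq> x \<Longrightarrow> slowed t p \<noteq> x"
  unfolding slowed_def using before_interval[OF clock(1) clock(1) order_refl order_refl] by simp

lemma slowed_zero: "p \<in> topspace X \<Longrightarrow> slowed 0 p = p"
  unfolding slowed_def using clock_0 v_0 by simp

lemma slowed_add:
  assumes p: "p \<in> topspace X"
  shows "slowed (s + t) p = slowed s (slowed t p)"
proof (cases "p = x")
  case True then show ?thesis unfolding slowed_def by simp
next
  case False
  let ?q = "v (clock t p) p"
  have q: "?q \<in> topspace X" "?q \<noteq> x" using v_in[OF p] slowed_ne[OF p False, of t] False unfolding slowed_def by auto
  have b: "clock t p + clock s ?q \<in> before p" by (rule before_shift[OF p clock(1)[OF p False] clock(1)[OF q]])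
  have "time_to (clock t p + clock s ?q) p = s + t"
    using time_to_add[OF p clock(1)[OF p False] clock(1)[OF q]] clock(2)[OF p False] clock(2)[OF q] by simp
  then have "clock (s + t) p = clock t p + clock s ?q" by (rule clock_eq[OF p b])
  then have "clock (s + t) p = clock s ?q + clock t p" by simp
  then have "v (clock (s + t) p) p = v (clock s ?q) ?q" using v_add[OF p] by simp
  then show ?thesis unfolding slowed_def using False q(2) by simp
qed

text \<open>Since \<open>time_to\<close> is monotone in the time, the clock of a nearby point is
  controlled by two values only: if those at \<open>s - h\<close> and \<open>s + h\<close> enclose
  \<open>t'\<close>, the clock lies between \<open>s - h\<close> and \<open>s + h\<close>.\<close>

lemma slowed_continuous_off:
  assumes p: "p \<in> topspace X" "p \<noteq> x" and U: "openin X U" "slowed t p \<in> U"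
  shows "\<exists>N d. openin X N \<and> p \<in> N \<and> 0 < d \<and> (\<forall>q\<in>N. \<forall>t'. \<bar>t' - t\<bar> < d \<longrightarrow> slowed t' q \<in> U)"
proof -
  define s where "s = clock t p"
  have s: "s \<in> before p" "time_to s p = t" using clock[OF p] unfolding s_def by auto
  let ?P = "prod_topology euclideanreal X"
  let ?W = "{z \<in> topspace ?P. (\<lambda>(t, p). v t p) z \<in> U}"
  have W: "openin ?P ?W" by (rule openin_continuous_map_preimage[OF flow_continuous(1)[OF flow] U(1)])
  have "(s, p) \<in> ?W" using p U(2) unfolding slowed_def s_def by simp
  from openin_prod_topology_alt[THEN iffD1, rule_format, OF W this]
  obtain A N0 where A: "openin euclideanreal A" "openin X N0" "s \<in> A" "p \<in> N0" "A \<times> N0 \<subseteq> ?W"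
    by (elim exE conjE) (rule that)
  have "open A" using A(1) by simp
  then obtain e where e: "e > 0" "ball s e \<subseteq> A" using A(3) open_contains_ball_eq by blast
  obtain N1 d1 where N1: "openin X N1" "p \<in> N1" "0 < d1" "\<forall>q\<in>N1. q \<in> topspace X \<and> q \<noteq> x \<and>
    (\<forall>s'. \<bar>s' - s\<bar> \<le> d1 \<longrightarrow> s' \<in> before q) \<and> \<bar>time_to s q - time_to s p\<bar> < 1" using time_to_near[OF p(1) s(1), of 1] by auto
  define h where "h = min d1 (e/2)"
  have h: "0 < h" "h \<le> d1" "h < e" unfolding h_def using N1(3) e(1) by auto
  have bp: "s - h \<in> before p" "s + h \<in> before p" using N1(2,4) h by auto
  \<comment> \<open>Half of the smaller margin: one half is spent on the change of the point, the
    other on the change of \<open>t\<close>.\<close>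
  define E where "E = min (time_to (s + h) p - t) (t - time_to (s - h) p) / 2"
  have E: "0 < E" "time_to (s - h) p + 2 * E \<le> t" "t + 2 * E \<le> time_to (s + h) p"
    using time_to_mono(1)[OF p(1) bp(1) s(1)] time_to_mono(1)[OF p(1) s(1) bp(2)] s(2) h(1) unfolding E_def by auto
  obtain N2 d2 where N2: "openin X N2" "p \<in> N2" "\<forall>q\<in>N2. q \<in> topspace X \<and> q \<noteq> x \<and>
    (\<forall>s'. \<bar>s' - (s - h)\<bar> \<le> d2 \<longrightarrow> s' \<in> before q) \<and> \<bar>time_to (s - h) q - time_to (s - h) p\<bar> < E" using time_to_near[OF p(1) bp(1) E(1)] by blast
  obtain N3 d3 where N3: "openin X N3" "p \<in> N3" "\<forall>q\<in>N3. q \<in> topspace X \<and> q \<noteq> x \<and>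
    (\<forall>s'. \<bar>s' - (s + h)\<bar> \<le> d3 \<longrightarrow> s' \<in> before q) \<and> \<bar>time_to (s + h) q - time_to (s + h) p\<bar> < E" using time_to_near[OF p(1) bp(2) E(1)] by blast
  let ?N = "N0 \<inter> N1 \<inter> N2 \<inter> N3"
  have "slowed t' q \<in> U" if q: "q \<in> ?N" and t': "\<bar>t' - t\<bar> < E" for q t'
  proof -
    have qt: "q \<in> topspace X" "q \<noteq> x" using q N1(4) by auto
    have bq: "s - h \<in> before q" "s + h \<in> before q" using q N1(4) h by auto
    have "time_to (s - h) q < t'" "t' < time_to (s + h) q"
    proof -
      have "\<bar>time_to (s - h) q - time_to (s - h) p\<bar> < E" "\<bar>time_to (s + h) q - time_to (s + h) p\<bar> < E" using q N2(3) N3(3) by blast+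
      then show "time_to (s - h) q < t'" "t' < time_to (s + h) q" using E t' by linarith+
    qed
    then have "s - h < clock t' q" "clock t' q < s + h"
      using time_to_mono(1)[OF qt(1) bq(1) clock(1)[OF qt]] time_to_mono(1)[OF qt(1) clock(1)[OF qt] bq(2)] clock(2)[OF qt] by auto
    then have "clock t' q \<in> ball s e" using h(3) by (simp add: dist_real_def abs_less_iff)
    then have "(clock t' q, q) \<in> A \<times> N0" using e(2) q by blast
    then have "v (clock t' q) q \<in> U" using A(5) by fastforce
    then show ?thesis unfolding slowed_def using qt by simp
  qed
  moreover have "openin X ?N" "p \<in> ?N" using A N1 N2 N3 by (auto intro!: openin_Int)
  ultimately show ?thesis using E(1) by blast
qed

end

lemma continuous_map_locally:
  assumes "\<And>p. p \<in> topspace X \<Longrightarrow> \<exists>N. openin X N \<and> p \<in> N \<and> continuous_map (subtopology X N) Y f"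
  shows "continuous_map X Y f"
  unfolding continuous_map_def
proof (intro conjI allI impI)
  show "f \<in> topspace X \<rightarrow> topspace Y"
  proof
    fix p assume "p \<in> topspace X"
    then obtain N where N: "p \<in> N" "continuous_map (subtopology X N) Y f" using assms by blast
    then show "f p \<in> topspace Y" using continuous_map_funspace[OF N(2)] \<open>p \<in> topspace X\<close> by (auto simp: Pi_iff)
  qed
  fix U assume U: "openin Y U"
  show "openin X {p \<in> topspace X. f p \<in> U}"
  proof (subst openin_subopen, intro ballI)
    fix p assume p: "p \<in> {p \<in> topspace X. f p \<in> U}"
    then obtain N where N: "openin X N" "p \<in> N" "continuous_map (subtopology X N) Y f" using assms by blast
    have "openin (subtopology X N) {p \<in> topspace (subtopology X N). f p \<in> U}"
      using openin_continuous_map_preimage[OF N(3) U] .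
    then have "openin X {p \<in> topspace (subtopology X N). f p \<in> U}" using N(1) by (rule openin_trans_full)
    moreover have "{p \<in> topspace (subtopology X N). f p \<in> U} \<subseteq> {p \<in> topspace X. f p \<in> U}" by auto
    moreover have "p \<in> {p \<in> topspace (subtopology X N). f p \<in> U}" using p N(2) by simp
    ultimately show "\<exists>T. openin X T \<and> p \<in> T \<and> T \<subseteq> {p \<in> topspace X. f p \<in> U}" by blast
  qed
qed

text \<open>What remains of a flow box when the flow is forgotten. It serves the uniform boxes as
  well as the arbitrary boxes of \<open>singular_replacement\<close>.\<close>

locale box_chart =
  fixes S :: "'a topology" and x :: 'a and H :: "(real \<times> real) set" and g :: "real \<times> real \<Rightarrow> 'a"
  assumes S_haus: "Hausdorff_space S" and H: "H \<in> {UNIV, half_plane}"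
    and g_emb': "embedding_map (top_of_set (square \<inter> H)) S g"
    and g_open: "openin S (g ` (open_square \<inter> H))" and g_0: "g (0, 0) = x"
begin

definition R :: "(real \<times> real) set" where
  "R = square \<inter> H"

definition chart :: "'a \<Rightarrow> real \<times> real" where
  "chart = inv_into R g"

lemma g_emb: "embedding_map (top_of_set R) S g"
  using g_emb' unfolding R_def .

lemma R_iff: "(a, u) \<in> R \<longleftrightarrow> -1 \<le> a \<and> a \<le> 1 \<and> -1 \<le> u \<and> u \<le> 1 \<and> (H = half_plane \<longrightarrow> 0 \<le> u)"
proof -
  have "half_plane \<noteq> UNIV"
  proof -
    have "(0, -1) \<notin> half_plane" unfolding half_plane_def by simp
    then show ?thesis by blast
  qed
  then show ?thesis using H unfolding R_def square_def by (auto simp: half_plane_def)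
qed

lemma open_square_R: "open_square \<inter> H \<subseteq> R" unfolding R_def square_def open_square_def by auto

lemma zero_R: "(0, 0) \<in> R" unfolding R_iff by simp

lemma g_inj: "inj_on g R"
  using g_emb unfolding embedding_map_def homeomorphic_eq_everything_map by simp

lemma g_cont: "continuous_map (top_of_set R) S g"
  using g_emb continuous_map_in_subtopology homeomorphic_imp_continuous_map unfolding embedding_map_def by blast

lemma g_in: "q \<in> R \<Longrightarrow> g q \<in> topspace S"
  using continuous_map_funspace[OF g_cont] by (auto simp: Pi_iff)

lemma x_in_S: "x \<in> topspace S" using g_in[OF zero_R] g_0 by simp

lemma g_eq_x: "q \<in> R \<Longrightarrow> g q = x \<longleftrightarrow> q = (0, 0)"
  using g_inj zero_R g_0 by (auto simp: inj_on_def)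

lemma chart_g: "q \<in> R \<Longrightarrow> chart (g q) = q" unfolding chart_def using g_inj by simp

lemma chart_in: "p \<in> g ` R \<Longrightarrow> chart p \<in> R" "p \<in> g ` R \<Longrightarrow> g (chart p) = p"
  using chart_g by auto

lemma chart_cont: "continuous_map (subtopology S (g ` R)) (top_of_set R) chart"
proof -
  have "homeomorphic_map (top_of_set R) (subtopology S (g ` R)) g" using g_emb unfolding embedding_map_def by simp
  then obtain f where f: "homeomorphic_maps (top_of_set R) (subtopology S (g ` R)) g f" using homeomorphic_map_maps by blast
  then have "continuous_map (subtopology S (g ` R)) (top_of_set R) f" unfolding homeomorphic_maps_def by blast
  moreover have "f p = chart p" if "p \<in> topspace (subtopology S (g ` R))" for p
    using f that chart_g unfolding homeomorphic_maps_def by auto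
  ultimately show ?thesis by (rule continuous_map_eq)
qed

lemma g_open_image:
  assumes "open U" "U \<inter> R \<subseteq> open_square"
  shows "openin S (g ` (U \<inter> R))"
proof -
  have "homeomorphic_map (top_of_set R) (subtopology S (g ` R)) g" using g_emb unfolding embedding_map_def by simp
  moreover have "openin (top_of_set R) (U \<inter> R)" using assms(1) by (metis Int_commute openin_open_Int)
  ultimately have "openin (subtopology S (g ` R)) (g ` (U \<inter> R))" by (simp add: homeomorphic_map_openness_eq)
  then obtain W where W: "openin S W" "g ` (U \<inter> R) = W \<inter> g ` R" unfolding openin_subtopology by blast
  have "U \<inter> R \<subseteq> open_square \<inter> H" using assms(2) unfolding R_def by blast
  then have "g ` (U \<inter> R) = W \<inter> g ` (open_square \<inter> H)" using W(2) open_square_R by blast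
  then show ?thesis using W(1) g_open by auto
qed

lemma compact_R: "compact R"
proof -
  have "closed half_plane" unfolding half_plane_def
    by (rule closed_Collect_le[OF continuous_on_const continuous_on_snd[OF continuous_on_id]])
  then have "closed H" using H by auto
  then show ?thesis unfolding R_def square_def by (intro compact_Int_closed compact_Times compact_Icc)
qed

lemma g_closed_image:
  assumes "closed K" "K \<subseteq> R"
  shows "closedin S (g ` K)"
proof -
  have "compact K" using assms compact_R by (metis compact_Int_closed inf.absorb_iff2)
  then have "compactin (top_of_set R) K" using assms(2) by (simp add: compactin_subtopology compactin_euclidean_iff)
  then have "compactin S (g ` K)" using image_compactin g_cont by blast
  then show ?thesis using S_haus compactin_imp_closedin by blast
qed

text \<open>Outside the core nothing is modified: the speed is that of \<open>v\<close>, and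
  collapse and blow-up are the identity. Continuity can thus be checked separately on the complement
  of its closed image and on the open box.\<close>

definition core :: "(real \<times> real) set" where
  "core = {q \<in> R. \<bar>fst q\<bar> \<le> 1/2 \<and> \<bar>snd q\<bar> \<le> 1/2}"

lemma core_closed: "closed core"
proof -
  have "closed (R \<inter> ({q. \<bar>fst q\<bar> \<le> 1/2} \<inter> {q. \<bar>snd q\<bar> \<le> 1/2}))"
    by (intro closed_Int compact_imp_closed[OF compact_R] closed_Collect_le continuous_intros)
  moreover have "R \<inter> ({q. \<bar>fst q\<bar> \<le> 1/2} \<inter> {q. \<bar>snd q\<bar> \<le> 1/2}) = core" unfolding core_def by auto
  ultimately show ?thesis by simp
qed

lemma core_image_closed: "closedin S (g ` core)"
  by (rule g_closed_image[OF core_closed]) (auto simp: core_def)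

lemma core_R: "core \<subseteq> open_square \<inter> H" unfolding core_def R_def open_square_def by auto

lemma lift_cont:
  assumes f: "continuous_on A f" "A \<subseteq> R" "f ` A \<subseteq> R"
  shows "continuous_map (subtopology S (g ` A)) S (\<lambda>p. g (f (chart p)))"
proof -
  have "continuous_map (subtopology S (g ` A)) (top_of_set R) chart"
    using continuous_map_from_subtopology_mono[OF chart_cont] f(2) by (simp add: image_mono)
  then have 1: "continuous_map (subtopology S (g ` A)) (top_of_set A) chart"
    using f(2) chart_g by (auto simp: continuous_map_in_subtopology)
  have 2: "continuous_map (top_of_set A) (top_of_set R) f" using f by (auto simp: continuous_map_in_subtopology)
  show ?thesis using continuous_map_compose[OF continuous_map_compose[OF 1 2] g_cont] by (simp add: o_def)
qed

lemma lift_real_cont: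
  assumes f: "continuous_on A f" "A \<subseteq> R"
  shows "continuous_map (subtopology S (g ` A)) euclideanreal (\<lambda>p. f (chart p))"
proof -
  have "continuous_map (subtopology S (g ` A)) (top_of_set R) chart"
    using continuous_map_from_subtopology_mono[OF chart_cont] f(2) by (simp add: image_mono)
  then have 1: "continuous_map (subtopology S (g ` A)) (top_of_set A) chart"
    using f(2) chart_g by (auto simp: continuous_map_in_subtopology)
  have 2: "continuous_map (top_of_set A) euclideanreal f" using f by simp
  show ?thesis using continuous_map_compose[OF 1 2] by (simp add: o_def)
qed

end

section \<open>Slowing down inside a uniform flow box\<close>

locale uniform_box =
  fixes S :: "'a topology" and v :: "real \<Rightarrow> 'a \<Rightarrow> 'a" and x :: 'a and H :: "(real \<times> real) set"
    and \<sigma> :: real and g :: "real \<times> real \<Rightarrow> 'a"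
  assumes v_flow: "flow_on S v" and S_Hausdorff: "Hausdorff_space S" and box: "uniform_flow_box S v x H \<sigma> g"
begin

sublocale box_chart S x H g
  using box S_Hausdorff unfolding uniform_flow_box_def by unfold_locales blast+

lemma \<sigma>_pos: "0 < \<sigma>"
  and g_flow: "(a, u) \<in> R \<Longrightarrow> a + s / \<sigma> \<in> {-1..1} \<Longrightarrow> v s (g (a, u)) = g (a + s / \<sigma>, u)"
  and g_section: "p \<in> R \<Longrightarrow> q \<in> R \<Longrightarrow> \<bar>s\<bar> \<le> \<sigma> \<Longrightarrow> v s (g p) = g q \<Longrightarrow> snd q = snd p \<and> fst q = fst p + s / \<sigma>"
  using box unfolding uniform_flow_box_def R_def by (blast, meson, blast)

text \<open>The box coordinate advances at rate \<open>1 / \<sigma>\<close>, so the right side is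
  reached in time. Being in the box a little later would require a first coordinate above 1 by
  \<open>g_section\<close>.\<close>

lemma horizontal_exit:
  assumes p: "p \<in> R" and t: "0 \<le> t" "\<And>s. s \<in> {0..t} \<Longrightarrow> v s (g p) \<in> g ` R"
  shows "fst p + t / \<sigma> \<le> 1"
proof (rule ccontr)
  assume gt: "\<not> fst p + t / \<sigma> \<le> 1"
  obtain a u where au: "p = (a, u)" by (cases p)
  have a: "-1 \<le> a" "a \<le> 1" using p au R_iff by auto
  \<comment> \<open>The overshoot beyond the right side, cut off at \<open>\<sigma>\<close> because
    \<open>g_section\<close> covers only such times.\<close>
  define d where "d = min \<sigma> (t - \<sigma> * (1 - a))"
  have d: "0 < d" "d \<le> \<sigma>" "\<sigma> * (1 - a) + d \<le> t" using gt \<sigma>_pos unfolding d_def au by (auto simp: field_simps)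
  have "0 \<le> \<sigma> * (1 - a) + d" using a d \<sigma>_pos by simp
  then obtain q where q: "q \<in> R" "v (\<sigma> * (1 - a) + d) (g p) = g q" using t(2)[of "\<sigma> * (1 - a) + d"] d by auto
  have 1: "(1, u) \<in> R" using p au R_iff by auto
  have "v (\<sigma> * (1 - a)) (g p) = g (1, u)" using g_flow[of a u "\<sigma> * (1 - a)"] p au \<sigma>_pos by simp
  then have "v d (g (1, u)) = g q"
    using q(2) flow_continuous(3)[OF v_flow g_in[OF p], of d "\<sigma> * (1 - a)"] by (simp add: add.commute)
  then have "fst q = 1 + d / \<sigma>" using g_section[OF 1 q(1), of d] d by simp
  moreover have "fst q \<le> 1" using q(1) R_iff[of "fst q" "snd q"] by simp
  ultimately show False using d \<sigma>_pos by (simp add: divide_le_0_iff)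
qed

lemma horizontal_arc_iff:
  assumes p: "p \<in> R" and q: "q \<in> R"
  shows "(\<exists>t\<ge>0. v t (g p) = g q \<and> (\<forall>s\<in>{0..t}. v s (g p) \<in> g ` R)) \<longleftrightarrow> snd p = snd q \<and> fst p \<le> fst q" (is "?L \<longleftrightarrow> ?r")
proof
  assume ?L
  then obtain t where t: "0 \<le> t" "v t (g p) = g q" "\<And>s. s \<in> {0..t} \<Longrightarrow> v s (g p) \<in> g ` R" by blast
  have e: "fst p + t / \<sigma> \<le> 1" by (rule horizontal_exit[OF p t(1,3)])
  have b: "fst p + t / \<sigma> \<in> {-1..1}"
  proof -
    have "0 \<le> t / \<sigma>" using t(1) \<sigma>_pos by simp
    then show ?thesis using e p R_iff[of "fst p" "snd p"] by simp
  qed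
  then have "v t (g p) = g (fst p + t / \<sigma>, snd p)" using g_flow[of "fst p" "snd p" t] p by simp
  moreover have "(fst p + t / \<sigma>, snd p) \<in> R" using p b R_iff[of "fst p" "snd p"] R_iff[of "fst p + t / \<sigma>" "snd p"] by simp
  ultimately have "q = (fst p + t / \<sigma>, snd p)" using g_inj q t(2) by (metis inj_onD)
  then show ?r using t(1) \<sigma>_pos by simp
next
  assume r: ?r
  obtain a u where au: "p = (a, u)" by (cases p)
  obtain b where bu: "q = (b, u)" using r au by (cases q) auto
  have st: "v s (g p) = g (a + s / \<sigma>, u) \<and> (a + s / \<sigma>, u) \<in> R" if "s \<in> {0..\<sigma> * (b - a)}" for s
  proof -
    have "0 \<le> s / \<sigma>" "s / \<sigma> \<le> b - a" using that \<sigma>_pos by (auto simp: field_simps)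
    then show ?thesis using g_flow[of a u s] p q unfolding au bu R_iff by auto
  qed
  show ?L
  proof (intro exI[of _ "\<sigma> * (b - a)"] conjI ballI)
    show "0 \<le> \<sigma> * (b - a)" using r au bu \<sigma>_pos by simp
    then show "v (\<sigma> * (b - a)) (g p) = g q" using st[of "\<sigma> * (b - a)"] \<sigma>_pos bu by simp
    show "v s (g p) \<in> g ` R" if "s \<in> {0..\<sigma> * (b - a)}" for s using st[OF that] by simp
  qed
qed

lemma trivial_box: "trivial_flow_box S v x H g"
proof -
  have "orbit_arcs_generated_by v g R (\<lambda>p. (1, 0))"
    unfolding orbit_arcs_generated_by_def
  proof (intro ballI)
    fix p q assume p: "p \<in> R" and q: "q \<in> R"
    show "(\<exists>t\<ge>0. v t (g p) = g q \<and> (\<forall>s\<in>{0..t}. v s (g p) \<in> g ` R)) \<longleftrightarrow>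
        (\<exists>T\<ge>0. \<exists>c. c 0 = p \<and> c T = q \<and> (\<forall>s\<in>{0..T}. c s \<in> R \<and> (c has_vector_derivative (1, 0)) (at s within {0..T})))"
      by (rule trans[OF horizontal_arc_iff[OF p q] unit_arcs[OF H, folded R_def, OF p q, symmetric]])
  qed
  then show ?thesis using H g_emb g_open g_0 unfolding trivial_flow_box_def R_def by blast
qed

end

text \<open>The last condition makes the time in which the slowed flow moves \<open>q\<close> by \<open>lam q\<close> at least \<open>\<sigma> / (12 * norm q)\<close>,
  which tends to infinity at \<open>x\<close>.\<close>

locale slow_box = uniform_box +
  fixes k :: "'a \<Rightarrow> real" and lam :: "real \<times> real \<Rightarrow> real"
  assumes kc: "continuous_map (subtopology S (topspace S - {x})) euclideanreal k"
    and kg: "\<And>p. p \<in> topspace S \<Longrightarrow> p \<noteq> x \<Longrightarrow> 1 \<le> k p"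
    and k_out: "\<And>p. p \<notin> g ` R \<Longrightarrow> k p = 1"
    and lam: "\<And>q. q \<in> R \<Longrightarrow> q \<noteq> (0,0) \<Longrightarrow> 0 < lam q \<and> lam q \<le> norm q / 2"
    and k_slow: "\<And>q q'. q \<in> R \<Longrightarrow> q' \<in> R \<Longrightarrow> q \<noteq> (0,0) \<Longrightarrow> norm q \<le> 1/8 \<Longrightarrow> dist q q' \<le> lam q \<Longrightarrow>
      1 / (12 * norm q * lam q) \<le> k (g q')"
begin

sublocale punctured_speed S v x k
  by unfold_locales (fact v_flow, fact S_haus, fact x_in_S, fact kc, erule (1) kg)

lemma horizontal_move:
  assumes q: "q \<in> R" "q \<noteq> (0,0)" "norm q \<le> 1/8" and s: "\<bar>s\<bar> \<le> \<sigma> * lam q"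
  defines "q' \<equiv> (fst q + s / \<sigma>, snd q)"
  shows "q' \<in> R" "q' \<noteq> (0,0)" "dist q q' = \<bar>s\<bar> / \<sigma>" "v s (g q) = g q'"
proof -
  have sl: "\<bar>s\<bar> / \<sigma> \<le> lam q" using s \<sigma>_pos by (simp add: field_simps)
  have l: "0 < lam q" "lam q \<le> norm q / 2" using lam[OF q(1,2)] by auto
  have "\<bar>fst q\<bar> \<le> 1/8" using q(3) norm_fst_le[of "fst q" "snd q"] by simp
  moreover have "\<bar>s / \<sigma>\<bar> \<le> 1/16"
  proof -
    have "\<bar>s / \<sigma>\<bar> = \<bar>s\<bar> / \<sigma>" using \<sigma>_pos by simp
    then show ?thesis using sl l q(3) by linarith
  qed
  ultimately have "fst q + s / \<sigma> \<le> 1" "-1 \<le> fst q + s / \<sigma>" by linarith+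
  then have b: "fst q + s / \<sigma> \<in> {-1..1}" by simp
  then show q'R: "q' \<in> R" using q(1) R_iff[of "fst q" "snd q"] R_iff[of "fst q + s / \<sigma>" "snd q"] unfolding q'_def prod.collapse by simp
  show d: "dist q q' = \<bar>s\<bar> / \<sigma>" unfolding q'_def using \<sigma>_pos by (cases q) (simp add: dist_Pair_Pair dist_real_def)
  show "q' \<noteq> (0,0)"
  proof
    assume "q' = (0,0)"
    then have "q' = 0" by (simp add: zero_prod_def)
    then have "norm q \<le> lam q" using d sl by simp
    moreover have "0 < norm q" using q(2) by (simp add: zero_prod_def)
    ultimately show False using l by simp
  qed
  show "v s (g q) = g q'" unfolding q'_def using g_flow[of "fst q" "snd q" s] q(1) b by simp
qed

lemma horizontal_time:
  assumes q: "q \<in> R" "q \<noteq> (0,0)" "norm q \<le> 1/8" and s: "\<bar>s\<bar> \<le> \<sigma> * lam q"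
  shows "s \<in> before (g q)" "0 \<le> s \<Longrightarrow> s / (12 * norm q * lam q) \<le> time_to s (g q)"
    "s \<le> 0 \<Longrightarrow> time_to s (g q) \<le> s / (12 * norm q * lam q)"
proof -
  have gq: "g q \<in> topspace S" "g q \<noteq> x" using g_in[OF q(1)] g_eq_x[OF q(1)] q(2) by auto
  have mv: "v r (g q) \<noteq> x \<and> 1 / (12 * norm q * lam q) \<le> k (v r (g q))" if "\<bar>r\<bar> \<le> \<bar>s\<bar>" for r
  proof -
    have r: "\<bar>r\<bar> \<le> \<sigma> * lam q" using that s by linarith
    have "\<bar>r\<bar> / \<sigma> \<le> lam q" using r \<sigma>_pos by (simp add: field_simps)
    then show ?thesis using horizontal_move[OF q r] g_eq_x k_slow[OF q(1) _ q(2,3)] by simp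
  qed
  show b: "s \<in> before (g q)" unfolding avoiding_times_def
  proof (intro CollectI ballI)
    fix r assume "r \<in> {min 0 s..max 0 s}"
    then have "\<bar>r\<bar> \<le> \<bar>s\<bar>" by auto
    then show "v r (g q) \<noteq> x" using mv by blast
  qed
  have 0: "0 \<in> before (g q)" using before_zero[OF gq] .
  show "s / (12 * norm q * lam q) \<le> time_to s (g q)" if "0 \<le> s"
    using time_to_lower[OF gq(1) 0 b that, of "1 / (12 * norm q * lam q)"] mv that time_to_0 by simp
  show "time_to s (g q) \<le> s / (12 * norm q * lam q)" if "s \<le> 0"
    using time_to_lower[OF gq(1) b 0 that, of "1 / (12 * norm q * lam q)"] mv that time_to_0 by simp
qed

text \<open>On an orbit that avoids \<open>x\<close> the slowed time is at least the original time.
  Otherwise the orbit passes, just before it meets \<open>x\<close>, a box point \<open>q\<close> as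
  close to the origin as desired, and moving on by \<open>lam q\<close> alone takes at least the
  time \<open>\<sigma> / (12 * norm q)\<close>. The sign \<open>e\<close> treats both directions of
  time at once.\<close>

lemma unbounded:
  assumes p: "p \<in> topspace S" "p \<noteq> x" and e: "e = 1 \<or> e = (-1::real)"
  shows "\<exists>s\<in>before p. M \<le> e * time_to s p"
proof -
  have 0: "0 \<in> before p" using before_zero[OF p] .
  have lower: "e * s \<le> e * time_to s p" if "s \<in> before p" "0 \<le> e * s" for s
    using e time_to_ge[OF p(1) 0 that(1)] time_to_ge[OF p(1) that(1) 0] that(2) time_to_0 by auto
  have before_iff: "e * s \<in> before p" if "0 \<le> s" "\<And>r. 0 \<le> r \<Longrightarrow> r \<le> s \<Longrightarrow> v (e * r) p \<noteq> x" for s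
    unfolding avoiding_times_def
  proof (intro CollectI ballI)
    fix r assume "r \<in> {min 0 (e * s)..max 0 (e * s)}"
    then have "0 \<le> e * r" "e * r \<le> s" "e * (e * r) = r" using e that(1) by (auto simp: min_def max_def split: if_splits)
    then show "v r p \<noteq> x" using that(2)[of "e * r"] by metis
  qed
  show ?thesis
  proof (cases "\<forall>r\<ge>0. v (e * r) p \<noteq> x")
    case True
    then have b: "e * \<bar>M\<bar> \<in> before p" by (intro before_iff) auto
    have eM: "e * (e * \<bar>M\<bar>) = \<bar>M\<bar>" using e by auto
    have "M \<le> e * time_to (e * \<bar>M\<bar>) p" using lower[OF b] unfolding eM by simp
    then show ?thesis using b by blast
  next
    case False
    define Z where "Z = {r \<in> {0..}. v (e * r) p = x}"
    have cm: "continuous_map euclideanreal S (\<lambda>r. v (e * r) p)"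
      by (rule flow_continuous_compose[OF v_flow]) (auto intro!: continuous_intros simp: p)
    have "closedin S {x}" using S_haus x_in_S by (simp add: Hausdorff_imp_t1_space closedin_t1_singleton)
    from closedin_continuous_map_preimage[OF cm this] have "closed {r. v (e * r) p = x}" by simp
    moreover have "Z = {0..} \<inter> {r. v (e * r) p = x}" unfolding Z_def by auto
    ultimately have Zc: "closed Z" by auto
    have "Z \<noteq> {}" "bdd_below Z" using False unfolding Z_def by auto
    define b where "b = Inf Z"
    have bZ: "b \<in> Z" unfolding b_def by (rule closed_contains_Inf[OF \<open>Z \<noteq> {}\<close> \<open>bdd_below Z\<close> Zc])
    have bmin: "v (e * r) p \<noteq> x" if "0 \<le> r" "r < b" for r
      using cInf_lower[of r Z] \<open>bdd_below Z\<close> that unfolding b_def Z_def by force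
    have bx: "v (e * b) p = x" "0 \<le> b" using bZ unfolding Z_def by auto
    have "b \<noteq> 0" using bx(1) p v_0 by auto
    then have "0 < b" using bx(2) by simp
    \<comment> \<open>Since \<open>norm q\<close> will be \<open>r / \<sigma>\<close>, the last
      bound makes \<open>\<sigma> / (12 * norm q)\<close> at least \<open>|M| + 1\<close>, and
      \<open>\<sigma> / 8\<close> keeps \<open>q\<close> in the range of
      \<open>k_slow\<close>.\<close>
    define r where "r = min b (min (\<sigma> / 8) (\<sigma>\<^sup>2 / (12 * (\<bar>M\<bar> + 1))))"
    have r: "0 < r" "r \<le> b" "r \<le> \<sigma> / 8" "r \<le> \<sigma>\<^sup>2 / (12 * (\<bar>M\<bar> + 1))"
  proof -
    have "0 < \<sigma>\<^sup>2 / (12 * (\<bar>M\<bar> + 1))" using \<sigma>_pos by simp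
    then show "0 < r" unfolding r_def using \<open>0 < b\<close> \<sigma>_pos by (simp only: min_less_iff_conj) simp
    show "r \<le> b" "r \<le> \<sigma> / 8" "r \<le> \<sigma>\<^sup>2 / (12 * (\<bar>M\<bar> + 1))" unfolding r_def by (meson min.cobounded1 min.cobounded2 order_trans)+
  qed
    define q where "q = (- (e * r) / \<sigma>, 0 :: real)"
    have nq: "norm q = r / \<sigma>" unfolding q_def using e r(1) \<sigma>_pos by (auto simp: norm_Pair)
    have r8: "r / \<sigma> \<le> 1/8" using r(3) \<sigma>_pos by (simp add: field_simps)
    have qR: "q \<in> R" "q \<noteq> (0,0)" "norm q \<le> 1/8"
      using e r(1) r8 \<sigma>_pos nq unfolding q_def R_iff by (auto simp: field_simps)
    have l: "0 < lam q" using lam[OF qR(1,2)] by blast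
    let ?s = "e * (b - r)"
    have sb: "?s \<in> before p" by (rule before_iff) (use r bmin in auto)
    have "\<bar>- (e * r) / \<sigma>\<bar> \<le> 1/8" using r8 e r(1) \<sigma>_pos by auto
    then have "- (e * r) / \<sigma> \<in> {-1..1}" by (simp only: abs_le_iff atLeastAtMost_iff) linarith
    then have "v (- (e * r)) x = g q"
      using g_flow[of 0 0 "- (e * r)"] zero_R g_0 unfolding q_def by simp
    moreover have "v (- (e * r) + e * b) p = v (- (e * r)) (v (e * b) p)" by (rule v_add[OF p(1)])
    moreover have "- (e * r) + e * b = ?s" by (simp add: algebra_simps)
    ultimately have sq: "v ?s p = g q" using bx(1) by simp
    let ?s' = "e * (\<sigma> * lam q)"
    have as: "\<bar>?s'\<bar> \<le> \<sigma> * lam q" using e l \<sigma>_pos by auto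
    note ht = horizontal_time[OF qR as]
    have "\<sigma> / (12 * norm q) \<le> e * time_to ?s' (g q)"
      using ht(2,3) e l \<sigma>_pos by (auto simp: field_simps)
    moreover have "\<bar>M\<bar> + 1 \<le> \<sigma> / (12 * norm q)"
      using r(1,4) \<sigma>_pos unfolding nq by (simp add: field_simps power2_eq_square)
    moreover have "0 \<le> e * time_to ?s p"
    proof -
      have es: "e * ?s = b - r" using e by auto
      show ?thesis using lower[OF sb] r(2) unfolding es by simp
    qed
    moreover have "?s + ?s' \<in> before p" using before_shift[OF p(1) sb] ht(1) sq by simp
    moreover have "time_to (?s + ?s') p = time_to ?s p + time_to ?s' (g q)" using time_to_add[OF p(1) sb] ht(1) sq by simp
    ultimately show ?thesis by (intro bexI[of _ "?s + ?s'"]) (auto simp: distrib_left)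
  qed
qed

sublocale time_change S v x k
proof
  show "\<exists>s\<in>before p. M \<le> time_to s p" if "p \<in> topspace S" "p \<noteq> x" for p M
    using unbounded[OF that, of 1 M] by simp
  show "\<exists>s\<in>before p. time_to s p \<le> - M" if "p \<in> topspace S" "p \<noteq> x" for p M
    using unbounded[OF that, of "-1" M] by force
qed

text \<open>By \<open>horizontal_time\<close> the clock of \<open>g q\<close> has not yet reached
  \<open>\<sigma> * lam q\<close> in either direction.\<close>

lemma slowed_drift:
  assumes q: "q \<in> R" "q \<noteq> (0,0)" "norm q \<le> 1/8" and t: "\<bar>t\<bar> < \<sigma> / (12 * norm q)"
  shows "\<exists>q'\<in>R. q' \<noteq> (0,0) \<and> dist q q' < lam q \<and> slowed t (g q) = g q'"
proof -
  have gq: "g q \<in> topspace S" "g q \<noteq> x" using g_in[OF q(1)] g_eq_x[OF q(1)] q(2) by auto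
  have l: "0 < lam q" using lam[OF q(1,2)] by blast
  let ?s = "\<sigma> * lam q"
  have s: "\<bar>?s\<bar> \<le> \<sigma> * lam q" "\<bar>- ?s\<bar> \<le> \<sigma> * lam q" using l \<sigma>_pos by auto
  have eq: "?s / (12 * norm q * lam q) = \<sigma> / (12 * norm q)" using l by simp
  have "t < time_to ?s (g q)" using horizontal_time(2)[OF q s(1)] t eq l \<sigma>_pos by auto
  then have 1: "clock t (g q) < ?s"
    using time_to_mono(1)[OF gq(1) clock(1)[OF gq] horizontal_time(1)[OF q s(1)], of t] clock(2)[OF gq] by simp
  have "time_to (- ?s) (g q) < t" using horizontal_time(3)[OF q s(2)] t eq l \<sigma>_pos by (auto simp: minus_divide_left[symmetric])
  then have 2: "- ?s < clock t (g q)"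
    using time_to_mono(1)[OF gq(1) horizontal_time(1)[OF q s(2)] clock(1)[OF gq], of t] clock(2)[OF gq] by simp
  have c: "\<bar>clock t (g q)\<bar> < ?s" using 1 2 by (simp add: abs_less_iff)
  then have d: "\<bar>clock t (g q)\<bar> / \<sigma> < lam q" using \<sigma>_pos by (simp add: field_simps)
  note m = horizontal_move[OF q less_imp_le[OF c]]
  show ?thesis
    using m d gq(2) unfolding slowed_def by (intro bexI[OF _ m(1)]) auto
qed

end

lemma continuous_map_nbhd:
  "continuous_map X Y f \<longleftrightarrow> (\<forall>p\<in>topspace X. f p \<in> topspace Y \<and>
     (\<forall>U. openin Y U \<and> f p \<in> U \<longrightarrow> (\<exists>N. openin X N \<and> p \<in> N \<and> (\<forall>q\<in>N. f q \<in> U))))"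
  unfolding continuous_map_eq_topcontinuous_at topcontinuous_at_def by blast

context uniform_box
begin

lemma punctured_image: "g ` (open_square \<inter> H) \<inter> (topspace S - {x}) = g ` (open_square \<inter> H - {(0,0)})"
proof (intro set_eqI iffI)
  fix p assume "p \<in> g ` (open_square \<inter> H) \<inter> (topspace S - {x})"
  then obtain z where "z \<in> open_square \<inter> H" "p = g z" "p \<noteq> x" by blast
  then show "p \<in> g ` (open_square \<inter> H - {(0,0)})" using g_0 by blast
next
  fix p assume "p \<in> g ` (open_square \<inter> H - {(0,0)})"
  then obtain z where z: "z \<in> open_square \<inter> H" "p = g z" "z \<noteq> (0,0)" by blast
  then have "z \<in> R" using open_square_R by blast
  then show "p \<in> g ` (open_square \<inter> H) \<inter> (topspace S - {x})" using z g_in g_eq_x by blast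
qed

text \<open>Needed is a continuous positive function \<open>lam\<close> below the modulus of
  continuity of \<open>G\<close> at each point. The distance of \<open>(q, q)\<close> from the set
  of pairs that violate the wanted estimate is such a function: it is Lipschitz, and it is positive
  by the continuity of \<open>G\<close>. The reciprocal speed then only has to grow like
  \<open>1 / (norm q * lam q)\<close> at the origin.\<close>

lemma ex_slow_speed:
  fixes G :: "real \<times> real \<Rightarrow> real \<times> real"
  assumes G: "continuous_on (R - {(0,0)}) G"
  shows "\<exists>k lam. slow_box S v x H \<sigma> g k lam \<and>
    (\<forall>q\<in>R - {(0,0)}. \<forall>q'\<in>R - {(0,0)}. dist q q' < lam q \<longrightarrow> dist (G q) (G q') < norm q)"
proof -
  \<comment> \<open>The pair of origins makes the set nonempty; the value of \<open>infdist\<close>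
    for the empty set is 0 by convention.\<close>
  define Bad where "Bad = insert ((0,0),(0,0)) {z. fst z \<in> R - {(0,0)} \<and> snd z \<in> R - {(0,0)} \<and> norm (fst z) \<le> dist (G (fst z)) (G (snd z))}"
  define lam where "lam q = min (norm q / 2) (infdist (q, q) Bad)" for q
  \<comment> \<open>A cut-off that is at least 1/2 on the square of half-width 1/4 and 0 outside the
    core.\<close>
  define bmp where "bmp q = max 0 (1 - 2 * max \<bar>fst q\<bar> \<bar>snd q\<bar>)" for q :: "real \<times> real"
  define \<kappa> where "\<kappa> q = 1 + bmp q / (norm q * lam q)" for q
  define k where "k p = (if p \<in> g ` R then \<kappa> (chart p) else 1)" for p
  have Bne: "Bad \<noteq> {}" unfolding Bad_def by simp
  have nz: "0 < norm q" if "q \<noteq> (0,0)" for q :: "real \<times> real" using that by (simp add: zero_prod_def)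
  have lam_pos: "0 < lam q" "lam q \<le> norm q / 2" if q: "q \<in> R" "q \<noteq> (0,0)" for q
  proof -
    show "lam q \<le> norm q / 2" unfolding lam_def by simp
    have "(q, q) \<notin> closure Bad"
    proof
      assume cl: "(q, q) \<in> closure Bad"
      obtain d where d: "d > 0" "\<And>q'. q' \<in> R - {(0,0)} \<Longrightarrow> dist q' q < d \<Longrightarrow> dist (G q') (G q) < norm q / 4"
        using G q nz[OF q(2)] unfolding continuous_on_iff by (metis DiffI divide_pos_pos singletonD zero_less_numeral)
      have "0 < min d (norm q / 2)" using d(1) nz[OF q(2)] by simp
      then obtain z where z: "z \<in> Bad" "dist z (q, q) < min d (norm q / 2)"
        using cl unfolding closure_approachable by blast
      have zf: "dist (fst z) q < min d (norm q / 2)" "dist (snd z) q < min d (norm q / 2)"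
        using z(2) dist_fst_le[of z "(q, q)"] dist_snd_le[of z "(q, q)"] by auto
      have "z \<noteq> ((0,0),(0,0))"
      proof
        assume "z = ((0,0),(0,0))"
        then have "dist (fst z) q = norm q" by (simp add: dist_norm zero_prod_def[symmetric])
        then show False using zf(1) nz[OF q(2)] by simp
      qed
      then have zB: "fst z \<in> R - {(0,0)}" "snd z \<in> R - {(0,0)}" "norm (fst z) \<le> dist (G (fst z)) (G (snd z))" using z(1) unfolding Bad_def by auto
      have "dist (G (fst z)) (G (snd z)) \<le> dist (G (fst z)) (G q) + dist (G (snd z)) (G q)" by (rule dist_triangle2)
      also have "\<dots> < norm q / 4 + norm q / 4" using d(2)[OF zB(1)] d(2)[OF zB(2)] zf by simp
      also have "\<dots> \<le> norm (fst z)" using zf(1) norm_triangle_ineq2[of q "fst z"] by (simp add: dist_norm norm_minus_commute)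
      finally show False using zB(3) by simp
    qed
    then have "infdist (q, q) Bad \<noteq> 0" using in_closure_iff_infdist_zero[OF Bne] by blast
    then have "0 < infdist (q, q) Bad" using infdist_nonneg[of "(q, q)" Bad] by simp
    then show "0 < lam q" unfolding lam_def using nz[OF q(2)] by simp
  qed
  \<comment> \<open>The factor 2 arises because both components of \<open>(q, q)\<close>
    move.\<close>
  have lam_lip: "lam q' \<le> lam q + 2 * dist q q'" for q q'
  proof -
    have "infdist (q', q') Bad \<le> infdist (q, q) Bad + dist (q', q') (q, q)" by (rule infdist_triangle)
    moreover have "dist (q', q') (q, q) \<le> 2 * dist q q'"
      unfolding dist_Pair_Pair using sqrt_sum_squares_le_sum[of "dist q' q" "dist q' q"] by (simp add: dist_commute)
    moreover have "norm q' / 2 \<le> norm q / 2 + 2 * dist q q'"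
    proof -
      have "norm q' - norm q \<le> dist q q'" using norm_triangle_ineq2[of q' q] by (simp add: dist_norm norm_minus_commute)
      then show ?thesis using zero_le_dist[of q q'] norm_ge_zero[of q] norm_ge_zero[of q'] by linarith
    qed
    ultimately show ?thesis unfolding lam_def by auto
  qed
  have lam_cont: "continuous_on A lam" for A unfolding lam_def by (intro continuous_intros ballI) simp
  have \<kappa>_cont: "continuous_on (R - {(0,0)}) \<kappa>" unfolding \<kappa>_def bmp_def
  proof (intro continuous_intros lam_cont ballI)
    fix q assume "q \<in> R - {(0,0)}"
    then have "0 < norm q" "0 < lam q" using nz lam_pos by auto
    then show "norm q * lam q \<noteq> 0" by simp
  qed
  have \<kappa>_out: "\<kappa> q = 1" if "q \<notin> core" "q \<in> R" for q
  proof -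
    have "1/2 \<le> \<bar>fst q\<bar> \<or> 1/2 \<le> \<bar>snd q\<bar>" using that unfolding core_def by auto
    then have "1/2 \<le> max \<bar>fst q\<bar> \<bar>snd q\<bar>" by (simp add: le_max_iff_disj)
    then show ?thesis unfolding \<kappa>_def bmp_def by simp
  qed
  have \<kappa>_ge: "1 \<le> \<kappa> q" if "q \<in> R" "q \<noteq> (0,0)" for q
    unfolding \<kappa>_def bmp_def using lam_pos[OF that] by simp
  have "slow_box S v x H \<sigma> g k lam"
  proof (unfold_locales)
    show "continuous_map (subtopology S (topspace S - {x})) euclideanreal k"
    proof (rule continuous_map_locally)
      fix p assume p: "p \<in> topspace (subtopology S (topspace S - {x}))"
      show "\<exists>N. openin (subtopology S (topspace S - {x})) N \<and> p \<in> N \<and>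
         continuous_map (subtopology (subtopology S (topspace S - {x})) N) euclideanreal k"
      proof (cases "p \<in> g ` core")
        case False
        let ?N = "(topspace S - g ` core) \<inter> (topspace S - {x})"
        have o: "openin (subtopology S (topspace S - {x})) ?N"
          using core_image_closed openin_subtopology_Int by blast
        have "k q = 1" if "q \<in> ?N" for q
        proof (cases "q \<in> g ` R")
          case True
          have "chart q \<notin> core" using that chart_in(2)[OF True] by force
          then show ?thesis unfolding k_def using True \<kappa>_out[OF _ chart_in(1)[OF True]] by simp
        qed (simp add: k_def)
        note k1 = this
        have "continuous_map (subtopology (subtopology S (topspace S - {x})) ?N) euclideanreal k"
        proof (rule continuous_map_eq[of _ _ "\<lambda>_. 1"])
          show "1 = k q" if "q \<in> topspace (subtopology (subtopology S (topspace S - {x})) ?N)" for q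
            using k1[of q] that by simp
        qed simp
        moreover have "p \<in> ?N" using p False by simp
        ultimately show ?thesis using o by blast
      next
        case True
        let ?A = "open_square \<inter> H - {(0,0)}"
        let ?N = "g ` (open_square \<inter> H) \<inter> (topspace S - {x})"
        have o: "openin (subtopology S (topspace S - {x})) ?N" using g_open openin_subtopology_Int by blast
        have N: "?N = g ` ?A" by (rule punctured_image)
        have A: "?A \<subseteq> R - {(0,0)}" using open_square_R by blast
        have "continuous_map (subtopology S (g ` ?A)) euclideanreal (\<lambda>p. \<kappa> (chart p))"
          by (rule lift_real_cont[OF continuous_on_subset[OF \<kappa>_cont A]]) (use A in blast)
        then have "continuous_map (subtopology S (g ` ?A)) euclideanreal k"
          by (rule continuous_map_eq) (use A in \<open>auto simp: k_def\<close>)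
        moreover have "subtopology (subtopology S (topspace S - {x})) ?N = subtopology S (g ` ?A)"

    proof -
      have "(topspace S - {x}) \<inter> ?N = g ` ?A" using N by blast
      then show ?thesis unfolding subtopology_subtopology by simp
    qed
        moreover have "p \<in> ?N" using True p core_R by auto
        ultimately show ?thesis using o by (intro exI[of _ ?N]) simp
      qed
    qed
    show "1 \<le> k p" if "p \<in> topspace S" "p \<noteq> x" for p
    proof (cases "p \<in> g ` R")
      case True
      then obtain z where z: "z \<in> R" "p = g z" by blast
      then have "z \<noteq> (0,0)" using that g_0 by auto
      then show ?thesis unfolding k_def using \<kappa>_ge[OF z(1)] chart_g[OF z(1)] z by simp
    qed (simp add: k_def)
    show "k p = 1" if "p \<notin> g ` R" for p using that unfolding k_def by simp
    show "0 < lam q \<and> lam q \<le> norm q / 2" if "q \<in> R" "q \<noteq> (0,0)" for q using lam_pos[OF that] by simp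
    show "1 / (12 * norm q * lam q) \<le> k (g q')"
      if q: "q \<in> R" "q' \<in> R" "q \<noteq> (0,0)" "norm q \<le> 1/8" "dist q q' \<le> lam q" for q q'
    proof -
      note l = lam_pos[OF q(1,3)]
      have nq: "norm q' \<le> norm q + dist q q'" "norm q \<le> norm q' + dist q q'"
        using norm_triangle_ineq2[of q' q] norm_triangle_ineq2[of q q'] unfolding dist_norm norm_minus_commute[of q' q] by linarith+
      then have n': "0 < norm q'" "norm q' \<le> 2 * norm q" "norm q' \<le> 3/16" using q(4,5) l nz[OF q(3)] by linarith+
      then have q'0: "q' \<noteq> (0,0)" by (auto simp: zero_prod_def[symmetric])
      have l': "0 < lam q'" "lam q' \<le> 3 * lam q" using lam_pos[OF q(2) q'0] lam_lip[of q' q] q(5) by linarith+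
      have "\<bar>fst q'\<bar> \<le> 3/16" "\<bar>snd q'\<bar> \<le> 3/16" using n'(3) norm_fst_le[of "fst q'" "snd q'"] norm_snd_le[of "snd q'" "fst q'"] by auto
      then have "max \<bar>fst q'\<bar> \<bar>snd q'\<bar> \<le> 1/4" by simp
      then have bmp: "1/2 \<le> bmp q'" unfolding bmp_def by simp
      have pos: "0 < norm q' * lam q'" using n' l' by simp
      \<comment> \<open>The origin of the 12: a factor 2 from comparing the norms at
        \<open>q\<close> and \<open>q'\<close>, 3 from comparing the values of \<open>lam\<close>,
        and 2 from the cut-off, which is only known to be at least 1/2.\<close>
      have "norm q' * lam q' \<le> (2 * norm q) * (3 * lam q)" using n' l' by (intro mult_mono) auto
      then have "(1/2) / ((2 * norm q) * (3 * lam q)) \<le> bmp q' / (norm q' * lam q')"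
        using bmp pos by (intro frac_le) auto
      then have "1 / (12 * norm q * lam q) \<le> \<kappa> q'" unfolding \<kappa>_def by simp
      then show ?thesis unfolding k_def using chart_g[OF q(2)] q(2) by simp
    qed
  qed
  moreover have "dist (G q) (G q') < norm q" if q: "q \<in> R - {(0,0)}" "q' \<in> R - {(0,0)}" "dist q q' < lam q" for q q'
  proof (rule ccontr)
    assume "\<not> dist (G q) (G q') < norm q"
    then have "(q, q') \<in> Bad" using q(1,2) unfolding Bad_def by simp
    then have "infdist (q, q) Bad \<le> dist (q, q) (q, q')" by (rule infdist_le)
    also have "\<dots> = dist q q'" by (simp add: dist_Pair_Pair)
    finally show False using q(3) unfolding lam_def by simp
  qed
  ultimately show ?thesis by blast
qed

end

section \<open>Blowing up a point of a flow\<close>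

text \<open>\<open>h\<close> collapses \<open>C\<close> to the origin and \<open>G\<close> inverts
  it elsewhere. The abstraction is used twice: for the sine curve, and for
  \<open>C = {(0, 0)}\<close> with identity maps, where the lifted flow is the slowed flow
  itself.\<close>

locale collapse_data = uniform_box +
  fixes G h :: "real \<times> real \<Rightarrow> real \<times> real" and C :: "(real \<times> real) set"
  assumes h_cont: "continuous_on R h" and h_R: "\<And>z. z \<in> R \<Longrightarrow> h z \<in> R" and C_R: "C \<subseteq> R"
    and h_zero: "\<And>z. z \<in> R \<Longrightarrow> h z = (0,0) \<longleftrightarrow> z \<in> C"
    and G_cont: "continuous_on (R - {(0,0)}) G"
    and G_R: "\<And>q. q \<in> R \<Longrightarrow> q \<noteq> (0,0) \<Longrightarrow> G q \<in> R"
    and hG: "\<And>q. q \<in> R \<Longrightarrow> q \<noteq> (0,0) \<Longrightarrow> h (G q) = q"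
    and Gh: "\<And>z. z \<in> R \<Longrightarrow> z \<notin> C \<Longrightarrow> G (h z) = z"
    and h_id: "\<And>z. z \<in> R \<Longrightarrow> 1/2 \<le> \<bar>fst z\<bar> \<or> 1/2 \<le> \<bar>snd z\<bar> \<Longrightarrow> h z = z"
begin

definition collapse_map :: "'a \<Rightarrow> 'a" where
  "collapse_map p = (if p \<in> g ` R then g (h (chart p)) else p)"

definition blow_map :: "'a \<Rightarrow> 'a" where
  "blow_map p = (if p \<in> g ` R then g (G (chart p)) else p)"

lemma collapse_map_g: "z \<in> R \<Longrightarrow> collapse_map (g z) = g (h z)"
  unfolding collapse_map_def using chart_g by simp

lemma blow_map_g: "z \<in> R \<Longrightarrow> blow_map (g z) = g (G z)"
  unfolding blow_map_def using chart_g by simp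

lemma G_id: "q \<in> R \<Longrightarrow> 1/2 \<le> \<bar>fst q\<bar> \<or> 1/2 \<le> \<bar>snd q\<bar> \<Longrightarrow> G q = q"
proof -
  assume q: "q \<in> R" "1/2 \<le> \<bar>fst q\<bar> \<or> 1/2 \<le> \<bar>snd q\<bar>"
  have hq: "h q = q" using h_id q by blast
  have "q \<noteq> (0,0)" using q(2) by auto
  then have "q \<notin> C" using h_zero[OF q(1)] hq by simp
  then show "G q = q" using Gh[OF q(1)] hq by simp
qed

lemma collapse_map_in: "p \<in> topspace S \<Longrightarrow> collapse_map p \<in> topspace S"
  unfolding collapse_map_def using g_in h_R chart_in(1) by simp

lemma collapse_map_eq_x: "p \<in> topspace S \<Longrightarrow> collapse_map p = x \<longleftrightarrow> p \<in> g ` C"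
proof (cases "p \<in> g ` R")
  case True
  then obtain z where z: "z \<in> R" "p = g z" by blast
  have "collapse_map p = x \<longleftrightarrow> h z = (0,0)" using z collapse_map_g g_eq_x[OF h_R[OF z(1)]] by simp
  also have "\<dots> \<longleftrightarrow> p \<in> g ` C" using h_zero[OF z(1)] z C_R inj_on_image_mem_iff[OF g_inj z(1) C_R] by simp
  finally show ?thesis .
next
  case False
  then have "p \<noteq> x" "p \<notin> g ` C" using g_0 zero_R C_R by blast+
  then show ?thesis unfolding collapse_map_def using False by simp
qed

lemma blow_collapse: "p \<in> topspace S \<Longrightarrow> p \<notin> g ` C \<Longrightarrow> blow_map (collapse_map p) = p"
proof (cases "p \<in> g ` R")
  case True
  assume "p \<notin> g ` C"
  then obtain z where z: "z \<in> R" "p = g z" "z \<notin> C" using True by blast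
  then show ?thesis using collapse_map_g blow_map_g h_R Gh by simp
qed (simp add: collapse_map_def blow_map_def)

lemma blow_map_in: "p \<in> topspace S \<Longrightarrow> p \<noteq> x \<Longrightarrow> blow_map p \<in> topspace S"
  and blow_map_notin: "p \<in> topspace S \<Longrightarrow> p \<noteq> x \<Longrightarrow> blow_map p \<notin> g ` C"
  and collapse_blow: "p \<in> topspace S \<Longrightarrow> p \<noteq> x \<Longrightarrow> collapse_map (blow_map p) = p"
proof -
  assume p: "p \<in> topspace S" "p \<noteq> x"
  show 1: "collapse_map (blow_map p) = p"
  proof (cases "p \<in> g ` R")
    case True
    then obtain z where z: "z \<in> R" "p = g z" by blast
    have "z \<noteq> (0,0)" using p z g_0 by auto
    then show ?thesis using z collapse_map_g blow_map_g G_R hG by simp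
  qed (simp add: collapse_map_def blow_map_def)
  show 2: "blow_map p \<in> topspace S"
  proof (cases "p \<in> g ` R")
    case True
    then obtain z where z: "z \<in> R" "p = g z" by blast
    have "z \<noteq> (0,0)" using p z g_0 by auto
    then show ?thesis using z blow_map_g G_R g_in by simp
  qed (simp add: p blow_map_def)
  show "blow_map p \<notin> g ` C" using collapse_map_eq_x[OF 2] 1 p(2) by simp
qed

lemma outside_core:
  assumes "p \<in> topspace S" "p \<notin> g ` core"
  shows "collapse_map p = p" "blow_map p = p"
proof -
  have "collapse_map p = p \<and> blow_map p = p"
  proof (cases "p \<in> g ` R")
    case True
    then obtain z where z: "z \<in> R" "p = g z" by blast
    then have "z \<notin> core" using assms(2) by blast
    then have "1/2 \<le> \<bar>fst z\<bar> \<or> 1/2 \<le> \<bar>snd z\<bar>" using z(1) unfolding core_def by auto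
    then show ?thesis using z collapse_map_g blow_map_g h_id G_id by simp
  qed (simp add: collapse_map_def blow_map_def)
  then show "collapse_map p = p" "blow_map p = p" by auto
qed

lemma collapse_map_cont: "continuous_map S S collapse_map"
proof (rule continuous_map_locally)
  fix p assume p: "p \<in> topspace S"
  show "\<exists>N. openin S N \<and> p \<in> N \<and> continuous_map (subtopology S N) S collapse_map"
  proof (cases "p \<in> g ` core")
    case False
    have "continuous_map (subtopology S (topspace S - g ` core)) S collapse_map"
      by (rule continuous_map_eq[of _ _ "\<lambda>p. p"])
         (auto simp: outside_core(1) intro: continuous_map_from_subtopology)
    then show ?thesis using core_image_closed p False by (intro exI[of _ "topspace S - g ` core"]) auto
  next
    case True
    have "continuous_map (subtopology S (g ` (open_square \<inter> H))) S (\<lambda>p. g (h (chart p)))"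
      by (rule lift_cont[OF continuous_on_subset[OF h_cont open_square_R] open_square_R]) (use h_R open_square_R in blast)
    then have "continuous_map (subtopology S (g ` (open_square \<inter> H))) S collapse_map"
      by (rule continuous_map_eq) (use open_square_R in \<open>auto simp: collapse_map_def\<close>)
    then show ?thesis using g_open True core_R by (intro exI[of _ "g ` (open_square \<inter> H)"]) blast
  qed
qed

lemma x_closed: "closedin S {x}"
  using S_haus x_in_S by (simp add: Hausdorff_imp_t1_space closedin_t1_singleton)

lemma blow_map_cont: "continuous_map (subtopology S (topspace S - {x})) S blow_map"
proof (rule continuous_map_locally)
  let ?X = "subtopology S (topspace S - {x})"
  fix p assume p: "p \<in> topspace ?X"
  show "\<exists>N. openin ?X N \<and> p \<in> N \<and> continuous_map (subtopology ?X N) S blow_map"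
  proof (cases "p \<in> g ` core")
    case False
    let ?N = "(topspace S - g ` core) \<inter> (topspace S - {x})"
    have o: "openin ?X ?N" using core_image_closed openin_subtopology_Int by blast
    have "continuous_map (subtopology ?X ?N) S blow_map"
      by (rule continuous_map_eq[of _ _ "\<lambda>p. p"])
         (auto simp: outside_core(2) intro!: continuous_map_from_subtopology)
    then show ?thesis using o p False by (intro exI[of _ ?N]) auto
  next
    case True
    let ?A = "open_square \<inter> H - {(0,0)}"
    let ?N = "g ` (open_square \<inter> H) \<inter> (topspace S - {x})"
    have o: "openin ?X ?N" using g_open openin_subtopology_Int by blast
    have N: "?N = g ` ?A" by (rule punctured_image)
    have A: "?A \<subseteq> R - {(0,0)}" "?A \<subseteq> R" using open_square_R by blast+
    have "continuous_map (subtopology S (g ` ?A)) S (\<lambda>p. g (G (chart p)))"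
      by (rule lift_cont[OF continuous_on_subset[OF G_cont A(1)] A(2)]) (use A(1) G_R in blast)
    then have "continuous_map (subtopology S (g ` ?A)) S blow_map"
      by (rule continuous_map_eq) (use A in \<open>auto simp: blow_map_def\<close>)
    moreover have "subtopology ?X ?N = subtopology S (g ` ?A)"

    proof -
      have "(topspace S - {x}) \<inter> ?N = g ` ?A" using N by blast
      then show ?thesis unfolding subtopology_subtopology by simp
    qed
    moreover have "p \<in> ?N" using True p core_R by auto
    ultimately show ?thesis using o by (intro exI[of _ ?N]) simp
  qed
qed

lemma C_closed: "closed C"
proof -
  have "closed (R \<inter> h -` {(0,0)})" by (rule continuous_closed_preimage[OF h_cont compact_imp_closed[OF compact_R]]) simp
  moreover have "R \<inter> h -` {(0,0)} = C" using h_zero C_R by auto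
  ultimately show ?thesis by simp
qed

lemma C_image_closed: "closedin S (g ` C)" by (rule g_closed_image[OF C_closed C_R])

end

text \<open>Because of \<open>drift\<close> the lifted flow hardly moves near \<open>C\<close> in bounded time, hence is continuous there.\<close>

locale blow_up_flow = slow_box + collapse_data +
  assumes drift: "\<And>q q'. q \<in> R \<Longrightarrow> q \<noteq> (0,0) \<Longrightarrow> q' \<in> R \<Longrightarrow> q' \<noteq> (0,0) \<Longrightarrow> dist q q' < lam q \<Longrightarrow>
    dist (G q) (G q') < norm q"
begin

definition blown :: "real \<Rightarrow> 'a \<Rightarrow> 'a" where
  "blown t p = (if p \<in> g ` C then p else blow_map (slowed t (collapse_map p)))"

lemma off_C: "p \<in> topspace S \<Longrightarrow> p \<notin> g ` C \<Longrightarrow> collapse_map p \<in> topspace S \<and> collapse_map p \<noteq> x"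
  using collapse_map_in collapse_map_eq_x by blast

lemma blown_off:
  assumes "p \<in> topspace S" "p \<notin> g ` C"
  shows "blown t p \<in> topspace S" "blown t p \<notin> g ` C" "collapse_map (blown t p) = slowed t (collapse_map p)"
proof -
  note c = off_C[OF assms]
  have s: "slowed t (collapse_map p) \<in> topspace S" "slowed t (collapse_map p) \<noteq> x" using slowed_in slowed_ne c by auto
  show "blown t p \<in> topspace S" "blown t p \<notin> g ` C" "collapse_map (blown t p) = slowed t (collapse_map p)"
    unfolding blown_def using assms(2) blow_map_in[OF s] blow_map_notin[OF s] collapse_blow[OF s] by simp_all
qed

lemma blown_semiconj: "p \<in> topspace S \<Longrightarrow> collapse_map (blown t p) = slowed t (collapse_map p)"
proof (cases "p \<in> g ` C")
  case True
  assume "p \<in> topspace S"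
  then have "collapse_map p = x" using collapse_map_eq_x True by blast
  then show ?thesis unfolding blown_def slowed_def using True by simp
qed (use blown_off in blast)

lemma blown_nbhd_off:
  assumes p: "p \<in> topspace S" "p \<notin> g ` C" and U: "openin S U" "blown t p \<in> U"
  shows "\<exists>N d. openin S N \<and> p \<in> N \<and> 0 < d \<and> (\<forall>q\<in>N. \<forall>t'. \<bar>t' - t\<bar> < d \<longrightarrow> blown t' q \<in> U)"
proof -
  note c = off_C[OF p]
  let ?X = "subtopology S (topspace S - {x})"
  have oX: "openin S (topspace S - {x})" using x_closed by blast
  let ?V = "{q \<in> topspace ?X. blow_map q \<in> U}"
  have V: "openin S ?V" using openin_continuous_map_preimage[OF blow_map_cont U(1)] oX openin_trans_full by blast
  have "slowed t (collapse_map p) \<in> ?V"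
    using U(2) slowed_in slowed_ne c p(2) unfolding blown_def by simp
  then obtain N d where N: "openin S N" "collapse_map p \<in> N" "0 < d" "\<forall>q\<in>N. \<forall>t'. \<bar>t' - t\<bar> < d \<longrightarrow> slowed t' q \<in> ?V"
    using slowed_continuous_off[of "collapse_map p" ?V t] c V by blast
  let ?N = "{q \<in> topspace S. collapse_map q \<in> N} \<inter> (topspace S - g ` C)"
  have "openin S ?N" using openin_continuous_map_preimage[OF collapse_map_cont N(1)] C_image_closed by blast
  moreover have "p \<in> ?N" using p N(2) by blast
  moreover have "blown t' q \<in> U" if "q \<in> ?N" "\<bar>t' - t\<bar> < d" for q t'
    using N(4) that unfolding blown_def by simp
  ultimately show ?thesis using N(3) by blast
qed

lemma blown_nbhd_on:
  assumes p: "p \<in> g ` C" and U: "openin S U" "p \<in> U"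
  shows "\<exists>N d. openin S N \<and> p \<in> N \<and> 0 < d \<and> (\<forall>q\<in>N. \<forall>t'. \<bar>t' - t\<bar> < d \<longrightarrow> blown t' q \<in> U)"
proof -
  obtain c where c: "c \<in> C" "p = g c" using p by blast
  have cR: "c \<in> R" using c C_R by blast
  have c0: "h c = (0,0)" using h_zero[OF cR] c by simp
  have c_core: "\<bar>fst c\<bar> < 1/2" "\<bar>snd c\<bar> < 1/2"
  proof -
    have "\<not> (1/2 \<le> \<bar>fst c\<bar> \<or> 1/2 \<le> \<bar>snd c\<bar>)" using h_id[OF cR] c0 by auto
    then show "\<bar>fst c\<bar> < 1/2" "\<bar>snd c\<bar> < 1/2" by auto
  qed
  have "openin (top_of_set R) {q \<in> topspace (top_of_set R). g q \<in> U}" by (rule openin_continuous_map_preimage[OF g_cont U(1)])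
  moreover have "c \<in> {q \<in> topspace (top_of_set R). g q \<in> U}" using cR c U(2) by simp
  ultimately obtain e0 where e0: "e0 > 0" "ball c e0 \<inter> R \<subseteq> {q \<in> topspace (top_of_set R). g q \<in> U}" unfolding openin_contains_ball by blast
  \<comment> \<open>The last bound makes points with collapsed norm below \<open>e/2\<close> drift
    by less than \<open>lam\<close> during all times up to \<open>|t| + 1\<close>; the bound 1/8 is
    the range of \<open>slowed_drift\<close>.\<close>
  define e where "e = min e0 (min (1/8) (\<sigma> / (24 * (\<bar>t\<bar> + 1))))"
  have "0 < \<sigma> / (24 * (\<bar>t\<bar> + 1))" using \<sigma>_pos by simp
  then have e: "0 < e" "e \<le> e0" "e \<le> 1/8" "e \<le> \<sigma> / (24 * (\<bar>t\<bar> + 1))"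
  proof -
    show "0 < e" unfolding e_def using e0(1) \<open>0 < \<sigma> / (24 * (\<bar>t\<bar> + 1))\<close> by simp
    show "e \<le> e0" "e \<le> 1/8" "e \<le> \<sigma> / (24 * (\<bar>t\<bar> + 1))" unfolding e_def
      by (rule min.cobounded1, rule order_trans[OF min.cobounded2 min.cobounded1], rule order_trans[OF min.cobounded2 min.cobounded2])
  qed
  have "openin (top_of_set R) (R \<inter> h -` ball (0,0) (e/2))" by (rule continuous_openin_preimage_gen[OF h_cont open_ball])
  then obtain W where W: "open W" "R \<inter> h -` ball (0,0) (e/2) = R \<inter> W" unfolding openin_open by blast
  let ?D = "W \<inter> ball c (min (1/2) (e/2))"
  have "open ?D" using W(1) by blast
  moreover have "?D \<inter> R \<subseteq> open_square"
  proof
    fix z assume z: "z \<in> ?D \<inter> R"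
    then have "dist c z < 1/2" by simp
    then have "dist (fst c) (fst z) < 1/2" "dist (snd c) (snd z) < 1/2" using dist_fst_le[of c z] dist_snd_le[of c z] by linarith+
    then have "\<bar>fst z\<bar> < 1" "\<bar>snd z\<bar> < 1" using c_core unfolding dist_real_def by linarith+
    then show "z \<in> open_square" unfolding open_square_def by (cases z) (auto simp: abs_less_iff)
  qed
  ultimately have N: "openin S (g ` (?D \<inter> R))" by (rule g_open_image)
  have "c \<in> R \<inter> W" unfolding W(2)[symmetric] using cR c0 e(1) by simp
  then have pN: "p \<in> g ` (?D \<inter> R)" using c e(1) by auto
  have "blown t' q \<in> U" if q: "q \<in> g ` (?D \<inter> R)" and t': "\<bar>t' - t\<bar> < 1" for q t'
  proof -
    obtain z where z: "z \<in> R" "z \<in> W" "dist c z < e/2" "q = g z" using q by auto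
    have in_U: "g z' \<in> U" if "z' \<in> R" "dist c z' < e" for z'
    proof -
      have "z' \<in> ball c e0 \<inter> R" using that e(2) by simp
      then show ?thesis using e0(2) by blast
    qed
    show ?thesis
    proof (cases "z \<in> C")
      case True
      then show ?thesis unfolding blown_def using z in_U[OF z(1)] e(1) by auto
    next
      case False
      let ?q = "h z"
      have q0: "?q \<in> R" "?q \<noteq> (0,0)" using h_R z(1) h_zero[OF z(1)] False by auto
      have "z \<in> R \<inter> h -` ball (0,0) (e/2)" using z W(2) by blast
      then have nq: "norm ?q < e/2" by (simp add: dist_norm zero_prod_def[symmetric])
      have npos: "0 < norm ?q" using q0(2) by (simp add: zero_prod_def)
      have "\<bar>t'\<bar> < \<bar>t\<bar> + 1" using t' by linarith
      also have "\<dots> \<le> \<sigma> / (12 * norm ?q)"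
      proof -
        have "norm ?q \<le> \<sigma> / (24 * (\<bar>t\<bar> + 1))" using nq e(1,4) by linarith
        then have "norm ?q * (24 * (\<bar>t\<bar> + 1)) \<le> \<sigma>" by (simp add: pos_le_divide_eq)
        moreover have "norm ?q * (12 * (\<bar>t\<bar> + 1)) \<le> norm ?q * (24 * (\<bar>t\<bar> + 1))" by (intro mult_left_mono) auto
        ultimately have "norm ?q * (12 * (\<bar>t\<bar> + 1)) \<le> \<sigma>" by (rule order_trans[rotated])
        then have "(\<bar>t\<bar> + 1) * (12 * norm ?q) \<le> \<sigma>" by (simp only: mult_ac)
        moreover have "0 < 12 * norm ?q" using npos by simp
        ultimately show ?thesis by (simp only: pos_le_divide_eq)
      qed
      finally obtain q' where q': "q' \<in> R" "q' \<noteq> (0,0)" "dist ?q q' < lam ?q" "slowed t' (g ?q) = g q'"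
        using slowed_drift[OF q0] nq e(3) by force
      have "dist (G ?q) (G q') < norm ?q" by (rule drift[OF q0 q'(1,2,3)])
      \<comment> \<open>One half of \<open>e\<close> is the distance of \<open>z\<close> from
        \<open>c\<close>, the other the drift, which is below \<open>norm ?q\<close>.\<close>
      then have "dist c (G q') < e" using z(3) nq Gh[OF z(1) False] dist_triangle[of c "G q'" z] by simp
      moreover have "q \<notin> g ` C" using False z(1,4) inj_on_image_mem_iff[OF g_inj z(1) C_R] by simp
      then have "blown t' q = g (G q')" unfolding blown_def using z(1,4) collapse_map_g q'(4) blow_map_g[OF q'(1)] by simp
      ultimately show ?thesis using in_U[OF G_R[OF q'(1,2)]] by simp
    qed
  qed
  then show ?thesis using N pN by (intro exI[of _ "g ` (?D \<inter> R)"] exI[of _ 1]) auto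
qed

lemma blown_flow: "flow_on S blown"
  unfolding flow_on_def
proof (intro conjI ballI allI)
  show "continuous_map (prod_topology euclideanreal S) S (\<lambda>(t, p). blown t p)"
    unfolding continuous_map_nbhd
  proof (intro ballI conjI allI impI)
    fix z assume z: "z \<in> topspace (prod_topology euclideanreal S)"
    then have p: "snd z \<in> topspace S" by auto
    show "(case z of (t, p) \<Rightarrow> blown t p) \<in> topspace S"
      using blown_off(1)[OF p] p unfolding case_prod_unfold by (cases "snd z \<in> g ` C") (auto simp: blown_def)
    fix U assume U: "openin S U \<and> (case z of (t, p) \<Rightarrow> blown t p) \<in> U"
    have "\<exists>N d. openin S N \<and> snd z \<in> N \<and> 0 < d \<and> (\<forall>q\<in>N. \<forall>t'. \<bar>t' - fst z\<bar> < d \<longrightarrow> blown t' q \<in> U)"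
    proof (cases "snd z \<in> g ` C")
      case True
      then have "snd z \<in> U" using U unfolding case_prod_unfold blown_def by simp
      then show ?thesis using blown_nbhd_on[OF True] U by blast
    next
      case False
      show ?thesis by (rule blown_nbhd_off[OF p False]) (use U in \<open>auto simp: case_prod_unfold\<close>)
    qed
    then obtain N d where N: "openin S N" "snd z \<in> N" "0 < d" "\<forall>q\<in>N. \<forall>t'. \<bar>t' - fst z\<bar> < d \<longrightarrow> blown t' q \<in> U" by blast
    show "\<exists>M. openin (prod_topology euclideanreal S) M \<and> z \<in> M \<and> (\<forall>q\<in>M. (case q of (t, p) \<Rightarrow> blown t p) \<in> U)"
    proof (intro exI[of _ "ball (fst z) d \<times> N"] conjI ballI)
      show "openin (prod_topology euclideanreal S) (ball (fst z) d \<times> N)" using N(1) by (simp add: openin_prod_Times_iff)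
      show "z \<in> ball (fst z) d \<times> N" using N(2,3) by (cases z) simp
      show "(case q of (t, p) \<Rightarrow> blown t p) \<in> U" if "q \<in> ball (fst z) d \<times> N" for q
        using N(4) that by (auto simp: dist_real_def abs_minus_commute)
    qed
  qed
  fix p assume p: "p \<in> topspace S"
  show "blown 0 p = p"
    using slowed_zero off_C[OF p] blow_collapse[OF p] unfolding blown_def by auto
  fix s t
  show "blown (s + t) p = blown s (blown t p)"
  proof (cases "p \<in> g ` C")
    case False
    then show ?thesis using blown_off[OF p False, of t] slowed_add off_C[OF p False] unfolding blown_def[of s] blown_def[of "s + t"] by simp
  qed (simp add: blown_def)
qed

end

section \<open>Singular replacements\<close>

text \<open>A description of singular replacements that mentions neither a box nor a speed. The
  range of \<open>\<tau>\<close> is determined by \<open>v\<close>, \<open>x\<close> and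
  \<open>p\<close> alone, so only the parametrization of the orbits is left open.\<close>

definition slowing_at ::
  "'a topology \<Rightarrow> (real \<Rightarrow> 'a \<Rightarrow> 'a) \<Rightarrow> 'a \<Rightarrow> (real \<Rightarrow> 'a \<Rightarrow> 'a) \<Rightarrow> bool" where
  "slowing_at X v x w \<longleftrightarrow> (\<forall>t. w t x = x) \<and>
     (\<forall>p\<in>topspace X - {x}. \<exists>\<tau>. strict_mono \<tau> \<and> range \<tau> = avoiding_times v x p \<and> \<tau> 0 = 0 \<and>
        (\<forall>t. w t p = v (\<tau> t) p))"

text \<open>The two reparametrizations of an orbit have the same range, so they differ by an
  increasing bijection of the line; the homeomorphism is the identity.\<close>

lemma slowing_at_equivalent:
  assumes "slowing_at X v x w1" "slowing_at X v x w2"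
  shows "topologically_equivalent X w1 X w2"
  unfolding topologically_equivalent_def
proof (rule exI[of _ id], intro conjI ballI)
  show "homeomorphic_map X X id" by simp
  fix p assume p: "p \<in> topspace X"
  show "\<exists>\<tau>. strict_mono \<tau> \<and> surj \<tau> \<and> (\<forall>t. id (w1 t p) = w2 (\<tau> t) (id p))"
  proof (cases "p = x")
    case True
    have "strict_mono (\<lambda>t::real. t)" "surj (\<lambda>t::real. t)" by (auto simp: strict_mono_def)
    then show ?thesis using assms True unfolding slowing_at_def by (intro exI[of _ "\<lambda>t. t"]) simp
  next
    case False
    obtain \<tau>1 where 1: "strict_mono \<tau>1" "range \<tau>1 = avoiding_times v x p" "\<forall>t. w1 t p = v (\<tau>1 t) p"
      using assms(1) p False unfolding slowing_at_def by blast
    obtain \<tau>2 where 2: "strict_mono \<tau>2" "range \<tau>2 = avoiding_times v x p" "\<forall>t. w2 t p = v (\<tau>2 t) p"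
      using assms(2) p False unfolding slowing_at_def by blast
    have "\<forall>t. \<exists>s. \<tau>2 s = \<tau>1 t" using 1(2) 2(2) by (metis rangeE rangeI)
    then obtain \<tau> where \<tau>: "\<And>t. \<tau>2 (\<tau> t) = \<tau>1 t" by metis
    have "strict_mono \<tau>"
      using 1(1) 2(1) \<tau> unfolding strict_mono_def by (metis 2(1) strict_mono_less)
    moreover have "\<exists>t. s = \<tau> t" for s
    proof -
      obtain t where "\<tau>1 t = \<tau>2 s" using 1(2) 2(2) by (metis rangeE rangeI)
      then have "\<tau>2 (\<tau> t) = \<tau>2 s" using \<tau> by simp
      then show ?thesis using strict_mono_eq[OF 2(1)] by metis
    qed
    then have "surj \<tau>" unfolding surj_def by blast
    ultimately show ?thesis using 1(3) 2(3) \<tau> by (metis id_apply)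
  qed
qed

lemma (in time_change) slowing_at_slowed: "slowing_at X v x slowed"
  unfolding slowing_at_def
proof (intro conjI allI ballI)
  show "slowed t x = x" for t unfolding slowed_def by simp
  fix p assume "p \<in> topspace X - {x}"
  then have p: "p \<in> topspace X" "p \<noteq> x" by auto
  show "\<exists>\<tau>. strict_mono \<tau> \<and> range \<tau> = before p \<and> \<tau> 0 = 0 \<and> (\<forall>t. slowed t p = v (\<tau> t) p)"
  proof (intro exI[of _ "\<lambda>t. clock t p"] conjI allI)
    show "strict_mono (\<lambda>t. clock t p)" using clock_strict_mono[OF p] by (simp add: strict_mono_def)
    show "range (\<lambda>t. clock t p) = before p"
      using clock(1)[OF p] clock_surj[OF p(1)] by (metis (no_types, lifting) image_subset_iff rangeI subsetI subset_antisym)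
    show "clock 0 p = 0" by (rule clock_0[OF p])
    show "slowed t p = v (clock t p) p" for t unfolding slowed_def using p by simp
  qed
qed

section \<open>Every singular replacement is a reparametrization of the flow outside the new
  singular point\<close>

definition arc_in :: "(real \<Rightarrow> 'a \<Rightarrow> 'a) \<Rightarrow> 'a set \<Rightarrow> 'a \<Rightarrow> 'a \<Rightarrow> bool" where
  "arc_in f A p q \<longleftrightarrow> (\<exists>t\<ge>0. f t p = q \<and> (\<forall>s\<in>{0..t}. f s p \<in> A))"

text \<open>The orbit of \<open>w\<close> through \<open>p\<close> follows that of \<open>v\<close> for the \<open>w\<close>-time \<open>T\<close>. The condition on the image
  says that \<open>\<tau>\<close> is continuous.\<close>

definition follows :: "(real \<Rightarrow> 'a \<Rightarrow> 'a) \<Rightarrow> (real \<Rightarrow> 'a \<Rightarrow> 'a) \<Rightarrow> 'a \<Rightarrow> real \<Rightarrow> bool" where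
  "follows v w p T \<longleftrightarrow> (\<exists>\<tau>. \<tau> 0 = 0 \<and> strict_mono_on {0..T} \<tau> \<and> \<tau> ` {0..T} = {0..\<tau> T} \<and>
     (\<forall>s\<in>{0..T}. w s p = v (\<tau> s) p))"

lemma follows_less: "follows v w p T \<Longrightarrow> 0 \<le> T' \<Longrightarrow> T' \<le> T \<Longrightarrow> follows v w p T'"
proof -
  assume "follows v w p T" and T: "0 \<le> T'" "T' \<le> T"
  then obtain \<tau> where \<tau>: "\<tau> 0 = 0" "strict_mono_on {0..T} \<tau>" "\<tau> ` {0..T} = {0..\<tau> T}" "\<forall>s\<in>{0..T}. w s p = v (\<tau> s) p"
    unfolding follows_def by blast
  have le: "\<tau> s \<le> \<tau> t \<longleftrightarrow> s \<le> t" if "s \<in> {0..T}" "t \<in> {0..T}" for s t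
    using strict_mono_on_leD[OF \<tau>(2)] strict_mono_onD[OF \<tau>(2)] that by (metis linorder_not_le)
  have "\<tau> ` {0..T'} = {0..\<tau> T'}"
  proof (intro set_eqI iffI)
    fix y assume "y \<in> \<tau> ` {0..T'}"
    then obtain s where s: "s \<in> {0..T'}" "y = \<tau> s" by blast
    have "\<tau> 0 \<le> \<tau> s" "\<tau> s \<le> \<tau> T'" using le[of 0 s] le[of s T'] s T by auto
    then show "y \<in> {0..\<tau> T'}" using \<tau>(1) s by simp
  next
    fix y assume y: "y \<in> {0..\<tau> T'}"
    then have "y \<in> {0..\<tau> T}" using le[of T' T] T by auto
    then obtain s where s: "s \<in> {0..T}" "y = \<tau> s" using \<tau>(3) by blast
    then have "s \<le> T'" using le[of s T'] y T by auto
    then show "y \<in> \<tau> ` {0..T'}" using s by auto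
  qed
  moreover have "strict_mono_on {0..T'} \<tau>" using \<tau>(2) T by (auto simp: strict_mono_on_def)
  ultimately show ?thesis unfolding follows_def using \<tau>(1,4) T by (intro exI[of _ \<tau>]) auto
qed

lemma follows_shift:
  assumes v: "flow_on X v" and w: "flow_on X w" and p: "p \<in> topspace X"
    and f: "follows v w p T" and a: "0 \<le> a" "a \<le> T"
  shows "follows v w (w a p) (T - a)"
proof -
  obtain \<tau> where \<tau>: "\<tau> 0 = 0" "strict_mono_on {0..T} \<tau>" "\<tau> ` {0..T} = {0..\<tau> T}" "\<forall>s\<in>{0..T}. w s p = v (\<tau> s) p"
    using f unfolding follows_def by blast
  have le: "\<tau> s \<le> \<tau> t \<longleftrightarrow> s \<le> t" if "s \<in> {0..T}" "t \<in> {0..T}" for s t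
    using strict_mono_on_leD[OF \<tau>(2)] strict_mono_onD[OF \<tau>(2)] that by (metis linorder_not_le)
  show ?thesis unfolding follows_def
  proof (intro exI[of _ "\<lambda>s. \<tau> (a + s) - \<tau> a"] conjI ballI)
    show "\<tau> (a + 0) - \<tau> a = 0" by simp
    show "strict_mono_on {0..T - a} (\<lambda>s. \<tau> (a + s) - \<tau> a)"
      using \<tau>(2) a by (auto simp: strict_mono_on_def)
    show "(\<lambda>s. \<tau> (a + s) - \<tau> a) ` {0..T - a} = {0..\<tau> (a + (T - a)) - \<tau> a}"
    proof (intro set_eqI iffI)
      fix y assume "y \<in> (\<lambda>s. \<tau> (a + s) - \<tau> a) ` {0..T - a}"
      then obtain s where s: "s \<in> {0..T - a}" "y = \<tau> (a + s) - \<tau> a" by blast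
      then show "y \<in> {0..\<tau> (a + (T - a)) - \<tau> a}" using le[of a "a + s"] le[of "a + s" T] a by auto
    next
      fix y assume y: "y \<in> {0..\<tau> (a + (T - a)) - \<tau> a}"
      have "0 \<le> \<tau> a" using le[of 0 a] \<tau>(1) a by auto
      then have "y + \<tau> a \<in> {0..\<tau> T}" using y by auto
      then obtain s where s: "s \<in> {0..T}" "y + \<tau> a = \<tau> s" using \<tau>(3) by (metis imageE)
      then have "a \<le> s" using le[of a s] y a by auto
      then show "y \<in> (\<lambda>s. \<tau> (a + s) - \<tau> a) ` {0..T - a}" using s by (intro image_eqI[of _ _ "s - a"]) auto
    qed
    fix s assume s: "s \<in> {0..T - a}"
    have "w s (w a p) = w (a + s) p" using flow_continuous(3)[OF w p, of s a] by (simp add: add.commute)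
    also have "\<dots> = v (\<tau> (a + s) - \<tau> a + \<tau> a) p" using \<tau>(4) s a by simp
    also have "\<dots> = v (\<tau> (a + s) - \<tau> a) (v (\<tau> a) p)" by (rule flow_continuous(3)[OF v p])
    finally show "w s (w a p) = v (\<tau> (a + s) - \<tau> a) (w a p)" using \<tau>(4) a by simp
  qed
qed

lemma follows_trans:
  assumes v: "flow_on X v" and w: "flow_on X w" and p: "p \<in> topspace X"
    and f: "follows v w p T" "follows v w (w T p) T'" and T: "0 \<le> T" "0 \<le> T'"
  shows "follows v w p (T + T')"
proof -
  obtain \<tau> where \<tau>: "\<tau> 0 = 0" "strict_mono_on {0..T} \<tau>" "\<tau> ` {0..T} = {0..\<tau> T}" "\<forall>s\<in>{0..T}. w s p = v (\<tau> s) p"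
    using f unfolding follows_def by blast
  obtain \<tau>' where \<tau>': "\<tau>' 0 = 0" "strict_mono_on {0..T'} \<tau>'" "\<tau>' ` {0..T'} = {0..\<tau>' T'}" "\<forall>s\<in>{0..T'}. w s (w T p) = v (\<tau>' s) (w T p)"
    using f unfolding follows_def by blast
  have le: "\<tau> s \<le> \<tau> t" if "0 \<le> s" "s \<le> t" "t \<le> T" for s t
    using strict_mono_on_leD[OF \<tau>(2)] that by auto
  have le': "\<tau>' s \<le> \<tau>' t" if "0 \<le> s" "s \<le> t" "t \<le> T'" for s t
    using strict_mono_on_leD[OF \<tau>'(2)] that by auto
  define \<rho> where "\<rho> s = (if s \<le> T then \<tau> s else \<tau> T + \<tau>' (s - T))" for s
  have \<rho>2: "\<rho> s = \<tau> T + \<tau>' (s - T)" if "T \<le> s" for s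
    using that \<tau>'(1) unfolding \<rho>_def by (cases "s = T") auto
  show ?thesis unfolding follows_def
  proof (intro exI[of _ \<rho>] conjI ballI)
    show "\<rho> 0 = 0" unfolding \<rho>_def using T \<tau>(1) by simp
    show "strict_mono_on {0..T + T'} \<rho>"
    proof (rule strict_mono_onI)
      fix r s assume rs: "r \<in> {0..T + T'}" "s \<in> {0..T + T'}" "r < s"
      consider "s \<le> T" | "T \<le> r" | "r < T" "T < s" by linarith
      then show "\<rho> r < \<rho> s"
      proof cases
        case 1 then show ?thesis unfolding \<rho>_def using strict_mono_onD[OF \<tau>(2), of r s] rs by auto
      next
        case 2 then show ?thesis using \<rho>2[of r] \<rho>2[of s] strict_mono_onD[OF \<tau>'(2), of "r - T" "s - T"] rs by auto
      next
        case 3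
        then have "\<tau> r < \<tau> T" using strict_mono_onD[OF \<tau>(2), of r T] rs by auto
        moreover have "0 \<le> \<tau>' (s - T)" using le'[of 0 "s - T"] \<tau>'(1) 3 rs by auto
        ultimately show ?thesis using 3 unfolding \<rho>_def by simp
      qed
    qed
    show "\<rho> ` {0..T + T'} = {0..\<rho> (T + T')}"
    proof -
      have "{0..T + T'} = {0..T} \<union> {T..T + T'}" using T by auto
      moreover have "\<rho> ` {0..T} = {0..\<tau> T}" unfolding \<tau>(3)[symmetric] by (rule image_cong) (auto simp: \<rho>_def)
      moreover have "\<rho> ` {T..T + T'} = {\<tau> T..\<tau> T + \<tau>' T'}"
      proof (intro set_eqI iffI)
        fix y assume "y \<in> \<rho> ` {T..T + T'}"
        then obtain s where s: "s \<in> {T..T + T'}" "y = \<rho> s" by blast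
        then show "y \<in> {\<tau> T..\<tau> T + \<tau>' T'}" using \<rho>2[of s] le'[of 0 "s - T"] le'[of "s - T" T'] \<tau>'(1) by auto
      next
        fix y assume "y \<in> {\<tau> T..\<tau> T + \<tau>' T'}"
        then have "y - \<tau> T \<in> {0..\<tau>' T'}" by auto
        then obtain s where s: "s \<in> {0..T'}" "y - \<tau> T = \<tau>' s" using \<tau>'(3) by (metis imageE)
        then show "y \<in> \<rho> ` {T..T + T'}" using \<rho>2[of "T + s"] by (intro image_eqI[of _ _ "T + s"]) auto
      qed
      moreover have "0 \<le> \<tau> T" "0 \<le> \<tau>' T'" using le[of 0 T] le'[of 0 T'] \<tau>(1) \<tau>'(1) T by auto
      moreover have "\<rho> (T + T') = \<tau> T + \<tau>' T'" using \<rho>2[of "T + T'"] T by simp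
      ultimately show ?thesis by (auto simp: image_Un)
    qed
    fix s assume s: "s \<in> {0..T + T'}"
    show "w s p = v (\<rho> s) p"
    proof (cases "s \<le> T")
      case True then show ?thesis using \<tau>(4) s unfolding \<rho>_def by simp
    next
      case False
      have "w s p = w (s - T) (w T p)" using flow_continuous(3)[OF w p, of "s - T" T] by simp
      also have "\<dots> = v (\<tau>' (s - T)) (w T p)" using \<tau>'(4) s False by simp
      also have "\<dots> = v (\<tau>' (s - T)) (v (\<tau> T) p)" using \<tau>(4) T by simp
      also have "\<dots> = v (\<tau>' (s - T) + \<tau> T) p" using flow_continuous(3)[OF v p] by simp
      finally show ?thesis using False unfolding \<rho>_def by (simp add: add.commute)
    qed
  qed
qed

lemma singular_if_constant_on_interval:
  assumes "flow_on X v" "p \<in> topspace X" "0 < d" "\<And>t. t \<in> {0..d} \<Longrightarrow> v t p = p"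
  shows "singular_point v p"
  by (rule singular_if_locally_constant[OF assms(1,2,3)]) (use assms(4) in auto)

text \<open>A flow and a singular replacement of it, with the integral curves already translated
  into reachability inside the box. The flows are known to agree outside only in forward
  time.\<close>

locale two_flows = box_chart +
  fixes v w :: "real \<Rightarrow> 'a \<Rightarrow> 'a"
  assumes v_flow: "flow_on S v" and w_flow: "flow_on S w"
    and v_arc: "\<And>p q. p \<in> R \<Longrightarrow> q \<in> R \<Longrightarrow> arc_in v (g ` R) (g p) (g q) \<longleftrightarrow> snd p = snd q \<and> fst p \<le> fst q"
    and w_arc: "\<And>p q. p \<in> R \<Longrightarrow> q \<in> R \<Longrightarrow> arc_in w (g ` R) (g p) (g q) \<longleftrightarrow> slow_le p q"
    and outside: "\<And>p t s. p \<in> topspace S \<Longrightarrow> 0 \<le> t \<Longrightarrow> (\<And>s. s \<in> {0..t} \<Longrightarrow> v s p \<notin> g ` R) \<Longrightarrow> s \<in> {0..t} \<Longrightarrow> w s p = v s p"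
begin

text \<open>By \<open>mono\<close> the orbit arc runs horizontally and never backwards. If it paused
  on a time interval, its point would be singular and the orbit constant, contrary to
  \<open>a < b\<close>.\<close>

lemma arc_parametrization:
  assumes f: "flow_on S f"
    and mono: "\<And>p q. p \<in> R \<Longrightarrow> q \<in> R \<Longrightarrow> arc_in f (g ` R) (g p) (g q) \<Longrightarrow> snd p = snd q \<and> fst p \<le> fst q"
    and ab: "(a, u) \<in> R" "(b, u) \<in> R" "a < b" "arc_in f (g ` R) (g (a, u)) (g (b, u))"
  shows "\<exists>T>0. \<exists>\<alpha>. \<alpha> 0 = a \<and> \<alpha> T = b \<and> strict_mono_on {0..T} \<alpha> \<and> continuous_on {0..T} \<alpha> \<and>
    (\<forall>s\<in>{0..T}. f s (g (a, u)) = g (\<alpha> s, u) \<and> (\<alpha> s, u) \<in> R)"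
proof -
  let ?p = "g (a, u)"
  have pS: "?p \<in> topspace S" using g_in ab(1) by blast
  obtain T where T: "0 \<le> T" "f T ?p = g (b, u)" "\<forall>s\<in>{0..T}. f s ?p \<in> g ` R" using ab(4) unfolding arc_in_def by blast
  have "T \<noteq> 0" using T(2) flow_continuous(2)[OF f pS] ab(3) inj_on_eq_iff[OF g_inj ab(1,2)] by force
  then have T0: "0 < T" using T(1) by simp
  define q where "q s = chart (f s ?p)" for s
  have q: "q s \<in> R" "f s ?p = g (q s)" if "s \<in> {0..T}" for s
    using T(3) that chart_in[of "f s ?p"] unfolding q_def by auto
  have step: "arc_in f (g ` R) (g (q s)) (g (q t))" if "0 \<le> s" "s \<le> t" "t \<le> T" for s t
    unfolding arc_in_def
  proof (intro exI[of _ "t - s"] conjI ballI)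
    have "f r (g (q s)) = f (s + r) ?p" for r
      using q(2)[of s] that flow_continuous(3)[OF f pS, of r s] by (simp add: add.commute)
    then show "f (t - s) (g (q s)) = g (q t)" "\<And>r. r \<in> {0..t - s} \<Longrightarrow> f r (g (q s)) \<in> g ` R"
      using q(2)[of t] T(3) that by auto
  qed (use that in simp)
  have q0: "q 0 = (a, u)" unfolding q_def using flow_continuous(2)[OF f pS] chart_g[OF ab(1)] by simp
  have qT: "q T = (b, u)" unfolding q_def using T(2) chart_g[OF ab(2)] by simp
  define \<alpha> where "\<alpha> s = fst (q s)" for s
  have qa: "q s = (\<alpha> s, u)" if "s \<in> {0..T}" for s
  proof -
    have "snd (q 0) = snd (q s)" using mono[OF q(1) q(1) step[of 0 s]] that T0 by auto
    then show ?thesis unfolding \<alpha>_def using q0 by (simp add: prod_eq_iff)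
  qed
  have le: "\<alpha> s \<le> \<alpha> t" if "0 \<le> s" "s \<le> t" "t \<le> T" for s t
    using mono[OF q(1) q(1) step[OF that]] that unfolding \<alpha>_def by simp
  have "strict_mono_on {0..T} \<alpha>"
  proof (rule strict_mono_onI)
    fix r s assume rs: "r \<in> {0..T}" "s \<in> {0..T}" "r < s"
    have "\<alpha> r \<noteq> \<alpha> s"
    proof
      assume eq: "\<alpha> r = \<alpha> s"
      have const: "f t (g (q r)) = g (q r)" if "t \<in> {0..s - r}" for t
      proof -
        have t: "r + t \<in> {0..T}" using that rs by auto
        have "\<alpha> (r + t) = \<alpha> r" using le[of r "r + t"] le[of "r + t" s] that rs eq by auto
        then have "q (r + t) = q r" using qa[OF t] qa[OF rs(1)] by simp
        moreover have "f t (g (q r)) = f (r + t) ?p"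
          using q(2)[OF rs(1)] flow_continuous(3)[OF f pS, of t r] by (simp add: add.commute)
        ultimately show ?thesis using q(2)[OF t] by simp
      qed
      have "singular_point f (g (q r))"
        by (rule singular_if_constant_on_interval[OF f g_in[OF q(1)[OF rs(1)]], of "s - r"]) (use rs const in auto)
      then have sing: "f t (g (q r)) = g (q r)" for t unfolding singular_point_def by blast
      have fr: "f t (g (q r)) = f (t + r) ?p" for t
        using q(2)[OF rs(1)] flow_continuous(3)[OF f pS, of t r] by simp
      have "?p = g (q r)" using sing[of "- r"] fr[of "- r"] flow_continuous(2)[OF f pS] by simp
      moreover have "g (b, u) = g (q r)" using sing[of "T - r"] fr[of "T - r"] T(2) by simp
      ultimately have "g (a, u) = g (b, u)" by simp
      then show False using inj_on_eq_iff[OF g_inj ab(1,2)] ab(3) by simp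
    qed
    then show "\<alpha> r < \<alpha> s" using le[of r s] rs by auto
  qed
  moreover have "continuous_on {0..T} \<alpha>"
  proof -
    have "continuous_map (top_of_set {0..T}) S (\<lambda>s. f s ?p)"
      using flow_continuous_compose[OF f, of "top_of_set {0..T}" "\<lambda>s. s" "\<lambda>_. ?p"] pS by simp
    then have "continuous_map (top_of_set {0..T}) (subtopology S (g ` R)) (\<lambda>s. f s ?p)"
      using T(3) by (auto simp: continuous_map_in_subtopology)
    from continuous_map_compose[OF this chart_cont] have "continuous_on {0..T} q"
      by (simp add: o_def q_def continuous_map_in_subtopology)
    then show ?thesis unfolding \<alpha>_def by (rule continuous_on_fst)
  qed
  moreover have "\<alpha> 0 = a" "\<alpha> T = b" unfolding \<alpha>_def using q0 qT by auto
  moreover have "f s ?p = g (\<alpha> s, u) \<and> (\<alpha> s, u) \<in> R" if "s \<in> {0..T}" for s using q[OF that] qa[OF that] by simp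
  ultimately show ?thesis using T0 by blast
qed

lemma strict_mono_on_image:
  fixes \<alpha> :: "real \<Rightarrow> real"
  assumes "0 \<le> T" "strict_mono_on {0..T} \<alpha>" "continuous_on {0..T} \<alpha>"
  shows "\<alpha> ` {0..T} = {\<alpha> 0..\<alpha> T}"
proof (intro set_eqI iffI)
  fix y assume "y \<in> \<alpha> ` {0..T}"
  then show "y \<in> {\<alpha> 0..\<alpha> T}" using strict_mono_on_leD[OF assms(2)] assms(1) by fastforce
next
  fix y assume "y \<in> {\<alpha> 0..\<alpha> T}"
  then have "\<exists>s\<ge>0. s \<le> T \<and> \<alpha> s = y" using assms by (intro IVT') auto
  then show "y \<in> \<alpha> ` {0..T}" by auto
qed

text \<open>Both flows sweep the same horizontal segment strictly monotonically;
  \<open>\<tau>\<close> is one sweep followed by the inverse of the other.\<close>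

lemma follows_in_box:
  assumes ab: "(a, u) \<in> R" "(b, u) \<in> R" "a < b" "slow_le (a, u) (b, u)"
  shows "\<exists>T>0. follows v w (g (a, u)) T \<and> w T (g (a, u)) = g (b, u)"
proof -
  have wm: "snd p = snd q \<and> fst p \<le> fst q" if "p \<in> R" "q \<in> R" "arc_in w (g ` R) (g p) (g q)" for p q
    using w_arc[OF that(1,2)] that(3) unfolding slow_le_def by blast
  have vm: "snd p = snd q \<and> fst p \<le> fst q" if "p \<in> R" "q \<in> R" "arc_in v (g ` R) (g p) (g q)" for p q
    using v_arc[OF that(1,2)] that(3) by blast
  have wa: "arc_in w (g ` R) (g (a, u)) (g (b, u))" and va: "arc_in v (g ` R) (g (a, u)) (g (b, u))"
    using w_arc[OF ab(1,2)] v_arc[OF ab(1,2)] ab(3,4) by auto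
  have "\<exists>T>0. \<exists>\<alpha>. \<alpha> 0 = a \<and> \<alpha> T = b \<and> strict_mono_on {0..T} \<alpha> \<and> continuous_on {0..T} \<alpha> \<and>
    (\<forall>s\<in>{0..T}. w s (g (a, u)) = g (\<alpha> s, u) \<and> (\<alpha> s, u) \<in> R)"
    by (rule arc_parametrization[OF w_flow _ ab(1,2,3) wa]) (rule wm)
  then obtain T \<alpha> where \<alpha>: "0 < T" "\<alpha> 0 = a" "\<alpha> T = b" "strict_mono_on {0..T} \<alpha>" "continuous_on {0..T} \<alpha>"
    "\<forall>s\<in>{0..T}. w s (g (a, u)) = g (\<alpha> s, u) \<and> (\<alpha> s, u) \<in> R"
    by (elim exE conjE) blast
  have "\<exists>T>0. \<exists>\<alpha>. \<alpha> 0 = a \<and> \<alpha> T = b \<and> strict_mono_on {0..T} \<alpha> \<and> continuous_on {0..T} \<alpha> \<and>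
    (\<forall>s\<in>{0..T}. v s (g (a, u)) = g (\<alpha> s, u) \<and> (\<alpha> s, u) \<in> R)"
    by (rule arc_parametrization[OF v_flow _ ab(1,2,3) va]) (rule vm)
  then obtain T' \<beta> where \<beta>: "0 < T'" "\<beta> 0 = a" "\<beta> T' = b" "strict_mono_on {0..T'} \<beta>" "continuous_on {0..T'} \<beta>"
    "\<forall>s\<in>{0..T'}. v s (g (a, u)) = g (\<beta> s, u) \<and> (\<beta> s, u) \<in> R"
    by (elim exE conjE) blast
  have ia: "\<alpha> ` {0..T} = {a..b}" using strict_mono_on_image[OF _ \<alpha>(4,5)] \<alpha>(1-3) by simp
  have ib: "\<beta> ` {0..T'} = {a..b}" using strict_mono_on_image[OF _ \<beta>(4,5)] \<beta>(1-3) by simp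
  define \<tau> where "\<tau> s = inv_into {0..T'} \<beta> (\<alpha> s)" for s
  have \<tau>: "\<tau> s \<in> {0..T'} \<and> \<beta> (\<tau> s) = \<alpha> s" if "s \<in> {0..T}" for s
  proof -
    have "\<alpha> s \<in> \<beta> ` {0..T'}" using ia ib that by blast
    then show ?thesis unfolding \<tau>_def using inv_into_into f_inv_into_f by metis
  qed
  have bi: "\<beta> r = \<beta> s \<Longrightarrow> r = s" if "r \<in> {0..T'}" "s \<in> {0..T'}" for r s
    using inj_onD[OF strict_mono_on_imp_inj_on[OF \<beta>(4)] _ that] .
  have t0: "\<tau> 0 = 0" using bi[of "\<tau> 0" 0] \<tau>[of 0] \<alpha>(1,2) \<beta>(1,2) by auto
  have tT: "\<tau> T = T'" using bi[of "\<tau> T" T'] \<tau>[of T] \<alpha>(1,3) \<beta>(1,3) by auto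
  have "follows v w (g (a, u)) T" unfolding follows_def
  proof (intro exI[of _ \<tau>] conjI ballI t0)
    show "strict_mono_on {0..T} \<tau>"
    proof (rule strict_mono_onI)
      fix r s assume rs: "r \<in> {0..T}" "s \<in> {0..T}" "r < s"
      have "\<beta> (\<tau> r) < \<beta> (\<tau> s)" using \<tau>[OF rs(1)] \<tau>[OF rs(2)] strict_mono_onD[OF \<alpha>(4) rs] by simp
      then show "\<tau> r < \<tau> s" using strict_mono_on_leD[OF \<beta>(4), of "\<tau> s" "\<tau> r"] \<tau>[OF rs(1)] \<tau>[OF rs(2)] by force
    qed
    show "\<tau> ` {0..T} = {0..\<tau> T}" unfolding tT
    proof (intro set_eqI iffI)
      fix y assume y: "y \<in> {0..T'}"
      then have "\<beta> y \<in> \<alpha> ` {0..T}" using ia ib by blast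
      then obtain s where s: "s \<in> {0..T}" "\<beta> y = \<alpha> s" by blast
      then have "\<tau> s = y" using bi[of "\<tau> s" y] \<tau>[OF s(1)] y by simp
      then show "y \<in> \<tau> ` {0..T}" using s(1) by blast
    qed (use \<tau> in auto)
    show "w s (g (a, u)) = v (\<tau> s) (g (a, u))" if "s \<in> {0..T}" for s
      using \<alpha>(6) \<beta>(6) \<tau>[OF that] that by simp
  qed
  moreover have "w T (g (a, u)) = g (b, u)" using \<alpha>(1,3,6) by auto
  ultimately show ?thesis using \<alpha>(1) by blast
qed

lemma box_image_closed: "closedin S (g ` R)"
  by (rule g_closed_image[OF compact_imp_closed[OF compact_R]]) simp

lemma follows_id: "(\<And>s. s \<in> {0..d} \<Longrightarrow> w s p = v s p) \<Longrightarrow> 0 \<le> d \<Longrightarrow> follows v w p d"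
  unfolding follows_def by (intro exI[of _ "\<lambda>s. s"]) (auto simp: strict_mono_on_def)

text \<open>The starting point may belong to the box, where \<open>outside\<close> does not apply.
  The comparison is made from the times \<open>r > 0\<close> on, and the case \<open>r = 0\<close>
  follows by continuity.\<close>

lemma follows_leaving:
  assumes p: "p \<in> topspace S" and d: "0 < d" "\<And>s. 0 < s \<Longrightarrow> s \<le> d \<Longrightarrow> v s p \<notin> g ` R"
  shows "follows v w p d"
proof (rule follows_id)
  fix s assume s: "s \<in> {0..d}"
  show "w s p = v s p"
  proof (cases "s = 0")
    case True then show ?thesis using flow_continuous(2)[OF w_flow p] flow_continuous(2)[OF v_flow p] by simp
  next
    case False
    define Z where "Z = {r. w (s - r) (v r p) = v s p}"
    have cm: "continuous_map euclideanreal S (\<lambda>r. w (s - r) (v r p))"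
      by (intro flow_continuous_compose[OF w_flow] flow_continuous_compose[OF v_flow]) (auto intro!: continuous_intros simp: p)
    have "v s p \<in> topspace S" using flow_continuous(4)[OF v_flow p] .
    then have "closedin S {v s p}" using S_haus by (simp add: Hausdorff_imp_t1_space closedin_t1_singleton)
    from closedin_continuous_map_preimage[OF cm this] have Zc: "closed Z" unfolding Z_def by simp
    have "r \<in> Z" if r: "0 < r" "r < s" for r
    proof -
      have vr: "v r p \<in> topspace S" using flow_continuous(4)[OF v_flow p] .
      have "w (s - r) (v r p) = v (s - r) (v r p)"
      proof (rule outside[OF vr, of "s - r"])
        fix t assume "t \<in> {0..s - r}"
        then have "v (t + r) p \<notin> g ` R" using d(2)[of "t + r"] r s by auto
        then show "v t (v r p) \<notin> g ` R" using flow_continuous(3)[OF v_flow p] by simp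
      qed (use r in auto)
      then show ?thesis unfolding Z_def using flow_continuous(3)[OF v_flow p, of "s - r" r] by simp
    qed
    then have "{0<..<s} \<subseteq> Z" by auto
    then have "closure {0<..<s} \<subseteq> Z" using Zc by (rule closure_minimal)
    moreover have "0 \<in> closure {0<..<s}" using s False by (simp add: closure_greaterThanLessThan)
    ultimately have "0 \<in> Z" by blast
    then show ?thesis unfolding Z_def using flow_continuous(2)[OF v_flow p] by simp
  qed
qed (use d in simp)

text \<open>The mirror image: the flows agree before the box is entered, and continuity extends this
  to the arrival. The arc is described from its starting point because \<open>outside\<close> speaks
  of forward time only.\<close>

lemma follows_entering:
  assumes p: "p \<in> topspace S" and d: "0 < d" "\<And>s. - d \<le> s \<Longrightarrow> s < 0 \<Longrightarrow> v s p \<notin> g ` R"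
  shows "follows v w (w (- d) p) d"
proof -
  define q where "q = v (- d) p"
  have q: "q \<in> topspace S" unfolding q_def using flow_continuous(4)[OF v_flow p] .
  have vq: "v s q = v (s - d) p" for s unfolding q_def using flow_continuous(3)[OF v_flow p, of s "- d"] by simp
  have out: "w s q = v s q" if "s \<in> {0..<d}" for s
  proof (rule outside[OF q, of s])
    fix t assume "t \<in> {0..s}"
    then show "v t q \<notin> g ` R" unfolding vq using d(2)[of "t - d"] that by auto
  qed (use that in auto)
  define Z where "Z = {r. v (- r) (w r q) = q}"
  have cm: "continuous_map euclideanreal S (\<lambda>r. v (- r) (w r q))"
    by (intro flow_continuous_compose[OF w_flow] flow_continuous_compose[OF v_flow]) (auto intro!: continuous_intros simp: q)
  have "closedin S {q}" using S_haus q by (simp add: Hausdorff_imp_t1_space closedin_t1_singleton)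
  from closedin_continuous_map_preimage[OF cm this] have Zc: "closed Z" unfolding Z_def by simp
  have "{0<..<d} \<subseteq> Z" unfolding Z_def using out flow_inverse[OF v_flow q] by auto
  then have "closure {0<..<d} \<subseteq> Z" using Zc by (rule closure_minimal)
  moreover have "d \<in> closure {0<..<d}" using d by (simp add: closure_greaterThanLessThan)
  ultimately have "v (- d) (w d q) = q" unfolding Z_def by blast
  then have "v d (v (- d) (w d q)) = v d q" by simp
  moreover have "w d q \<in> topspace S" using flow_continuous(4)[OF w_flow q] .
  ultimately have wd: "w d q = v d q" using flow_inverse[OF v_flow, of "w d q" "- d"] by simp
  then have "w d q = p" using vq[of d] flow_continuous(2)[OF v_flow p] by simp
  then have "w (- d) p = q" using flow_inverse[OF w_flow q, of d] by simp
  moreover have "follows v w q d" by (rule follows_id) (use out wd d in \<open>auto simp: less_eq_real_def\<close>)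
  ultimately show ?thesis by simp
qed

lemma box_not_singular:
  assumes q: "q \<in> R"
  shows "\<not> singular_point v (g q)"
proof
  assume s: "singular_point v (g q)"
  obtain a u where au: "q = (a, u)" by (cases q)
  show False
  proof (cases "a < 1")
    case True
    have 1: "(1, u) \<in> R" using q unfolding au R_iff by simp
    have "arc_in v (g ` R) (g q) (g (1, u))" using v_arc[OF q 1] True au by simp
    then have "g q = g (1, u)" using s unfolding arc_in_def singular_point_def by auto
    then show False using inj_on_eq_iff[OF g_inj q 1] True au by simp
  next
    case False
    have 0: "(0, u) \<in> R" using q unfolding au R_iff by simp
    have "arc_in v (g ` R) (g (0, u)) (g q)" using v_arc[OF 0 q] False au by simp
    then obtain t where "v t (g (0, u)) = g q" unfolding arc_in_def by blast
    then have "v (- t) (g q) = g (0, u)" using flow_inverse[OF v_flow g_in[OF 0]] by metis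
    then have "g q = g (0, u)" using s unfolding singular_point_def by metis
    then show False using inj_on_eq_iff[OF g_inj q 0] False au by simp
  qed
qed

lemma stays_outside:
  assumes p: "p \<in> topspace S" and K: "closedin S K" "p \<notin> K"
  shows "\<exists>d>0. \<exists>V. openin S V \<and> p \<in> V \<and> V \<inter> K = {} \<and> (\<forall>t. \<bar>t\<bar> \<le> d \<longrightarrow> (\<forall>q\<in>V. v t q \<notin> K))"
proof -
  have U: "openin S (topspace S - K)" "p \<in> topspace S - K" using K p by auto
  obtain T V where T: "T > 0" "openin S V" "p \<in> V" "V \<subseteq> topspace S - K" "\<forall>t. \<bar>t\<bar> \<le> T \<longrightarrow> (\<forall>q\<in>V. v t q \<in> topspace S - K)"
    using flow_tube[OF v_flow p U] by (elim exE conjE) blast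
  then show ?thesis by (intro exI[of _ T] conjI exI[of _ V]) auto
qed

text \<open>A point of the box near \<open>p\<close> needs a minimal time to reach the middle of the box.\<close>

lemma exit_right:
  assumes p: "(1, u) \<in> R"
  shows "\<exists>d>0. \<forall>s. 0 < s \<longrightarrow> s \<le> d \<longrightarrow> v s (g (1, u)) \<notin> g ` R"
proof -
  let ?p = "g (1, u)" and ?K = "{q \<in> R. fst q \<le> 0}"
  have pS: "?p \<in> topspace S" using g_in p by blast
  have "closed ?K" using closed_Int[OF compact_imp_closed[OF compact_R] closed_Collect_le[of "fst :: real \<times> real \<Rightarrow> real" "\<lambda>_. 0"]]
    by (simp add: Collect_conj_eq continuous_on_fst)
  then have K: "closedin S (g ` ?K)" by (rule g_closed_image) auto
  have pK: "?p \<notin> g ` ?K" using inj_on_eq_iff[OF g_inj p] by force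
  obtain T V where T: "T > 0" "openin S V" "?p \<in> V" "V \<inter> g ` ?K = {}" "\<forall>t. \<bar>t\<bar> \<le> T \<longrightarrow> (\<forall>q\<in>V. v t q \<notin> g ` ?K)"
    using stays_outside[OF pS K pK] by (elim exE conjE) blast
  obtain T' V' where T': "T' > 0" "?p \<in> V'" "\<forall>t. \<bar>t\<bar> \<le> T' \<longrightarrow> (\<forall>q\<in>V'. v t q \<in> V)"
    using flow_tube[OF v_flow pS T(2,3)] by (elim exE conjE) blast
  define d where "d = min T T'"
  have "v s ?p \<notin> g ` R" if s: "0 < s" "s \<le> d" for s
  proof
    assume "v s ?p \<in> g ` R"
    then obtain q where q: "q \<in> R" "v s ?p = g q" by blast
    have "\<bar>s\<bar> \<le> T'" using s unfolding d_def by simp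
    then have gV: "g q \<in> V" using T'(2,3) q(2) by metis
    have q0: "0 < fst q" using T(4) gV q(1) by force
    have m: "(0, snd q) \<in> R" using q(1) R_iff[of "fst q" "snd q"] R_iff[of 0 "snd q"] by simp
    have mS: "g (0, snd q) \<in> topspace S" using g_in m by blast
    have "arc_in v (g ` R) (g (0, snd q)) (g q)" using v_arc[OF m q(1)] q0 by simp
    then obtain t where t: "0 \<le> t" "v t (g (0, snd q)) = g q" "\<forall>r\<in>{0..t}. v r (g (0, snd q)) \<in> g ` R" unfolding arc_in_def by blast
    \<comment> \<open>Going back from \<open>g q\<close> for the time \<open>t\<close> leads to the
      middle of the box, which cannot be reached within time \<open>T\<close>. Hence the arc from
      \<open>?p\<close> to the return point is part of the arc from the middle, and it stays in the
      box, where it could only rest at the right side.\<close>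
    have "s \<le> t"
    proof (rule ccontr)
      assume "\<not> s \<le> t"
      then have "\<bar>- t\<bar> \<le> T" using t(1) s(2) unfolding d_def by simp
      then have "v (- t) (g q) \<notin> g ` ?K" using T(5) gV by blast
      moreover have "v (- t) (g q) = g (0, snd q)" using t(2) flow_inverse[OF v_flow mS] by metis
      ultimately show False using m by auto
    qed
    have shifted: "v r ?p = v (t - s + r) (g (0, snd q))" for r
    proof -
      have "v (- s) (g q) = ?p" using q(2) flow_inverse[OF v_flow pS] by metis
      then have "v r ?p = v (r - s) (g q)"
        using flow_continuous(3)[OF v_flow g_in[OF q(1)], of r "- s"] by simp
      also have "\<dots> = v (r - s + t) (g (0, snd q))" using flow_continuous(3)[OF v_flow mS, of "r - s" t] t(2) by simp
      finally show ?thesis by (simp add: algebra_simps)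
    qed
    have inR: "v r ?p \<in> g ` R" if "r \<in> {0..s}" for r
      unfolding shifted using t(3) that \<open>s \<le> t\<close> by auto
    have const: "v r ?p = ?p" if r: "r \<in> {0..s}" for r
    proof -
      obtain q' where q': "q' \<in> R" "v r ?p = g q'" using inR[OF r] by blast
      have "arc_in v (g ` R) ?p (g q')" unfolding arc_in_def
        using q'(2) inR r by (intro exI[of _ r]) auto
      then have "u = snd q'" "1 \<le> fst q'" using v_arc[OF p q'(1)] by auto
      moreover have "fst q' \<le> 1" using q'(1) R_iff[of "fst q'" "snd q'"] by simp
      ultimately have "q' = (1, u)" by (simp add: prod_eq_iff)
      then show ?thesis using q'(2) by simp
    qed
    have "singular_point v ?p" by (rule singular_if_constant_on_interval[OF v_flow pS s(1) const])
    then show False using box_not_singular[OF p] by blast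
  qed
  moreover have "0 < d" unfolding d_def using T T' by simp
  ultimately show ?thesis by blast
qed

lemma exit_left:
  assumes p: "(-1, u) \<in> R"
  shows "\<exists>d>0. \<forall>s. - d \<le> s \<longrightarrow> s < 0 \<longrightarrow> v s (g (-1, u)) \<notin> g ` R"
proof -
  let ?p = "g (-1, u)" and ?K = "{q \<in> R. 0 \<le> fst q}"
  have pS: "?p \<in> topspace S" using g_in p by blast
  have "closed ?K" using closed_Int[OF compact_imp_closed[OF compact_R] closed_Collect_le[of "\<lambda>_. 0" "fst :: real \<times> real \<Rightarrow> real"]]
    by (simp add: Collect_conj_eq continuous_on_fst)
  then have K: "closedin S (g ` ?K)" by (rule g_closed_image) auto
  have pK: "?p \<notin> g ` ?K" using inj_on_eq_iff[OF g_inj p] by force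
  obtain T V where T: "T > 0" "openin S V" "?p \<in> V" "V \<inter> g ` ?K = {}" "\<forall>t. \<bar>t\<bar> \<le> T \<longrightarrow> (\<forall>q\<in>V. v t q \<notin> g ` ?K)"
    using stays_outside[OF pS K pK] by (elim exE conjE) blast
  obtain T' V' where T': "T' > 0" "?p \<in> V'" "\<forall>t. \<bar>t\<bar> \<le> T' \<longrightarrow> (\<forall>q\<in>V'. v t q \<in> V)"
    using flow_tube[OF v_flow pS T(2,3)] by (elim exE conjE) blast
  define d where "d = min T T'"
  have "v (- s) ?p \<notin> g ` R" if s: "0 < s" "s \<le> d" for s
  proof
    assume "v (- s) ?p \<in> g ` R"
    then obtain q where q: "q \<in> R" "v (- s) ?p = g q" by blast
    have "\<bar>- s\<bar> \<le> T'" using s unfolding d_def by simp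
    then have gV: "g q \<in> V" using T'(2,3) q(2) by metis
    have q0: "fst q < 0" using T(4) gV q(1) by force
    have m: "(0, snd q) \<in> R" using q(1) R_iff[of "fst q" "snd q"] R_iff[of 0 "snd q"] by simp
    have qS: "g q \<in> topspace S" using g_in q(1) by blast
    have "arc_in v (g ` R) (g q) (g (0, snd q))" using v_arc[OF q(1) m] q0 by simp
    then obtain t where t: "0 \<le> t" "v t (g q) = g (0, snd q)" "\<forall>r\<in>{0..t}. v r (g q) \<in> g ` R" unfolding arc_in_def by blast
    have "s \<le> t"
    proof (rule ccontr)
      assume "\<not> s \<le> t"
      then have "\<bar>t\<bar> \<le> T" using t(1) s(2) unfolding d_def by simp
      then have "v t (g q) \<notin> g ` ?K" using T(5) gV by blast
      then show False using t(2) m by auto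
    qed
    have vs: "v s (g q) = ?p" using q(2) flow_inverse[OF v_flow pS, of "- s"] by simp
    have inR: "v r (g q) \<in> g ` R" if "r \<in> {0..s}" for r using t(3) that \<open>s \<le> t\<close> by auto
    have const: "v r (g q) = ?p" if r: "r \<in> {0..s}" for r
    proof -
      obtain q' where q': "q' \<in> R" "v r (g q) = g q'" using inR[OF r] by blast
      have sh: "v a (g q') = v (a + r) (g q)" for a using q'(2) flow_continuous(3)[OF v_flow qS, of a r] by simp
      have "arc_in v (g ` R) (g q') ?p" unfolding arc_in_def sh
        using vs inR r by (intro exI[of _ "s - r"]) auto
      then have "snd q' = u" "fst q' \<le> -1" using v_arc[OF q'(1) p] by auto
      moreover have "- 1 \<le> fst q'" using q'(1) R_iff[of "fst q'" "snd q'"] by simp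
      ultimately have "q' = (-1, u)" by (simp add: prod_eq_iff)
      then show ?thesis using q'(2) by simp
    qed
    have "g q = ?p" using const[of 0] s flow_continuous(2)[OF v_flow qS] by simp
    then have "singular_point v ?p" using singular_if_constant_on_interval[OF v_flow pS s(1)] const by simp
    then show False using box_not_singular[OF p] by blast
  qed
  then have "v s ?p \<notin> g ` R" if "- d \<le> s" "s < 0" for s using that by (metis minus_le_iff minus_minus neg_0_less_iff_less)
  moreover have "0 < d" unfolding d_def using T T' by simp
  ultimately show ?thesis by blast
qed

text \<open>No other point of the box is reachable from the origin under \<open>slow_le\<close>, so
  \<open>x\<close> does not move as long as it stays in the box, and a point at rest for a while is
  singular.\<close>

lemma w_x: "w t x = x"
proof -
  have x: "x \<in> g ` (open_square \<inter> H)" using g_0 H unfolding open_square_def half_plane_def by (intro image_eqI[of _ _ "(0,0)"]) auto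
  obtain T V where T: "T > 0" "x \<in> V" "\<forall>t. \<bar>t\<bar> \<le> T \<longrightarrow> (\<forall>q\<in>V. w t q \<in> g ` (open_square \<inter> H))"
    using flow_tube[OF w_flow x_in_S g_open x] by (elim exE conjE) blast
  have inR: "w t x \<in> g ` R" if "t \<in> {0..T}" for t
  proof -
    have "\<bar>t\<bar> \<le> T" using that by simp
    then show ?thesis using T(2,3) open_square_R by blast
  qed
  have "w t x = x" if t: "t \<in> {0..T}" for t
  proof -
    obtain q where q: "q \<in> R" "w t x = g q" using inR[OF t] by blast
    have "arc_in w (g ` R) (g (0,0)) (g q)" unfolding arc_in_def g_0 using q inR t by (intro exI[of _ t]) auto
    then have "q = (0, 0)" using w_arc[OF zero_R q(1)] unfolding slow_le_def by auto
    then show ?thesis using q g_0 by simp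
  qed
  then have "singular_point w x" using singular_if_constant_on_interval[OF w_flow x_in_S T(1)] by blast
  then show ?thesis unfolding singular_point_def by blast
qed

lemma w_singular:
  assumes p: "p \<in> topspace S" "singular_point v p"
  shows "w t p = p"
proof -
  have "p \<notin> g ` R" using box_not_singular p(2) by blast
  then have "v s p \<notin> g ` R" for s using p(2) unfolding singular_point_def by simp
  then have pos: "w s p = p" if "0 \<le> s" for s using outside[OF p(1) that, of s] p(2) that unfolding singular_point_def by simp
  show ?thesis
  proof (cases "0 \<le> t")
    case False
    then have "w (- t) p = p" using pos by simp
    then show ?thesis using flow_inverse[OF w_flow p(1), of "- t"] by simp
  qed (rule pos)
qed

lemma follows_forward:
  assumes p: "p \<in> topspace S" "p \<noteq> x"
  shows "\<exists>d>0. follows v w p d"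
proof (cases "p \<in> g ` R")
  case False
  obtain d V where d: "d > 0" "p \<in> V" "\<forall>t. \<bar>t\<bar> \<le> d \<longrightarrow> (\<forall>q\<in>V. v t q \<notin> g ` R)"
    using stays_outside[OF p(1) box_image_closed False] by (elim exE conjE) blast
  then have "follows v w p d" by (intro follows_leaving p) auto
  then show ?thesis using d(1) by blast
next
  case True
  then obtain a u where au: "(a, u) \<in> R" "p = g (a, u)" by force
  have ne: "(a, u) \<noteq> (0, 0)" using p(2) au g_0 by auto
  show ?thesis
  proof (cases "a = 1")
    case True
    then obtain d where "d > 0" "\<forall>s. 0 < s \<longrightarrow> s \<le> d \<longrightarrow> v s p \<notin> g ` R" using exit_right au by blast
    then show ?thesis using follows_leaving[OF p(1)] by blast
  next
    case False
    have a1: "a < 1" using au(1) False unfolding R_iff by simp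
    \<comment> \<open>On the axis left of the origin the comparison has to stop before the origin;
      the midpoint is chosen.\<close>
    define b where "b = (if u = 0 \<and> a < 0 then a / 2 else 1)"
    have "(b, u) \<in> R" "a < b" "slow_le (a, u) (b, u)" using au(1) a1 ne unfolding b_def slow_le_def R_iff by auto
    then show ?thesis using follows_in_box[OF au(1), of b] au(2) by blast
  qed
qed

lemma follows_backward:
  assumes p: "p \<in> topspace S" "p \<noteq> x"
  shows "\<exists>d>0. follows v w (w (- d) p) d"
proof (cases "p \<in> g ` R")
  case False
  obtain d V where d: "d > 0" "p \<in> V" "\<forall>t. \<bar>t\<bar> \<le> d \<longrightarrow> (\<forall>q\<in>V. v t q \<notin> g ` R)"
    using stays_outside[OF p(1) box_image_closed False] by (elim exE conjE) blast
  then have "follows v w (w (- d) p) d" by (intro follows_entering p) auto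
  then show ?thesis using d(1) by blast
next
  case True
  then obtain b u where bu: "(b, u) \<in> R" "p = g (b, u)" by force
  have ne: "(b, u) \<noteq> (0, 0)" using p(2) bu g_0 by auto
  show ?thesis
  proof (cases "b = -1")
    case True
    then obtain d where "d > 0" "\<forall>s. - d \<le> s \<longrightarrow> s < 0 \<longrightarrow> v s p \<notin> g ` R" using exit_left bu by blast
    then show ?thesis using follows_entering[OF p(1)] by blast
  next
    case False
    have b1: "-1 < b" using bu(1) False unfolding R_iff by simp
    define a where "a = (if u = 0 \<and> 0 < b then b / 2 else -1)"
    have a: "(a, u) \<in> R" "a < b" "slow_le (a, u) (b, u)" using bu(1) b1 ne unfolding a_def slow_le_def R_iff by auto
    then obtain T where T: "T > 0" "follows v w (g (a, u)) T" "w T (g (a, u)) = p" using follows_in_box[OF a(1) bu(1)] bu(2) by blast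
    then have "w (- T) p = g (a, u)" using flow_inverse[OF w_flow g_in[OF a(1)], of T] by simp
    then show ?thesis using T by auto
  qed
qed

text \<open>Bolzano's bisection principle: near each time the flow is followed on both sides, and
  following is transitive.\<close>

lemma follows_all:
  assumes p: "p \<in> topspace S" "p \<noteq> x" and ab: "a \<le> b"
  shows "follows v w (w a p) (b - a)"
proof -
  have wS: "w t p \<in> topspace S" for t using flow_continuous(4)[OF w_flow p(1)] .
  have ne: "w t p \<noteq> x" for t
  proof
    assume "w t p = x"
    then have "p = w (- t) x" using flow_inverse[OF w_flow p(1)] by metis
    then show False using w_x p(2) by simp
  qed
  have add: "w s (w t p) = w (s + t) p" for s t using flow_continuous(3)[OF w_flow p(1)] by simp
  show ?thesis using ab
  proof (induction a b rule: Bolzano)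
    case (trans a b c)
    have "follows v w (w a p) ((b - a) + (c - b))"
      by (rule follows_trans[OF v_flow w_flow wS trans(1)]) (use trans add in auto)
    then show ?case by simp
  next
    case (local y)
    obtain d1 where d1: "d1 > 0" "follows v w (w y p) d1" using follows_forward[OF wS ne] by blast
    obtain d2 where d2: "d2 > 0" "follows v w (w (- d2) (w y p)) d2" using follows_backward[OF wS ne] by blast
    define q where "q = w (y - d2) p"
    have q: "w (- d2) (w y p) = q" unfolding q_def add by simp
    have "w d2 q = w y p" unfolding q_def add by simp
    then have f: "follows v w q (d2 + d1)"
      using follows_trans[OF v_flow w_flow, of q d2 d1] d1 d2 wS unfolding q by (simp add: q_def)
    show ?case
    proof (intro exI[of _ "min d1 d2"] conjI allI impI)
      show "0 < min d1 d2" using d1 d2 by simp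
      fix a b assume ab: "a \<le> y \<and> y \<le> b \<and> b - a < min d1 d2"
      have "follows v w (w (a - y + d2) q) (d2 + d1 - (a - y + d2))"
        by (rule follows_shift[OF v_flow w_flow _ f]) (use ab wS in \<open>auto simp: q_def\<close>)
      moreover have "w (a - y + d2) q = w a p" unfolding q_def add by simp
      ultimately show "follows v w (w a p) (b - a)" using follows_less[of v w "w a p" _ "b - a"] ab by auto
    qed
  qed
qed

end

text \<open>The reparametrizations over unit intervals are added up in both directions from 0. The
  range is an interval because consecutive pieces share their end values.\<close>

lemma follows_glue:
  assumes v: "flow_on X v" and w: "flow_on X w" and p: "p \<in> topspace X"
    and f: "\<And>n::int. follows v w (w (of_int n) p) 1"
  shows "\<exists>\<tau>. strict_mono \<tau> \<and> \<tau> 0 = 0 \<and> (\<forall>t. w t p = v (\<tau> t) p) \<and>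
    (\<forall>a b r. \<tau> a \<le> r \<longrightarrow> r \<le> \<tau> b \<longrightarrow> r \<in> range \<tau>)"
proof -
  have "\<forall>n::int. \<exists>\<tau>. \<tau> 0 = 0 \<and> strict_mono_on {0..1} \<tau> \<and> \<tau> ` {0..1} = {0..\<tau> 1} \<and>
     (\<forall>s\<in>{0..1}. w s (w (of_int n) p) = v (\<tau> s) (w (of_int n) p))"
    using f unfolding follows_def by blast
  then obtain T where T: "\<forall>n::int. T n 0 = 0 \<and> strict_mono_on {0..1} (T n) \<and> T n ` {0..1} = {0..T n 1} \<and>
     (\<forall>s\<in>{0..1}. w s (w (of_int n) p) = v (T n s) (w (of_int n) p))" by metis
  define c where "c n = sum (\<lambda>i. T i 1) {0..<n} - sum (\<lambda>i. T i 1) {n..<0}" for n :: int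
  have c0: "c 0 = 0" unfolding c_def by simp
  have cs: "c (n + 1) = c n + T n 1" for n
  proof (cases "0 \<le> n")
    case True
    then have "{0..<n + 1} = insert n {0..<n}" "{n..<0} = {}" "{n + 1..<0} = {}" by auto
    then show ?thesis unfolding c_def by simp
  next
    case False
    then have "{n..<0} = insert n {n + 1..<0}" "{0..<n} = {}" "{0..<n + 1} = {}" by auto
    then show ?thesis unfolding c_def by simp
  qed
  have T0: "T n 0 = 0" for n using T by blast
  have Tm: "T n s < T n t" if "0 \<le> s" "s < t" "t \<le> 1" for n s t
    using T that strict_mono_onD[of "{0..1}" "T n" s t] by auto
  have cm: "c n \<le> c (n + int k)" for n k
  proof (induction k)
    case (Suc k)
    have "T (n + int k) 0 < T (n + int k) 1" using Tm by simp
    then have "0 < T (n + int k) 1" using T by simp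
    then have "c n \<le> c (n + int k + 1)" using cs[of "n + int k"] Suc by linarith
    moreover have "n + int (Suc k) = n + int k + 1" by simp
    ultimately show ?case by (simp only:)
  qed simp
  have wc: "w (of_int n) p = v (c n) p" for n
  proof -
    have step: "w (of_int (m + 1)) p = v (T m 1) (w (of_int m) p)" for m
    proof -
      have "of_int (m + 1) = 1 + real_of_int m" by simp
      then have "w (of_int (m + 1)) p = w 1 (w (of_int m) p)" using flow_continuous(3)[OF w p, of 1 "of_int m"] by (simp only:)
      also have "\<dots> = v (T m 1) (w (of_int m) p)" using T by (meson atLeastAtMost_iff order_refl zero_le_one)
      finally show ?thesis .
    qed
    show ?thesis
    proof (induction n rule: int_induct[of _ 0])
      case base show ?case using c0 flow_continuous(2)[OF w p] flow_continuous(2)[OF v p] by simp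
    next
      case (step1 i)
      have "w (of_int (i + 1)) p = v (T i 1) (v (c i) p)" using step[of i] step1 by simp
      also have "\<dots> = v (c (i + 1)) p" unfolding cs flow_continuous(3)[OF v p, symmetric] by (simp add: add.commute)
      finally show ?case .
    next
      case (step2 i)
      have "v (c i) p = v (T (i - 1) 1) (w (of_int (i - 1)) p)" using step2 step[of "i - 1"] by simp
      then have "v (- T (i - 1) 1) (v (c i) p) = w (of_int (i - 1)) p"
        using flow_inverse[OF v flow_continuous(4)[OF w p]] by metis
      moreover have "v (- T (i - 1) 1) (v (c i) p) = v (- T (i - 1) 1 + c i) p"
        by (rule flow_continuous(3)[OF v p, symmetric])
      moreover have "c i = c (i - 1) + T (i - 1) 1" using cs[of "i - 1"] by (simp only: diff_add_cancel)
      then have "- T (i - 1) 1 + c i = c (i - 1)" by linarith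
      ultimately show ?case by (simp only:)
    qed
  qed
  define \<tau> where "\<tau> t = c \<lfloor>t\<rfloor> + T \<lfloor>t\<rfloor> (frac t)" for t
  have ge: "c \<lfloor>t\<rfloor> \<le> \<tau> t" and lt: "\<tau> t < c (\<lfloor>t\<rfloor> + 1)" for t
  proof -
    have fr: "0 \<le> frac t" "frac t < 1" by (auto simp: frac_lt_1)
    have "T \<lfloor>t\<rfloor> (frac t) < T \<lfloor>t\<rfloor> 1" using Tm fr by simp
    then show "\<tau> t < c (\<lfloor>t\<rfloor> + 1)" unfolding \<tau>_def cs by linarith
    have "0 \<le> T \<lfloor>t\<rfloor> (frac t)"
    proof (cases "frac t = 0")
      case False
      then have "T \<lfloor>t\<rfloor> 0 < T \<lfloor>t\<rfloor> (frac t)" using Tm[of 0 "frac t"] fr by simp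
      then show ?thesis unfolding T0 by (rule less_imp_le)
    qed (use T0 in \<open>metis order_refl\<close>)
    then show "c \<lfloor>t\<rfloor> \<le> \<tau> t" unfolding \<tau>_def by linarith
  qed
  have sm: "strict_mono \<tau>"
  proof (rule strict_monoI)
    fix s t :: real assume st: "s < t"
    show "\<tau> s < \<tau> t"
    proof (cases "\<lfloor>s\<rfloor> = \<lfloor>t\<rfloor>")
      case True
      have "frac s < frac t" using st True unfolding frac_def by simp
      then have "T \<lfloor>t\<rfloor> (frac s) < T \<lfloor>t\<rfloor> (frac t)" using Tm[of "frac s" "frac t" "\<lfloor>t\<rfloor>"] frac_lt_1[of t] frac_ge_0[of s] by linarith
      then show ?thesis unfolding \<tau>_def True by linarith
    next
      case False
      have "\<lfloor>s\<rfloor> \<le> \<lfloor>t\<rfloor>" using st by (simp add: floor_mono)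
      then have k: "\<lfloor>t\<rfloor> = \<lfloor>s\<rfloor> + 1 + int (nat (\<lfloor>t\<rfloor> - \<lfloor>s\<rfloor> - 1))" using False by simp
      have "\<tau> s < c (\<lfloor>s\<rfloor> + 1)" by (rule lt)
      also have "\<dots> \<le> c \<lfloor>t\<rfloor>" using cm[of "\<lfloor>s\<rfloor> + 1" "nat (\<lfloor>t\<rfloor> - \<lfloor>s\<rfloor> - 1)"] unfolding k[symmetric] .
      also have "\<dots> \<le> \<tau> t" by (rule ge)
      finally show ?thesis .
    qed
  qed
  have unit: "{c n..<c (n + 1)} \<subseteq> range \<tau>" for n
  proof
    fix r assume r: "r \<in> {c n..<c (n + 1)}"
    then have "c n \<le> r" "r < c n + T n 1" unfolding cs atLeastLessThan_iff by blast+
    then have "r - c n \<in> {0..T n 1}" unfolding atLeastAtMost_iff by linarith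
    then have "r - c n \<in> T n ` {0..1}" using T by blast
    then obtain s where s: "s \<in> {0..1}" "r - c n = T n s" by blast
    have "s \<noteq> 1" using s(2) \<open>r < c n + T n 1\<close> by auto
    then have fl: "\<lfloor>of_int n + s\<rfloor> = n" using s(1) by (simp add: floor_eq_iff)
    then have "frac (of_int n + s) = s" unfolding frac_def by simp
    then have "\<tau> (of_int n + s) = r" using s(2) unfolding \<tau>_def fl by simp
    then show "r \<in> range \<tau>" by blast
  qed
  have block: "{c n..<c (n + int k)} \<subseteq> range \<tau>" for n k
  proof (induction k)
    case (Suc k)
    have "n + int (Suc k) = n + int k + 1" by simp
    then have "{c n..<c (n + int (Suc k))} = {c n..<c (n + int k + 1)}" by (simp only:)
    moreover have "{a..<d} \<subseteq> {a..<b} \<union> {b..<d}" for a b d :: real by auto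
    ultimately have "{c n..<c (n + int (Suc k))} \<subseteq> {c n..<c (n + int k)} \<union> {c (n + int k)..<c (n + int k + 1)}" by blast
    then show ?case using Suc unit[of "n + int k"] by blast
  qed simp
  have convex: "r \<in> range \<tau>" if r: "\<tau> a \<le> r" "r \<le> \<tau> b" for a b r
  proof -
    have "a \<le> b" using r strict_mono_less_eq[OF sm, of a b] by linarith
    then have "\<lfloor>a\<rfloor> \<le> \<lfloor>b\<rfloor>" by (rule floor_mono)
    then have k: "\<lfloor>b\<rfloor> + 1 = \<lfloor>a\<rfloor> + int (nat (\<lfloor>b\<rfloor> + 1 - \<lfloor>a\<rfloor>))" by simp
    have "r \<in> {c \<lfloor>a\<rfloor>..<c (\<lfloor>b\<rfloor> + 1)}" using ge[of a] lt[of b] r by simp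
    then show ?thesis using block[of "\<lfloor>a\<rfloor>" "nat (\<lfloor>b\<rfloor> + 1 - \<lfloor>a\<rfloor>)"] unfolding k[symmetric] by blast
  qed
  have "w t p = v (\<tau> t) p" for t
  proof -
    have "w t p = w (frac t) (w (of_int \<lfloor>t\<rfloor>) p)"
      using flow_continuous(3)[OF w p, of "frac t" "of_int \<lfloor>t\<rfloor>"] unfolding frac_def by simp
    also have "\<dots> = v (T \<lfloor>t\<rfloor> (frac t)) (w (of_int \<lfloor>t\<rfloor>) p)" using T frac_lt_1[of t] frac_ge_0[of t] by (meson atLeastAtMost_iff less_imp_le)
    also have "\<dots> = v (T \<lfloor>t\<rfloor> (frac t) + c \<lfloor>t\<rfloor>) p" unfolding wc flow_continuous(3)[OF v p] ..
    finally show ?thesis unfolding \<tau>_def by (simp add: add.commute)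
  qed
  moreover have "\<tau> 0 = 0" unfolding \<tau>_def using c0 T0 by simp
  ultimately show ?thesis using sm convex by blast
qed

lemma mono_tendsto_Sup_at_top:
  fixes \<tau> :: "real \<Rightarrow> real"
  assumes "mono \<tau>" "bdd_above (range \<tau>)"
  shows "(\<tau> \<longlongrightarrow> Sup (range \<tau>)) at_top"
proof (rule order_tendstoI)
  fix a assume "a < Sup (range \<tau>)"
  then obtain t where t: "a < \<tau> t" using less_cSup_iff[OF _ assms(2), of a] by auto
  show "eventually (\<lambda>s. a < \<tau> s) at_top"
    using eventually_ge_at_top[of t] by eventually_elim (use t monoD[OF assms(1)] in force)
next
  fix a assume "Sup (range \<tau>) < a"
  moreover have "\<tau> s \<le> Sup (range \<tau>)" for s by (rule cSup_upper[OF rangeI assms(2)])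
  ultimately have "\<tau> s < a" for s by (meson le_less_trans)
  then show "eventually (\<lambda>s. \<tau> s < a) at_top" by simp
qed

lemma mono_tendsto_Inf_at_bot:
  fixes \<tau> :: "real \<Rightarrow> real"
  assumes "mono \<tau>" "bdd_below (range \<tau>)"
  shows "(\<tau> \<longlongrightarrow> Inf (range \<tau>)) at_bot"
proof (rule order_tendstoI)
  fix a assume "Inf (range \<tau>) < a"
  then obtain t where t: "\<tau> t < a" using cInf_less_iff[OF _ assms(2), of a] by auto
  show "eventually (\<lambda>s. \<tau> s < a) at_bot"
    using eventually_le_at_bot[of t] by eventually_elim (use t monoD[OF assms(1)] in force)
next
  fix a assume "a < Inf (range \<tau>)"
  moreover have "Inf (range \<tau>) \<le> \<tau> s" for s by (rule cInf_lower[OF rangeI assms(2)])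
  ultimately have "a < \<tau> s" for s by (meson less_le_trans)
  then show "eventually (\<lambda>s. a < \<tau> s) at_bot" by simp
qed

context two_flows
begin

text \<open>The orbit of \<open>w\<close> cannot come to rest at a point other than \<open>x\<close>: near such a point \<open>w\<close> follows \<open>v\<close>.\<close>

lemma no_end:
  assumes p: "p \<in> topspace S" "\<not> singular_point v p" and \<tau>: "\<And>t. w t p = v (\<tau> t) p"
    and lim: "(\<tau> \<longlongrightarrow> b) F" "\<And>r. filterlim (\<lambda>t. r + t) F F" "F \<noteq> bot" and b: "v b p \<noteq> x"
  shows False
proof -
  define q where "q = v b p"
  have q: "q \<in> topspace S" unfolding q_def using flow_continuous(4)[OF v_flow p(1)] .
  have cv: "continuous_map euclideanreal S (\<lambda>s. v s p)"
    using flow_continuous_compose[OF v_flow, of euclideanreal "\<lambda>s. s" "\<lambda>_. p"] p(1) by simp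
  have "limitin euclideanreal \<tau> b F" using lim(1) by simp
  from continuous_map_limit[OF cv this] have lw: "limitin S (\<lambda>t. w t p) q F" unfolding q_def by (simp add: o_def \<tau>)
  have fixed: "w s q = q" for s
  proof -
    have "continuous_map S S (w s)"
      using flow_continuous_compose[OF w_flow, of S "\<lambda>_. s" "\<lambda>p. p"] by simp
    from continuous_map_limit[OF this lw] have "limitin S (\<lambda>t. w (s + t) p) (w s q) F"
      by (simp add: o_def flow_continuous(3)[OF w_flow p(1)])
    moreover have "limitin S (\<lambda>t. w (s + t) p) q F"
      using lw lim(2)[of s] unfolding limitin_def filterlim_iff by blast
    ultimately show ?thesis using limitin_Hausdorff_unique lim(3) S_haus by metis
  qed
  obtain d where "d > 0" "follows v w q d" using follows_forward[OF q] b unfolding q_def by blast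
  then obtain \<tau>' where t': "\<tau>' 0 = 0" "strict_mono_on {0..d} \<tau>'" "\<tau>' ` {0..d} = {0..\<tau>' d}" "\<forall>s\<in>{0..d}. w s q = v (\<tau>' s) q"
    unfolding follows_def by (elim exE conjE) blast
  have pos: "0 < \<tau>' d" using strict_mono_onD[OF t'(2), of 0 d] t'(1) \<open>d > 0\<close> by simp
  have "v r q = q" if "r \<in> {0..\<tau>' d}" for r
  proof -
    have "r \<in> \<tau>' ` {0..d}" using that unfolding t'(3) .
    then obtain s where s: "s \<in> {0..d}" "r = \<tau>' s" by (elim imageE)
    have "w s q = v (\<tau>' s) q" using t'(4) s(1) by (rule bspec)
    then show ?thesis unfolding s(2) fixed by (rule sym)
  qed
  then have "singular_point v q" by (rule singular_if_constant_on_interval[OF v_flow q pos])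
  then have sq: "v t q = q" for t unfolding singular_point_def by blast
  have "v t p = q" for t
  proof -
    have "v t p = v (t - b) q" unfolding q_def using flow_continuous(3)[OF v_flow p(1), of "t - b" b] by simp
    then show ?thesis using sq by simp
  qed
  then have "v t p = p" for t using flow_continuous(2)[OF v_flow p(1)] by metis
  then show False using p(2) unfolding singular_point_def by blast
qed

text \<open>The range of \<open>\<tau>\<close> is an interval that contains 0, and \<open>w\<close>
  does not reach \<open>x\<close>; this gives one inclusion. If an avoiding time were missing from
  the range, \<open>\<tau>\<close> would be bounded on that side and converge to an avoiding time,
  which \<open>no_end\<close> excludes.\<close>

lemma slowing_at: "slowing_at S v x w"
  unfolding slowing_at_def
proof (intro conjI allI ballI w_x)
  fix p assume "p \<in> topspace S - {x}"
  then have p: "p \<in> topspace S" "p \<noteq> x" by auto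
  show "\<exists>\<tau>. strict_mono \<tau> \<and> range \<tau> = avoiding_times v x p \<and> \<tau> 0 = 0 \<and> (\<forall>t. w t p = v (\<tau> t) p)"
  \<comment> \<open>At a singular point both flows rest, and the identity serves as
    \<open>\<tau>\<close>; \<open>no_end\<close> speaks of nonsingular points only.\<close>
  proof (cases "singular_point v p")
    case True
    then have "avoiding_times v x p = UNIV" using p(2) unfolding avoiding_times_def singular_point_def by simp
    then have "strict_mono (\<lambda>t::real. t) \<and> range (\<lambda>t. t) = avoiding_times v x p \<and> (\<lambda>t. t) 0 = (0::real) \<and> (\<forall>t. w t p = v t p)"
      using True w_singular[OF p(1)] unfolding singular_point_def by (simp add: strict_mono_def)
    then show ?thesis by (intro exI[of _ "\<lambda>t. t"]) blast
  next
    case False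
    have "follows v w (w (of_int n) p) 1" for n using follows_all[OF p, of "of_int n" "of_int n + 1"] by simp
    from follows_glue[OF v_flow w_flow p(1) this]
    obtain \<tau> where \<tau>: "strict_mono \<tau>" "\<tau> 0 = 0" "\<forall>t. w t p = v (\<tau> t) p" "\<forall>a b r. \<tau> a \<le> r \<longrightarrow> r \<le> \<tau> b \<longrightarrow> r \<in> range \<tau>" by blast
    have wt: "\<And>t. w t p = v (\<tau> t) p" using \<tau>(3) by blast
    have ne: "w t p \<noteq> x" for t
    proof
      assume "w t p = x"
      then have "p = w (- t) x" using flow_inverse[OF w_flow p(1)] by metis
      then show False using w_x p(2) by simp
    qed
    have "range \<tau> \<subseteq> avoiding_times v x p"
    proof
      fix s assume "s \<in> range \<tau>"
      then obtain t where t: "s = \<tau> t" by blast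
      show "s \<in> avoiding_times v x p" unfolding avoiding_times_def
      proof (intro CollectI ballI)
        fix r assume r: "r \<in> {min 0 s..max 0 s}"
        have "r \<in> range \<tau>"
        proof (cases "0 \<le> s")
          case True then show ?thesis using r \<tau>(4)[rule_format, of 0 r t] \<tau>(2) t by simp
        next
          case False then show ?thesis using r \<tau>(4)[rule_format, of t r 0] \<tau>(2) t by simp
        qed
        then show "v r p \<noteq> x" using wt ne by (metis rangeE)
      qed
    qed
    moreover have "b \<in> range \<tau>" if b: "b \<in> avoiding_times v x p" for b
    proof (rule ccontr)
      assume nb: "b \<notin> range \<tau>"
      have m: "mono \<tau>" using \<tau>(1) by (rule strict_mono_mono)
      have ab: "v r p \<noteq> x" if "r \<in> {min 0 b..max 0 b}" for r using b that unfolding avoiding_times_def by blast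
      consider "0 \<le> b" | "b \<le> 0" by linarith
      then show False
      proof cases
        case 1
        have le: "\<tau> t \<le> b" for t using \<tau>(4)[rule_format, of 0 b t] \<tau>(2) nb 1 by force
        then have bdd: "bdd_above (range \<tau>)" by (intro bdd_aboveI[of _ b]) auto
        have "Sup (range \<tau>) \<le> b" using le by (intro cSup_least) auto
        moreover have "\<tau> 0 \<le> Sup (range \<tau>)" by (rule cSup_upper[OF rangeI bdd])
        ultimately have "v (Sup (range \<tau>)) p \<noteq> x" using ab \<tau>(2) by simp
        then show False
          using no_end[OF p(1) False wt mono_tendsto_Sup_at_top[OF m bdd]] filterlim_tendsto_add_at_top[OF tendsto_const filterlim_ident] by simp
      next
        case 2
        have shift: "filterlim (\<lambda>t. r + t) at_bot at_bot" for r :: real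
          unfolding filterlim_at_bot
        proof
          fix Z show "eventually (\<lambda>t. r + t \<le> Z) at_bot" using eventually_le_at_bot[of "Z - r"] by eventually_elim simp
        qed
        have le: "b \<le> \<tau> t" for t using \<tau>(4)[rule_format, of t b 0] \<tau>(2) nb 2 by force
        then have bdd: "bdd_below (range \<tau>)" by (intro bdd_belowI[of _ b]) auto
        have "b \<le> Inf (range \<tau>)" using le by (intro cInf_greatest) auto
        moreover have "Inf (range \<tau>) \<le> \<tau> 0" by (rule cInf_lower[OF rangeI bdd])
        ultimately have "v (Inf (range \<tau>)) p \<noteq> x" using ab \<tau>(2) by simp
        then show False
          using no_end[OF p(1) False wt mono_tendsto_Inf_at_bot[OF m bdd]] shift by simp
      qed
    qed
    ultimately have "range \<tau> = avoiding_times v x p" by blast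
    then show ?thesis using \<tau> by blast
  qed
qed

end

lemma singular_replacement_slowing_at:
  assumes haus: "Hausdorff_space S" and v: "flow_on S v" and w: "singular_replacement S v x w"
  shows "slowing_at S v x w"
proof -
  obtain H g \<phi> where b: "trivial_flow_box S v x H g" "slowing_function \<phi>"
    "orbit_arcs_generated_by w g (square \<inter> H) (\<lambda>p. (\<phi> p, 0))"
    "\<forall>p\<in>topspace S. \<forall>t\<ge>0. (\<forall>s\<in>{0..t}. v s p \<notin> g ` (square \<inter> H)) \<longrightarrow> (\<forall>s\<in>{0..t}. w s p = v s p)"
    and wf: "flow_on S w"
    using w unfolding singular_replacement_def by blast
  have t: "H \<in> {UNIV, half_plane}" "embedding_map (top_of_set (square \<inter> H)) S g"
    "openin S (g ` (open_square \<inter> H))" "g (0, 0) = x" "orbit_arcs_generated_by v g (square \<inter> H) (\<lambda>p. (1, 0))"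
    using b(1) unfolding trivial_flow_box_def by auto
  interpret box_chart S x H g by (rule box_chart.intro[OF haus t(1-4)])
  interpret two_flows S x H g v w
  proof unfold_locales
    show "arc_in v (g ` R) (g p) (g q) \<longleftrightarrow> snd p = snd q \<and> fst p \<le> fst q" if "p \<in> R" "q \<in> R" for p q
      unfolding arc_in_def R_def
      by (rule trans[OF bspec[OF bspec[OF t(5)[unfolded orbit_arcs_generated_by_def]]] unit_arcs[OF t(1)]])
        (use that in \<open>simp_all only: R_def\<close>)
    show "arc_in w (g ` R) (g p) (g q) \<longleftrightarrow> slow_le p q" if "p \<in> R" "q \<in> R" for p q
      unfolding arc_in_def R_def
      by (rule trans[OF bspec[OF bspec[OF b(3)[unfolded orbit_arcs_generated_by_def]]] slowing_arcs[OF b(2) t(1)]])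
        (use that in \<open>simp_all only: R_def\<close>)
    show "w s p = v s p" if "p \<in> topspace S" "0 \<le> t" "\<And>s. s \<in> {0..t} \<Longrightarrow> v s p \<notin> g ` R" "s \<in> {0..t}" for p t s
      using b(4)[unfolded R_def[symmetric], rule_format, OF that(1,2)] that(3,4) by blast
  qed (fact v wf)+
  show ?thesis by (rule slowing_at)
qed

lemma flow_on_cong:
  assumes v: "flow_on X v" and eq: "\<And>t p. p \<in> topspace X \<Longrightarrow> w t p = v t p"
  shows "flow_on X w"
  unfolding flow_on_def
proof (intro conjI allI ballI)
  show "continuous_map (prod_topology euclideanreal X) X (\<lambda>(t, p). w t p)"
    by (rule continuous_map_eq[OF flow_continuous(1)[OF v]]) (auto simp: eq)
qed (use eq flow_continuous(2-4)[OF v] in auto)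

section \<open>The slowed flow as a singular replacement\<close>

context slow_box
begin

text \<open>Continuity at \<open>x\<close> is obtained from the lifting construction for the trivial
  blow-up, whose drift condition only asks that \<open>lam q\<close> is at most
  \<open>norm q\<close>.\<close>

lemma slowed_flow: "flow_on S slowed"
proof -
  interpret trivial: blow_up_flow S v x H \<sigma> g k lam "\<lambda>q. q" "\<lambda>z. z" "{(0, 0)}"
  proof unfold_locales
    fix q q' assume q: "q \<in> R" "q \<noteq> (0, 0)" "dist q q' < lam q"
    have "0 < norm q" using q(2) by (simp add: zero_prod_def)
    then show "dist q q' < norm q" using lam[OF q(1,2)] q(3) by linarith
  qed (use zero_R in auto)
  have "slowed t p = trivial.blown t p" if p: "p \<in> topspace S" for t p
  proof -
    have id: "trivial.collapse_map z = z" "trivial.blow_map z = z" for z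
      unfolding trivial.collapse_map_def trivial.blow_map_def using chart_in(2) by auto
    show ?thesis unfolding trivial.blown_def id using g_0 by (simp add: slowed_def)
  qed
  then show ?thesis by (rule flow_on_cong[OF trivial.blown_flow])
qed

lemma slowed_arcs:
  assumes p: "p \<in> R" and q: "q \<in> R"
  shows "(\<exists>t\<ge>0. slowed t (g p) = g q \<and> (\<forall>s\<in>{0..t}. slowed s (g p) \<in> g ` R)) \<longleftrightarrow> slow_le p q" (is "?L \<longleftrightarrow> _")
proof (cases "p = (0, 0)")
  case True
  have s: "slowed t (g p) = g p" for t unfolding True g_0 slowed_def by simp
  have "?L \<longleftrightarrow> p = q" using inj_on_eq_iff[OF g_inj p q] p unfolding s by auto
  also have "\<dots> \<longleftrightarrow> slow_le p q" unfolding True slow_le_def by auto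
  finally show ?thesis .
next
  case False
  have gp: "g p \<in> topspace S" "g p \<noteq> x" using g_in[OF p] g_eq_x[OF p] False by auto
  note 0 = before_zero[OF gp]
  obtain a u where au: "p = (a, u)" by (cases p)
  have sl: "slowed t (g p) = v (clock t (g p)) (g p)" for t unfolding slowed_def using gp by simp
  show ?thesis
  proof
    assume ?L
    then obtain t where t: "0 \<le> t" "slowed t (g p) = g q" "\<And>s. s \<in> {0..t} \<Longrightarrow> slowed s (g p) \<in> g ` R" by blast
    define s where "s = clock t (g p)"
    have sb: "s \<in> before (g p)" and ts: "time_to s (g p) = t" unfolding s_def using clock[OF gp] by auto
    have s0: "0 \<le> s"
    proof (rule ccontr)
      assume "\<not> 0 \<le> s"
      then have "time_to s (g p) < time_to 0 (g p)" using time_to_mono(1)[OF gp(1) sb 0] by simp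
      then show False using ts t(1) time_to_0 by simp
    qed
    have inR: "v r (g p) \<in> g ` R" if r: "r \<in> {0..s}" for r
    proof -
      have rb: "r \<in> before (g p)" using before_interval[OF 0 sb] r by simp
      have "r = 0 \<or> 0 < r" "r = s \<or> r < s" using r by auto
      then have "0 \<le> time_to r (g p)" "time_to r (g p) \<le> t"
        using time_to_mono(1)[OF gp(1) 0 rb] time_to_mono(1)[OF gp(1) rb sb] time_to_0 ts by force+
      then have "slowed (time_to r (g p)) (g p) \<in> g ` R" using t(3) by simp
      then show ?thesis unfolding sl clock_surj[OF gp(1) rb] .
    qed
    have "fst p + s / \<sigma> \<le> 1" by (rule horizontal_exit[OF p s0 inR])
    moreover have "0 \<le> s / \<sigma>" using s0 \<sigma>_pos by simp
    ultimately have b: "a + s / \<sigma> \<in> {-1..1}" "(a + s / \<sigma>, u) \<in> R" using p unfolding au R_iff by auto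
    have "v s (g p) = g q" using t(2) sl[of t] unfolding s_def by simp
    moreover have "v s (g p) = g (a + s / \<sigma>, u)" using g_flow[of a u s] p b(1) unfolding au by blast
    ultimately have "g q = g (a + s / \<sigma>, u)" by simp
    then have q': "q = (a + s / \<sigma>, u)" using inj_on_eq_iff[OF g_inj q b(2)] by simp
    have "\<not> (u = 0 \<and> a \<le> 0 \<and> 0 \<le> a + s / \<sigma>)"
    proof
      assume z: "u = 0 \<and> a \<le> 0 \<and> 0 \<le> a + s / \<sigma>"
      have "- (a * \<sigma>) \<le> s" using z \<sigma>_pos by (simp add: field_simps)
      moreover have "0 \<le> - (a * \<sigma>)" using z \<sigma>_pos by (simp add: mult_le_0_iff)
      ultimately have "v (- (a * \<sigma>)) (g p) \<noteq> x" using before_interval[OF 0 sb] by blast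
      moreover have "v (- (a * \<sigma>)) (g p) = g (0, 0)" using g_flow[of a u "- (a * \<sigma>)"] p z \<sigma>_pos unfolding au by simp
      ultimately show False using g_0 by simp
    qed
    then show "slow_le p q" using \<open>0 \<le> s / \<sigma>\<close> unfolding slow_le_def q' au by simp
  next
    assume le: "slow_le p q"
    then obtain b where b: "q = (b, u)" "a \<le> b" unfolding slow_le_def au by (cases q) auto
    show ?L
    proof (cases "p = q")
      case True
      then show ?thesis using p slowed_zero[OF gp(1)] by (intro exI[of _ 0]) auto
    next
      case False
      then have nz: "\<not> (u = 0 \<and> a \<le> 0 \<and> 0 \<le> b)" using le unfolding slow_le_def au b by auto
      define s where "s = \<sigma> * (b - a)"
      have s0: "0 \<le> s" unfolding s_def using b \<sigma>_pos by simp
      have mv: "v r (g p) = g (a + r / \<sigma>, u) \<and> (a + r / \<sigma>, u) \<in> R \<and> (a + r / \<sigma>, u) \<noteq> (0, 0)" if r: "0 \<le> r" "r \<le> s" for r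
      proof -
        have "0 \<le> r / \<sigma>" "r / \<sigma> \<le> b - a" using r \<sigma>_pos unfolding s_def by (auto simp: field_simps)
        moreover from this have "(a + r / \<sigma>, u) \<noteq> (0, 0)" using nz by auto
        ultimately show ?thesis using g_flow[of a u r] p q unfolding au b R_iff by auto
      qed
      have sb: "s \<in> before (g p)" unfolding avoiding_times_def
      proof (intro CollectI ballI)
        fix r assume "r \<in> {min 0 s..max 0 s}"
        then have "0 \<le> r" "r \<le> s" using s0 by auto
        then show "v r (g p) \<noteq> x" using mv g_eq_x by metis
      qed
      define t where "t = time_to s (g p)"
      have cs: "clock t (g p) = s" unfolding t_def by (rule clock_surj[OF gp(1) sb])
      have cm: "clock r (g p) \<le> clock r' (g p)" if "r \<le> r'" for r r'
        using clock_strict_mono[OF gp, of r r'] that by (cases "r = r'") auto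
      have "0 \<le> t" using time_to_mono(1)[OF gp(1) sb 0] time_to_0 s0 unfolding t_def by (metis not_le)
      moreover have "slowed t (g p) = g q" unfolding sl cs using mv[of s] s0 \<sigma>_pos b unfolding s_def by simp
      moreover have "slowed r (g p) \<in> g ` R" if "r \<in> {0..t}" for r
      proof -
        have "0 \<le> clock r (g p)" "clock r (g p) \<le> s" using cm[of 0 r] cm[of r t] that clock_0[OF gp] cs by auto
        then show ?thesis unfolding sl using mv by (metis imageI)
      qed
      ultimately show ?thesis by blast
    qed
  qed
qed

lemma slowed_outside:
  assumes p: "p \<in> topspace S" and t: "\<And>s. s \<in> {0..t} \<Longrightarrow> v s p \<notin> g ` R" and s: "s \<in> {0..t}"
  shows "slowed s p = v s p"
proof -
  have xR: "x \<in> g ` R" using zero_R g_0 by force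
  have "v 0 p \<notin> g ` R" using t[of 0] s by simp
  then have px: "p \<noteq> x" using v_0[OF p] xR by auto
  have sb: "s \<in> before p" unfolding avoiding_times_def
  proof (intro CollectI ballI)
    fix r assume "r \<in> {min 0 s..max 0 s}"
    then have "r \<in> {0..t}" using s by auto
    then show "v r p \<noteq> x" using t xR by metis
  qed
  have "time_to s p = integral {0..s} (\<lambda>r. k (v r p))" using time_to_diff[OF p before_zero[OF p px] sb] s time_to_0 by simp
  also have "\<dots> = integral {0..s} (\<lambda>r. 1)" using k_out t s by (intro integral_cong) auto
  also have "\<dots> = s" using s by simp
  finally have "clock s p = s" by (rule clock_eq[OF p sb])
  then show ?thesis unfolding slowed_def using px by simp
qed

lemma slowed_singular_replacement: "singular_replacement S v x slowed"
proof -
  obtain \<phi> where \<phi>: "slowing_function \<phi>" using ex_slowing_function by blast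
  have "orbit_arcs_generated_by slowed g (square \<inter> H) (\<lambda>p. (\<phi> p, 0))"
    unfolding orbit_arcs_generated_by_def R_def[symmetric]
    by (intro ballI trans[OF slowed_arcs slowing_arcs[OF \<phi> H, folded R_def, symmetric]])
  moreover have "\<forall>p\<in>topspace S. \<forall>t\<ge>0. (\<forall>s\<in>{0..t}. v s p \<notin> g ` (square \<inter> H)) \<longrightarrow> (\<forall>s\<in>{0..t}. slowed s p = v s p)"
    using slowed_outside unfolding R_def[symmetric] by blast
  ultimately show ?thesis unfolding singular_replacement_def using slowed_flow trivial_box \<phi> by blast
qed

end

section \<open>Limit sets\<close>

lemma in_omega_limit:
  "q \<in> omega_limit X v p \<longleftrightarrow> q \<in> topspace X \<and> (\<forall>U. openin X U \<longrightarrow> q \<in> U \<longrightarrow> (\<forall>n. \<exists>t>n. v t p \<in> U))"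
proof -
  have "q \<in> omega_limit X v p \<longleftrightarrow>
      (\<forall>n. q \<in> topspace X \<and> (\<forall>U. q \<in> U \<and> openin X U \<longrightarrow> (\<exists>y. y \<in> {v t p | t. t > n} \<and> y \<in> U)))"
    unfolding omega_limit_def by (simp add: in_closure_of)
  then show ?thesis by blast
qed

lemma closedin_omega_limit: "closedin X (omega_limit X v p)"
  unfolding omega_limit_def by (rule closedin_INT) auto

lemma omega_limit_flow:
  assumes v: "flow_on X v" and p: "p \<in> topspace X" and q: "q \<in> omega_limit X v p"
  shows "v s q \<in> omega_limit X v p"
  unfolding in_omega_limit
proof (intro conjI allI impI)
  have qX: "q \<in> topspace X" using q in_omega_limit by metis
  then show "v s q \<in> topspace X" by (rule flow_continuous(4)[OF v])
  fix U n assume U: "openin X U" "v s q \<in> U"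
  have "continuous_map X X (v s)" using flow_continuous_compose[OF v, of X "\<lambda>_. s" "\<lambda>p. p"] by simp
  then have "openin X {r \<in> topspace X. v s r \<in> U}" using U(1) by (rule openin_continuous_map_preimage)
  moreover have "q \<in> {r \<in> topspace X. v s r \<in> U}" using U(2) qX by simp
  ultimately obtain t where "t > n - s" "v t p \<in> {r \<in> topspace X. v s r \<in> U}"
    using q[unfolded in_omega_limit] by blast
  then show "\<exists>t>n. v t p \<in> U" using flow_continuous(3)[OF v p, of s t] by (intro exI[of _ "s + t"]) auto
qed

lemma omega_limit_reparametrized:
  assumes \<tau>: "strict_mono (\<tau> :: real \<Rightarrow> real)" "range \<tau> = UNIV" and w: "\<And>t. w t p = v (\<tau> t) p"
  shows "omega_limit X w p = omega_limit X v p"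
proof -
  have "(\<exists>t>n. w t p \<in> U) \<longleftrightarrow> (\<exists>t>\<tau> n. v t p \<in> U)" for n U
  proof
    assume "\<exists>t>n. w t p \<in> U"
    then show "\<exists>t>\<tau> n. v t p \<in> U" using \<tau>(1) w by (auto simp: strict_mono_def)
  next
    assume "\<exists>t>\<tau> n. v t p \<in> U"
    then obtain t where t: "t > \<tau> n" "v t p \<in> U" by blast
    obtain s where "t = \<tau> s" using \<tau>(2) by (metis UNIV_I rangeE)
    then show "\<exists>t>n. w t p \<in> U" using t strict_mono_less[OF \<tau>(1)] w by metis
  qed
  moreover have "(\<forall>n. P (\<tau> n)) \<longleftrightarrow> (\<forall>n. P n)" for P using \<tau>(2) by (metis UNIV_I rangeE)
  ultimately have "(\<forall>n. \<exists>t>n. w t p \<in> U) \<longleftrightarrow> (\<forall>n. \<exists>t>n. v t p \<in> U)" for U by simp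
  then show ?thesis unfolding set_eq_iff in_omega_limit by simp
qed

text \<open>The first coordinate of the passage is left free: the flow sweeps the whole horizontal
  arc at height \<open>b\<close> anyway.\<close>

definition from_above :: "(real \<Rightarrow> 'a \<Rightarrow> 'a) \<Rightarrow> 'a \<Rightarrow> (real \<times> real) set \<Rightarrow> (real \<times> real \<Rightarrow> 'a) \<Rightarrow> bool" where
  "from_above v y R g \<longleftrightarrow>
     (\<forall>\<delta>>0. \<forall>n. \<exists>t>n. \<exists>a b. (a, b) \<in> R \<and> v t y = g (a, b) \<and> 0 < b \<and> b < \<delta>)"

context uniform_box
begin

text \<open>Otherwise \<open>y\<close> would lie on the orbit of \<open>x\<close>.\<close>

lemma height_nonzero:
  assumes y: "y \<in> topspace S" "y \<notin> omega_limit S v y" and x: "x \<in> omega_limit S v y"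
    and au: "(a, u) \<in> R" "v t y = g (a, u)"
  shows "u \<noteq> 0"
proof
  assume "u = 0"
  then have "v (\<sigma> * a) x = v t y"
    using g_flow[of 0 0 "\<sigma> * a"] zero_R au \<sigma>_pos g_0 unfolding R_iff by simp
  then have "v (- t + \<sigma> * a) x = y"
    using flow_continuous(3)[OF v_flow x_in_S, of "- t" "\<sigma> * a"] flow_inverse[OF v_flow y(1)] by simp
  then show False using omega_limit_flow[OF v_flow y(1) x] y(2) by metis
qed

text \<open>The orbit of \<open>y\<close> returns to every neighbourhood of \<open>x\<close>, and
  its heights there are never 0, so one sign occurs arbitrarily late with arbitrarily small size.
  Negative heights exist only in a full box, which can be reflected.\<close>

lemma from_above_or_below:
  assumes y: "y \<in> topspace S" "y \<notin> omega_limit S v y" and x: "x \<in> omega_limit S v y"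
  shows "from_above v y R g \<or> (H = UNIV \<and> from_above v y R (\<lambda>(a, u). g (a, - u)))"
proof (cases "from_above v y R g")
  case False
  then obtain \<delta>0 n0 where above: "\<delta>0 > 0" "\<And>t a b. t > n0 \<Longrightarrow> (a, b) \<in> R \<Longrightarrow> v t y = g (a, b) \<Longrightarrow> 0 < b \<Longrightarrow> b < \<delta>0 \<Longrightarrow> False"
    unfolding from_above_def by blast
  have below: "\<exists>t>n. \<exists>a b. (a, b) \<in> R \<and> v t y = g (a, b) \<and> b < 0 \<and> - b < \<delta>" if \<delta>: "\<delta> > 0" for \<delta> n
  proof -
    define d where "d = min (min \<delta> \<delta>0) (1/2)"
    have d: "0 < d" "d \<le> \<delta>" "d \<le> \<delta>0" "d \<le> 1/2" unfolding d_def using \<delta> above(1) by auto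
    let ?U = "{-d<..<d} \<times> {-d<..<d}"
    have "open ?U" by (intro open_Times) auto
    moreover have "?U \<inter> R \<subseteq> open_square" unfolding open_square_def using d(4) by auto
    ultimately have "openin S (g ` (?U \<inter> R))" by (rule g_open_image)
    moreover have "x \<in> g ` (?U \<inter> R)" using zero_R g_0 d(1) by (intro image_eqI[of _ _ "(0, 0)"]) auto
    ultimately obtain t where t: "t > max n n0" "v t y \<in> g ` (?U \<inter> R)"
      using x[unfolded in_omega_limit] by blast
    then obtain a b where ab: "(a, b) \<in> R" "v t y = g (a, b)" "- d < b" "b < d" by auto
    have "b \<noteq> 0" by (rule height_nonzero[OF y x ab(1,2)])
    moreover have "\<not> 0 < b" using above(2)[OF _ ab(1,2)] t(1) ab(4) d(3) by auto
    ultimately show ?thesis using t(1) ab d(2) by (intro exI[of _ t]) force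
  qed
  obtain t a b where "(a, b) \<in> R" "b < 0" using below[of 1 0] by auto
  then have H': "H = UNIV" using H unfolding R_iff by auto
  have "from_above v y R (\<lambda>(a, u). g (a, - u))" unfolding from_above_def
  proof (intro allI impI)
    fix \<delta> n :: real assume "\<delta> > 0"
    from below[OF this, of n] obtain t a b where t: "t > n" "(a, b) \<in> R" "v t y = g (a, b)" "b < 0" "- b < \<delta>" by blast
    have "(a, - b) \<in> R" using t(2,4) H' H unfolding R_iff by (auto simp: half_plane_def)
    then have "\<exists>a b. (a, b) \<in> R \<and> v t y = (case (a, b) of (a, u) \<Rightarrow> g (a, - u)) \<and> 0 < b \<and> b < \<delta>"
      using t exI[of "\<lambda>c. (a, c) \<in> R \<and> v t y = g (a, - c) \<and> 0 < c \<and> c < \<delta>" "- b"] by auto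
    then show "\<exists>t>n. \<exists>a b. (a, b) \<in> R \<and> v t y = (case (a, b) of (a, u) \<Rightarrow> g (a, - u)) \<and> 0 < b \<and> b < \<delta>"
      using t(1) by blast
  qed
  then show ?thesis using H' by blast
qed blast

lemma reflected:
  assumes H': "H = UNIV"
  shows "uniform_flow_box S v x H \<sigma> (\<lambda>(a, u). g (a, - u))"
proof -
  define r :: "real \<times> real \<Rightarrow> real \<times> real" where "r = (\<lambda>(a, u). (a, - u))"
  have rr: "r (r p) = p" and rs: "p \<in> square \<Longrightarrow> r p \<in> square" and ro: "p \<in> open_square \<Longrightarrow> r p \<in> open_square" for p
    unfolding r_def square_def open_square_def by (auto split: prod.splits)
  have rc: "continuous_on A r" for A unfolding r_def case_prod_unfold by (intro continuous_intros)
  have gr: "(\<lambda>(a, u). g (a, - u)) = g \<circ> r" unfolding r_def by (auto simp: fun_eq_iff)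
  have "homeomorphic_maps (top_of_set square) (top_of_set square) r r"
    unfolding homeomorphic_maps_def using rr rs rc by auto
  then have "homeomorphic_map (top_of_set square) (top_of_set square) r" using homeomorphic_map_maps by blast
  then have "embedding_map (top_of_set square) (top_of_set square) r"
    using surjective_embedding_map by blast
  then have emb: "embedding_map (top_of_set square) S (g \<circ> r)"
    by (rule embedding_map_compose) (use g_emb' H' in simp)
  have "r ` open_square = open_square" using ro rr by (metis image_subset_iff rev_image_eqI subsetI subset_antisym)
  then have op: "openin S ((g \<circ> r) ` open_square)" unfolding image_comp[symmetric] using g_open H' by simp
  have sq: "R = square" unfolding R_def using H' by simp
  have fl: "v s (g (r (a, u))) = g (r (a + s / \<sigma>, u))" if "(a, u) \<in> square" "a + s / \<sigma> \<in> {-1..1}" for a u s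
    using g_flow[of a "- u" s] rs[OF that(1)] that(2) unfolding sq r_def by simp
  have se: "snd q = snd p \<and> fst q = fst p + s / \<sigma>"
    if "p \<in> square" "q \<in> square" "\<bar>s\<bar> \<le> \<sigma>" "v s (g (r p)) = g (r q)" for p q s
    using g_section[of "r p" "r q" s] rs that unfolding sq by (simp add: r_def case_prod_unfold)
  have "(g \<circ> r) (0, 0) = x" using g_0 unfolding r_def by simp
  then show ?thesis unfolding uniform_flow_box_def gr
    using H' \<sigma>_pos emb op fl se by simp
qed

end

lemma ex_box_from_above:
  assumes S: "surface S" and v: "flow_on S v" and y: "y \<in> topspace S" "y \<notin> omega_limit S v y"
    and x: "x \<in> omega_limit S v y" "\<not> singular_point v x"
  shows "\<exists>H \<sigma> g. uniform_flow_box S v x H \<sigma> g \<and> y \<notin> g ` (square \<inter> H) \<and> from_above v y (square \<inter> H) g"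
proof -
  have haus: "Hausdorff_space S" using S unfolding surface_def by blast
  have xS: "x \<in> topspace S" using x(1) in_omega_limit by metis
  have "closedin S {y}" using haus y(1) by (simp add: Hausdorff_imp_t1_space closedin_t1_singleton)
  \<comment> \<open>The box is chosen away from \<open>y\<close>, so that neither collapse nor
    blow-up moves \<open>y\<close>.\<close>
  then have op: "openin S (topspace S - {y})" by blast
  have "x \<noteq> y" using x(1) y(2) by blast
  then have "x \<in> topspace S - {y}" using xS by simp
  from ex_uniform_flow_box[OF S v xS x(2) op this]
  obtain H \<sigma> g where box: "uniform_flow_box S v x H \<sigma> g" and sub: "g ` (square \<inter> H) \<subseteq> topspace S - {y}" by blast
  interpret uniform_box S v x H \<sigma> g by (rule uniform_box.intro[OF v haus box])
  from from_above_or_below[OF y x(1)] show ?thesis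
  proof
    assume "from_above v y R g"
    then show ?thesis using box sub unfolding R_def by blast
  next
    assume r: "H = UNIV \<and> from_above v y R (\<lambda>(a, u). g (a, - u))"
    have "y \<notin> (\<lambda>(a, u). g (a, - u)) ` (square \<inter> H)"
    proof
      assume "y \<in> (\<lambda>(a, u). g (a, - u)) ` (square \<inter> H)"
      then obtain a u where "(a, u) \<in> square" "y = g (a, - u)" by auto
      moreover from this have "(a, - u) \<in> square \<inter> H" using r unfolding square_def by auto
      ultimately show False using sub by blast
    qed
    then show ?thesis using reflected r unfolding R_def by blast
  qed
qed

section \<open>The blow-up in the upper half of a box\<close>

definition on_upper :: "(real \<times> real \<Rightarrow> real \<times> real) \<Rightarrow> real \<times> real \<Rightarrow> real \<times> real" where
  "on_upper f p = (if 0 \<le> snd p then f p else p)"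

text \<open>This makes the collapse fit continuously to the identity below the edge, also at the
  origin.\<close>

lemma collapse_edge: "p \<in> half_box \<Longrightarrow> snd p = 0 \<Longrightarrow> collapse p = p"
  using collapse_blow_up[of p] blow_up_id[of p] zero_in_blob by (cases "p = (0, 0)") (auto simp: collapse_def)

context uniform_box
begin

lemma half_box_R: "half_box \<subseteq> R"
  unfolding half_box_def by (auto simp: R_iff)

lemma R_upper:
  assumes "z \<in> R"
  shows "0 \<le> snd z \<longleftrightarrow> z \<in> half_box"
proof -
  have "(fst z, snd z) \<in> R" using assms by simp
  then show ?thesis unfolding R_iff half_box_def mem_Times_iff by auto
qed

lemma on_upper_continuous:
  assumes f: "continuous_on (half_box - Z) f" and edge: "\<And>z. z \<in> half_box - Z \<Longrightarrow> snd z = 0 \<Longrightarrow> f z = z"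
  shows "continuous_on (R - Z) (on_upper f)"
proof -
  let ?A = "(R - Z) \<inter> {z. 0 \<le> snd z}" and ?B = "(R - Z) \<inter> {z. snd z \<le> 0}"
  have A: "?A \<subseteq> half_box - Z" using R_upper by blast
  have "closed {z :: real \<times> real. 0 \<le> snd z}" "closed {z :: real \<times> real. snd z \<le> 0}"
    by (intro closed_Collect_le continuous_intros)+
  then have "closedin (top_of_set (?A \<union> ?B)) ?A" "closedin (top_of_set (?A \<union> ?B)) ?B"
    by (auto simp: closedin_closed)
  then have "continuous_on (?A \<union> ?B) (\<lambda>z. if 0 \<le> snd z then f z else z)"
    by (rule continuous_on_cases_local[OF _ _ continuous_on_subset[OF f A] continuous_on_id]) (use edge A in auto)
  moreover have "?A \<union> ?B = R - Z" by auto
  ultimately show ?thesis unfolding on_upper_def by simp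
qed

lemma upper_collapse_data: "collapse_data S v x H \<sigma> g (on_upper blow_up) (on_upper collapse) blob"
proof unfold_locales
  note simps = on_upper_def R_upper
  have zb: "(0, 0) \<in> half_box" by (simp add: half_box_def)
  have up: "0 \<le> snd p" if "p \<in> half_box" for p using that unfolding half_box_def by auto
  show "continuous_on R (on_upper collapse)"
    using on_upper_continuous[of "{}" collapse] collapse_cont collapse_edge by simp
  show "continuous_on (R - {(0, 0)}) (on_upper blow_up)"
    by (rule on_upper_continuous[OF blow_up_cont]) (use blow_up_id in auto)
  show "blob \<subseteq> R" using blob_half_box half_box_R by blast
  show "on_upper collapse z \<in> R" if "z \<in> R" for z
    using that collapse_half_box[of z] half_box_R R_upper[OF that] unfolding on_upper_def by auto
  show "on_upper collapse z = (0, 0) \<longleftrightarrow> z \<in> blob" if "z \<in> R" for z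
    using collapse_eq_zero[of z] R_upper[OF that] blob_half_box unfolding on_upper_def by auto
  show "on_upper blow_up q \<in> R" if "q \<in> R" "q \<noteq> (0, 0)" for q
    using that blow_up_half_box[of q] half_box_R R_upper[OF that(1)] unfolding on_upper_def by auto
  show "on_upper collapse (on_upper blow_up q) = q" if "q \<in> R" "q \<noteq> (0, 0)" for q
    using that blow_up_half_box[of q] up[of "blow_up q"] collapse_blow_up[of q] R_upper[OF that(1)] unfolding on_upper_def by simp
  show "on_upper blow_up (on_upper collapse z) = z" if "z \<in> R" "z \<notin> blob" for z
    using that blow_up_collapse[of z] up[of "collapse z"] R_upper[OF that(1)] unfolding on_upper_def by simp
  show "on_upper collapse z = z" if z: "z \<in> R" "1/2 \<le> \<bar>fst z\<bar> \<or> 1/2 \<le> \<bar>snd z\<bar>" for z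
  proof (cases "0 \<le> snd z")
    case True
    then have hb: "z \<in> half_box" using R_upper[OF z(1)] by simp
    have "1/2 \<le> shell z" "z \<noteq> (0, 0)" using z(2) True unfolding shell_def by (auto simp: le_max_iff_disj)
    then have "blow_up z = z" using blow_up_id hb by blast
    then show ?thesis using collapse_blow_up[OF hb \<open>z \<noteq> (0, 0)\<close>] True unfolding on_upper_def by simp
  qed (simp add: on_upper_def)
qed

lemma ex_blow_up: "\<exists>k lam. blow_up_flow S v x H \<sigma> g k lam (on_upper blow_up) (on_upper collapse) blob"
proof -
  interpret c: collapse_data S v x H \<sigma> g "on_upper blow_up" "on_upper collapse" blob by (rule upper_collapse_data)
  from ex_slow_speed[OF c.G_cont] obtain k lam where sb: "slow_box S v x H \<sigma> g k lam" and
    dr: "\<And>q q'. q \<in> R - {(0,0)} \<Longrightarrow> q' \<in> R - {(0,0)} \<Longrightarrow> dist q q' < lam q \<Longrightarrow> dist (on_upper blow_up q) (on_upper blow_up q') < norm q"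
    by blast
  interpret s: slow_box S v x H \<sigma> g k lam by (rule sb)
  have "blow_up_flow S v x H \<sigma> g k lam (on_upper blow_up) (on_upper collapse) blob"
    by unfold_locales (use dr in blast)
  then show ?thesis by blast
qed

end

section \<open>The blown-up limit set\<close>

locale limit_blow_up =
  blow_up_flow S v x H \<sigma> g k lam "on_upper blow_up" "on_upper collapse" blob for S v x H \<sigma> g k lam +
  fixes y :: 'a and \<omega> :: "'a set"
  assumes y_in: "y \<in> topspace S" and y_out: "y \<notin> g ` R" and limit: "omega_limit S v y = \<omega>"
    and x_limit: "x \<in> \<omega>" and y_not_limit: "y \<notin> \<omega>" and above: "from_above v y R g"
begin

definition \<Omega> :: "'a set" where
  "\<Omega> = {p \<in> topspace S. collapse_map p \<in> \<omega>}"

lemma \<omega>_flow: "q \<in> \<omega> \<Longrightarrow> v s q \<in> \<omega>"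
  using omega_limit_flow[OF v_flow y_in, of q s] unfolding limit .

text \<open>The limit set is invariant and contains \<open>x\<close>, so an orbit outside it never
  meets \<open>x\<close>, and slowing down merely reparametrizes the whole orbit.\<close>

lemma off_\<omega>:
  assumes p: "p \<in> topspace S" "p \<notin> \<omega>"
  shows "v s p \<noteq> x" "p \<noteq> x" "before p = UNIV" "v s p \<notin> \<omega>"
proof -
  show 1: "v s p \<notin> \<omega>" for s
  proof
    assume "v s p \<in> \<omega>"
    then have "v (- s) (v s p) \<in> \<omega>" by (rule \<omega>_flow)
    then show False using flow_inverse[OF v_flow p(1)] p(2) by simp
  qed
  then show 2: "v s p \<noteq> x" for s using x_limit by metis
  then show "before p = UNIV" unfolding avoiding_times_def by blast
  show "p \<noteq> x" using p(2) x_limit by blast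
qed

lemma clock_off:
  assumes p: "p \<in> topspace S" "p \<notin> \<omega>"
  shows "strict_mono (\<lambda>t. clock t p)" "range (\<lambda>t. clock t p) = UNIV" "slowed t p = v (clock t p) p"
    "clock (time_to t p) p = t" "time_to (clock t p) p = t" "strict_mono (\<lambda>t. time_to t p)"
proof -
  note o = off_\<omega>[OF p]
  have b: "s \<in> before p" for s using o(3) by simp
  show "strict_mono (\<lambda>t. clock t p)" using clock_strict_mono[OF p(1) o(2)] by (simp add: strict_mono_def)
  show cs: "clock (time_to t p) p = t" for t by (rule clock_surj[OF p(1) b])
  show "range (\<lambda>t. clock t p) = UNIV" using cs by (metis surjI)
  show "slowed t p = v (clock t p) p" unfolding slowed_def using o(2) by simp
  show "time_to (clock t p) p = t" by (rule clock(2)[OF p(1) o(2)])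
  show "strict_mono (\<lambda>t. time_to t p)" using time_to_mono(1)[OF p(1) b b] by (simp add: strict_mono_def)
qed

lemma slowed_limit: "omega_limit S slowed y = \<omega>"
  unfolding limit[symmetric]
  by (rule omega_limit_reparametrized[of "\<lambda>t. clock t y"]) (rule clock_off(1-3)[OF y_in y_not_limit])+

lemma y_out_blob: "y \<notin> g ` blob"
  using y_out C_R by blast

lemma collapse_y: "collapse_map y = y"
  unfolding collapse_map_def by (simp add: y_out)

lemma blown_y: "blown t y = blow_map (slowed t y)" "collapse_map (blown t y) = slowed t y"
  unfolding blown_semiconj[OF y_in] collapse_y by (simp_all add: blown_def y_out_blob collapse_y)

lemma blown_limit_sub: "omega_limit S blown y \<subseteq> \<Omega>"
proof
  fix p assume p: "p \<in> omega_limit S blown y"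
  then have pS: "p \<in> topspace S" using in_omega_limit by metis
  have "collapse_map p \<in> omega_limit S slowed y" unfolding in_omega_limit
  proof (intro conjI allI impI)
    show "collapse_map p \<in> topspace S" by (rule collapse_map_in[OF pS])
    fix U n assume U: "openin S U" "collapse_map p \<in> U"
    have "openin S {q \<in> topspace S. collapse_map q \<in> U}" by (rule openin_continuous_map_preimage[OF collapse_map_cont U(1)])
    moreover have "p \<in> {q \<in> topspace S. collapse_map q \<in> U}" using pS U(2) by simp
    ultimately obtain t where "t > n" "blown t y \<in> {q \<in> topspace S. collapse_map q \<in> U}"
      using p[unfolded in_omega_limit] by blast
    then show "\<exists>t>n. slowed t y \<in> U" using blown_y(2) by auto
  qed
  then show "p \<in> \<Omega>" unfolding \<Omega>_def slowed_limit using pS by simp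
qed

text \<open>Each late passage of the orbit of \<open>y\<close> at a small height \<open>b\<close>
  sweeps the entire horizontal arc, hence also the point \<open>(a, b)\<close> whose blow-up is
  close to \<open>c\<close>. Slowing down can only delay that moment.\<close>

lemma stem_in_limit:
  assumes c: "c \<in> stem" "0 < snd c"
  shows "g c \<in> omega_limit S blown y"
  unfolding in_omega_limit
proof (intro conjI allI impI)
  have cR: "c \<in> R" using c(1) C_R unfolding blob_def by blast
  then show "g c \<in> topspace S" by (rule g_in)
  fix U n assume U: "openin S U" "g c \<in> U"
  have "openin (top_of_set R) {z \<in> topspace (top_of_set R). g z \<in> U}" by (rule openin_continuous_map_preimage[OF g_cont U(1)])
  then have "openin (top_of_set R) {z \<in> R. g z \<in> U}" by simp
  moreover have "c \<in> {z \<in> R. g z \<in> U}" using cR U(2) by simp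
  ultimately obtain e where e: "e > 0" "\<And>z. z \<in> R \<Longrightarrow> dist z c < e \<Longrightarrow> g z \<in> U"
    unfolding openin_euclidean_subtopology_iff by blast
  obtain \<delta> where \<delta>: "\<delta> > 0" "\<And>b. 0 < b \<Longrightarrow> b < \<delta> \<Longrightarrow> \<exists>a\<in>{-1..1}. dist (blow_up (a, b)) c < e"
    using blow_up_horizontal_dense[OF c e(1)] by blast
  \<comment> \<open>\<open>2 * \<sigma>\<close> is the time needed to cross the box, so the passage
    at abscissa \<open>a\<close> is still later than \<open>n\<close> and at a positive
    time.\<close>
  obtain t a0 b where t: "t > \<bar>n\<bar> + 2 * \<sigma>" "(a0, b) \<in> R" "v t y = g (a0, b)" "0 < b" "b < \<delta>"
    using above \<delta>(1) unfolding from_above_def by blast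
  obtain a where a: "a \<in> {-1..1}" "dist (blow_up (a, b)) c < e" using \<delta>(2) t by blast
  have ab: "(a, b) \<in> R" using a t(2) unfolding R_iff by auto
  define s where "s = t + \<sigma> * (a - a0)"
  have "\<bar>a - a0\<bar> \<le> 2" using a(1) t(2) unfolding R_iff by auto
  then have "\<bar>\<sigma> * (a - a0)\<bar> \<le> \<sigma> * 2" using \<sigma>_pos by (simp add: abs_mult)
  then have s: "n < s" "0 < s" using t(1) unfolding s_def by linarith+
  have "v s y = v (\<sigma> * (a - a0)) (v t y)" unfolding s_def using flow_continuous(3)[OF v_flow y_in, of "\<sigma> * (a - a0)" t] by (simp add: add.commute)
  also have "\<dots> = g (a, b)" unfolding t(3) using g_flow[OF t(2), of "\<sigma> * (a - a0)"] \<sigma>_pos a(1) by simp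
  finally have vs: "v s y = g (a, b)" .
  note oy = off_\<omega>[OF y_in y_not_limit]
  have "s \<le> time_to s y" using time_to_ge[OF y_in _ _ less_imp_le[OF s(2)]] oy(3) time_to_0[of y] by simp
  moreover have "slowed (time_to s y) y = g (a, b)" using clock_off(3,4)[OF y_in y_not_limit] vs by simp
  then have "blown (time_to s y) y = g (blow_up (a, b))" using blown_y(1) blow_map_g[OF ab] t(4) unfolding on_upper_def by simp
  moreover have "blow_up (a, b) \<in> R" using G_R[OF ab] t(4) unfolding on_upper_def by simp
  then have "g (blow_up (a, b)) \<in> U" using e(2) a(2) by blast
  ultimately show "\<exists>t>n. blown t y \<in> U" using s(1) by (intro exI[of _ "time_to s y"]) auto
qed

text \<open>Off the blob, limit points are transported by the continuous \<open>blow_map\<close>. On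
  the blob, the part of the stem at positive height lies in the limit set, which is closed and hence
  contains everything that \<open>blob_closure\<close> provides.\<close>

lemma blown_limit: "omega_limit S blown y = \<Omega>"
proof (intro subset_antisym blown_limit_sub subsetI)
  fix p assume "p \<in> \<Omega>"
  then have p: "p \<in> topspace S" "collapse_map p \<in> \<omega>" unfolding \<Omega>_def by auto
  show "p \<in> omega_limit S blown y"
  proof (cases "p \<in> g ` blob")
    case True
    then obtain c where c: "c \<in> blob" "p = g c" by blast
    have "closedin (top_of_set R) {z \<in> topspace (top_of_set R). g z \<in> omega_limit S blown y}"
      by (rule closedin_continuous_map_preimage[OF g_cont closedin_omega_limit])
    then have "closedin (top_of_set R) {z \<in> R. g z \<in> omega_limit S blown y}" by simp
    then have "closed {z \<in> R. g z \<in> omega_limit S blown y}"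
      using compact_R compact_imp_closed closedin_closed_trans by blast
    moreover have "stem \<inter> {p. 0 < snd p} \<subseteq> {z \<in> R. g z \<in> omega_limit S blown y}"
      using stem_in_limit C_R unfolding blob_def by blast
    ultimately have "closure (stem \<inter> {p. 0 < snd p}) \<subseteq> {z \<in> R. g z \<in> omega_limit S blown y}" by (intro closure_minimal)
    then show ?thesis using blob_closure c by blast
  next
    case False
    show ?thesis unfolding in_omega_limit
    proof (intro conjI allI impI p(1))
      fix U n assume U: "openin S U" "p \<in> U"
      let ?V = "{q \<in> topspace S - {x}. blow_map q \<in> U}"
      have "openin (subtopology S (topspace S - {x})) {q \<in> topspace (subtopology S (topspace S - {x})). blow_map q \<in> U}"
        by (rule openin_continuous_map_preimage[OF blow_map_cont U(1)])
      moreover have "{q \<in> topspace (subtopology S (topspace S - {x})). blow_map q \<in> U} = ?V" by auto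
      ultimately have "openin (subtopology S (topspace S - {x})) ?V" by simp
      moreover have "openin S (topspace S - {x})" using x_closed by blast
      ultimately have "openin S ?V" by (rule openin_trans_full)
      moreover have "collapse_map p \<in> ?V" using off_C[OF p(1) False] blow_collapse[OF p(1) False] U(2) by simp
      moreover have "collapse_map p \<in> omega_limit S slowed y" using p(2) slowed_limit by simp
      ultimately obtain t where "t > n" "slowed t y \<in> ?V" unfolding in_omega_limit by blast
      then show "\<exists>t>n. blown t y \<in> U" using blown_y(1) by auto
    qed
  qed
qed

text \<open>\<open>blow_map\<close> and \<open>collapse_map\<close> are inverse to each other
  between the complements. The reparametrization is \<open>time_to\<close>, a bijection of the line
  because the orbits concerned avoid \<open>x\<close>.\<close>

lemma complements_equivalent:
  "topologically_equivalent (subtopology S (topspace S - \<omega>)) v (subtopology S (topspace S - \<Omega>)) blown"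
  unfolding topologically_equivalent_def
proof (intro exI[of _ blow_map] conjI ballI)
  have ne: "p \<noteq> x" if "p \<in> topspace S - \<omega>" for p using that x_limit by blast
  have bm: "blow_map p \<in> topspace S - \<Omega>" if "p \<in> topspace S - \<omega>" for p
    using blow_map_in[of p] collapse_blow[of p] ne[OF that] that unfolding \<Omega>_def by auto
  have cm: "collapse_map p \<in> topspace S - \<omega>" if "p \<in> topspace S - \<Omega>" for p
    using collapse_map_in[of p] that unfolding \<Omega>_def by auto
  have nC: "p \<notin> g ` blob" if "p \<in> topspace S - \<Omega>" for p
    using collapse_map_eq_x[of p] that x_limit unfolding \<Omega>_def by auto
  have "homeomorphic_maps (subtopology S (topspace S - \<omega>)) (subtopology S (topspace S - \<Omega>)) blow_map collapse_map"
    unfolding homeomorphic_maps_def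
  proof (intro conjI ballI)
    have "continuous_map (subtopology S (topspace S - \<omega>)) S blow_map"
      using continuous_map_from_subtopology_mono[OF blow_map_cont, of "topspace S - \<omega>"] x_limit by blast
    then show "continuous_map (subtopology S (topspace S - \<omega>)) (subtopology S (topspace S - \<Omega>)) blow_map"
      using bm by (auto simp: continuous_map_in_subtopology)
    show "continuous_map (subtopology S (topspace S - \<Omega>)) (subtopology S (topspace S - \<omega>)) collapse_map"
      using continuous_map_from_subtopology[OF collapse_map_cont] cm by (auto simp: continuous_map_in_subtopology)
    show "collapse_map (blow_map p) = p" if "p \<in> topspace (subtopology S (topspace S - \<omega>))" for p
      using collapse_blow[of p] ne[of p] that by auto
    show "blow_map (collapse_map p) = p" if "p \<in> topspace (subtopology S (topspace S - \<Omega>))" for p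
      using blow_collapse[of p] nC[of p] that by auto
  qed
  then show "homeomorphic_map (subtopology S (topspace S - \<omega>)) (subtopology S (topspace S - \<Omega>)) blow_map"
    using homeomorphic_map_maps by blast
  fix p assume "p \<in> topspace (subtopology S (topspace S - \<omega>))"
  then have p: "p \<in> topspace S" "p \<notin> \<omega>" by auto
  have px: "p \<noteq> x" using ne p by blast
  show "\<exists>\<tau>. strict_mono \<tau> \<and> surj \<tau> \<and> (\<forall>t. blow_map (v t p) = blown (\<tau> t) (blow_map p))"
  proof (intro exI[of _ "\<lambda>t. time_to t p"] conjI allI)
    show "strict_mono (\<lambda>t. time_to t p)" by (rule clock_off(6)[OF p])
    show "surj (\<lambda>t. time_to t p)" using clock_off(5)[OF p] by (metis surjI)
    fix t
    have "blown (time_to t p) (blow_map p) = blow_map (slowed (time_to t p) p)"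
      unfolding blown_def using blow_map_notin[OF p(1) px] collapse_blow[OF p(1) px] by simp
    also have "\<dots> = blow_map (v t p)" using clock_off(3,4)[OF p] by simp
    finally show "blow_map (v t p) = blown (time_to t p) (blow_map p)" ..
  qed
qed

text \<open>Away from \<open>x\<close>, openness is transported by \<open>blow_map\<close>. At
  \<open>x\<close> the box helps, since the surface need not be compact: the box points outside the
  preimage form a compact set, whose collapsed image is closed and misses \<open>x\<close>, so
  removing it from the open box leaves a neighbourhood of \<open>x\<close> inside
  \<open>U\<close>.\<close>

lemma collapse_quotient: "quotient_map S S collapse_map"
  unfolding quotient_map_def
proof (intro conjI allI impI)
  show "collapse_map ` topspace S = topspace S"
  proof (intro subset_antisym subsetI)
    fix q assume q: "q \<in> topspace S"
    show "q \<in> collapse_map ` topspace S"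
    proof (cases "q = x")
      case True
      then show ?thesis using collapse_map_g[OF zero_R] h_zero[OF zero_R] zero_in_blob g_0 x_in_S by (metis image_eqI)
    next
      case False
      then show ?thesis using collapse_blow[OF q] blow_map_in[OF q] by (metis image_eqI)
    qed
  qed (use collapse_map_in in auto)
  fix U assume U: "U \<subseteq> topspace S"
  define P where "P = {p \<in> topspace S. collapse_map p \<in> U}"
  show "openin S {p \<in> topspace S. collapse_map p \<in> U} \<longleftrightarrow> openin S U"
    unfolding P_def[symmetric]
  proof
    assume P: "openin S P"
    have "openin (subtopology S (topspace S - {x})) {p \<in> topspace (subtopology S (topspace S - {x})). blow_map p \<in> P}"
      by (rule openin_continuous_map_preimage[OF blow_map_cont P])
    moreover have "blow_map p \<in> P \<longleftrightarrow> p \<in> U" if "p \<in> topspace S" "p \<noteq> x" for p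
      unfolding P_def using collapse_blow[OF that] blow_map_in[OF that] by simp
    then have "{p \<in> topspace (subtopology S (topspace S - {x})). blow_map p \<in> P} = U - {x}" using U by auto
    ultimately have "openin (subtopology S (topspace S - {x})) (U - {x})" by simp
    moreover have "openin S (topspace S - {x})" using x_closed by blast
    ultimately have o1: "openin S (U - {x})" by (rule openin_trans_full)
    show "openin S U"
    proof (subst openin_subopen, intro ballI)
      fix q assume q: "q \<in> U"
      show "\<exists>T. openin S T \<and> q \<in> T \<and> T \<subseteq> U"
      proof (cases "x \<in> U")
        case False
        then have "U - {x} = U" by blast
        then show ?thesis using o1 q by auto
      next
        case True
        define K where "K = {z \<in> R. g z \<notin> P}"
        have "closedin S (topspace S - P)" using P by blast
        from closedin_continuous_map_preimage[OF g_cont this]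
        have "closedin (top_of_set R) {z \<in> topspace (top_of_set R). g z \<in> topspace S - P}" .
        moreover have "{z \<in> topspace (top_of_set R). g z \<in> topspace S - P} = K" unfolding K_def using g_in by auto
        ultimately have "compact K" using closedin_compact[OF compact_R] by simp
        moreover have "continuous_on K (on_upper collapse)" by (rule continuous_on_subset[OF h_cont]) (auto simp: K_def)
        ultimately have "compact (on_upper collapse ` K)" by (rule compact_continuous_image[rotated])
        then have cl: "closedin S (g ` on_upper collapse ` K)"
          using g_closed_image compact_imp_closed h_R unfolding K_def by blast
        have "z \<notin> K" if "z \<in> R" "on_upper collapse z = (0, 0)" for z
          using that collapse_map_g[of z] g_0 True g_in unfolding K_def P_def by simp
        then have "x \<notin> g ` on_upper collapse ` K" using g_eq_x h_R unfolding K_def by blast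
        moreover have "x \<in> g ` (open_square \<inter> H)"
          using H g_0 unfolding open_square_def half_plane_def by (intro image_eqI[of _ _ "(0, 0)"]) auto
        ultimately have xN: "x \<in> g ` (open_square \<inter> H) - g ` on_upper collapse ` K" by blast
        have o2: "openin S (g ` (open_square \<inter> H) - g ` on_upper collapse ` K)" by (rule openin_diff[OF g_open cl])
        have "g ` (open_square \<inter> H) - g ` on_upper collapse ` K \<subseteq> U"
        proof
          fix r assume r: "r \<in> g ` (open_square \<inter> H) - g ` on_upper collapse ` K"
          then obtain z' where z': "z' \<in> R" "r = g z'" using open_square_R by blast
          show "r \<in> U"
          proof (cases "z' = (0, 0)")
            case True
            then show ?thesis using z'(2) g_0 \<open>x \<in> U\<close> by simp
          next
            case False
            let ?z = "on_upper blow_up z'"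
            have z: "?z \<in> R" "on_upper collapse ?z = z'" using G_R[OF z'(1) False] hG[OF z'(1) False] by auto
            have "?z \<notin> K"
            proof
              assume "?z \<in> K"
              then have "on_upper collapse ?z \<in> on_upper collapse ` K" by (rule imageI)
              then have "r \<in> g ` on_upper collapse ` K" unfolding z(2) z'(2) by (rule imageI)
              then show False using r by blast
            qed
            then have "g ?z \<in> P" using z(1) unfolding K_def by blast
            then show ?thesis unfolding P_def using collapse_map_g[OF z(1)] z(2) z'(2) by simp
          qed
        qed
        then show ?thesis using o1 o2 q xN by (cases "q = x") blast+
      qed
    qed
  qed (use openin_continuous_map_preimage[OF collapse_map_cont] P_def in simp)
qed

lemma blob_collapses: "collapses_to_point S S collapse_map (g ` blob)"
  unfolding collapses_to_point_def
proof (intro conjI ballI collapse_quotient)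
  show "g ` blob \<noteq> {}" using zero_in_blob by blast
  show "g ` blob \<subseteq> topspace S" using C_R g_in by blast
  fix p q assume p: "p \<in> topspace S" and q: "q \<in> topspace S"
  show "collapse_map p = collapse_map q \<longleftrightarrow> p = q \<or> p \<in> g ` blob \<and> q \<in> g ` blob"
    using collapse_map_eq_x[OF p] collapse_map_eq_x[OF q] blow_collapse[OF p] blow_collapse[OF q] by metis
qed

lemma blob_connected: "connectedin S (g ` blob)"
proof -
  have "connectedin (top_of_set R) blob" using connected_blob C_R by (simp add: connectedin_subtopology)
  then show ?thesis by (rule connectedin_continuous_map_image[OF g_cont])
qed

lemma blob_invariant: "invariant_set S blown (g ` blob)"
proof -
  have "orbit blown p = {p}" if "p \<in> g ` blob" for p unfolding orbit_def blown_def using that by auto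
  then have "g ` blob = (\<Union>p\<in>g ` blob. orbit blown p)" by auto
  moreover have "g ` blob \<subseteq> topspace S" using C_R g_in by blast
  ultimately show ?thesis unfolding invariant_set_def by blast
qed

lemma blob_limit: "g ` blob \<subseteq> \<Omega>"
proof
  fix p assume p: "p \<in> g ` blob"
  then have "p \<in> topspace S" using C_R g_in by blast
  then show "p \<in> \<Omega>" unfolding \<Omega>_def using collapse_map_eq_x[of p] p x_limit by auto
qed

text \<open>A nonempty open subset would be visited by the orbit of \<open>y\<close>, which stays
  outside the limit set.\<close>

lemma limit_interior: "openin S U \<Longrightarrow> U \<subseteq> \<omega> \<Longrightarrow> U = {}"
proof (rule ccontr)
  assume U: "openin S U" "U \<subseteq> \<omega>" "U \<noteq> {}"
  then obtain q where "q \<in> U" "q \<in> omega_limit S v y" using limit by blast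
  then obtain t where "v t y \<in> U" using U(1) unfolding in_omega_limit by blast
  then show False using off_\<omega>(4)[OF y_in y_not_limit] U(2) by blast
qed

text \<open>By invariance the limit set contains, with a point of the box, the whole horizontal arc
  at its height. A connected set with two different heights would thus force an open rectangle into
  the limit set.\<close>

lemma limit_heights_constant:
  assumes c: "connected C" "C \<subseteq> R" "g ` C \<subseteq> \<omega>" and pq: "p \<in> C" "q \<in> C"
  shows "snd p = snd q"
proof -
  have le: "\<not> snd p < snd q" if pq: "p \<in> C" "q \<in> C" for p q
  proof
    assume lt: "snd p < snd q"
    have "continuous_on C snd" by (intro continuous_intros)
    then have conn: "connected (snd ` C)" using c(1) by (rule connected_continuous_image)
    have bd: "-1 \<le> snd p" "snd q \<le> 1" using c(2) pq R_iff[of "fst p" "snd p"] R_iff[of "fst q" "snd q"] by auto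
    let ?U = "{-1<..<1::real} \<times> {snd p<..<snd q}"
    have "open ?U" by (intro open_Times) auto
    moreover have "?U \<inter> R \<subseteq> open_square" unfolding open_square_def using bd by auto
    ultimately have op: "openin S (g ` (?U \<inter> R))" by (rule g_open_image)
    have "g ` (?U \<inter> R) \<subseteq> \<omega>"
    proof
      fix r assume "r \<in> g ` (?U \<inter> R)"
      then obtain a u where au: "(a, u) \<in> R" "r = g (a, u)" "snd p < u" "u < snd q" by auto
      then have "u \<in> snd ` C" using connectedD_interval[OF conn, of "snd p" "snd q" u] pq by simp
      then obtain a' where a': "(a', u) \<in> C" by force
      then have a'R: "(a', u) \<in> R" using c(2) by blast
      have "v (\<sigma> * (a - a')) (g (a', u)) = g (a, u)"
        using g_flow[OF a'R, of "\<sigma> * (a - a')"] \<sigma>_pos au(1) unfolding R_iff by simp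
      moreover have "g (a', u) \<in> \<omega>" using c(3) a' by blast
      ultimately show "r \<in> \<omega>" using \<omega>_flow au(2) by metis
    qed
    then have "g ` (?U \<inter> R) = {}" by (rule limit_interior[OF op])
    moreover have "(0, (snd p + snd q) / 2) \<in> ?U \<inter> R"
      using lt c(2) pq R_iff[of "fst p" "snd p"] R_iff[of "fst q" "snd q"] by (auto simp: R_iff)
    ultimately show False by blast
  qed
  show ?thesis using le[OF pq] le[OF pq(2,1)] by simp
qed

text \<open>Before its first arrival at the bar, a path in the limit set runs in the blob, that is, on the
  stem: elsewhere its collapsed height would vary.\<close>

lemma not_arcwise_connected: "\<not> arcwise_connected_in S \<Omega>"
proof
  assume arc: "arcwise_connected_in S \<Omega>"
  have z0: "(0, 0) \<in> blob" and z1: "(0, 1/4) \<in> bar" "(0, 1/4) \<in> blob"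
    using zero_in_blob unfolding blob_def bar_def by auto
  have "x \<in> \<Omega>" "g (0, 1/4) \<in> \<Omega>" using blob_limit z0 z1 g_0 by force+
  moreover have "x \<noteq> g (0, 1/4)" using g_eq_x[of "(0, 1/4)"] z1(2) C_R by force
  ultimately obtain \<gamma> where \<gamma>: "embedding_map (top_of_set {0..1::real}) S \<gamma>" "\<gamma> ` {0..1} \<subseteq> \<Omega>" "\<gamma> 0 = x" "\<gamma> 1 = g (0, 1/4)"
    using arc unfolding arcwise_connected_in_def by metis
  have \<gamma>c: "continuous_map (top_of_set {0..1}) S \<gamma>"
    using homeomorphic_imp_continuous_map[OF \<gamma>(1)[unfolded embedding_map_def]] unfolding continuous_map_in_subtopology by blast
  have barR: "bar \<subseteq> R" "closed bar" using C_R unfolding blob_def bar_def by (auto intro!: closed_Times)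
  define T where "T = {t \<in> {0..1}. \<gamma> t \<in> g ` bar}"
  have "closedin (top_of_set {0..1}) {t \<in> topspace (top_of_set {0..1}). \<gamma> t \<in> g ` bar}"
    by (rule closedin_continuous_map_preimage[OF \<gamma>c g_closed_image[OF barR(2,1)]])
  then have "closed T" unfolding T_def using closedin_closed_trans[of "{0..1::real}"] by simp
  moreover have "T \<noteq> {}" "bdd_below T" using \<gamma>(4) z1(1) unfolding T_def by (auto intro!: exI[of _ 1])
  ultimately have bT: "Inf T \<in> T" by (intro closed_contains_Inf)
  define b where "b = Inf T"
  have b: "b \<in> {0..1}" "\<gamma> b \<in> g ` bar" using bT unfolding b_def T_def by auto
  have first: "\<gamma> t \<notin> g ` bar" if "0 \<le> t" "t < b" for t
    using cInf_lower[of t T] \<open>bdd_below T\<close> that b(1) unfolding b_def T_def by force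
  have "x \<notin> g ` bar" using g_eq_x barR(1) unfolding bar_def by force
  then have b0: "0 < b" using b \<gamma>(3) by (cases "b = 0") auto
  obtain c0 where c0: "(c0, 1/4) \<in> bar" "\<gamma> b = g (c0, 1/4)" using b(2) unfolding bar_def by auto
  \<comment> \<open>An open part of the upper box around the bar: shortly before \<open>b\<close>
    the path can be followed in the chart, at positive heights.\<close>
  let ?W = "{-1<..<1} \<times> {0<..<1/2} :: (real \<times> real) set"
  have WR: "?W \<subseteq> R" by (auto simp: R_iff)
  have "open ?W" by (intro open_Times) auto
  moreover have "?W \<inter> R \<subseteq> open_square" unfolding open_square_def by auto
  ultimately have "openin S (g ` (?W \<inter> R))" by (rule g_open_image)
  then have "openin S (g ` ?W)" using WR by (simp add: Int_absorb2)
  from openin_continuous_map_preimage[OF \<gamma>c this]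
  have "openin (top_of_set {0..1}) {t \<in> {0..1}. \<gamma> t \<in> g ` ?W}" by simp
  moreover have "b \<in> {t \<in> {0..1}. \<gamma> t \<in> g ` ?W}" using b(1) c0 unfolding bar_def by auto
  ultimately obtain e where e: "e > 0" "\<And>t. t \<in> {0..1} \<Longrightarrow> dist t b < e \<Longrightarrow> \<gamma> t \<in> g ` ?W"
    unfolding openin_euclidean_subtopology_iff by blast
  define a where "a = max 0 (b - e / 2)"
  have a: "0 \<le> a" "a < b" "b - e < a" unfolding a_def using b0 e(1) by (auto simp: less_max_iff_disj)
  have ab01: "{a..b} \<subseteq> {0..1}" using a(1) b(1) by auto
  have inW: "\<gamma> t \<in> g ` ?W" if "t \<in> {a..b}" for t
    using e(2)[of t] that a ab01 by (auto simp: dist_real_def)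
  define z where "z t = chart (\<gamma> t)" for t
  have z: "z t \<in> ?W" "g (z t) = \<gamma> t" if t: "t \<in> {a..b}" for t
  proof -
    obtain w where "w \<in> ?W" "\<gamma> t = g w" using inW[OF t] by blast
    then show "z t \<in> ?W" "g (z t) = \<gamma> t" using chart_g[of w] WR unfolding z_def by auto
  qed
  have zR: "z t \<in> R" if "t \<in> {a..b}" for t by (rule subsetD[OF WR z(1)[OF that]])
  have "continuous_map (top_of_set {a..b}) S \<gamma>" using continuous_map_from_subtopology_mono[OF \<gamma>c ab01] .
  then have "continuous_map (top_of_set {a..b}) (subtopology S (g ` R)) \<gamma>"
    using imageI[OF zR, of _ g] z(2) by (simp add: continuous_map_in_subtopology image_subset_iff Pi_iff)
  from continuous_map_compose[OF this chart_cont] have zc: "continuous_on {a..b} z"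
    by (simp add: o_def z_def continuous_map_in_subtopology)
  define C where "C = on_upper collapse ` z ` {a..b}"
  have "continuous_on (z ` {a..b}) (on_upper collapse)" by (rule continuous_on_subset[OF h_cont image_subsetI[OF zR]])
  then have "connected C" unfolding C_def
    by (rule connected_continuous_image[OF _ connected_continuous_image[OF zc connected_Icc]])
  moreover have "C \<subseteq> R" unfolding C_def image_image by (rule image_subsetI[OF h_R[OF zR]])
  moreover have "g ` C \<subseteq> \<omega>"
  proof -
    have "g (on_upper collapse (z t)) \<in> \<omega>" if t: "t \<in> {a..b}" for t
    proof -
      have "\<gamma> t \<in> \<Omega>" using \<gamma>(2) t ab01 by blast
      then show ?thesis using collapse_map_g[OF zR[OF t]] z(2)[OF t] unfolding \<Omega>_def by simp
    qed
    then show ?thesis unfolding C_def image_image by (rule image_subsetI)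
  qed
  ultimately have const: "snd p = snd q" if "p \<in> C" "q \<in> C" for p q
    using limit_heights_constant[of C p q] that by simp
  have zb: "z b = (c0, 1/4)" unfolding z_def c0(2) using chart_g c0(1) barR(1) by blast
  then have "on_upper collapse (z b) = (0, 0)" using h_zero[of "z b"] c0(1) C_R unfolding blob_def by auto
  moreover have "on_upper collapse (z b) \<in> C" unfolding C_def using a(2) by (intro imageI) simp
  \<comment> \<open>At time \<open>b\<close> the path is on the bar, so its collapse is at the
    origin; this fixes the constant height as 0.\<close>
  ultimately have "(0, 0) \<in> C" by simp
  then have height: "snd (on_upper collapse (z t)) = 0" if "t \<in> {a..b}" for t
    using const[of "on_upper collapse (z t)" "(0, 0)"] that unfolding C_def by simp
  have in_stem: "z t \<in> stem" if t: "t \<in> {a..<b}" for t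
  proof -
    have t': "t \<in> {a..b}" using t by simp
    have zW: "0 < snd (z t)" using z(1)[OF t'] by (auto simp: mem_Times_iff)
    then have hb: "z t \<in> half_box" using R_upper[OF zR[OF t']] by simp
    have cz: "snd (collapse (z t)) = 0" using height[OF t'] zW unfolding on_upper_def by simp
    have "z t \<in> blob"
    proof (rule ccontr)
      assume nb: "z t \<notin> blob"
      \<comment> \<open>Off the blob, collapsed height 0 means a point of the lower edge, which the
        blow-up fixes; but the path is at positive height.\<close>
      note bc = blow_up_collapse[OF hb nb]
      have "blow_up (collapse (z t)) = collapse (z t)" using blow_up_id[OF bc(2)] cz bc(3) by blast
      then show False using bc(1) cz zW by simp
    qed
    moreover have "\<gamma> t \<notin> g ` bar" using first[of t] t a(1) by simp
    then have "z t \<notin> bar" using z(2)[OF t'] by force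
    ultimately show ?thesis unfolding blob_def by blast
  qed
  define Y where "Y t = snd (z t)" for t
  have st: "Y t < 1/4 \<and> fst (z t) = sin (pi / (1/4 - Y t)) / 4" if "t \<in> {a..<b}" for t
    using in_stem[OF that] unfolding stem_def Y_def by auto
  have bl: "at b within {a..b} = at_left b" using at_within_Icc_at_left a(2) by blast
  have "(z \<longlongrightarrow> z b) (at_left b)" using zc a(2) unfolding continuous_on_def bl[symmetric] by simp
  then have lim: "(Y \<longlongrightarrow> 1/4) (at_left b)" "((\<lambda>t. fst (z t)) \<longlongrightarrow> c0) (at_left b)"
    unfolding Y_def zb by (auto dest: tendsto_fst tendsto_snd)
  have ev: "eventually (\<lambda>t. t \<in> {a..<b}) (at_left b)"
    using eventually_at_left_real[OF a(2)] by eventually_elim auto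
  have "((\<lambda>t. sin (pi / (1/4 - Y t)) / 4) \<longlongrightarrow> c0) (at_left b)"
    by (rule Lim_transform_eventually[OF lim(2)]) (use ev in eventually_elim, use st in blast)
  moreover have "continuous_on {a..<b} Y" unfolding Y_def
    by (rule continuous_on_snd[OF continuous_on_subset[OF zc]]) auto
  ultimately show False using no_path_up_stem[OF a(2) _ _ lim(1)] st by auto
qed

end

theorem theorem4:
  fixes S :: "'a topology" and v :: "real \<Rightarrow> 'a \<Rightarrow> 'a"
    and \<omega> :: "'a set" and x y z :: 'a
  assumes "surface S" and "flow_on S v"
    and "z \<in> topspace S" and "\<omega> = omega_limit S v z"
    and "x \<in> \<omega>" and "\<not> singular_point v x"
    and "y \<in> topspace S - \<omega>" and "omega_limit S v y = \<omega>"
  shows "(\<exists>vx. singular_replacement S v x vx) \<and>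
    (\<exists>vt. flow_on S vt \<and>
      \<not> arcwise_connected_in S (omega_limit S vt y) \<and>
      topologically_equivalent
        (subtopology S (topspace S - \<omega>)) v
        (subtopology S (topspace S - omega_limit S vt y)) vt \<and>
      (\<forall>vx. singular_replacement S v x vx \<longrightarrow>
        (\<exists>v' h C.
          flow_on S v' \<and>
          topologically_equivalent S vx S v' \<and>
          topologically_semiconjugate S v' S vt h \<and>
          connectedin S C \<and> closedin S C \<and> invariant_set S vt C \<and>
          C \<subseteq> omega_limit S vt y \<and>
          collapses_to_point S S h C)))"
proof -
  have haus: "Hausdorff_space S" using assms(1) unfolding surface_def by blast
  have y: "y \<in> topspace S" "y \<notin> omega_limit S v y" and x: "x \<in> omega_limit S v y" using assms by auto
  obtain H \<sigma> g where fb: "uniform_flow_box S v x H \<sigma> g" "y \<notin> g ` (square \<inter> H)" "from_above v y (square \<inter> H) g"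
    using ex_box_from_above[OF assms(1,2) y x assms(6)] by blast
  interpret uniform_box S v x H \<sigma> g by (rule uniform_box.intro[OF assms(2) haus fb(1)])
  obtain k lam where blow: "blow_up_flow S v x H \<sigma> g k lam (on_upper blow_up) (on_upper collapse) blob"
    using ex_blow_up by blast
  interpret blow_up_flow S v x H \<sigma> g k lam "on_upper blow_up" "on_upper collapse" blob by (rule blow)
  interpret limit_blow_up S v x H \<sigma> g k lam y \<omega>
    by unfold_locales (use y fb(2,3) assms(5,7,8) in \<open>simp_all add: R_def\<close>)
  have "topologically_semiconjugate S slowed S blown collapse_map"
    using collapse_map_cont collapse_quotient blown_semiconj
    unfolding topologically_semiconjugate_def quotient_map_def by simp
  \<comment> \<open>The same \<open>slowed\<close> serves as \<open>v'\<close> for every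
    \<open>vx\<close>, because both are described by \<open>slowing_at\<close>.\<close>
  moreover have "topologically_equivalent S vx S slowed" if "singular_replacement S v x vx" for vx
    by (rule slowing_at_equivalent[OF singular_replacement_slowing_at[OF haus assms(2) that] slowing_at_slowed])
  ultimately have "\<exists>v' h C. flow_on S v' \<and> topologically_equivalent S vx S v' \<and> topologically_semiconjugate S v' S blown h \<and>
      connectedin S C \<and> closedin S C \<and> invariant_set S blown C \<and> C \<subseteq> omega_limit S blown y \<and> collapses_to_point S S h C"
    if "singular_replacement S v x vx" for vx
    using that slowed_flow blob_connected C_image_closed blob_invariant blob_limit blob_collapses
    unfolding blown_limit by blast
  moreover have "\<not> arcwise_connected_in S (omega_limit S blown y)" unfolding blown_limit by (rule not_arcwise_connected)
  moreover have "topologically_equivalent (subtopology S (topspace S - \<omega>)) v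
      (subtopology S (topspace S - omega_limit S blown y)) blown"
    unfolding blown_limit by (rule complements_equivalent)
  ultimately show ?thesis using slowed_singular_replacement blown_flow by blast
qed

end
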